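(* Consider Platzman's model $(\mathbb W\times\mathbb Y,\mathbb A,P,c)$ with a one-step cost function $c:\mathbb W\times\mathbb A\to[0,+\infty]$ (not depending on observations). If the stochastic kernel $P$ on $\mathbb W\times\mathbb Y$ given $\mathbb W\times\mathbb A$ is semi-uniform Feller, and $c$ is $\mathbb K$-inf-compact on $\mathbb W\times\mathbb A$, then the transition kernel $\hat q$ on $\mathbb P(\mathbb W)$ given $\mathbb P(\mathbb W)\times\mathbb A$ is weakly continuous, the one-step cost function $\hat c$ is $\mathbb K$-inf-compact on $\mathbb P(\mathbb W)\times\mathbb A$, and for the belief-MDP $(\mathbb P(\mathbb W),\mathbb A,\hat q,\hat c)$ and every $\alpha\ge0$: (i) the optimality equations hold and define optimal policies: for all $z\in\mathbb P(\mathbb W)$ and $t=0,1,\ldots$, $$v_{t+1,\alpha}(z)=\min_{a\in\mathbb A}\Big\{\hat c(z,a)+\alpha\int v_{t,\alpha}(z')\hat q(dz'|z,a)\Big\},\qquad v_\alpha(z)=\min_{a\in\mathbb A}\Big\{\hat c(z,a)+\alpha\int v_\alpha(z')\hat q(dz'|z,a)\Big\},$$ where $v_{0,\alpha}\equiv0$; for $T=1,2,\ldots$, each $T$-horizon Markov policy $(\phi_0,\ldots,\phi_{T-1})$ such that $\phi_{T-1-t}(z)$ attains the minimum in the first equation for all $z$ and $t=0,\ldots,T-1$ is $T$-horizon optimal; and a stationary policy $\phi$ is discount-optimal if and only if $\phi(z)$ attains the minimum in the second equation for all $z$; (ii) value iterations converge to optimal values if zero terminal costs are chosen: $v_{t,\alpha}(z)\to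 v_\alpha(z)$ as $t\to\infty$ for all $z\in\mathbb P(\mathbb W)$; (iii) Markov optimal policies exist for finite-horizon problems; (iv) stationary optimal policies exist for infinite-horizon problems. Moreover, for $c:\mathbb W\times\mathbb A\to[0,+\infty]$ $\mathbb K$-inf-compact on $\mathbb W\times\mathbb A$, all these conclusions hold for a $\mathrm{POMDP}_1$ $(\mathbb W,\mathbb Y,\mathbb A,P_1,Q_1,c)$ such that $P_1$ is weakly continuous and $Q_1$ is continuous in total variation, and for a $\mathrm{POMDP}_2$ $(\mathbb W,\mathbb Y,\mathbb A,P_2,Q_2,c)$ satisfying either (a) $P_2$ is weakly continuous and $Q_2$ is continuous in total variation (jointly in $(a,w)$), or (b) $P_2$ is continuous in total variation and $Q_2$ is continuous in $a$ in total variation (i.e., for each $w\in\mathbb W$, $a^{(n)}\to a$ implies $\sup_{C\in\mathcal B(\mathbb Y)}|Q_2(C|a^{(n)},w)-Q_2(C|a,w)|\to0$).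
   Context: Kernels. For a metric space $S$, $\mathcal B(S)$ is its Borel $\sigma$-field and $\mathbb P(S)$ the set of Borel probability measures with the topology of weak convergence. A stochastic kernel $\Psi$ on $S_1$ given $S_2$ is a map $\mathcal B(S_1)\times S_2\to[0,1]$ that is a probability measure in the first argument and Borel measurable in the second. It is weakly continuous (continuous in total variation) if $s^{(n)}\to s$ implies $\Psi(\cdot|s^{(n)})\to\Psi(\cdot|s)$ weakly (respectively $\sup_{B\in\mathcal B(S_1)}|\Psi(B|s^{(n)})-\Psi(B|s)|\to0$). For a kernel on $S_1\times S_2$ write $\Psi(A,B|s_3):=\Psi(A\times B|s_3)$. A stochastic kernel $\Psi$ on $S_1\times S_2$ given $S_3$ (Borel subsets of Polish spaces) is semi-uniform Feller if, whenever $s_3^{(n)}\to s_3$ in $S_3$, for each bounded continuous $f:S_1\to\mathbb R$, $$\lim_{n\to\infty}\sup_{B\in\mathcal B(S_2)}\Big|\int_{S_1}f(s_1)\Psi(ds_1,B|s_3^{(n)})-\int_{S_1}f(s_1)\Psi(ds_1,B|s_3)\Big|=0.$$ A function $u:S_1\times S_2\to[-\infty,+\infty]$ is $\mathbb K$-inf-compact (on $S_1\times S_2$) if for every nonempty compact $K\subset S_1$ and $\lambda\in\mathbb R$ the set $\{(s_1,s_2)\in K\times S_2:u(s_1,s_2)\le\lambda\}$ is compact. Models. Platzman's model $(\mathbb W\times\mathbb Y,\mathbb A,P,c)$ consists of Borel subsets $\mathbb W,\mathbb Y$ of Polish spaces (unobservable states and observations), a nonempty action space $\mathbb A$ that is a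 Borel subset of a Polish space, a stochastic kernel $P$ on $\mathbb W\times\mathbb Y$ given $\mathbb W\times\mathbb A$, assumed in the definition of the model to be weakly continuous, and a Borel measurable nonnegative cost $c$. A $\mathrm{POMDP}_1$, with $P_1(dw'|w,a)$ a stochastic kernel on $\mathbb W$ given $\mathbb W\times\mathbb A$ and $Q_1(dy|w,a)$ a stochastic kernel on $\mathbb Y$ given $\mathbb W\times\mathbb A$, is Platzman's model with $P(B\times C|w,a):=P_1(B|w,a)Q_1(C|w,a)$. A $\mathrm{POMDP}_2$, with $P_2(dw'|w,a)$ a stochastic kernel on $\mathbb W$ given $\mathbb W\times\mathbb A$ and $Q_2(dy|a,w)$ a stochastic kernel on $\mathbb Y$ given $\mathbb A\times\mathbb W$, is Platzman's model with $P(B\times C|w,a):=\int_BQ_2(C|a,w')P_2(dw'|w,a)$. Belief-MDP. $R(B\times C|z,a):=\int_{\mathbb W}P(B\times C|w,a)z(dw)$, $z\in\mathbb P(\mathbb W)$. There is a stochastic kernel $H(\cdot|z,a,y')$ on $\mathbb W$ given $\mathbb P(\mathbb W)\times\mathbb A\times\mathbb Y$ with $R(B\times C|z,a)=\int_CH(B|z,a,y')R(\mathbb W,dy'|z,a)$; $H(z,a,y')\in\mathbb P(\mathbb W)$ denotes the corresponding measure. Then $\hat q(D|z,a):=\int_{\mathbb Y}\mathbf I\{H(z,a,y')\in D\}R(\mathbb W,dy'|z,a)$, $D\in\mathcal B(\mathbb P(\mathbb W))$ (independent of the choice of $H$), and $\hat c(z,a):=\int_{\mathbb W}c(w,a)z(dw)$.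 The belief-MDP is the MDP with state space $\mathbb X:=\mathbb P(\mathbb W)$, action space $\mathbb A$, transition probability $\hat q$ and cost $\hat c$. MDP notions. A policy is a sequence $\pi=\{\pi_t\}$ of stochastic kernels on $\mathbb A$ given $\mathbb X\times(\mathbb A\times\mathbb X)^t$; with an initial state $x$ it defines a probability measure on $(\mathbb X\times\mathbb A)^\infty$ with expectation $\mathbb E_x^\pi$. For $\alpha\ge0$, $v^\pi_{T,\alpha}(x):=\mathbb E^\pi_x\sum_{t=0}^{T-1}\alpha^t\hat c(x_t,a_t)$, $v^\pi_{0,\alpha}:=0$, $v^\pi_\alpha$ is the case $T=\infty$; $v_{T,\alpha}:=\inf_\pi v^\pi_{T,\alpha}$, $v_\alpha:=\inf_\pi v^\pi_\alpha$. A policy is $T$-horizon optimal (discount-optimal) if $v^\pi_{T,\alpha}=v_{T,\alpha}$ (respectively $v^\pi_\alpha=v_\alpha$) on $\mathbb X$. A Markov policy is given by Borel maps $\phi_t:\mathbb X\to\mathbb A$ with $a_t=\phi_t(x_t)$; it is stationary if $\phi_t=\phi$ for all $t$. Conventions: $0^0=1$, $0\cdot\infty=0$. *)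

theory Defs
  imports "HOL-Probability.Probability"
begin

section \<open>Borel spaces, the weak topology, and stochastic kernels\<close>

text \<open>
  All spaces are abstract topologies, since the state space of the belief-MDP is a set of measures
  whose topology does not come from a type class. A Borel subset \<open>W\<close> of a Polish space
  enters as \<open>top_of_set W\<close>.
\<close>

definition borel_of :: "'s topology \<Rightarrow> 's measure" where
  "borel_of S = sigma (topspace S) {U. openin S U}"

definition prob_measures :: "'s topology \<Rightarrow> 's measure set" where
  "prob_measures S = space (prob_algebra (borel_of S))"

definition bounded_continuous :: "'s topology \<Rightarrow> ('s \<Rightarrow> real) \<Rightarrow> bool" where
  "bounded_continuous S f \<longleftrightarrow> continuous_map S euclideanreal f \<and> bounded (f ` topspace S)"

text \<open>
  The space of Borel probability measures on \<open>S\<close>: the coarsest topology that makes all maps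
  \<open>\<mu> \<mapsto> \<integral>f d\<mu>\<close>, \<open>f\<close> bounded continuous, continuous. Its Borel \<open>\<sigma>\<close>-field is
  \<open>borel_of (weak_topology S)\<close>.
\<close>

definition weak_topology :: "'s topology \<Rightarrow> 's measure topology" where
  "weak_topology S = topology_generated_by
     {{\<mu> \<in> prob_measures S. (\<integral>x. f x \<partial>\<mu>) \<in> U} | f U. bounded_continuous S f \<and> open U}"

lemma topspace_weak_topology: "topspace (weak_topology S) = prob_measures S"
proof -
  have "bounded_continuous S (\<lambda>_. 0)"
    by (auto simp: bounded_continuous_def image_constant_conv)
  then have "{\<mu> \<in> prob_measures S. (\<integral>x. (\<lambda>_. 0::real) x \<partial>\<mu>) \<in> UNIV}
    \<in> {{\<mu> \<in> prob_measures S. (\<integral>x. f x \<partial>\<mu>) \<in> U} | f U. bounded_continuous S f \<and> open U}"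
    using open_UNIV by blast
  then show ?thesis
    unfolding weak_topology_def topology_generated_by_topspace by auto
qed

text \<open>
  Measurability into \<open>prob_algebra\<close> says that every \<open>\<Psi> s\<close> is a Borel probability measure on
  \<open>S1\<close> and that \<open>s \<mapsto> \<Psi> s B\<close> is Borel for every Borel set \<open>B\<close>.
\<close>

definition stochastic_kernel :: "'s topology \<Rightarrow> 't topology \<Rightarrow> ('t \<Rightarrow> 's measure) \<Rightarrow> bool" where
  "stochastic_kernel S1 S2 \<Psi> \<longleftrightarrow> \<Psi> \<in> borel_of S2 \<rightarrow>\<^sub>M prob_algebra (borel_of S1)"

definition weakly_continuous :: "'s topology \<Rightarrow> 't topology \<Rightarrow> ('t \<Rightarrow> 's measure) \<Rightarrow> bool" where
  "weakly_continuous S1 S2 \<Psi> \<longleftrightarrow>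
     (\<forall>s l. limitin S2 s l sequentially \<longrightarrow>
        limitin (weak_topology S1) (\<lambda>n. \<Psi> (s n)) (\<Psi> l) sequentially)"

definition tv_continuous :: "'s topology \<Rightarrow> 't topology \<Rightarrow> ('t \<Rightarrow> 's measure) \<Rightarrow> bool" where
  "tv_continuous S1 S2 \<Psi> \<longleftrightarrow>
     (\<forall>s l. limitin S2 s l sequentially \<longrightarrow>
        (\<lambda>n. SUP B\<in>sets (borel_of S1). \<bar>measure (\<Psi> (s n)) B - measure (\<Psi> l) B\<bar>)
          \<longlonglongrightarrow> 0)"

text \<open>The measure \<open>M(\<cdot>, B)\<close> on \<open>S1\<close>, where \<open>M(A, B) = M(A \<times> B)\<close>.\<close>

definition section_measure :: "'s topology \<Rightarrow> ('s \<times> 't) measure \<Rightarrow> 't set \<Rightarrow> 's measure" where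
  "section_measure S1 M B =
     measure_of (topspace S1) (sets (borel_of S1)) (\<lambda>A. emeasure M (A \<times> B))"

definition semi_uniform_feller ::
    "'s1 topology \<Rightarrow> 's2 topology \<Rightarrow> 's3 topology \<Rightarrow> ('s3 \<Rightarrow> ('s1 \<times> 's2) measure) \<Rightarrow> bool" where
  "semi_uniform_feller S1 S2 S3 \<Psi> \<longleftrightarrow>
     (\<forall>s l f. limitin S3 s l sequentially \<longrightarrow> bounded_continuous S1 f \<longrightarrow>
        (\<lambda>n. SUP B\<in>sets (borel_of S2).
               \<bar>(\<integral>x. f x \<partial>section_measure S1 (\<Psi> (s n)) B)
                 - (\<integral>x. f x \<partial>section_measure S1 (\<Psi> l) B)\<bar>) \<longlonglongrightarrow> 0)"

definition K_inf_compact :: "'s topology \<Rightarrow> 't topology \<Rightarrow> ('s \<times> 't \<Rightarrow> ereal) \<Rightarrow> bool" where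
  "K_inf_compact S1 S2 u \<longleftrightarrow>
     (\<forall>K. \<forall>r::real. compactin S1 K \<and> K \<noteq> {} \<longrightarrow>
        compactin (prod_topology S1 S2) {s \<in> K \<times> topspace S2. u s \<le> ereal r})"


section \<open>Markov decision processes\<close>

text \<open>
  A history \<open>(x\<^sub>0, a\<^sub>0, x\<^sub>1, \<dots>, a\<^bsub>t-1\<^esub>, x\<^sub>t)\<close> is encoded as
  \<open>(x\<^sub>0, h)\<close> with \<open>h i = (a\<^sub>i, x\<^bsub>i+1\<^esub>)\<close> for \<open>i < t\<close>, \<open>h\<close> being
  \<open>undefined\<close> elsewhere.
\<close>

type_synonym ('x, 'a) policy = "nat \<Rightarrow> 'x \<times> (nat \<Rightarrow> 'a \<times> 'x) \<Rightarrow> 'a measure"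

definition history_space ::
    "'x topology \<Rightarrow> 'a topology \<Rightarrow> nat \<Rightarrow> ('x \<times> (nat \<Rightarrow> 'a \<times> 'x)) topology" where
  "history_space X A t = prod_topology X (product_topology (\<lambda>_. prod_topology A X) {..<t})"

definition policies :: "'x topology \<Rightarrow> 'a topology \<Rightarrow> ('x, 'a) policy set" where
  "policies X A = {\<pi>. \<forall>t. stochastic_kernel A (history_space X A t) (\<pi> t)}"

text \<open>
  The history at time \<open>t\<close> of a trajectory \<open>\<omega>\<close> with \<open>\<omega> i = (x\<^sub>i, a\<^sub>i)\<close> for
  \<open>i < t\<close>, and current state \<open>y\<close>.
\<close>

definition history :: "nat \<Rightarrow> (nat \<Rightarrow> 'x \<times> 'a) \<Rightarrow> 'x \<Rightarrow> 'x \<times> (nat \<Rightarrow> 'a \<times> 'x)" where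
  "history t \<omega> y =
     (if t = 0 then y else fst (\<omega> 0),
      \<lambda>i\<in>{..<t}. (snd (\<omega> i), if Suc i = t then y else fst (\<omega> (Suc i))))"

text \<open>The conditional law of \<open>(x\<^sub>t, a\<^sub>t)\<close> given \<open>(x\<^sub>i, a\<^sub>i)\<close>, \<open>i < t\<close>.\<close>

definition step_kernel ::
    "'x topology \<Rightarrow> 'a topology \<Rightarrow> ('x \<times> 'a \<Rightarrow> 'x measure) \<Rightarrow> ('x, 'a) policy \<Rightarrow> 'x
      \<Rightarrow> nat \<Rightarrow> (nat \<Rightarrow> 'x \<times> 'a) \<Rightarrow> ('x \<times> 'a) measure" where
  "step_kernel X A q \<pi> x t \<omega> =
     (if t = 0 then return (borel_of X) x else q (\<omega> (t - 1))) \<bind>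
       (\<lambda>y. distr (\<pi> t (history t \<omega> y)) (borel_of (prod_topology X A)) (Pair y))"

text \<open>
  The measure on \<open>(X \<times> A)\<^sup>\<infinity>\<close> that the Ionescu-Tulcea theorem provides for these
  conditional laws.
\<close>

definition strategic_measure ::
    "'x topology \<Rightarrow> 'a topology \<Rightarrow> ('x \<times> 'a \<Rightarrow> 'x measure) \<Rightarrow> ('x, 'a) policy \<Rightarrow> 'x
      \<Rightarrow> (nat \<Rightarrow> 'x \<times> 'a) measure" where
  "strategic_measure X A q \<pi> x =
     projective_family.lim UNIV
       (Ionescu_Tulcea.CI (step_kernel X A q \<pi> x) (\<lambda>_. borel_of (prod_topology X A)))
       (\<lambda>_. borel_of (prod_topology X A))"

definition policy_cost_fin ::
    "'x topology \<Rightarrow> 'a topology \<Rightarrow> ('x \<times> 'a \<Rightarrow> 'x measure) \<Rightarrow> ('x \<times> 'a \<Rightarrow> ennreal) \<Rightarrow> real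
      \<Rightarrow> nat \<Rightarrow> ('x, 'a) policy \<Rightarrow> 'x \<Rightarrow> ennreal" where
  "policy_cost_fin X A q c \<alpha> T \<pi> x =
     (\<integral>\<^sup>+\<omega>. (\<Sum>t<T. ennreal (\<alpha> ^ t) * c (\<omega> t)) \<partial>strategic_measure X A q \<pi> x)"

definition policy_cost_inf ::
    "'x topology \<Rightarrow> 'a topology \<Rightarrow> ('x \<times> 'a \<Rightarrow> 'x measure) \<Rightarrow> ('x \<times> 'a \<Rightarrow> ennreal) \<Rightarrow> real
      \<Rightarrow> ('x, 'a) policy \<Rightarrow> 'x \<Rightarrow> ennreal" where
  "policy_cost_inf X A q c \<alpha> \<pi> x =
     (\<integral>\<^sup>+\<omega>. (\<Sum>t. ennreal (\<alpha> ^ t) * c (\<omega> t)) \<partial>strategic_measure X A q \<pi> x)"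

definition value_fin ::
    "'x topology \<Rightarrow> 'a topology \<Rightarrow> ('x \<times> 'a \<Rightarrow> 'x measure) \<Rightarrow> ('x \<times> 'a \<Rightarrow> ennreal) \<Rightarrow> real
      \<Rightarrow> nat \<Rightarrow> 'x \<Rightarrow> ennreal" where
  "value_fin X A q c \<alpha> T x = (INF \<pi>\<in>policies X A. policy_cost_fin X A q c \<alpha> T \<pi> x)"

definition value_inf ::
    "'x topology \<Rightarrow> 'a topology \<Rightarrow> ('x \<times> 'a \<Rightarrow> 'x measure) \<Rightarrow> ('x \<times> 'a \<Rightarrow> ennreal) \<Rightarrow> real
      \<Rightarrow> 'x \<Rightarrow> ennreal" where
  "value_inf X A q c \<alpha> x = (INF \<pi>\<in>policies X A. policy_cost_inf X A q c \<alpha> \<pi> x)"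

definition horizon_optimal ::
    "'x topology \<Rightarrow> 'a topology \<Rightarrow> ('x \<times> 'a \<Rightarrow> 'x measure) \<Rightarrow> ('x \<times> 'a \<Rightarrow> ennreal) \<Rightarrow> real
      \<Rightarrow> nat \<Rightarrow> ('x, 'a) policy \<Rightarrow> bool" where
  "horizon_optimal X A q c \<alpha> T \<pi> \<longleftrightarrow>
     (\<forall>x\<in>topspace X. policy_cost_fin X A q c \<alpha> T \<pi> x = value_fin X A q c \<alpha> T x)"

definition discount_optimal ::
    "'x topology \<Rightarrow> 'a topology \<Rightarrow> ('x \<times> 'a \<Rightarrow> 'x measure) \<Rightarrow> ('x \<times> 'a \<Rightarrow> ennreal) \<Rightarrow> real
      \<Rightarrow> ('x, 'a) policy \<Rightarrow> bool" where
  "discount_optimal X A q c \<alpha> \<pi> \<longleftrightarrow>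
     (\<forall>x\<in>topspace X. policy_cost_inf X A q c \<alpha> \<pi> x = value_inf X A q c \<alpha> x)"

definition borel_selectors :: "'x topology \<Rightarrow> 'a topology \<Rightarrow> ('x \<Rightarrow> 'a) set" where
  "borel_selectors X A = borel_of X \<rightarrow>\<^sub>M borel_of A"

text \<open>
  The policy choosing \<open>a\<^sub>t = \<phi> t x\<^sub>t\<close>. A \<open>T\<close>-horizon Markov policy
  \<open>(\<phi>\<^sub>0, \<dots>, \<phi>\<^bsub>T-1\<^esub>)\<close> is represented by any continuation to a sequence of
  Borel maps; the \<open>T\<close>-horizon cost does not depend on the continuation.
\<close>

definition markov_policy :: "'a topology \<Rightarrow> (nat \<Rightarrow> 'x \<Rightarrow> 'a) \<Rightarrow> ('x, 'a) policy" where
  "markov_policy A \<phi> =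
     (\<lambda>t (x, h). return (borel_of A) (\<phi> t (if t = 0 then x else snd (h (t - 1)))))"

definition stationary_policy :: "'a topology \<Rightarrow> ('x \<Rightarrow> 'a) \<Rightarrow> ('x, 'a) policy" where
  "stationary_policy A \<phi> = markov_policy A (\<lambda>_. \<phi>)"

definition bellman ::
    "('x \<times> 'a \<Rightarrow> 'x measure) \<Rightarrow> ('x \<times> 'a \<Rightarrow> ennreal) \<Rightarrow> real \<Rightarrow> ('x \<Rightarrow> ennreal) \<Rightarrow> 'x \<Rightarrow> 'a
      \<Rightarrow> ennreal" where
  "bellman q c \<alpha> v x a = c (x, a) + ennreal \<alpha> * (\<integral>\<^sup>+x'. v x' \<partial>q (x, a))"

definition attains_min :: "'a topology \<Rightarrow> ('a \<Rightarrow> ennreal) \<Rightarrow> 'a \<Rightarrow> bool" where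
  "attains_min A f a \<longleftrightarrow> is_arg_min f (\<lambda>b. b \<in> topspace A) a"

text \<open>\<open>m = min\<^bsub>a\<in>A\<^esub> f a\<close>, the minimum being attained.\<close>

definition is_minimum :: "'a topology \<Rightarrow> ('a \<Rightarrow> ennreal) \<Rightarrow> ennreal \<Rightarrow> bool" where
  "is_minimum A f m \<longleftrightarrow> (\<exists>a. attains_min A f a \<and> f a = m)"

definition optimality_equations_define_optimal_policies ::
    "'x topology \<Rightarrow> 'a topology \<Rightarrow> ('x \<times> 'a \<Rightarrow> 'x measure) \<Rightarrow> ('x \<times> 'a \<Rightarrow> ennreal) \<Rightarrow> real
      \<Rightarrow> bool" where
  "optimality_equations_define_optimal_policies X A q c \<alpha> \<longleftrightarrow>
     (\<forall>x\<in>topspace X. value_fin X A q c \<alpha> 0 x = 0) \<and>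
     (\<forall>x\<in>topspace X. \<forall>t.
        is_minimum A (bellman q c \<alpha> (value_fin X A q c \<alpha> t) x) (value_fin X A q c \<alpha> (Suc t) x)) \<and>
     (\<forall>x\<in>topspace X.
        is_minimum A (bellman q c \<alpha> (value_inf X A q c \<alpha>) x) (value_inf X A q c \<alpha> x)) \<and>
     (\<forall>T\<ge>1. \<forall>\<phi>. (\<forall>t. \<phi> t \<in> borel_selectors X A) \<longrightarrow>
        (\<forall>x\<in>topspace X. \<forall>t<T.
           attains_min A (bellman q c \<alpha> (value_fin X A q c \<alpha> t) x) (\<phi> (T - 1 - t) x)) \<longrightarrow>
        horizon_optimal X A q c \<alpha> T (markov_policy A \<phi>)) \<and>
     (\<forall>\<phi>\<in>borel_selectors X A.
        discount_optimal X A q c \<alpha> (stationary_policy A \<phi>) \<longleftrightarrow>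
        (\<forall>x\<in>topspace X. attains_min A (bellman q c \<alpha> (value_inf X A q c \<alpha>) x) (\<phi> x)))"

definition value_iteration_converges ::
    "'x topology \<Rightarrow> 'a topology \<Rightarrow> ('x \<times> 'a \<Rightarrow> 'x measure) \<Rightarrow> ('x \<times> 'a \<Rightarrow> ennreal) \<Rightarrow> real
      \<Rightarrow> bool" where
  "value_iteration_converges X A q c \<alpha> \<longleftrightarrow>
     (\<forall>x\<in>topspace X. (\<lambda>t. value_fin X A q c \<alpha> t x) \<longlonglongrightarrow> value_inf X A q c \<alpha> x)"

definition markov_optimal_policies_exist ::
    "'x topology \<Rightarrow> 'a topology \<Rightarrow> ('x \<times> 'a \<Rightarrow> 'x measure) \<Rightarrow> ('x \<times> 'a \<Rightarrow> ennreal) \<Rightarrow> real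
      \<Rightarrow> bool" where
  "markov_optimal_policies_exist X A q c \<alpha> \<longleftrightarrow>
     (\<forall>T\<ge>1. \<exists>\<phi>. (\<forall>t. \<phi> t \<in> borel_selectors X A) \<and>
        horizon_optimal X A q c \<alpha> T (markov_policy A \<phi>))"

definition stationary_optimal_policies_exist ::
    "'x topology \<Rightarrow> 'a topology \<Rightarrow> ('x \<times> 'a \<Rightarrow> 'x measure) \<Rightarrow> ('x \<times> 'a \<Rightarrow> ennreal) \<Rightarrow> real
      \<Rightarrow> bool" where
  "stationary_optimal_policies_exist X A q c \<alpha> \<longleftrightarrow>
     (\<exists>\<phi>\<in>borel_selectors X A. discount_optimal X A q c \<alpha> (stationary_policy A \<phi>))"


section \<open>Platzman's model and partially observable Markov decision processes\<close>

definition model_spaces ::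
    "'w::polish_space set \<Rightarrow> 'y::polish_space set \<Rightarrow> 'a::polish_space set \<Rightarrow> bool" where
  "model_spaces W Y A \<longleftrightarrow> W \<in> sets borel \<and> Y \<in> sets borel \<and> A \<in> sets borel \<and> A \<noteq> {}"

text \<open>Nonnegativity of the cost is built into the type \<open>ennreal\<close>.\<close>

definition platzman_model ::
    "'w::polish_space set \<Rightarrow> 'y::polish_space set \<Rightarrow> 'a::polish_space set
      \<Rightarrow> ('w \<times> 'a \<Rightarrow> ('w \<times> 'y) measure) \<Rightarrow> ('w \<times> 'a \<Rightarrow> ennreal) \<Rightarrow> bool" where
  "platzman_model W Y A P c \<longleftrightarrow>
     model_spaces W Y A \<and>
     stochastic_kernel (top_of_set (W \<times> Y)) (top_of_set (W \<times> A)) P \<and>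
     weakly_continuous (top_of_set (W \<times> Y)) (top_of_set (W \<times> A)) P \<and>
     c \<in> borel_measurable (borel_of (top_of_set (W \<times> A)))"

text \<open>
  In the two models below the kernel \<open>P\<close> is not separately required to be weakly continuous, as
  it is for Platzman's model; the continuity conditions imposed later are on \<open>P1, Q1\<close> and
  \<open>P2, Q2\<close>.
\<close>

definition pomdp1 ::
    "'w::polish_space set \<Rightarrow> 'y::polish_space set \<Rightarrow> 'a::polish_space set
      \<Rightarrow> ('w \<times> 'a \<Rightarrow> 'w measure) \<Rightarrow> ('w \<times> 'a \<Rightarrow> 'y measure) \<Rightarrow> ('w \<times> 'a \<Rightarrow> ennreal) \<Rightarrow> bool" where
  "pomdp1 W Y A P1 Q1 c \<longleftrightarrow>
     model_spaces W Y A \<and>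
     stochastic_kernel (top_of_set W) (top_of_set (W \<times> A)) P1 \<and>
     stochastic_kernel (top_of_set Y) (top_of_set (W \<times> A)) Q1 \<and>
     c \<in> borel_measurable (borel_of (top_of_set (W \<times> A)))"

definition pomdp1_kernel ::
    "('w \<times> 'a \<Rightarrow> 'w measure) \<Rightarrow> ('w \<times> 'a \<Rightarrow> 'y measure) \<Rightarrow> 'w \<times> 'a \<Rightarrow> ('w \<times> 'y) measure" where
  "pomdp1_kernel P1 Q1 = (\<lambda>s. P1 s \<Otimes>\<^sub>M Q1 s)"

definition pomdp2 ::
    "'w::polish_space set \<Rightarrow> 'y::polish_space set \<Rightarrow> 'a::polish_space set
      \<Rightarrow> ('w \<times> 'a \<Rightarrow> 'w measure) \<Rightarrow> ('a \<times> 'w \<Rightarrow> 'y measure) \<Rightarrow> ('w \<times> 'a \<Rightarrow> ennreal) \<Rightarrow> bool" where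
  "pomdp2 W Y A P2 Q2 c \<longleftrightarrow>
     model_spaces W Y A \<and>
     stochastic_kernel (top_of_set W) (top_of_set (W \<times> A)) P2 \<and>
     stochastic_kernel (top_of_set Y) (top_of_set (A \<times> W)) Q2 \<and>
     c \<in> borel_measurable (borel_of (top_of_set (W \<times> A)))"

text \<open>\<open>P(B \<times> C | w, a) = \<integral>\<^sub>B Q2(C | a, w') P2(dw' | w, a)\<close>.\<close>

definition pomdp2_kernel ::
    "'w::topological_space set \<Rightarrow> 'y::topological_space set \<Rightarrow> ('w \<times> 'a \<Rightarrow> 'w measure)
      \<Rightarrow> ('a \<times> 'w \<Rightarrow> 'y measure) \<Rightarrow> 'w \<times> 'a \<Rightarrow> ('w \<times> 'y) measure" where
  "pomdp2_kernel W Y P2 Q2 =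
     (\<lambda>(w, a). P2 (w, a) \<bind>
        (\<lambda>w'. distr (Q2 (a, w')) (borel_of (top_of_set (W \<times> Y))) (Pair w')))"


section \<open>The belief-MDP\<close>

abbreviation beliefs :: "'w::topological_space set \<Rightarrow> 'w measure topology" where
  "beliefs W \<equiv> weak_topology (top_of_set W)"

text \<open>\<open>R(E | z, a) = \<integral>P(E | w, a) z(dw)\<close>, and its marginal \<open>R(W, \<cdot> | z, a)\<close>.\<close>

definition belief_joint ::
    "('w \<times> 'a \<Rightarrow> ('w \<times> 'y) measure) \<Rightarrow> 'w measure \<Rightarrow> 'a \<Rightarrow> ('w \<times> 'y) measure" where
  "belief_joint P z a = z \<bind> (\<lambda>w. P (w, a))"

definition belief_obs ::
    "'y::topological_space set \<Rightarrow> ('w \<times> 'a \<Rightarrow> ('w \<times> 'y) measure) \<Rightarrow> 'w measure \<Rightarrow> 'a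
      \<Rightarrow> 'y measure" where
  "belief_obs Y P z a = distr (belief_joint P z a) (borel_of (top_of_set Y)) snd"

definition is_filter_kernel ::
    "'w::topological_space set \<Rightarrow> 'y::topological_space set \<Rightarrow> 'a::topological_space set
      \<Rightarrow> ('w \<times> 'a \<Rightarrow> ('w \<times> 'y) measure) \<Rightarrow> ('w measure \<times> 'a \<times> 'y \<Rightarrow> 'w measure) \<Rightarrow> bool" where
  "is_filter_kernel W Y A P H \<longleftrightarrow>
     stochastic_kernel (top_of_set W) (prod_topology (beliefs W) (top_of_set (A \<times> Y))) H \<and>
     (\<forall>z\<in>topspace (beliefs W). \<forall>a\<in>A.
        \<forall>B\<in>sets (borel_of (top_of_set W)). \<forall>C\<in>sets (borel_of (top_of_set Y)).
          emeasure (belief_joint P z a) (B \<times> C) =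
            (\<integral>\<^sup>+y\<in>C. emeasure (H (z, a, y)) B \<partial>belief_obs Y P z a))"

text \<open>Such a kernel exists, and the law of \<open>H(z, a, y')\<close> does not depend on its choice.\<close>

definition filter_kernel ::
    "'w::topological_space set \<Rightarrow> 'y::topological_space set \<Rightarrow> 'a::topological_space set
      \<Rightarrow> ('w \<times> 'a \<Rightarrow> ('w \<times> 'y) measure) \<Rightarrow> 'w measure \<times> 'a \<times> 'y \<Rightarrow> 'w measure" where
  "filter_kernel W Y A P = (SOME H. is_filter_kernel W Y A P H)"

definition belief_kernel ::
    "'w::topological_space set \<Rightarrow> 'y::topological_space set \<Rightarrow> 'a::topological_space set
      \<Rightarrow> ('w \<times> 'a \<Rightarrow> ('w \<times> 'y) measure) \<Rightarrow> 'w measure \<times> 'a \<Rightarrow> 'w measure measure" where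
  "belief_kernel W Y A P =
     (\<lambda>(z, a). distr (belief_obs Y P z a) (borel_of (beliefs W)) (\<lambda>y. filter_kernel W Y A P (z, a, y)))"

definition belief_cost :: "('w \<times> 'a \<Rightarrow> ennreal) \<Rightarrow> 'w measure \<times> 'a \<Rightarrow> ennreal" where
  "belief_cost c = (\<lambda>(z, a). \<integral>\<^sup>+w. c (w, a) \<partial>z)"

definition belief_mdp_conclusions ::
    "'w::topological_space set \<Rightarrow> 'y::topological_space set \<Rightarrow> 'a::topological_space set
      \<Rightarrow> ('w \<times> 'a \<Rightarrow> ('w \<times> 'y) measure) \<Rightarrow> ('w \<times> 'a \<Rightarrow> ennreal) \<Rightarrow> bool" where
  "belief_mdp_conclusions W Y A P c \<longleftrightarrow>
     (let X = beliefs W; A' = top_of_set A; q = belief_kernel W Y A P; c' = belief_cost c in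
        stochastic_kernel X (prod_topology X A') q \<and>
        weakly_continuous X (prod_topology X A') q \<and>
        K_inf_compact X A' (\<lambda>s. enn2ereal (c' s)) \<and>
        (\<forall>\<alpha>\<ge>0.
           optimality_equations_define_optimal_policies X A' q c' \<alpha> \<and>
           value_iteration_converges X A' q c' \<alpha> \<and>
           markov_optimal_policies_exist X A' q c' \<alpha> \<and>
           stationary_optimal_policies_exist X A' q c' \<alpha>))"

end

theory Submission
  imports Defs
begin

text \<open>
  The belief-MDP lives on the space of probability measures on \<open>W\<close> with the weak topology. This
  space is again separable and metrizable, and its Borel field is the one generated by evaluations
  (\<open>separable_metrizable_weak_topology\<close>, \<open>sets_borel_of_weak_topology\<close>). The theorem therefore
  splits into two regularity statements, on the transition kernel and on the cost of the belief-MDP,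
  and a general theorem on Markov decision processes with inf-compact costs.

  The transition kernel. The semi-uniform Feller property says that integrals of continuous functions
  of the state converge uniformly over sets of observations, or, equivalently, along every sequence of
  such sets (\<open>feller_along_sets\<close>). It passes from \<open>P\<close> to the joint law \<open>R\<close> of the next state and the
  next observation (\<open>belief_joint_feller_along_sets\<close>), because the integrands that depend on the
  sets converge continuously and can be integrated against weakly convergent beliefs
  (\<open>uniform_weak_convergence\<close>). Then the law of the observation is continuous in total variation.
  All these laws are thus absolutely continuous with respect to one measure, with jointly measurable
  densities, which gives the filter \<open>H\<close> as a kernel in the belief, the action and the observation
  together (\<open>disintegration\<close>). If beliefs and actions converge, then the integrals of a bounded
  continuous function against the posteriors converge in \<open>L\<^sup>1\<close> of the limiting observation law: the
  set on which the difference is positive varies with the index, and this is where uniformity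
  over sets is needed (\<open>conditional_integral_L1\<close>). Countably many test functions determine weak
  convergence, so along a subsequence the posteriors converge weakly for almost every observation, and
  the law of the posterior is weakly continuous (\<open>filter_law_continuous\<close>).

  The cost. If \<open>\<integral>c(w, a\<^sub>n) z\<^sub>n(dw) \<le> r\<close> and \<open>z\<^sub>n\<close> converges weakly, then by Markov's inequality the set
  \<open>{c(\<cdot>, a\<^sub>n) \<le> 2r + 1}\<close> has \<open>z\<^sub>n\<close>-measure at least one half. These sets cannot escape from every
  point of \<open>W\<close>, so some subsequence of them contains a convergent sequence of states, and the
  inf-compactness of \<open>c\<close> yields a convergent subsequence of actions (\<open>belief_cost_K_inf_compact\<close>).

  The decision process. Adding a nonnegative lower semicontinuous continuation value to an
  inf-compact cost keeps it inf-compact (\<open>bellman_K_inf_compact\<close>). Hence minima over actions are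
  attained, depend lower semicontinuously on the state, and have Borel selectors
  (\<open>measurable_minimum_selector\<close>). The value iterates increase to a solution of the
  infinite-horizon equation (\<open>limit_value_optimality\<close>), and comparing them with the cost of a policy
  takes only the one-dimensional marginals of the measure of the policy
  (\<open>value_iterate_le_cost\<close>, \<open>stationary_cost_eq_limit_value\<close>, \<open>stationary_cost_recursion\<close>).

  In both partially observable models the joint kernel inherits the property along sequences of sets
  from the continuity of its two factors (\<open>pomdp1_feller_along_sets\<close>, \<open>pomdp2_feller_along_sets\<close>).
\<close>

section \<open>Borel fields of second countable topologies\<close>

definition separable_metrizable :: "'s topology \<Rightarrow> bool" where
  "separable_metrizable X \<longleftrightarrow> metrizable_space X \<and> second_countable X"

lemma space_borel_of [simp]: "space (borel_of S) = topspace S"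
  by (simp add: borel_of_def space_measure_of_conv)

lemma sets_borel_of: "sets (borel_of S) = sigma_sets (topspace S) {U. openin S U}"
  unfolding borel_of_def by (rule sets_measure_of) (auto dest: openin_subset)

lemma openin_borel_of: "openin S U \<Longrightarrow> U \<in> sets (borel_of S)"
  by (auto simp: sets_borel_of)

lemma closedin_borel_of: "closedin S C \<Longrightarrow> C \<in> sets (borel_of S)"
proof -
  assume "closedin S C"
  then have "openin S (topspace S - C)" "C \<subseteq> topspace S"
    by (auto simp: closedin_def)
  then have "topspace S - (topspace S - C) \<in> sets (borel_of S)"
    using sets.compl_sets[OF openin_borel_of, of S] by auto
  then show ?thesis
    using \<open>C \<subseteq> topspace S\<close> by (simp add: double_diff)
qed

lemma measurable_borel_ofI:
  assumes "\<And>x. x \<in> space M \<Longrightarrow> f x \<in> topspace S"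
    and "\<And>U. openin S U \<Longrightarrow> f -` U \<inter> space M \<in> sets M"
  shows "f \<in> M \<rightarrow>\<^sub>M borel_of S"
  unfolding borel_of_def using assms by (intro measurable_measure_of) (auto dest: openin_subset)

lemma continuous_map_measurable:
  assumes "continuous_map S T f"
  shows "f \<in> borel_of S \<rightarrow>\<^sub>M borel_of T"
proof (rule measurable_borel_ofI)
  fix U assume "openin T U"
  moreover have "f -` U \<inter> space (borel_of S) = {x \<in> topspace S. f x \<in> U}"
    by auto
  ultimately show "f -` U \<inter> space (borel_of S) \<in> sets (borel_of S)"
    using assms by (auto simp: continuous_map intro!: openin_borel_of)
qed (use assms in \<open>auto simp: continuous_map_def\<close>)

lemma measurable_borel_of_euclidean:
  "f \<in> M \<rightarrow>\<^sub>M borel_of euclidean \<longleftrightarrow> f \<in> borel_measurable M"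
proof -
  have "sets (borel_of (euclidean :: 'b topology)) = sets borel"
    by (simp add: sets_borel_of borel_def sets_measure_of_conv)
  then show ?thesis
    using measurable_cong_sets[OF refl] by blast
qed

lemma continuous_map_borel_measurable:
  "continuous_map S euclidean f \<Longrightarrow> f \<in> borel_measurable (borel_of S)"
  using continuous_map_measurable[of S euclidean f] by (simp add: measurable_borel_of_euclidean)

lemma sets_borel_of_top_of_set:
  "sets (borel_of (top_of_set W)) = sets (restrict_space borel W)"
proof
  show "sets (borel_of (top_of_set W)) \<subseteq> sets (restrict_space borel W)"
    unfolding sets_borel_of
    by (rule sets.sigma_sets_subset'[of _ "restrict_space borel W", simplified])
       (auto simp: openin_open sets_restrict_space)
  have "(\<lambda>x. x) \<in> borel_measurable (borel_of (top_of_set W))"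
    by (rule continuous_map_borel_measurable) (simp add: continuous_map_in_subtopology)
  then have "(\<lambda>x. x) -` B \<inter> space (borel_of (top_of_set W)) \<in> sets (borel_of (top_of_set W))"
    if "B \<in> sets borel" for B
    using that by (rule measurable_sets)
  then show "sets (restrict_space borel W) \<subseteq> sets (borel_of (top_of_set W))"
    by (auto simp: sets_restrict_space Int_commute)
qed

lemma measurable_borel_of_top_of_set:
  "f \<in> M \<rightarrow>\<^sub>M borel_of (top_of_set W) \<longleftrightarrow> f \<in> borel_measurable M \<and> f \<in> space M \<rightarrow> W"
  using measurable_cong_sets[OF refl sets_borel_of_top_of_set, of M W]
  by (auto simp: measurable_restrict_space2_iff)

text \<open>
  Naming the base makes the rectangles that generate a product topology available;
  \<open>second_countable\<close> only asserts that some countable base exists.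
\<close>

definition topology_base :: "'s topology \<Rightarrow> 's set set \<Rightarrow> bool" where
  "topology_base X D \<longleftrightarrow> (\<forall>V\<in>D. openin X V) \<and>
     (\<forall>U x. openin X U \<and> x \<in> U \<longrightarrow> (\<exists>V\<in>D. x \<in> V \<and> V \<subseteq> U))"

lemma second_countable_iff_base: "second_countable X \<longleftrightarrow> (\<exists>D. countable D \<and> topology_base X D)"
  by (simp add: second_countable_def topology_base_def)

lemma topology_baseD:
  assumes "topology_base X D"
  shows "V \<in> D \<Longrightarrow> openin X V" "openin X U \<Longrightarrow> x \<in> U \<Longrightarrow> \<exists>V\<in>D. x \<in> V \<and> V \<subseteq> U"
  using assms unfolding topology_base_def by blast+

text \<open>
  Every open set is a countable union of base sets, so measurability has to be tested on these only.
\<close>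

lemma measurable_borel_of_base:
  assumes D: "countable D" "topology_base X D"
    and f: "\<And>x. x \<in> space M \<Longrightarrow> f x \<in> topspace X" "\<And>V. V \<in> D \<Longrightarrow> f -` V \<inter> space M \<in> sets M"
  shows "f \<in> M \<rightarrow>\<^sub>M borel_of X"
proof (rule measurable_borel_ofI[OF f(1)])
  fix U assume "openin X U"
  then have "f -` U \<inter> space M = (\<Union>V\<in>{V \<in> D. V \<subseteq> U}. f -` V \<inter> space M)"
    using topology_baseD(2)[OF D(2)] by blast
  also have "\<dots> \<in> sets M"
    using D(1) f(2) by (intro sets.countable_UN') auto
  finally show "f -` U \<inter> space M \<in> sets M" .
qed

lemma topology_base_prod:
  assumes B: "topology_base S B" and C: "topology_base T C"
  shows "topology_base (prod_topology S T) ((\<lambda>(V, V'). V \<times> V') ` (B \<times> C))"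
  unfolding topology_base_def
proof (intro conjI ballI allI impI)
  show "openin (prod_topology S T) V" if "V \<in> (\<lambda>(V, V'). V \<times> V') ` (B \<times> C)" for V
    using that topology_baseD(1)[OF B] topology_baseD(1)[OF C] by (auto simp: openin_prod_Times_iff)
  fix U x assume U: "openin (prod_topology S T) U \<and> x \<in> U"
  then have "(fst x, snd x) \<in> U"
    by simp
  then have "\<exists>V V'. openin S V \<and> openin T V' \<and> fst x \<in> V \<and> snd x \<in> V' \<and> V \<times> V' \<subseteq> U"
    using conjunct1[OF U, unfolded openin_prod_topology_alt, rule_format] by simp
  then obtain V V' where V: "openin S V" "openin T V'" "fst x \<in> V" "snd x \<in> V'" "V \<times> V' \<subseteq> U"
    by blast
  obtain E where "E \<in> B" "fst x \<in> E" "E \<subseteq> V"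
    using topology_baseD(2)[OF B V(1,3)] by blast
  moreover obtain F where "F \<in> C" "snd x \<in> F" "F \<subseteq> V'"
    using topology_baseD(2)[OF C V(2,4)] by blast
  ultimately show "\<exists>V\<in>(\<lambda>(V, V'). V \<times> V') ` (B \<times> C). x \<in> V \<and> V \<subseteq> U"
    using V(5) by (intro bexI[of _ "E \<times> F"]) (auto simp: mem_Times_iff)
qed

lemma topology_base_finite_product:
  assumes I: "finite I" and B: "topology_base T B"
  shows "topology_base (product_topology (\<lambda>_. T) I) (PiE I ` PiE I (\<lambda>_. B))"
  unfolding topology_base_def
proof (intro conjI ballI allI impI)
  show "openin (product_topology (\<lambda>_. T) I) V" if "V \<in> PiE I ` PiE I (\<lambda>_. B)" for V
    using that topology_baseD(1)[OF B] I by (auto simp: openin_PiE_gen PiE_iff)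
  fix U x assume "openin (product_topology (\<lambda>_. T) I) U \<and> x \<in> U"
  then obtain V where V: "\<forall>i\<in>I. openin T (V i)" "x \<in> PiE I V" "PiE I V \<subseteq> U"
    unfolding openin_product_topology_alt by (elim conjE) (use that in metis)
  have "\<forall>i\<in>I. \<exists>E. E \<in> B \<and> x i \<in> E \<and> E \<subseteq> V i"
  proof
    fix i assume "i \<in> I"
    then have "openin T (V i)" "x i \<in> V i"
      using V(1,2) by (auto simp: PiE_iff)
    from topology_baseD(2)[OF B this] show "\<exists>E. E \<in> B \<and> x i \<in> E \<and> E \<subseteq> V i"
      by blast
  qed
  from bchoice[OF this] obtain E where E: "\<forall>i\<in>I. E i \<in> B \<and> x i \<in> E i \<and> E i \<subseteq> V i"
    by blast
  have "PiE I (restrict E I) \<subseteq> PiE I V"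
    using E by (intro PiE_mono) auto
  then show "\<exists>W\<in>PiE I ` PiE I (\<lambda>_. B). x \<in> W \<and> W \<subseteq> U"
    using E V(2,3) by (intro bexI[of _ "PiE I (restrict E I)"] conjI imageI) (auto simp: PiE_iff extensional_def)
qed

lemma second_countable_prod_topology:
  "second_countable S \<Longrightarrow> second_countable T \<Longrightarrow> second_countable (prod_topology S T)"
  unfolding second_countable_iff_base using topology_base_prod by (metis countable_SIGMA countable_image)

lemma second_countable_finite_product:
  "finite I \<Longrightarrow> second_countable T \<Longrightarrow> second_countable (product_topology (\<lambda>_. T) I)"
  unfolding second_countable_iff_base using topology_base_finite_product by (metis countable_PiE countable_image)

lemma separable_metrizable_prod_topology:
  "separable_metrizable S \<Longrightarrow> separable_metrizable T \<Longrightarrow> separable_metrizable (prod_topology S T)"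
  by (auto simp: separable_metrizable_def second_countable_prod_topology metrizable_space_prod_topology)

lemma separable_metrizable_subtopology:
  "separable_metrizable S \<Longrightarrow> separable_metrizable (subtopology S T)"
  by (auto simp: separable_metrizable_def second_countable_subtopology metrizable_space_subtopology)

lemma separable_metrizable_euclidean:
  "separable_metrizable (euclidean :: 'a::polish_space topology)"
proof -
  obtain B :: "'a set set" where B: "countable B" "topological_basis B"
    using ex_countable_basis by blast
  have "second_countable (euclidean :: 'a topology)"
    unfolding second_countable_def
    using B(2) by (intro exI[of _ B] conjI B(1))
      (auto simp: topological_basis_open elim!: topological_basisE)
  then show ?thesis
    by (simp add: separable_metrizable_def metrizable_space_euclidean)
qed

lemma separable_metrizable_top_of_set:
  "separable_metrizable (top_of_set (W :: 'a::polish_space set))"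
  by (intro separable_metrizable_subtopology separable_metrizable_euclidean)

text \<open>
  An open set of the product is a countable union of open rectangles; this is where second
  countability enters.
\<close>

lemma sets_borel_of_prod_topology:
  assumes "second_countable S" "second_countable T"
  shows "sets (borel_of (prod_topology S T)) = sets (borel_of S \<Otimes>\<^sub>M borel_of T)"
proof
  obtain B C where B: "countable B" "topology_base S B" and C: "countable C" "topology_base T C"
    using assms unfolding second_countable_iff_base by blast
  have "(\<lambda>x. x) \<in> borel_of S \<Otimes>\<^sub>M borel_of T \<rightarrow>\<^sub>M borel_of (prod_topology S T)"
  proof (rule measurable_borel_of_base[OF _ topology_base_prod[OF B(2) C(2)]])
    fix V assume "V \<in> (\<lambda>(V, V'). V \<times> V') ` (B \<times> C)"
    then have "V \<in> sets (borel_of S \<Otimes>\<^sub>M borel_of T)"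
      using topology_baseD(1)[OF B(2)] topology_baseD(1)[OF C(2)] by (auto intro!: pair_measureI openin_borel_of)
    then show "(\<lambda>x. x) -` V \<inter> space (borel_of S \<Otimes>\<^sub>M borel_of T) \<in> sets (borel_of S \<Otimes>\<^sub>M borel_of T)"
      by simp
  qed (use B(1) C(1) in \<open>auto simp: space_pair_measure\<close>)
  from measurable_sets[OF this]
  show "sets (borel_of (prod_topology S T)) \<subseteq> sets (borel_of S \<Otimes>\<^sub>M borel_of T)"
    using sets.sets_into_space[of _ "borel_of (prod_topology S T)"] by (force simp: space_pair_measure Int_absorb2)
  have "A \<times> A' \<in> sets (borel_of (prod_topology S T))"
    if "A \<in> sets (borel_of S)" "A' \<in> sets (borel_of T)" for A A'
  proof -
    have "fst -` A \<inter> space (borel_of (prod_topology S T)) \<in> sets (borel_of (prod_topology S T))"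
      "snd -` A' \<inter> space (borel_of (prod_topology S T)) \<in> sets (borel_of (prod_topology S T))"
      by (rule measurable_sets[OF continuous_map_measurable[OF continuous_map_fst] that(1)]
          measurable_sets[OF continuous_map_measurable[OF continuous_map_snd] that(2)])+
    moreover have "A \<times> A' = (fst -` A \<inter> space (borel_of (prod_topology S T)))
       \<inter> (snd -` A' \<inter> space (borel_of (prod_topology S T)))"
      using that[THEN sets.sets_into_space] by auto
    ultimately show ?thesis
      by simp
  qed
  moreover have "space (borel_of S) \<times> space (borel_of T) \<in> sets (borel_of (prod_topology S T))"
    using sets.top[of "borel_of (prod_topology S T)"] by simp
  ultimately show "sets (borel_of S \<Otimes>\<^sub>M borel_of T) \<subseteq> sets (borel_of (prod_topology S T))"
    unfolding sets_pair_measure by (intro sets.sigma_sets_subset') auto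
qed

lemma measurable_borel_of_finite_product:
  assumes I: "finite I" and T: "second_countable T"
    and ext: "\<And>x. x \<in> space M \<Longrightarrow> f x \<in> extensional I"
    and meas: "\<And>i. i \<in> I \<Longrightarrow> (\<lambda>x. f x i) \<in> M \<rightarrow>\<^sub>M borel_of T"
  shows "f \<in> M \<rightarrow>\<^sub>M borel_of (product_topology (\<lambda>_. T) I)"
proof -
  obtain B where B: "countable B" "topology_base T B"
    using T unfolding second_countable_iff_base by blast
  show ?thesis
  proof (rule measurable_borel_of_base[OF _ topology_base_finite_product[OF I B(2)]])
    show "countable (PiE I ` PiE I (\<lambda>_. B))"
      using I B(1) by (intro countable_image countable_PiE)
    show "f x \<in> topspace (product_topology (\<lambda>_. T) I)" if "x \<in> space M" for x
      using ext[OF that] measurable_space[OF meas that] by (auto simp: PiE_iff)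
    fix V assume "V \<in> PiE I ` PiE I (\<lambda>_. B)"
    then obtain E where E: "\<forall>i\<in>I. E i \<in> B" "V = PiE I E"
      by (auto simp: PiE_iff)
    have "f -` V \<inter> space M = {x \<in> space M. \<forall>i\<in>I. f x i \<in> E i}"
      using ext by (auto simp: E(2) PiE_iff)
    also have "\<dots> \<in> sets M"
    proof (intro sets.sets_Collect_finite_All I)
      fix i assume i: "i \<in> I"
      then have "(\<lambda>x. f x i) -` E i \<inter> space M \<in> sets M"
        using E(1) topology_baseD(1)[OF B(2)] by (intro measurable_sets[OF meas] openin_borel_of) auto
      then show "{x \<in> space M. f x i \<in> E i} \<in> sets M"
        by (simp add: vimage_def Int_def conj_commute)
    qed
    finally show "f -` V \<inter> space M \<in> sets M" .
  qed
qed

section \<open>Semicontinuity along sequences and its test functions\<close>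

lemma metrizable_closedin_sequentially:
  assumes "metrizable_space X"
  shows "closedin X C \<longleftrightarrow>
    C \<subseteq> topspace X \<and> (\<forall>\<sigma> l. range \<sigma> \<subseteq> C \<and> limitin X \<sigma> l sequentially \<longrightarrow> l \<in> C)"
proof -
  obtain M d where "Metric_space M d" "X = Metric_space.mtopology M d"
    using assms by (auto simp: metrizable_space_def)
  then show ?thesis
    by (simp add: Metric_space.metric_closedin_iff_sequentially_closed Metric_space.topspace_mtopology)
qed

lemma metrizable_compactin_sequentially:
  assumes "metrizable_space X"
  shows "compactin X K \<longleftrightarrow> K \<subseteq> topspace X \<and>
    (\<forall>\<sigma>::nat\<Rightarrow>'a. range \<sigma> \<subseteq> K \<longrightarrow>
      (\<exists>l r. l \<in> K \<and> strict_mono r \<and> limitin X (\<sigma> \<circ> r) l sequentially))"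
proof -
  obtain M d where "Metric_space M d" "X = Metric_space.mtopology M d"
    using assms by (auto simp: metrizable_space_def)
  then show ?thesis
    by (simp add: Metric_space.compactin_sequentially Metric_space.topspace_mtopology)
qed

lemma metrizable_continuous_map_sequentially:
  assumes "metrizable_space X" "\<And>x. x \<in> topspace X \<Longrightarrow> f x \<in> topspace Y"
    and lim: "\<And>\<sigma> l. limitin X \<sigma> l sequentially \<Longrightarrow> range \<sigma> \<subseteq> topspace X \<Longrightarrow>
      limitin Y (\<lambda>n. f (\<sigma> n)) (f l) sequentially"
  shows "continuous_map X Y f"
  unfolding continuous_map_closedin
proof (intro conjI ballI allI impI)
  fix C assume C: "closedin Y C"
  show "closedin X {x \<in> topspace X. f x \<in> C}"
    unfolding metrizable_closedin_sequentially[OF assms(1)]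
  proof (intro conjI allI impI)
    fix \<sigma> l assume *: "range \<sigma> \<subseteq> {x \<in> topspace X. f x \<in> C} \<and> limitin X \<sigma> l sequentially"
    then have "limitin Y (\<lambda>n. f (\<sigma> n)) (f l) sequentially"
      by (intro lim) auto
    then have "f l \<in> C"
      by (rule limitin_closedin[OF _ C]) (use * in \<open>auto intro!: always_eventually\<close>)
    then show "l \<in> {x \<in> topspace X. f x \<in> C}"
      using * limitin_topspace by auto
  qed auto
qed (use assms(2) in auto)

text \<open>
  Closed sublevel sets make measurability and the stability under suprema immediate; the
  sequential forms below are the ones that interact with integrals.
\<close>

definition lower_semicontinuous :: "'s topology \<Rightarrow> ('s \<Rightarrow> ennreal) \<Rightarrow> bool" where
  "lower_semicontinuous X u \<longleftrightarrow> (\<forall>t. closedin X {x \<in> topspace X. u x \<le> t})"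

lemma lower_semicontinuous_openin:
  assumes "lower_semicontinuous X u"
  shows "openin X {x \<in> topspace X. t < u x}"
proof -
  have "{x \<in> topspace X. t < u x} = topspace X - {x \<in> topspace X. u x \<le> t}"
    by auto
  then show ?thesis
    using assms by (simp add: lower_semicontinuous_def openin_diff)
qed

lemma lower_semicontinuous_le_liminf:
  assumes "lower_semicontinuous X u" "limitin X \<sigma> l F"
  shows "u l \<le> Liminf F (\<lambda>n. u (\<sigma> n))"
  unfolding le_Liminf_iff
proof (intro allI impI)
  fix y assume "y < u l"
  then have "eventually (\<lambda>n. \<sigma> n \<in> {x \<in> topspace X. y < u x}) F"
    using assms by (intro limitinD[OF assms(2)] lower_semicontinuous_openin) (auto dest: limitin_topspace)
  then show "eventually (\<lambda>n. y < u (\<sigma> n)) F"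
    by (rule eventually_mono) auto
qed

lemma lower_semicontinuous_sequentially:
  assumes "metrizable_space X"
    and "\<And>\<sigma> l t. limitin X \<sigma> l sequentially \<Longrightarrow> range \<sigma> \<subseteq> topspace X \<Longrightarrow> (\<And>n. u (\<sigma> n) \<le> t) \<Longrightarrow> u l \<le> t"
  shows "lower_semicontinuous X u"
  unfolding lower_semicontinuous_def metrizable_closedin_sequentially[OF assms(1)]
proof (intro allI conjI impI)
  fix t \<sigma> l assume *: "range \<sigma> \<subseteq> {x \<in> topspace X. u x \<le> t} \<and> limitin X \<sigma> l sequentially"
  have "u l \<le> t"
    by (rule assms(2)[of \<sigma>]) (use * in auto)
  then show "l \<in> {x \<in> topspace X. u x \<le> t}"
    using * limitin_topspace by auto
qed auto

lemma lower_semicontinuous_sequentially_liminf: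
  assumes "metrizable_space X"
    and "\<And>\<sigma> l. limitin X \<sigma> l sequentially \<Longrightarrow> range \<sigma> \<subseteq> topspace X \<Longrightarrow> u l \<le> liminf (\<lambda>n. u (\<sigma> n))"
  shows "lower_semicontinuous X u"
proof (rule lower_semicontinuous_sequentially[OF assms(1)])
  fix \<sigma> l t assume *: "limitin X \<sigma> l sequentially" "range \<sigma> \<subseteq> topspace X" "\<And>n. u (\<sigma> n) \<le> t"
  have "liminf (\<lambda>n. u (\<sigma> n)) \<le> liminf (\<lambda>n. t)"
    by (intro Liminf_mono always_eventually) (simp add: *(3))
  then show "u l \<le> t"
    using assms(2)[OF *(1,2)] by (simp add: Liminf_const)
qed

lemma lower_semicontinuous_measurable:
  "lower_semicontinuous X u \<Longrightarrow> u \<in> borel_measurable (borel_of X)"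
  by (rule borel_measurableI_le) (auto simp: lower_semicontinuous_def intro: closedin_borel_of)

lemma lower_semicontinuous_SUP:
  assumes "\<And>i. i \<in> I \<Longrightarrow> lower_semicontinuous X (u i)" "\<And>x. x \<in> topspace X \<Longrightarrow> v x = (SUP i\<in>I. u i x)"
  shows "lower_semicontinuous X v"
  unfolding lower_semicontinuous_def
proof
  fix t
  have eq: "{x \<in> topspace X. v x \<le> t} = topspace X \<inter> (\<Inter>i\<in>I. {x \<in> topspace X. u i x \<le> t})"
    using assms(2) by (auto simp: SUP_le_iff)
  show "closedin X {x \<in> topspace X. v x \<le> t}"
  proof (cases "I = {}")
    case False
    have "closedin X (\<Inter>i\<in>I. {x \<in> topspace X. u i x \<le> t})"
      using False assms(1) by (intro closedin_Inter) (auto simp: lower_semicontinuous_def)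
    then show ?thesis
      unfolding eq by (rule closedin_Int[OF closedin_topspace])
  qed (simp add: eq)
qed

lemma lower_semicontinuous_add_cmult:
  assumes "metrizable_space X" "lower_semicontinuous X u" "lower_semicontinuous X v"
  shows "lower_semicontinuous X (\<lambda>x. u x + ennreal c * v x)"
proof (rule lower_semicontinuous_sequentially_liminf[OF assms(1)])
  fix \<sigma> l assume *: "limitin X \<sigma> l sequentially"
  have "ennreal c * v l \<le> ennreal c * liminf (\<lambda>n. v (\<sigma> n))"
    by (intro mult_left_mono lower_semicontinuous_le_liminf[OF assms(3) *]) auto
  also have "\<dots> \<le> liminf (\<lambda>n. ennreal c * v (\<sigma> n))"
    unfolding le_Liminf_iff
  proof (intro allI impI)
    fix y assume y: "y < ennreal c * liminf (\<lambda>n. v (\<sigma> n))"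
    have "ennreal c * liminf (\<lambda>n. v (\<sigma> n)) = (SUP n. ennreal c * (INF m\<in>{n..}. v (\<sigma> m)))"
      unfolding liminf_SUP_INF by (rule SUP_mult_left_ennreal)
    then obtain n where n: "y < ennreal c * (INF m\<in>{n..}. v (\<sigma> m))"
      using y by (auto simp: less_SUP_iff)
    have "y < ennreal c * v (\<sigma> m)" if "m \<ge> n" for m
      by (rule less_le_trans[OF n]) (use that in \<open>auto intro!: mult_left_mono INF_lower\<close>)
    then show "\<forall>\<^sub>F n in sequentially. y < ennreal c * v (\<sigma> n)"
      by (auto simp: eventually_sequentially)
  qed
  finally have "u l + ennreal c * v l \<le> liminf (\<lambda>n. u (\<sigma> n)) + liminf (\<lambda>n. ennreal c * v (\<sigma> n))"
    by (intro add_mono lower_semicontinuous_le_liminf[OF assms(2) *])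
  also have "\<dots> \<le> liminf (\<lambda>n. u (\<sigma> n) + ennreal c * v (\<sigma> n))"
    unfolding liminf_SUP_INF
  proof (subst ennreal_SUP_add[symmetric])
    show "incseq (\<lambda>n. INF m\<in>{n..}. u (\<sigma> m))" "incseq (\<lambda>n. INF m\<in>{n..}. ennreal c * v (\<sigma> m))"
      by (auto intro!: incseq_SucI INF_superset_mono)
  qed (intro SUP_mono bexI[OF _ UNIV_I] INF_greatest add_mono INF_lower)
  finally show "u l + ennreal c * v l \<le> liminf (\<lambda>n. u (\<sigma> n) + ennreal c * v (\<sigma> n))" .
qed

text \<open>
  The functions are \<open>min 1 (m D)\<close>, where \<open>D\<close> is the distance to the complement. They take
  the value \<open>1\<close> at each point of the open set for large \<open>m\<close>, and do not merely converge to it, so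
  that products of the functions \<open>1 - h m\<close> become exactly zero.
\<close>

lemma open_indicator_approximation:
  assumes "metrizable_space X" "openin X U"
  shows "\<exists>h :: nat \<Rightarrow> 'a \<Rightarrow> real. \<forall>m. continuous_map X euclideanreal (h m) \<and>
    (\<forall>x\<in>topspace X. 0 \<le> h m x \<and> h m x \<le> 1 \<and> (x \<notin> U \<longrightarrow> h m x = 0) \<and> (x \<in> U \<longrightarrow> (\<exists>k. h k x = 1)))"
proof (cases "U = topspace X")
  case True
  then show ?thesis
    by (intro exI[of _ "\<lambda>_ _. 1"]) auto
next
  case False
  obtain M d where Md: "Metric_space M d" "X = Metric_space.mtopology M d"
    using assms by (auto simp: metrizable_space_def)
  interpret Metric_space M d by fact
  have topX: "topspace X = M"
    by (simp add: Md)
  define D where "D x = (INF y\<in>M - U. d x y)" for x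
  have ne: "M - U \<noteq> {}"
    using False openin_subset[OF assms(2)] by (auto simp: topX)
  have bdd: "bdd_below ((\<lambda>y. d x y) ` (M - U))" for x
    by (intro bdd_belowI[of _ 0]) auto
  have D_nonneg: "0 \<le> D x" for x
    unfolding D_def using ne by (intro cINF_greatest) auto
  have D_lip: "D x \<le> d x y + D y" if "x \<in> M" "y \<in> M" for x y
  proof -
    have "D x - d x y \<le> d y z" if z: "z \<in> M - U" for z
    proof -
      have "D x \<le> d x z"
        unfolding D_def using z by (intro cINF_lower bdd) auto
      also have "\<dots> \<le> d x y + d y z"
        using z \<open>x \<in> M\<close> \<open>y \<in> M\<close> by (intro triangle) auto
      finally show ?thesis
        by simp
    qed
    then have "D x - d x y \<le> D y"
      unfolding D_def[of y] using ne by (intro cINF_greatest) auto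
    then show ?thesis
      by simp
  qed
  have D_cont: "continuous_map X euclideanreal D"
  proof (rule metrizable_continuous_map_sequentially[OF assms(1)])
    fix \<sigma> l assume *: "limitin X \<sigma> l sequentially" "range \<sigma> \<subseteq> topspace X"
    have l: "l \<in> M" and \<sigma>: "\<And>n. \<sigma> n \<in> M"
      using * limitin_topspace[OF *(1)] by (auto simp: topX)
    have bound: "norm (D (\<sigma> n) - D l) \<le> d (\<sigma> n) l" for n
      using D_lip[OF \<sigma> l] D_lip[OF l \<sigma>] by (simp add: abs_le_iff commute algebra_simps)
    have "(\<lambda>n. d (\<sigma> n) l) \<longlonglongrightarrow> 0"
      using *(1) unfolding Md limit_metric_sequentially LIMSEQ_iff by (force simp: dist_real_def)
    then have "(\<lambda>n. D (\<sigma> n) - D l) \<longlonglongrightarrow> 0"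
      by (rule Lim_null_comparison[OF always_eventually, rotated]) (simp add: bound del: real_norm_def)
    then show "limitin euclideanreal (\<lambda>n. D (\<sigma> n)) (D l) sequentially"
      by (simp add: LIM_zero_iff)
  qed auto
  have D_zero: "D x = 0" if "x \<in> M - U" for x
  proof -
    have "D x \<le> d x x"
      unfolding D_def using that by (intro cINF_lower bdd) auto
    then show ?thesis
      using D_nonneg[of x] that by simp
  qed
  have D_pos: "0 < D x" if x: "x \<in> U" for x
  proof -
    obtain r where r: "r > 0" "mball x r \<subseteq> U"
      using assms(2) x unfolding Md openin_mtopology by auto
    have "r \<le> d x y" if "y \<in> M - U" for y
      using r(2) that x openin_subset[OF assms(2)] by (force simp: in_mball topX)
    then have "r \<le> D x"
      unfolding D_def using ne by (intro cINF_greatest) auto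
    then show ?thesis
      using r(1) by simp
  qed
  show ?thesis
  proof (intro exI[of _ "\<lambda>m x. min 1 (real m * D x)"] allI conjI ballI impI)
    show "continuous_map X euclideanreal (\<lambda>x. min 1 (real m * D x))" for m
      by (intro continuous_map_real_min continuous_map_real_mult continuous_map_const[THEN iffD2] D_cont) auto
    fix x assume x: "x \<in> topspace X"
    show "x \<notin> U \<Longrightarrow> min 1 (real m * D x) = 0" for m
      using x D_zero[of x] by (auto simp: topX)
    assume "x \<in> U"
    then obtain k where "1 < real k * D x"
      using D_pos ex_less_of_nat_mult by blast
    then show "\<exists>k. min 1 (real k * D x) = 1"
      by (intro exI[of _ k]) simp
  qed (auto simp: D_nonneg)
qed

text \<open>
  One countable family serves all lower semicontinuous functions at once: the finite maxima of
  rational multiples of the functions that approximate the indicators of a countable base. The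
  countability is what later reduces weak convergence to countably many integrals.
\<close>

lemma lower_semicontinuous_approximation:
  assumes "separable_metrizable X"
  obtains G :: "('a \<Rightarrow> real) set" where "countable G"
    "\<And>g. g \<in> G \<Longrightarrow> bounded_continuous X g" "\<And>g x. g \<in> G \<Longrightarrow> x \<in> topspace X \<Longrightarrow> 0 \<le> g x"
    "\<And>u. lower_semicontinuous X u \<Longrightarrow> \<exists>g::nat \<Rightarrow> 'a \<Rightarrow> real. range g \<subseteq> G \<and>
       (\<forall>x\<in>topspace X. incseq (\<lambda>k. g k x) \<and> (SUP k. ennreal (g k x)) = u x)"
proof -
  obtain B where B: "countable B" "\<And>V. V \<in> B \<Longrightarrow> openin X V"
      "\<And>U x. openin X U \<Longrightarrow> x \<in> U \<Longrightarrow> \<exists>V\<in>B. x \<in> V \<and> V \<subseteq> U"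
    using assms unfolding separable_metrizable_def second_countable_def by metis
  have "\<forall>U\<in>B. \<exists>h :: nat \<Rightarrow> 'a \<Rightarrow> real. \<forall>m. continuous_map X euclideanreal (h m) \<and>
    (\<forall>x\<in>topspace X. 0 \<le> h m x \<and> h m x \<le> 1 \<and> (x \<notin> U \<longrightarrow> h m x = 0) \<and> (x \<in> U \<longrightarrow> (\<exists>k. h k x = 1)))"
    using assms B(2) by (intro ballI open_indicator_approximation) (auto simp: separable_metrizable_def)
  then obtain h :: "'a set \<Rightarrow> nat \<Rightarrow> 'a \<Rightarrow> real" where
    h_cont: "\<And>U m. U \<in> B \<Longrightarrow> continuous_map X euclideanreal (h U m)" and
    h: "\<And>U m x. U \<in> B \<Longrightarrow> x \<in> topspace X \<Longrightarrow> 0 \<le> h U m x \<and> h U m x \<le> 1 \<and>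
        (x \<notin> U \<longrightarrow> h U m x = 0) \<and> (x \<in> U \<longrightarrow> (\<exists>k. h U k x = 1))"
    by metis
  define G0 where "G0 = (\<lambda>(U, m, r) x. real_of_rat r * h U m x) ` (B \<times> (UNIV :: nat set) \<times> {r. 0 \<le> r})"
  define J where "J F = (\<lambda>x. Max (insert 0 ((\<lambda>g. g x) ` F)))" for F :: "('a \<Rightarrow> real) set"
  have G0: "countable G0"
    unfolding G0_def using B(1) by auto
  have G0_cont: "continuous_map X euclideanreal g" if "g \<in> G0" for g
    using that h_cont unfolding G0_def by (auto intro!: continuous_map_real_mult)
  have G0_bdd: "\<exists>b. \<forall>x\<in>topspace X. g x \<le> b" if "g \<in> G0" for g
  proof -
    obtain p where "g = (\<lambda>(U, m, r) x. real_of_rat r * h U m x) p"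
        "p \<in> B \<times> (UNIV :: nat set) \<times> {r. 0 \<le> r}"
      by (rule imageE[OF \<open>g \<in> G0\<close>[unfolded G0_def]])
    then obtain U m r where "U \<in> B" "0 \<le> r" "g = (\<lambda>x. real_of_rat r * h U m x)"
      by (cases p) (auto intro: that)
    then show ?thesis
      using h by (intro exI[of _ "real_of_rat r"]) (auto intro!: mult_left_le)
  qed
  have J_insert: "J (insert g F) x = max (g x) (J F x)" if "finite F" for g F x
  proof -
    have "insert 0 ((\<lambda>g. g x) ` insert g F) = insert (g x) (insert 0 ((\<lambda>g. g x) ` F))"
      by auto
    then show ?thesis
      unfolding J_def using that by (simp del: insert_iff)
  qed
  have J_props: "continuous_map X euclideanreal (J F) \<and> (\<exists>b. \<forall>x\<in>topspace X. J F x \<le> b)"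
    if "finite F" "F \<subseteq> G0" for F
    using that
  proof (induction F)
    case empty
    show ?case
      by (auto simp: J_def)
  next
    case (insert g F)
    then obtain b b' where "\<forall>x\<in>topspace X. J F x \<le> b" "\<forall>x\<in>topspace X. g x \<le> b'"
      using G0_bdd by blast
    then have "\<exists>b. \<forall>x\<in>topspace X. J (insert g F) x \<le> b"
      by (intro exI[of _ "max b' b"] ballI) (simp only: J_insert[OF insert(1)], intro max.mono, auto)
    moreover have "continuous_map X euclideanreal (\<lambda>x. max (g x) (J F x))"
      using insert G0_cont by (intro continuous_map_real_max) auto
    ultimately show ?case
      by (simp add: ext[OF J_insert[OF insert(1)]])
  qed
  have J_nonneg: "0 \<le> J F x" if "finite F" for F x
    unfolding J_def using that by (intro Max_ge) auto
  let ?G = "J ` {F. finite F \<and> F \<subseteq> G0}"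
  show ?thesis
  proof (rule that[of ?G])
    show "countable ?G"
      using G0 by (intro countable_image countable_Collect_finite_subset)
    show "0 \<le> g x" if "g \<in> ?G" for g x
      using that J_nonneg by auto
    show "bounded_continuous X g" if g: "g \<in> ?G" for g
    proof -
      obtain F where F: "finite F" "F \<subseteq> G0" "g = J F"
        using g by auto
      then obtain b where "\<forall>x\<in>topspace X. g x \<le> b"
        using J_props[OF F(1,2)] by auto
      then have "\<forall>x\<in>topspace X. norm (g x) \<le> b"
        using J_nonneg[OF F(1)] by (auto simp: F)
      then show ?thesis
        using F(3) J_props[OF F(1,2)] unfolding bounded_continuous_def bounded_iff by auto
    qed
    fix u assume u: "lower_semicontinuous X u"
    define N where "N = {g \<in> G0. \<forall>x\<in>topspace X. ennreal (g x) \<le> u x}"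
    (* The intersection matters when N is empty: from_nat_into then returns arbitrary functions. *)
    define F where "F k = N \<inter> from_nat_into N ` {..<k}" for k :: nat
    have F: "finite (F k)" "F k \<subseteq> N" "F k \<subseteq> G0" for k
      by (auto simp: F_def N_def)
    have N: "countable N"
      using G0 by (rule countable_subset[rotated]) (auto simp: N_def)
    show "\<exists>g. range g \<subseteq> ?G \<and> (\<forall>x\<in>topspace X. incseq (\<lambda>k. g k x) \<and> (SUP k. ennreal (g k x)) = u x)"
    proof (intro exI[of _ "\<lambda>k. J (F k)"] conjI ballI)
      show "range (\<lambda>k. J (F k)) \<subseteq> ?G"
        using F by auto
      fix x assume x: "x \<in> topspace X"
      show "incseq (\<lambda>k. J (F k) x)"
        unfolding J_def
      proof (rule incseq_SucI, rule Max_mono)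
        show "insert 0 ((\<lambda>g. g x) ` F k) \<subseteq> insert 0 ((\<lambda>g. g x) ` F (Suc k))" for k
          by (auto simp: F_def)
      qed (use F in auto)
      show "(SUP k. ennreal (J (F k) x)) = u x"
      proof (rule antisym)
        have "ennreal (J (F k) x) \<le> u x" for k
        proof -
          have "J (F k) x \<in> insert 0 ((\<lambda>g. g x) ` F k)"
            unfolding J_def using F by (intro Max_in) auto
          then have "J (F k) x = 0 \<or> (\<exists>g\<in>F k. J (F k) x = g x)"
            by blast
          then show ?thesis
            using F(2)[of k] x by (auto simp: N_def)
        qed
        then show "(SUP k. ennreal (J (F k) x)) \<le> u x"
          by (rule SUP_least)
        show "u x \<le> (SUP k. ennreal (J (F k) x))"
        proof (rule dense_le)
          fix t assume "t < u x"
          then obtain r where r: "t < ennreal (real_of_rat r)" "ennreal (real_of_rat r) < u x"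
            using ennreal_rat_dense by blast
          have r0: "0 \<le> r"
            using r(1) by (metis ennreal_neg less_le not_less_zero of_rat_less_0_iff linorder_not_le zero_le)
          have "openin X {y \<in> topspace X. ennreal (real_of_rat r) < u y}"
            by (rule lower_semicontinuous_openin[OF u])
          then obtain V where V: "V \<in> B" "x \<in> V" "V \<subseteq> {y \<in> topspace X. ennreal (real_of_rat r) < u y}"
            using B(3) x r(2) by (metis (no_types, lifting) mem_Collect_eq)
          then obtain m where m: "h V m x = 1"
            using h x by blast
          let ?g = "\<lambda>y. real_of_rat r * h V m y"
          have "ennreal (?g y) \<le> u y" if "y \<in> topspace X" for y
          proof (cases "y \<in> V")
            case True
            have "ennreal (?g y) \<le> ennreal (real_of_rat r)"
              using h[OF V(1) that] r0 by (intro ennreal_leI mult_left_le) auto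
            then show ?thesis
              using V(3) True by auto
          qed (use h[OF V(1) that] in auto)
          moreover have "?g \<in> G0"
            unfolding G0_def using V(1) r0 by (intro image_eqI[of _ _ "(V, m, r)"]) auto
          ultimately have g: "?g \<in> N"
            by (auto simp: N_def)
          then obtain i where "from_nat_into N i = ?g"
            using from_nat_into_surj[OF N] by blast
          then have "?g \<in> F (Suc i)"
            using g by (force simp: F_def)
          then have "?g x \<le> J (F (Suc i)) x"
            unfolding J_def using F by (intro Max_ge) auto
          then have "ennreal (real_of_rat r) \<le> ennreal (J (F (Suc i)) x)"
            using m by (intro ennreal_leI) simp
          also have "\<dots> \<le> (SUP k. ennreal (J (F k) x))"
            by (rule SUP_upper) simp
          finally show "t \<le> (SUP k. ennreal (J (F k) x))"
            using r(1) by simp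
        qed
      qed
    qed
  qed
qed

lemma lower_semicontinuous_incseq_approximation:
  assumes "separable_metrizable X" "lower_semicontinuous X u"
  obtains g :: "nat \<Rightarrow> 'a \<Rightarrow> real" where "\<And>k. bounded_continuous X (g k)"
    "\<And>k x. x \<in> topspace X \<Longrightarrow> 0 \<le> g k x"
    "\<And>x. x \<in> topspace X \<Longrightarrow> incseq (\<lambda>k. g k x) \<and> (SUP k. ennreal (g k x)) = u x"
proof -
  obtain G :: "('a \<Rightarrow> real) set" where G: "countable G"
    "\<And>g. g \<in> G \<Longrightarrow> bounded_continuous X g" "\<And>g x. g \<in> G \<Longrightarrow> x \<in> topspace X \<Longrightarrow> 0 \<le> g x"
    "\<And>u. lower_semicontinuous X u \<Longrightarrow> \<exists>g::nat \<Rightarrow> 'a \<Rightarrow> real. range g \<subseteq> G \<and>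
       (\<forall>x\<in>topspace X. incseq (\<lambda>k. g k x) \<and> (SUP k. ennreal (g k x)) = u x)"
    using lower_semicontinuous_approximation[OF assms(1)] by blast
  obtain g :: "nat \<Rightarrow> 'a \<Rightarrow> real" where g: "range g \<subseteq> G"
      "\<forall>x\<in>topspace X. incseq (\<lambda>k. g k x) \<and> (SUP k. ennreal (g k x)) = u x"
    using G(4)[OF assms(2)] by blast
  then have "g k \<in> G" for k
    by auto
  then show ?thesis
    using g(2) G(2,3) by (intro that[of g]) auto
qed

section \<open>The weak topology\<close>

lemma prob_measuresD:
  assumes "\<mu> \<in> prob_measures S"
  shows "prob_space \<mu>" "sets \<mu> = sets (borel_of S)" "space \<mu> = topspace S"
  using assms by (auto simp: prob_measures_def space_prob_algebra dest: sets_eq_imp_space_eq)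

lemma prob_measures_iff: "\<mu> \<in> prob_measures S \<longleftrightarrow> sets \<mu> = sets (borel_of S) \<and> prob_space \<mu>"
  by (simp add: prob_measures_def space_prob_algebra)

lemma measurable_prob_measures:
  "\<mu> \<in> prob_measures S \<Longrightarrow> f \<in> borel_of S \<rightarrow>\<^sub>M N \<Longrightarrow> f \<in> \<mu> \<rightarrow>\<^sub>M N"
  using measurable_cong_sets[OF prob_measuresD(2) refl] by blast

lemma bounded_continuousE:
  assumes "bounded_continuous S f"
  obtains b where "0 \<le> b" "\<forall>x\<in>topspace S. \<bar>f x\<bar> \<le> b"
proof -
  obtain b where "\<forall>y\<in>f ` topspace S. norm y \<le> b"
    using assms by (auto simp: bounded_continuous_def bounded_iff)
  then show ?thesis
    by (intro that[of "max 0 b"]) (auto simp: le_max_iff_disj)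
qed

lemma bounded_continuousI:
  assumes "continuous_map S euclideanreal f" "\<And>x. x \<in> topspace S \<Longrightarrow> \<bar>f x\<bar> \<le> b"
  shows "bounded_continuous S f"
  using assms by (auto simp: bounded_continuous_def bounded_iff)

lemma bounded_continuous_measurable:
  "bounded_continuous S f \<Longrightarrow> f \<in> borel_measurable (borel_of S)"
  by (auto simp: bounded_continuous_def intro: continuous_map_borel_measurable)

lemma prob_space_bounded_integral:
  fixes f :: "'a \<Rightarrow> real"
  assumes "prob_space M" "f \<in> borel_measurable M" "\<And>x. x \<in> space M \<Longrightarrow> \<bar>f x\<bar> \<le> b"
  shows "integrable M f" "\<bar>\<integral>x. f x \<partial>M\<bar> \<le> b"
proof -
  interpret prob_space M by fact
  show i: "integrable M f"
    using assms(2,3) by (intro integrable_const_bound[of _ b]) auto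
  have "\<bar>\<integral>x. f x \<partial>M\<bar> \<le> (\<integral>x. \<bar>f x\<bar> \<partial>M)"
    by (rule integral_abs_bound)
  also have "\<dots> \<le> (\<integral>x. b \<partial>M)"
    using i assms(3) by (intro integral_mono) auto
  finally show "\<bar>\<integral>x. f x \<partial>M\<bar> \<le> b"
    by (simp add: prob_space)
qed

lemma bounded_measurable_integrable:
  assumes "\<mu> \<in> prob_measures S" "f \<in> borel_measurable (borel_of S)"
    "\<And>x. x \<in> topspace S \<Longrightarrow> \<bar>f x\<bar> \<le> b"
  shows "integrable \<mu> (f :: _ \<Rightarrow> real)"
  using assms prob_measuresD[OF assms(1)]
  by (intro prob_space_bounded_integral(1)[of _ _ b] measurable_prob_measures[OF assms(1)]) auto

lemma bounded_continuous_integrable: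
  assumes "\<mu> \<in> prob_measures S" "bounded_continuous S f"
  shows "integrable \<mu> f"
proof -
  obtain b where b: "0 \<le> b" "\<forall>x\<in>topspace S. \<bar>f x\<bar> \<le> b"
    by (rule bounded_continuousE[OF assms(2)])
  show ?thesis
    by (rule bounded_measurable_integrable[OF assms(1) bounded_continuous_measurable[OF assms(2)], of b])
      (use b in auto)
qed

lemma continuous_map_integral:
  assumes "bounded_continuous S f"
  shows "continuous_map (weak_topology S) euclideanreal (\<lambda>\<mu>. \<integral>x. f x \<partial>\<mu>)"
  unfolding continuous_map topspace_weak_topology
proof (intro conjI allI impI)
  fix U assume "openin euclideanreal U"
  then have "{\<mu> \<in> prob_measures S. (\<integral>x. f x \<partial>\<mu>) \<in> U}
    \<in> {{\<mu> \<in> prob_measures S. (\<integral>x. f x \<partial>\<mu>) \<in> U} | f U. bounded_continuous S f \<and> open U}"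
    using assms by auto
  then show "openin (weak_topology S) {\<mu> \<in> prob_measures S. (\<integral>x. f x \<partial>\<mu>) \<in> U}"
    unfolding weak_topology_def by (rule topology_generated_by_Basis)
qed auto

text \<open>
  The topology is generated by preimages under integrals; neighbourhoods that are finite
  intersections or unions of such sets are handled by induction on their generation.
\<close>

lemma limitin_weak_topology:
  "limitin (weak_topology S) \<mu>s \<mu> F \<longleftrightarrow> \<mu> \<in> prob_measures S \<and>
     (\<forall>\<^sub>F n in F. \<mu>s n \<in> prob_measures S) \<and>
     (\<forall>f. bounded_continuous S f \<longrightarrow> ((\<lambda>n. \<integral>x. f x \<partial>\<mu>s n) \<longlongrightarrow> (\<integral>x. f x \<partial>\<mu>)) F)"
    (is "?L \<longleftrightarrow> ?R")
proof
  assume L: ?L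
  have "\<forall>\<^sub>F n in F. \<mu>s n \<in> prob_measures S"
    using limitinD[OF L openin_topspace] limitin_topspace[OF L] by (simp add: topspace_weak_topology)
  moreover have "((\<lambda>n. \<integral>x. f x \<partial>\<mu>s n) \<longlongrightarrow> (\<integral>x. f x \<partial>\<mu>)) F" if "bounded_continuous S f" for f
    using continuous_map_limit[OF continuous_map_integral[OF that] L] by (simp add: comp_def)
  ultimately show ?R
    using limitin_topspace[OF L] by (simp add: topspace_weak_topology)
next
  assume R: ?R
  let ?B = "{{\<mu> \<in> prob_measures S. (\<integral>x. f x \<partial>\<mu>) \<in> U} | f U. bounded_continuous S f \<and> open U}"
  have "\<mu> \<in> U \<longrightarrow> eventually (\<lambda>n. \<mu>s n \<in> U) F" if "generate_topology_on ?B U" for U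
    using that
  proof induction
    case (Int a b)
    then show ?case
      by (auto intro: eventually_conj)
  next
    case (UN K)
    show ?case
    proof
      assume "\<mu> \<in> \<Union>K"
      then obtain k where k: "k \<in> K" "\<mu> \<in> k"
        by blast
      then have "eventually (\<lambda>n. \<mu>s n \<in> k) F"
        using UN.IH by simp
      then show "eventually (\<lambda>n. \<mu>s n \<in> \<Union>K) F"
        by (rule eventually_mono) (use k(1) in blast)
    qed
  next
    case (Basis s)
    then obtain f U where f: "s = {\<mu> \<in> prob_measures S. (\<integral>x. f x \<partial>\<mu>) \<in> U}" "bounded_continuous S f" "open U"
      by auto
    show ?case
    proof
      assume "\<mu> \<in> s"
      then have "\<forall>\<^sub>F n in F. (\<integral>x. f x \<partial>\<mu>s n) \<in> U"
        using R f by (intro topological_tendstoD[of _ "\<integral>x. f x \<partial>\<mu>"]) auto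
      moreover have "\<forall>\<^sub>F n in F. \<mu>s n \<in> prob_measures S"
        using R by simp
      ultimately show "\<forall>\<^sub>F n in F. \<mu>s n \<in> s"
        by eventually_elim (simp add: f)
    qed
  qed auto
  then show ?L
    using R unfolding limitin_def topspace_weak_topology
    by (auto simp: weak_topology_def openin_topology_generated_by_iff)
qed

lemma lower_semicontinuous_ennreal:
  assumes "continuous_map X euclideanreal g"
  shows "lower_semicontinuous X (\<lambda>x. ennreal (g x))"
  unfolding lower_semicontinuous_def
proof
  fix t :: ennreal
  show "closedin X {x \<in> topspace X. ennreal (g x) \<le> t}"
  proof (cases t)
    case (real r)
    have "closedin X {x \<in> topspace X. g x \<in> {..r}}"
      using assms by (rule closedin_continuous_map_preimage) simp
    then show ?thesis
      using real by (simp add: ennreal_le_iff)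
  qed simp
qed

lemma lower_semicontinuous_indicator:
  assumes "openin X U"
  shows "lower_semicontinuous X (indicator U)"
  unfolding lower_semicontinuous_def
proof
  fix t :: ennreal
  have "{x \<in> topspace X. indicator U x \<le> t} = (if 1 \<le> t then topspace X else topspace X - U)"
    by (auto split: split_indicator)
  then show "closedin X {x \<in> topspace X. indicator U x \<le> t}"
    using assms by (auto intro: closedin_diff)
qed

lemma nn_integral_bounded_continuous:
  assumes "\<mu> \<in> prob_measures S" "bounded_continuous S g" "\<And>x. x \<in> topspace S \<Longrightarrow> 0 \<le> g x"
  shows "(\<integral>\<^sup>+x. ennreal (g x) \<partial>\<mu>) = ennreal (\<integral>x. g x \<partial>\<mu>)"
  using assms prob_measuresD[OF assms(1)]
  by (intro nn_integral_eq_integral bounded_continuous_integrable AE_I2) auto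

lemma nn_integral_SUP_approximation:
  assumes "\<mu> \<in> prob_measures S" "\<And>k. bounded_continuous S (g k)"
    "\<And>k x. x \<in> topspace S \<Longrightarrow> 0 \<le> g k x"
    "\<And>x. x \<in> topspace S \<Longrightarrow> incseq (\<lambda>k. g k x) \<and> (SUP k. ennreal (g k x)) = u x"
  shows "(\<integral>\<^sup>+x. u x \<partial>\<mu>) = (SUP k. ennreal (\<integral>x. g k x \<partial>\<mu>))"
proof -
  note \<mu> = prob_measuresD[OF assms(1)]
  have "(\<integral>\<^sup>+x. u x \<partial>\<mu>) = (\<integral>\<^sup>+x. (SUP k. ennreal (g k x)) \<partial>\<mu>)"
    using assms(4) \<mu> by (intro nn_integral_cong) auto
  also have "\<dots> = (SUP k. \<integral>\<^sup>+x. ennreal (g k x) \<partial>\<mu>)"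
  proof (rule nn_integral_monotone_convergence_SUP_AE)
    show "AE x in \<mu>. ennreal (g k x) \<le> ennreal (g (Suc k) x)" for k
      using assms(4) \<mu> by (intro AE_I2 ennreal_leI) (auto simp: incseq_Suc_iff)
    show "(\<lambda>x. ennreal (g k x)) \<in> borel_measurable \<mu>" for k
      using measurable_prob_measures[OF assms(1) bounded_continuous_measurable[OF assms(2)]] by simp
  qed
  also have "\<dots> = (SUP k. ennreal (\<integral>x. g k x \<partial>\<mu>))"
    using nn_integral_bounded_continuous[OF assms(1,2,3)] by simp
  finally show ?thesis .
qed

text \<open>
  The integrand is an increasing limit of bounded continuous functions, so the integral is a
  supremum of continuous functions of the measure.
\<close>

lemma lower_semicontinuous_nn_integral:
  assumes "separable_metrizable S" "lower_semicontinuous S u"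
  shows "lower_semicontinuous (weak_topology S) (\<lambda>\<mu>. \<integral>\<^sup>+x. u x \<partial>\<mu>)"
proof -
  obtain g :: "nat \<Rightarrow> 'a \<Rightarrow> real" where g: "\<And>k. bounded_continuous S (g k)"
    "\<And>k x. x \<in> topspace S \<Longrightarrow> 0 \<le> g k x"
    "\<And>x. x \<in> topspace S \<Longrightarrow> incseq (\<lambda>k. g k x) \<and> (SUP k. ennreal (g k x)) = u x"
    using lower_semicontinuous_incseq_approximation[OF assms] by blast
  show ?thesis
  proof (rule lower_semicontinuous_SUP[where I=UNIV])
    show "lower_semicontinuous (weak_topology S) (\<lambda>\<mu>. ennreal (\<integral>x. g k x \<partial>\<mu>))" for k
      by (intro lower_semicontinuous_ennreal continuous_map_integral g(1))
    show "(\<integral>\<^sup>+x. u x \<partial>\<mu>) = (SUP k. ennreal (\<integral>x. g k x \<partial>\<mu>))" if "\<mu> \<in> topspace (weak_topology S)" for \<mu>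
      using that g by (intro nn_integral_SUP_approximation) (auto simp: topspace_weak_topology)
  qed
qed

lemma prob_measures_eqI:
  assumes "\<mu> \<in> prob_measures S" "\<nu> \<in> prob_measures S"
    and eq: "\<And>U. openin S U \<Longrightarrow> emeasure \<mu> U = emeasure \<nu> U"
  shows "\<mu> = \<nu>"
proof (rule measure_eqI_generator_eq[where E="{U. openin S U}" and \<Omega>="topspace S" and A="\<lambda>_. topspace S"])
  interpret prob_space \<mu>
    using prob_measuresD[OF assms(1)] by simp
  show "emeasure \<mu> (topspace S) \<noteq> \<infinity>" for i :: nat
    by simp
qed (use prob_measuresD[OF assms(1)] prob_measuresD[OF assms(2)] eq in
  \<open>auto simp: Int_stable_def sets_borel_of dest: openin_subset\<close>)

text \<open>
  Every nonnegative bounded continuous \<open>f\<close> is an increasing limit of members of the countable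
  family, which bounds the limit inferior of its integrals from below. Applied to \<open>b + f\<close> and to
  \<open>b - f\<close>, this gives convergence.
\<close>

lemma weak_convergence_determining_sequence:
  assumes "separable_metrizable S"
  obtains \<gamma> :: "nat \<Rightarrow> 'a \<Rightarrow> real" where "\<And>i. bounded_continuous S (\<gamma> i)"
    "\<And>\<mu>s \<mu>. \<mu> \<in> prob_measures S \<Longrightarrow> (\<And>n. \<mu>s n \<in> prob_measures S) \<Longrightarrow>
       (\<And>i. (\<lambda>n. \<integral>x. \<gamma> i x \<partial>\<mu>s n) \<longlonglongrightarrow> (\<integral>x. \<gamma> i x \<partial>\<mu>)) \<Longrightarrow>
       limitin (weak_topology S) \<mu>s \<mu> sequentially"
    "\<And>\<mu> \<nu>. \<mu> \<in> prob_measures S \<Longrightarrow> \<nu> \<in> prob_measures S \<Longrightarrow>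
       (\<And>i. (\<integral>x. \<gamma> i x \<partial>\<mu>) = (\<integral>x. \<gamma> i x \<partial>\<nu>)) \<Longrightarrow> \<mu> = \<nu>"
proof -
  obtain G :: "('a \<Rightarrow> real) set" where G: "countable G"
    "\<And>g. g \<in> G \<Longrightarrow> bounded_continuous S g" "\<And>g x. g \<in> G \<Longrightarrow> x \<in> topspace S \<Longrightarrow> 0 \<le> g x"
    "\<And>u. lower_semicontinuous S u \<Longrightarrow> \<exists>g::nat \<Rightarrow> 'a \<Rightarrow> real. range g \<subseteq> G \<and>
       (\<forall>x\<in>topspace S. incseq (\<lambda>k. g k x) \<and> (SUP k. ennreal (g k x)) = u x)"
    using lower_semicontinuous_approximation[OF assms(1)] by blast
  have approx: "\<exists>g :: nat \<Rightarrow> 'a \<Rightarrow> real. (\<forall>k. g k \<in> G) \<and>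
      (\<forall>\<mu>\<in>prob_measures S. (\<integral>\<^sup>+x. u x \<partial>\<mu>) = (SUP k. ennreal (\<integral>x. g k x \<partial>\<mu>)))
      \<and> (\<forall>k. \<forall>x\<in>topspace S. ennreal (g k x) \<le> u x)"
    if u: "lower_semicontinuous S u" for u
  proof -
    obtain g :: "nat \<Rightarrow> 'a \<Rightarrow> real" where g: "range g \<subseteq> G"
        "\<forall>x\<in>topspace S. incseq (\<lambda>k. g k x) \<and> (SUP k. ennreal (g k x)) = u x"
      using G(4)[OF u] by blast
    then have gG: "g k \<in> G" for k
      by auto
    have 1: "(\<integral>\<^sup>+x. u x \<partial>\<mu>) = (SUP k. ennreal (\<integral>x. g k x \<partial>\<mu>))" if "\<mu> \<in> prob_measures S" for \<mu>
      using that g(2) G(2,3) gG by (intro nn_integral_SUP_approximation) auto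
    have 2: "ennreal (g k x) \<le> u x" if "x \<in> topspace S" for k x
    proof -
      have "ennreal (g k x) \<le> (SUP k. ennreal (g k x))"
        by (rule SUP_upper) simp
      then show ?thesis
        using g(2) that by simp
    qed
    show ?thesis
      using gG 1 2 by (intro exI[of _ g]) simp
  qed
  have "lower_semicontinuous S (\<lambda>_. ennreal 1)"
    by (rule lower_semicontinuous_ennreal) simp
  then have "G \<noteq> {}"
    using approx by fast
  then have range: "range (from_nat_into G) = G"
    using G(1) by (rule range_from_nat_into)
  show ?thesis
  proof (rule that[of "from_nat_into G"])
    show "bounded_continuous S (from_nat_into G i)" for i
      using range G(2) by auto
  next
    fix \<mu> \<nu> assume *: "\<mu> \<in> prob_measures S" "\<nu> \<in> prob_measures S"
      "\<And>i. (\<integral>x. from_nat_into G i x \<partial>\<mu>) = (\<integral>x. from_nat_into G i x \<partial>\<nu>)"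
    have eq: "(\<integral>x. g x \<partial>\<mu>) = (\<integral>x. g x \<partial>\<nu>)" if "g \<in> G" for g
    proof -
      obtain i where "g = from_nat_into G i"
        using range \<open>g \<in> G\<close> by blast
      then show ?thesis
        using *(3) by simp
    qed
    show "\<mu> = \<nu>"
    proof (rule prob_measures_eqI[OF *(1,2)])
      fix U assume U: "openin S U"
      obtain g :: "nat \<Rightarrow> 'a \<Rightarrow> real" where g: "\<forall>k. g k \<in> G"
        "\<forall>\<mu>\<in>prob_measures S. (\<integral>\<^sup>+x. indicator U x \<partial>\<mu>) = (SUP k. ennreal (\<integral>x. g k x \<partial>\<mu>))"
        using approx[OF lower_semicontinuous_indicator[OF U]] by blast
      have "(\<integral>\<^sup>+x. indicator U x \<partial>\<mu>) = (\<integral>\<^sup>+x. indicator U x \<partial>\<nu>)"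
        using g *(1,2) eq by simp
      then show "emeasure \<mu> U = emeasure \<nu> U"
        using *(1,2)[THEN prob_measuresD(2)] openin_borel_of[OF U] by simp
    qed
  next
    fix \<mu>s \<mu> assume \<mu>: "\<mu> \<in> prob_measures S" and \<mu>s: "\<And>n. \<mu>s n \<in> prob_measures S"
      and lim: "\<And>i. (\<lambda>n. \<integral>x. from_nat_into G i x \<partial>\<mu>s n) \<longlonglongrightarrow> (\<integral>x. from_nat_into G i x \<partial>\<mu>)"
    have limG: "(\<lambda>n. \<integral>x. g x \<partial>\<mu>s n) \<longlonglongrightarrow> (\<integral>x. g x \<partial>\<mu>)" if "g \<in> G" for g
    proof -
      obtain i where "g = from_nat_into G i"
        using range \<open>g \<in> G\<close> by blast
      then show ?thesis
        using lim by simp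
    qed
    have lower: "\<forall>\<^sub>F n in sequentially. t < (\<integral>x. f x \<partial>\<mu>s n)"
      if f: "bounded_continuous S f" "\<And>x. x \<in> topspace S \<Longrightarrow> 0 \<le> f x" and t: "t < (\<integral>x. f x \<partial>\<mu>)" for f t
    proof -
      have "lower_semicontinuous S (\<lambda>x. ennreal (f x))"
        using f(1) by (intro lower_semicontinuous_ennreal) (simp add: bounded_continuous_def)
      from approx[OF this] obtain g :: "nat \<Rightarrow> 'a \<Rightarrow> real" where g: "\<forall>k. g k \<in> G"
        "\<forall>\<mu>\<in>prob_measures S. (\<integral>\<^sup>+x. ennreal (f x) \<partial>\<mu>) = (SUP k. ennreal (\<integral>x. g k x \<partial>\<mu>))"
        "\<forall>k. \<forall>x\<in>topspace S. ennreal (g k x) \<le> ennreal (f x)"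
        by blast
      have fint: "(\<integral>\<^sup>+x. ennreal (f x) \<partial>\<nu>) = ennreal (\<integral>x. f x \<partial>\<nu>)" if "\<nu> \<in> prob_measures S" for \<nu>
        using nn_integral_bounded_continuous[OF that f] .
      have "\<exists>k. t < (\<integral>x. g k x \<partial>\<mu>)"
      proof (rule ccontr)
        assume "\<not> ?thesis"
        then have le: "(\<integral>x. g k x \<partial>\<mu>) \<le> t" for k
          by (auto simp: not_less)
        have "0 \<le> (\<integral>x. g 0 x \<partial>\<mu>)"
          using g(1) G(3) prob_measuresD(3)[OF \<mu>] by (intro integral_nonneg_AE AE_I2) auto
        then have "0 \<le> t"
          using le[of 0] by simp
        have "ennreal (\<integral>x. f x \<partial>\<mu>) \<le> ennreal t"
          unfolding fint[OF \<mu>, symmetric] bspec[OF g(2) \<mu>] by (intro SUP_least ennreal_leI le)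
        then show False
          using t \<open>0 \<le> t\<close> by (simp add: ennreal_le_iff)
      qed
      then obtain k where k: "t < (\<integral>x. g k x \<partial>\<mu>)" ..
      have "\<forall>\<^sub>F n in sequentially. t < (\<integral>x. g k x \<partial>\<mu>s n)"
        using g(1) by (intro order_tendstoD(1)[OF limG k]) auto
      then show ?thesis
      proof eventually_elim
        case (elim n)
        have "g k x \<le> f x" if "x \<in> topspace S" for x
          using g(3)[THEN spec, THEN bspec, OF that] ennreal_le_iff[OF f(2)[OF that]] by blast
        then have "(\<integral>x. g k x \<partial>\<mu>s n) \<le> (\<integral>x. f x \<partial>\<mu>s n)"
          using prob_measuresD(3)[OF \<mu>s]
          by (intro integral_mono bounded_continuous_integrable[OF \<mu>s] G(2)[OF g(1)[rule_format]] f(1)) simp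
        then show ?case
          using elim by simp
      qed
    qed
    have "(\<lambda>n. \<integral>x. f x \<partial>\<mu>s n) \<longlonglongrightarrow> (\<integral>x. f x \<partial>\<mu>)" if f: "bounded_continuous S f" for f
    proof -
      obtain b where b: "0 \<le> b" "\<forall>x\<in>topspace S. \<bar>f x\<bar> \<le> b"
        by (rule bounded_continuousE[OF f])
      have cont: "continuous_map S euclideanreal f"
        using f by (simp add: bounded_continuous_def)
      have 1: "bounded_continuous S (\<lambda>x. b + f x)" "bounded_continuous S (\<lambda>x. b - f x)"
        using b by (intro bounded_continuousI[of _ _ "2 * b"] continuous_map_add continuous_map_diff cont
            continuous_map_const[THEN iffD2]; force simp: abs_le_iff)+
      have 2: "(\<integral>x. b + f x \<partial>\<nu>) = b + (\<integral>x. f x \<partial>\<nu>)" "(\<integral>x. b - f x \<partial>\<nu>) = b - (\<integral>x. f x \<partial>\<nu>)"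
        if "\<nu> \<in> prob_measures S" for \<nu>
      proof -
        interpret prob_space \<nu>
          using prob_measuresD[OF that] by simp
        show "(\<integral>x. b + f x \<partial>\<nu>) = b + (\<integral>x. f x \<partial>\<nu>)" "(\<integral>x. b - f x \<partial>\<nu>) = b - (\<integral>x. f x \<partial>\<nu>)"
          using bounded_continuous_integrable[OF that f] by (simp_all add: prob_space)
      qed
      show ?thesis
      proof (rule order_tendstoI)
        fix t assume "t < (\<integral>x. f x \<partial>\<mu>)"
        then have "\<forall>\<^sub>F n in sequentially. b + t < (\<integral>x. b + f x \<partial>\<mu>s n)"
          using b by (intro lower[OF 1(1)]) (force simp: 2[OF \<mu>] abs_le_iff)+
        then show "\<forall>\<^sub>F n in sequentially. t < (\<integral>x. f x \<partial>\<mu>s n)"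
          by (simp add: 2[OF \<mu>s])
      next
        fix t assume "(\<integral>x. f x \<partial>\<mu>) < t"
        then have "\<forall>\<^sub>F n in sequentially. b - t < (\<integral>x. b - f x \<partial>\<mu>s n)"
          using b by (intro lower[OF 1(2)]) (force simp: 2[OF \<mu>] abs_le_iff)+
        then show "\<forall>\<^sub>F n in sequentially. (\<integral>x. f x \<partial>\<mu>s n) < t"
          by (simp add: 2[OF \<mu>s])
      qed
    qed
    then show "limitin (weak_topology S) \<mu>s \<mu> sequentially"
      using \<mu> \<mu>s by (simp add: limitin_weak_topology)
  qed
qed

text \<open>
  The integrals of the determining sequence embed the space of measures into the space of real
  sequences.
\<close>

lemma weak_topology_embedding:
  assumes "separable_metrizable S"
  obtains e :: "'a measure \<Rightarrow> nat \<Rightarrow> real" where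
    "homeomorphic_map (weak_topology S) (top_of_set (e ` prob_measures S)) e"
    "e \<in> borel_measurable (prob_algebra (borel_of S))"
proof -
  obtain \<gamma> :: "nat \<Rightarrow> 'a \<Rightarrow> real" where \<gamma>: "\<And>i. bounded_continuous S (\<gamma> i)"
    "\<And>\<mu>s \<mu>. \<mu> \<in> prob_measures S \<Longrightarrow> (\<And>n. \<mu>s n \<in> prob_measures S) \<Longrightarrow>
       (\<And>i. (\<lambda>n. \<integral>x. \<gamma> i x \<partial>\<mu>s n) \<longlonglongrightarrow> (\<integral>x. \<gamma> i x \<partial>\<mu>)) \<Longrightarrow>
       limitin (weak_topology S) \<mu>s \<mu> sequentially"
    "\<And>\<mu> \<nu>. \<mu> \<in> prob_measures S \<Longrightarrow> \<nu> \<in> prob_measures S \<Longrightarrow>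
       (\<And>i. (\<integral>x. \<gamma> i x \<partial>\<mu>) = (\<integral>x. \<gamma> i x \<partial>\<nu>)) \<Longrightarrow> \<mu> = \<nu>"
    using weak_convergence_determining_sequence[OF assms] by blast
  define e where "e \<mu> = (\<lambda>i. \<integral>x. \<gamma> i x \<partial>\<mu>)" for \<mu> :: "'a measure"
  define P where "P = prob_measures S"
  have inj: "inj_on e P"
    by (rule inj_onI, rule \<gamma>(3)) (auto simp: e_def P_def fun_eq_iff)
  have "continuous_map (weak_topology S) (product_topology (\<lambda>_. euclideanreal) UNIV) e"
    unfolding e_def by (simp add: continuous_map_componentwise_UNIV continuous_map_integral \<gamma>(1))
  then have cont: "continuous_map (weak_topology S) (top_of_set (e ` P)) e"
    by (simp add: euclidean_product_topology continuous_map_in_subtopology topspace_weak_topology P_def)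
  have inv: "continuous_map (top_of_set (e ` P)) (weak_topology S) (inv_into P e)"
  proof (rule metrizable_continuous_map_sequentially)
    show "metrizable_space (top_of_set (e ` P))"
      by (intro metrizable_space_subtopology metrizable_space_euclidean)
    show "inv_into P e y \<in> topspace (weak_topology S)" if "y \<in> topspace (top_of_set (e ` P))" for y
      using that inv_into_into[of y e P] by (simp add: topspace_weak_topology P_def)
    fix y l assume *: "limitin (top_of_set (e ` P)) y l sequentially" "range y \<subseteq> topspace (top_of_set (e ` P))"
    then have l: "l \<in> e ` P" "y \<longlonglongrightarrow> l"
      by (auto simp: limitin_subtopology)
    have y: "y n \<in> e ` P" for n
      using *(2) by auto
    have ev: "(\<integral>x. \<gamma> i x \<partial>inv_into P e y) = y i" if "y \<in> e ` P" for y i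
      using f_inv_into_f[OF that] unfolding e_def by (metis)
    show "limitin (weak_topology S) (\<lambda>n. inv_into P e (y n)) (inv_into P e l) sequentially"
    proof (rule \<gamma>(2))
      show "inv_into P e l \<in> prob_measures S" "inv_into P e (y n) \<in> prob_measures S" for n
        using inv_into_into[OF l(1)] inv_into_into[OF y] by (auto simp: P_def)
      show "(\<lambda>n. \<integral>x. \<gamma> i x \<partial>inv_into P e (y n)) \<longlonglongrightarrow> (\<integral>x. \<gamma> i x \<partial>inv_into P e l)" for i
        unfolding ev[OF l(1)] ev[OF y]
        by (rule continuous_on_tendsto_compose[OF continuous_on_product_coordinates l(2)]) auto
    qed
  qed
  have "homeomorphic_maps (weak_topology S) (top_of_set (e ` P)) e (inv_into P e)"
    unfolding homeomorphic_maps_def using cont inv inj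
    by (auto simp: topspace_weak_topology P_def)
  moreover have "e \<in> borel_measurable (prob_algebra (borel_of S))"
    unfolding e_def prob_algebra_def
    by (intro measurable_coordinatewise_then_product measurable_restrict_space1
        integral_measurable_subprob_algebra bounded_continuous_measurable \<gamma>(1))
  ultimately show ?thesis
    using that[of e] by (auto simp: homeomorphic_maps_map P_def)
qed

lemma separable_metrizable_weak_topology:
  assumes "separable_metrizable S"
  shows "separable_metrizable (weak_topology S)"
proof -
  obtain e :: "'a measure \<Rightarrow> nat \<Rightarrow> real" where
    "homeomorphic_map (weak_topology S) (top_of_set (e ` prob_measures S)) e"
    using weak_topology_embedding[OF assms] by blast
  then have "weak_topology S homeomorphic_space top_of_set (e ` prob_measures S)"
    by (rule homeomorphic_map_imp_homeomorphic_space)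
  then show ?thesis
    using separable_metrizable_top_of_set[of "e ` prob_measures S"]
    by (simp add: separable_metrizable_def homeomorphic_metrizable_space homeomorphic_space_second_countability)
qed

text \<open>
  Evaluation at an open set is lower semicontinuous, hence Borel. Conversely the embedding into
  the space of sequences is measurable, and weakly open sets are preimages of open sets under it.
  Measurability of measure-valued maps can thus be checked in \<open>prob_algebra\<close>.
\<close>

lemma sets_borel_of_weak_topology:
  assumes "separable_metrizable S"
  shows "sets (borel_of (weak_topology S)) = sets (prob_algebra (borel_of S))"
proof
  have sp: "space (borel_of (weak_topology S)) = space (prob_algebra (borel_of S))"
    by (simp add: topspace_weak_topology prob_measures_def)
  have "(\<lambda>\<mu>. \<mu>) \<in> borel_of (weak_topology S) \<rightarrow>\<^sub>M prob_algebra (borel_of S)"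
  proof (rule measurable_prob_algebra_generated[where \<Omega>="topspace S" and G="{U. openin S U}"])
    fix U assume "U \<in> {U. openin S U}"
    then have U: "openin S U"
      by simp
    have "(\<lambda>\<mu>. \<integral>\<^sup>+x. indicator U x \<partial>\<mu>) \<in> borel_measurable (borel_of (weak_topology S))"
      using assms U by (intro lower_semicontinuous_measurable lower_semicontinuous_nn_integral
          lower_semicontinuous_indicator)
    also have "?this \<longleftrightarrow> (\<lambda>\<mu>. emeasure \<mu> U) \<in> borel_measurable (borel_of (weak_topology S))"
      using openin_borel_of[OF U]
      by (intro measurable_cong nn_integral_indicator) (simp add: topspace_weak_topology prob_measuresD)
    finally show "(\<lambda>\<mu>. emeasure \<mu> U) \<in> borel_measurable (borel_of (weak_topology S))" .
  qed (auto simp: sets_borel_of Int_stable_def topspace_weak_topology prob_measures_iff dest: openin_subset)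
  then have "(\<lambda>\<mu>. \<mu>) -` A \<inter> space (borel_of (weak_topology S)) \<in> sets (borel_of (weak_topology S))"
    if "A \<in> sets (prob_algebra (borel_of S))" for A
    using that by (rule measurable_sets)
  then show "sets (prob_algebra (borel_of S)) \<subseteq> sets (borel_of (weak_topology S))"
    unfolding sp using sets.sets_into_space[of _ "prob_algebra (borel_of S)"] by (force simp: Int_absorb2)
  obtain e :: "'a measure \<Rightarrow> nat \<Rightarrow> real" where
    e: "homeomorphic_map (weak_topology S) (top_of_set (e ` prob_measures S)) e"
    "e \<in> borel_measurable (prob_algebra (borel_of S))"
    using weak_topology_embedding[OF assms] by blast
  have "U \<in> sets (prob_algebra (borel_of S))" if U: "openin (weak_topology S) U" for U
  proof -
    have UP: "U \<subseteq> prob_measures S"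
      using openin_subset[OF U] by (simp add: topspace_weak_topology)
    have "openin (top_of_set (e ` prob_measures S)) (e ` U)"
      using e(1) U UP by (simp add: homeomorphic_map_openness topspace_weak_topology)
    then obtain V where V: "open V" "e ` U = e ` prob_measures S \<inter> V"
      by (auto simp: openin_open)
    have "inj_on e (prob_measures S)"
      using e(1) by (simp add: homeomorphic_eq_everything_map topspace_weak_topology)
    then have "U = e -` V \<inter> space (prob_algebra (borel_of S))"
      using V(2) UP unfolding prob_measures_def[symmetric] by (auto dest: inj_onD)
    moreover have "e -` V \<inter> space (prob_algebra (borel_of S)) \<in> sets (prob_algebra (borel_of S))"
      using V(1) by (intro measurable_sets[OF e(2)]) auto
    ultimately show ?thesis
      by simp
  qed
  then show "sets (borel_of (weak_topology S)) \<subseteq> sets (prob_algebra (borel_of S))"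
    unfolding sets_borel_of[of "weak_topology S"] topspace_weak_topology prob_measures_def
    by (intro sets.sigma_sets_subset') auto
qed

section \<open>Uniform convergence of integrals along weakly convergent measures\<close>

lemma metrizable_decreasing_base:
  assumes "metrizable_space X" "l \<in> topspace X"
  obtains U :: "nat \<Rightarrow> 'a set" where "\<And>k. openin X (U k)" "\<And>k. l \<in> U k" "decseq U"
    "\<And>V. openin X V \<Longrightarrow> l \<in> V \<Longrightarrow> \<exists>k. U k \<subseteq> V"
proof -
  obtain M d where Md: "Metric_space M d" "X = Metric_space.mtopology M d"
    using assms by (auto simp: metrizable_space_def)
  interpret Metric_space M d by fact
  have l: "l \<in> M"
    using assms(2) by (simp add: Md)
  show ?thesis
  proof (rule that[of "\<lambda>k. mball l (inverse (Suc k))"])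
    show "decseq (\<lambda>k. mball l (inverse (Suc k)))"
      by (intro decseq_SucI mball_subset_concentric) (simp add: field_simps)
    fix V assume "openin X V" "l \<in> V"
    then obtain r where r: "0 < r" "mball l r \<subseteq> V"
      unfolding Md openin_mtopology by auto
    obtain k where "inverse (Suc k) < r"
      using reals_Archimedean[OF r(1)] by auto
    then have "mball l (inverse (Suc k)) \<subseteq> mball l r"
      by (intro mball_subset_concentric) simp
    then show "\<exists>k. mball l (inverse (Suc k)) \<subseteq> V"
      using r(2) by blast
  qed (use l in \<open>auto simp: Md\<close>)
qed

lemma strict_mono_selection:
  fixes P :: "nat \<Rightarrow> nat \<Rightarrow> bool"
  assumes "\<And>m k. \<exists>n>m. P k n"
  shows "\<exists>r. strict_mono r \<and> (\<forall>k. P k (r k))"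
proof -
  have "\<exists>r. \<forall>k. P k (r k) \<and> r k < r (Suc k)"
    by (rule dependent_nat_choice) (use assms in blast)+
  then show ?thesis
    by (auto simp: strict_mono_Suc_iff)
qed

text \<open>
  If the bound failed on every neighbourhood, then points at which it fails, filled up with the
  constant \<open>l\<close>, would form a sequence that converges to \<open>l\<close> and contradicts the hypothesis.
\<close>

lemma continuous_convergence_locally_uniform:
  fixes g :: "nat \<Rightarrow> 'a \<Rightarrow> real"
  assumes "metrizable_space S" "l \<in> topspace S" "0 < \<epsilon>"
    and lim: "\<And>\<sigma>. limitin S \<sigma> l sequentially \<Longrightarrow> (\<And>n. \<sigma> n \<in> topspace S) \<Longrightarrow>
      (\<lambda>n. g n (\<sigma> n) - h n) \<longlonglongrightarrow> 0"
  shows "\<exists>U. openin S U \<and> l \<in> U \<and> (\<exists>N. \<forall>n\<ge>N. \<forall>x\<in>U. \<bar>g n x - h n\<bar> \<le> \<epsilon>)"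
proof (rule ccontr)
  assume contra: "\<not> ?thesis"
  obtain U where U: "\<And>k. openin S (U k)" "\<And>k. l \<in> U k" "decseq U"
    "\<And>V. openin S V \<Longrightarrow> l \<in> V \<Longrightarrow> \<exists>k. U k \<subseteq> V"
    using metrizable_decreasing_base[OF assms(1,2)] by metis
  have "\<exists>n>N. \<exists>x. x \<in> U k \<and> \<bar>g n x - h n\<bar> > \<epsilon>" for N k
    using contra U(1)[of k] U(2)[of k] by (metis not_le Suc_le_lessD)
  from strict_mono_selection[where P = "\<lambda>k n. \<exists>x. x \<in> U k \<and> \<bar>g n x - h n\<bar> > \<epsilon>", OF this]
  obtain p where mono: "strict_mono p" and "\<forall>k. \<exists>x. x \<in> U k \<and> \<bar>g (p k) x - h (p k)\<bar> > \<epsilon>"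
    by blast
  then obtain \<xi> where \<xi>: "\<And>k. \<xi> k \<in> U k" "\<And>k. \<bar>g (p k) (\<xi> k) - h (p k)\<bar> > \<epsilon>"
    by metis
  define \<sigma> where "\<sigma> n = (if n \<in> range p then \<xi> (inv p n) else l)" for n
  have \<sigma>p: "\<sigma> (p k) = \<xi> k" for k
    using strict_mono_imp_inj_on[OF mono] by (simp add: \<sigma>_def inv_f_f)
  have \<sigma>U: "\<sigma> n \<in> U k" if "p k \<le> n" for n k
  proof (cases "n \<in> range p")
    case True
    then obtain j where j: "n = p j"
      by auto
    then have "U j \<subseteq> U k"
      using that mono U(3) by (simp add: strict_mono_less_eq decseq_def)
    then show ?thesis
      using \<xi>(1)[of j] by (auto simp: j \<sigma>p)
  qed (simp add: \<sigma>_def U(2))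
  have top: "\<sigma> n \<in> topspace S" for n
    using \<xi>(1) openin_subset[OF U(1)] assms(2) by (auto simp: \<sigma>_def)
  have "limitin S \<sigma> l sequentially"
    unfolding limitin_sequentially
  proof (intro conjI assms(2) allI impI)
    fix V assume "openin S V \<and> l \<in> V"
    then obtain k where "U k \<subseteq> V"
      using U(4) by blast
    then show "\<exists>N. \<forall>n\<ge>N. \<sigma> n \<in> V"
      using \<sigma>U by blast
  qed
  then have "(\<lambda>n. g n (\<sigma> n) - h n) \<longlonglongrightarrow> 0"
    using top by (rule lim)
  then have "(\<lambda>k. g (p k) (\<sigma> (p k)) - h (p k)) \<longlonglongrightarrow> 0"
    using LIMSEQ_subseq_LIMSEQ[OF _ mono] by (fastforce simp: comp_def)
  then have "\<forall>\<^sub>F k in sequentially. \<bar>g (p k) (\<sigma> (p k)) - h (p k)\<bar> < \<epsilon>"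
    using assms(3) by (auto dest: tendstoD simp: dist_real_def)
  then obtain k where "\<bar>g (p k) (\<sigma> (p k)) - h (p k)\<bar> < \<epsilon>"
    by (auto simp: eventually_sequentially)
  then show False
    using \<xi>(2)[of k] by (simp add: \<sigma>p)
qed

text \<open>
  This takes the place of a compact set of nearly full measure: finitely many continuous
  functions, each supported in one member of the cover, whose sum is close to \<open>1\<close> in the mean.
\<close>

lemma partition_of_unity_integral:
  assumes "separable_metrizable S" "z \<in> prob_measures S" "0 < (\<epsilon>::real)"
    and \<U>: "\<forall>U\<in>\<U>. openin S U" "topspace S \<subseteq> \<Union>\<U>"
  shows "\<exists>(k::nat) (V :: nat \<Rightarrow> 'a set) (p :: nat \<Rightarrow> 'a \<Rightarrow> real).
    (\<forall>i. V i \<in> \<U>) \<and> (\<forall>i. bounded_continuous S (p i)) \<and>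
    (\<forall>i. \<forall>x\<in>topspace S. 0 \<le> p i x \<and> (x \<notin> V i \<longrightarrow> p i x = 0)) \<and>
    (\<forall>x\<in>topspace S. (\<Sum>i<k. p i x) \<le> 1) \<and> (\<integral>x. 1 - (\<Sum>i<k. p i x) \<partial>z) < \<epsilon>"
proof -
  have met: "metrizable_space S" and sc: "second_countable S"
    using assms(1) by (auto simp: separable_metrizable_def)
  obtain \<V> where \<V>: "countable \<V>" "\<V> \<subseteq> \<U>" "topspace S \<subseteq> \<Union>\<V>"
    using second_countable_imp_Lindelof_space[OF sc] \<U> openin_subset
    unfolding Lindelof_space_def by (metis Sup_least subset_antisym order_refl)
  have "\<forall>U\<in>\<V>. \<exists>h :: nat \<Rightarrow> 'a \<Rightarrow> real. \<forall>m. continuous_map S euclideanreal (h m) \<and>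
    (\<forall>x\<in>topspace S. 0 \<le> h m x \<and> h m x \<le> 1 \<and> (x \<notin> U \<longrightarrow> h m x = 0) \<and> (x \<in> U \<longrightarrow> (\<exists>k. h k x = 1)))"
    using met \<U>(1) \<V>(2) by (intro ballI open_indicator_approximation) auto
  then obtain h :: "'a set \<Rightarrow> nat \<Rightarrow> 'a \<Rightarrow> real" where
    h_cont: "\<And>U m. U \<in> \<V> \<Longrightarrow> continuous_map S euclideanreal (h U m)" and
    h: "\<And>U m x. U \<in> \<V> \<Longrightarrow> x \<in> topspace S \<Longrightarrow> 0 \<le> h U m x \<and> h U m x \<le> 1 \<and>
        (x \<notin> U \<longrightarrow> h U m x = 0) \<and> (x \<in> U \<longrightarrow> (\<exists>k. h U k x = 1))"
    by metis
  interpret prob_space z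
    using prob_measuresD[OF assms(2)] by simp
  have "topspace S \<noteq> {}"
    using not_empty prob_measuresD(3)[OF assms(2)] by simp
  then have "\<V> \<times> (UNIV::nat set) \<noteq> {}"
    using \<V>(3) by auto
  moreover have "countable (\<V> \<times> (UNIV::nat set))"
    using \<V>(1) by simp
  ultimately have "range (from_nat_into (\<V> \<times> (UNIV::nat set))) = \<V> \<times> (UNIV::nat set)"
    by (rule range_from_nat_into)
  then obtain q :: "nat \<Rightarrow> 'a set \<times> nat" where q: "range q = \<V> \<times> (UNIV::nat set)"
    by (rule that)
  have qV: "fst (q i) \<in> \<V>" for i
  proof -
    have "q i \<in> \<V> \<times> (UNIV::nat set)"
      unfolding q[symmetric] by simp
    then show ?thesis
      by (simp add: mem_Times_iff)
  qed
  define b where "b i = h (fst (q i)) (snd (q i))" for i :: nat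
  have b: "continuous_map S euclideanreal (b i)" for i
    unfolding b_def using h_cont qV by simp
  have b01: "0 \<le> b i x" "b i x \<le> 1" "x \<notin> fst (q i) \<longrightarrow> b i x = 0" if "x \<in> topspace S" for i x
    unfolding b_def using h[OF qV that] by auto
  have b1: "\<exists>i. b i x = 1" if "x \<in> topspace S" for x
  proof -
    obtain U where U: "U \<in> \<V>" "x \<in> U"
      using \<V>(3) \<open>x \<in> topspace S\<close> by blast
    then obtain m where m: "h U m x = 1"
      using h[OF U(1) \<open>x \<in> topspace S\<close>] by blast
    have "(U, m) \<in> range q"
      using q U(1) by simp
    then obtain i where "q i = (U, m)"
      by (metis imageE)
    then show ?thesis
      using m by (intro exI[of _ i]) (simp add: b_def)
  qed
  (* The classical telescoping: the functions p i sum to 1 - \<pi> k, and \<pi> k vanishes once some b i equals 1. *)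
  define \<pi> where "\<pi> k x = (\<Prod>i<k. 1 - b i x)" for k :: nat and x
  define p where "p i x = b i x * \<pi> i x" for i x
  have \<pi>01: "0 \<le> \<pi> k x" "\<pi> k x \<le> 1" if "x \<in> topspace S" for k x
    unfolding \<pi>_def using b01[OF that] by (auto intro!: prod_nonneg prod_le_1)
  have sum_p: "(\<Sum>i<k. p i x) = 1 - \<pi> k x" for k x
    by (induction k) (simp_all add: p_def \<pi>_def algebra_simps)
  have \<pi>_cont: "continuous_map S euclideanreal (\<pi> k)" for k
  proof (induction k)
    case (Suc k)
    have "\<pi> (Suc k) = (\<lambda>x. \<pi> k x * (1 - b k x))"
      by (auto simp: \<pi>_def)
    then show ?case
      using Suc b by (auto intro!: continuous_map_real_mult continuous_map_diff)
  qed (simp add: \<pi>_def)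
  have \<pi>_bc: "bounded_continuous S (\<pi> k)" for k
    using \<pi>01 by (intro bounded_continuousI[of _ _ 1] \<pi>_cont) auto
  have "(\<lambda>k. \<integral>x. \<pi> k x \<partial>z) \<longlonglongrightarrow> (\<integral>x. 0 \<partial>z)"
  proof (rule integral_dominated_convergence[where w="\<lambda>_. 1"])
    show "AE x in z. (\<lambda>k. \<pi> k x) \<longlonglongrightarrow> 0"
    proof (rule AE_I2)
      fix x assume "x \<in> space z"
      then have x: "x \<in> topspace S"
        using prob_measuresD(3)[OF assms(2)] by simp
      then obtain i where "b i x = 1"
        using b1 by blast
      then have "\<pi> k x = 0" if "k > i" for k
        using that unfolding \<pi>_def by (intro prod_zero) (auto intro!: bexI[of _ i])
      then have "\<forall>\<^sub>F k in sequentially. \<pi> k x = 0"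
        by (auto simp: eventually_sequentially intro!: exI[of _ "Suc i"])
      then show "(\<lambda>k. \<pi> k x) \<longlonglongrightarrow> 0"
        by (rule tendsto_eventually)
    qed
    show "AE x in z. norm (\<pi> k x) \<le> 1" for k
      using \<pi>01 prob_measuresD(3)[OF assms(2)] by (intro AE_I2) auto
    show "\<pi> k \<in> borel_measurable z" for k
      by (intro measurable_prob_measures[OF assms(2)] bounded_continuous_measurable \<pi>_bc)
  qed auto
  then have "\<forall>\<^sub>F k in sequentially. (\<integral>x. \<pi> k x \<partial>z) < \<epsilon>"
    using assms(3) by (intro order_tendstoD(2)) simp
  then obtain k where k: "(\<integral>x. \<pi> k x \<partial>z) < \<epsilon>"
    by (auto simp: eventually_sequentially)
  show ?thesis
  proof (intro exI[of _ k] exI[of _ "\<lambda>i. fst (q i)"] exI[of _ p] conjI allI ballI impI)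
    show "fst (q i) \<in> \<U>" for i
      using qV \<V>(2) by blast
    have "continuous_map S euclideanreal (p i)" for i
      unfolding p_def using b \<pi>_cont by (auto intro!: continuous_map_real_mult)
    then show "bounded_continuous S (p i)" for i
      using b01 \<pi>01 by (intro bounded_continuousI[of _ _ 1]) (auto simp: p_def abs_mult intro!: mult_le_one)
    show "(\<integral>x. 1 - (\<Sum>i<k. p i x) \<partial>z) < \<epsilon>"
      using k by (simp add: sum_p)
    fix x assume x: "x \<in> topspace S"
    show "(\<Sum>i<k. p i x) \<le> 1"
      using \<pi>01(1)[OF x] by (simp add: sum_p)
    show "0 \<le> p i x" for i
      unfolding p_def using b01(1)[OF x] \<pi>01(1)[OF x] by simp
    show "x \<notin> fst (q i) \<Longrightarrow> p i x = 0" for i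
      unfolding p_def using b01(3)[OF x] by simp
  qed
qed

text \<open>
  Continuous convergence makes \<open>g n\<close> and \<open>h n\<close> nearly equal to the number \<open>h n (l i)\<close> on the
  \<open>i\<close>-th piece of a partition of unity. Both integrals are therefore close to the same combination
  of finitely many integrals that converge weakly. The comparison functions \<open>h n\<close> vary with
  \<open>n\<close> because the sets of observations will.
\<close>

lemma uniform_weak_convergence:
  fixes g h :: "nat \<Rightarrow> 'a \<Rightarrow> real"
  assumes S: "separable_metrizable S"
    and z: "limitin (weak_topology S) zs z sequentially"
    and meas: "\<And>n. g n \<in> borel_measurable (borel_of S)" "\<And>n. h n \<in> borel_measurable (borel_of S)"
    and bound: "\<And>n x. x \<in> topspace S \<Longrightarrow> \<bar>g n x\<bar> \<le> M" "\<And>n x. x \<in> topspace S \<Longrightarrow> \<bar>h n x\<bar> \<le> M"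
    and lim: "\<And>\<sigma> l. limitin S \<sigma> l sequentially \<Longrightarrow> (\<And>n. \<sigma> n \<in> topspace S) \<Longrightarrow>
      (\<lambda>n. g n (\<sigma> n) - h n l) \<longlonglongrightarrow> 0"
      "\<And>\<sigma> l. limitin S \<sigma> l sequentially \<Longrightarrow> (\<And>n. \<sigma> n \<in> topspace S) \<Longrightarrow>
      (\<lambda>n. h n (\<sigma> n) - h n l) \<longlonglongrightarrow> 0"
  shows "(\<lambda>n. (\<integral>x. g n x \<partial>zs n) - (\<integral>x. h n x \<partial>z)) \<longlonglongrightarrow> 0"
proof -
  have met: "metrizable_space S"
    using S by (simp add: separable_metrizable_def)
  have zP: "z \<in> prob_measures S" and zsP: "\<forall>\<^sub>F n in sequentially. zs n \<in> prob_measures S"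
    and zconv: "\<And>f. bounded_continuous S f \<Longrightarrow> (\<lambda>n. \<integral>x. f x \<partial>zs n) \<longlonglongrightarrow> (\<integral>x. f x \<partial>z)"
    using z by (auto simp: limitin_weak_topology)
  interpret z: prob_space z
    using prob_measuresD[OF zP] by simp
  have "topspace S \<noteq> {}"
    using z.not_empty prob_measuresD(3)[OF zP] by simp
  then have M: "0 \<le> M"
    using bound(1) by (meson abs_ge_zero ex_in_conv order_trans)
  define near where "near \<epsilon> l N U \<longleftrightarrow>
      (\<forall>n\<ge>N. \<forall>x\<in>U. \<bar>g n x - h n l\<bar> \<le> \<epsilon> \<and> \<bar>h n x - h n l\<bar> \<le> \<epsilon>)" for \<epsilon> l N U
  have key: "\<forall>\<^sub>F n in sequentially. \<bar>(\<integral>x. g n x \<partial>zs n) - (\<integral>x. h n x \<partial>z)\<bar> \<le> 3 * \<epsilon> + 3 * M * \<epsilon>"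
    if \<epsilon>: "0 < \<epsilon>" for \<epsilon>
  proof -
    define \<U> where "\<U> = {U. openin S U \<and> (\<exists>l N. l \<in> topspace S \<and> near \<epsilon> l N U)}"
    have cover: "topspace S \<subseteq> \<Union>\<U>"
    proof
      fix l assume l: "l \<in> topspace S"
      obtain U N where U: "openin S U" "l \<in> U" "\<forall>n\<ge>N. \<forall>x\<in>U. \<bar>g n x - h n l\<bar> \<le> \<epsilon>"
        using continuous_convergence_locally_uniform[OF met l \<epsilon>, of g "\<lambda>n. h n l"] lim(1) by blast
      obtain U' N' where U': "openin S U'" "l \<in> U'" "\<forall>n\<ge>N'. \<forall>x\<in>U'. \<bar>h n x - h n l\<bar> \<le> \<epsilon>"
        using continuous_convergence_locally_uniform[OF met l \<epsilon>, of h "\<lambda>n. h n l"] lim(2) by blast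
      have "near \<epsilon> l (max N N') (U \<inter> U')"
        using U(3) U'(3) by (auto simp: near_def)
      then have "U \<inter> U' \<in> \<U>"
        using U(1) U'(1) l by (auto simp: \<U>_def)
      then show "l \<in> \<Union>\<U>"
        using U(2) U'(2) by blast
    qed
    have \<U>_open: "\<forall>U\<in>\<U>. openin S U"
      by (simp add: \<U>_def)
    obtain k :: nat and V :: "nat \<Rightarrow> 'a set" and p :: "nat \<Rightarrow> 'a \<Rightarrow> real" where
      P: "(\<forall>i. V i \<in> \<U>) \<and> (\<forall>i. bounded_continuous S (p i)) \<and>
        (\<forall>i. \<forall>x\<in>topspace S. 0 \<le> p i x \<and> (x \<notin> V i \<longrightarrow> p i x = 0)) \<and>
        (\<forall>x\<in>topspace S. (\<Sum>i<k. p i x) \<le> 1) \<and> (\<integral>x. 1 - (\<Sum>i<k. p i x) \<partial>z) < \<epsilon>"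
      using partition_of_unity_integral[OF S zP \<epsilon> \<U>_open cover] by (elim exE) (rule that)
    then have p: "\<And>i. V i \<in> \<U>" "\<And>i. bounded_continuous S (p i)"
      "\<And>i x. x \<in> topspace S \<Longrightarrow> 0 \<le> p i x" "\<And>i x. x \<in> topspace S \<Longrightarrow> x \<notin> V i \<Longrightarrow> p i x = 0"
      "\<And>x. x \<in> topspace S \<Longrightarrow> (\<Sum>i<k. p i x) \<le> 1" "(\<integral>x. 1 - (\<Sum>i<k. p i x) \<partial>z) < \<epsilon>"
      by blast+
    have "\<forall>i. \<exists>l N. l \<in> topspace S \<and> near \<epsilon> l N (V i)"
      using p(1) by (auto simp: \<U>_def)
    then obtain l N where lN: "\<And>i. l i \<in> topspace S" "\<And>i. near \<epsilon> (l i) (N i) (V i)"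
      by metis
    define r where "r x = 1 - (\<Sum>i<k. p i x)" for x
    define s where "s n x = (\<Sum>i<k. h n (l i) * p i x)" for n x
    have r0: "0 \<le> r x" if "x \<in> topspace S" for x
      using p(5)[OF that] by (simp add: r_def)
    have r_bc: "bounded_continuous S r"
    proof (rule bounded_continuousI[of _ _ 1])
      show "continuous_map S euclideanreal r"
        unfolding r_def using p(2)
        by (auto intro!: continuous_map_diff continuous_map_sum simp: bounded_continuous_def)
      show "\<bar>r x\<bar> \<le> 1" if "x \<in> topspace S" for x
        using r0[OF that] p(3)[OF that] by (auto simp: r_def sum_nonneg)
    qed
    have s_int: "integrable \<mu> (s n)" "(\<integral>x. s n x \<partial>\<mu>) = (\<Sum>i<k. h n (l i) * (\<integral>x. p i x \<partial>\<mu>))"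
      if "\<mu> \<in> prob_measures S" for \<mu> n
      unfolding s_def using bounded_continuous_integrable[OF that p(2)]
      by (auto intro!: integrable_sum)
    have approx: "\<bar>f x - s n x\<bar> \<le> \<epsilon> + M * r x"
      if "x \<in> topspace S" and n: "\<forall>i<k. N i \<le> n" and f: "f = g n \<or> f = h n" for f n x
    proof -
      have fM: "\<bar>f x\<bar> \<le> M"
        using f bound \<open>x \<in> topspace S\<close> by auto
      have "\<bar>f x - h n (l i)\<bar> * p i x \<le> \<epsilon> * p i x" if "i < k" for i
      proof (cases "x \<in> V i")
        case True
        then have "\<bar>f x - h n (l i)\<bar> \<le> \<epsilon>"
          using lN(2)[of i] n \<open>i < k\<close> f unfolding near_def by auto
        then show ?thesis
          using p(3)[OF \<open>x \<in> topspace S\<close>] by (intro mult_right_mono) auto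
      qed (use p(4) \<open>x \<in> topspace S\<close> in auto)
      then have "(\<Sum>i<k. \<bar>f x - h n (l i)\<bar> * p i x) \<le> (\<Sum>i<k. \<epsilon> * p i x)"
        by (intro sum_mono) auto
      also have "\<dots> = \<epsilon> * (\<Sum>i<k. p i x)"
        by (simp add: sum_distrib_left)
      also have "\<dots> \<le> \<epsilon>"
        using p(5)[OF \<open>x \<in> topspace S\<close>] \<epsilon> by (simp add: mult_left_le)
      finally have 1: "(\<Sum>i<k. \<bar>f x - h n (l i)\<bar> * p i x) \<le> \<epsilon>" .
      have "f x - s n x = (\<Sum>i<k. (f x - h n (l i)) * p i x) + f x * r x"
        by (simp add: r_def s_def sum_subtractf sum_distrib_left algebra_simps)
      also have "\<bar>\<dots>\<bar> \<le> (\<Sum>i<k. \<bar>(f x - h n (l i)) * p i x\<bar>) + \<bar>f x * r x\<bar>"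
        by (rule order_trans[OF abs_triangle_ineq add_right_mono[OF sum_abs]])
      also have "\<dots> \<le> \<epsilon> + M * r x"
        using 1 fM r0[OF \<open>x \<in> topspace S\<close>] p(3)[OF \<open>x \<in> topspace S\<close>]
        by (intro add_mono) (auto simp: abs_mult intro!: mult_right_mono)
      finally show ?thesis .
    qed
    have int_approx: "\<bar>(\<integral>x. f x \<partial>\<mu>) - (\<integral>x. s n x \<partial>\<mu>)\<bar> \<le> \<epsilon> + M * (\<integral>x. r x \<partial>\<mu>)"
      if \<mu>: "\<mu> \<in> prob_measures S" and n: "\<forall>i<k. N i \<le> n" and f: "f = g n \<or> f = h n" for f n \<mu>
    proof -
      interpret prob_space \<mu>
        using prob_measuresD[OF \<mu>] by simp
      have fi: "integrable \<mu> f"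
        using f meas bound by (auto intro!: bounded_measurable_integrable[OF \<mu>])
      have ri: "integrable \<mu> r"
        using bounded_continuous_integrable[OF \<mu> r_bc] .
      have "(\<integral>x. f x \<partial>\<mu>) - (\<integral>x. s n x \<partial>\<mu>) = (\<integral>x. f x - s n x \<partial>\<mu>)"
        using fi s_int(1)[OF \<mu>] by simp
      also have "\<bar>\<dots>\<bar> \<le> (\<integral>x. \<bar>f x - s n x\<bar> \<partial>\<mu>)"
        by (rule integral_abs_bound)
      also have "\<dots> \<le> (\<integral>x. \<epsilon> + M * r x \<partial>\<mu>)"
        using fi ri s_int(1)[OF \<mu>] approx[OF _ n f] prob_measuresD(3)[OF \<mu>]
        by (intro integral_mono) auto
      also have "\<dots> = \<epsilon> + M * (\<integral>x. r x \<partial>\<mu>)"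
        using ri by (simp add: prob_space)
      finally show ?thesis .
    qed
    have rlim: "\<forall>\<^sub>F n in sequentially. (\<integral>x. r x \<partial>zs n) < \<epsilon>"
      using p(6) by (intro order_tendstoD(2)[OF zconv[OF r_bc]]) (simp add: r_def)
    have "(\<lambda>n. M * (\<Sum>i<k. \<bar>(\<integral>x. p i x \<partial>zs n) - (\<integral>x. p i x \<partial>z)\<bar>)) \<longlonglongrightarrow> M * (\<Sum>i<k. 0)"
      by (intro tendsto_mult_left tendsto_sum tendsto_rabs_zero LIM_zero zconv p(2))
    then have "\<forall>\<^sub>F n in sequentially. M * (\<Sum>i<k. \<bar>(\<integral>x. p i x \<partial>zs n) - (\<integral>x. p i x \<partial>z)\<bar>) < \<epsilon>"
      using \<epsilon> by (intro order_tendstoD(2)) auto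
    moreover have "\<forall>\<^sub>F n in sequentially. \<forall>i<k. N i \<le> n"
      by (intro eventually_sequentiallyI[of "Max (insert 0 (N ` {..<k}))"]) auto
    ultimately show ?thesis
      using zsP rlim
    proof eventually_elim
      case (elim n)
      have 1: "\<bar>(\<integral>x. g n x \<partial>zs n) - (\<integral>x. s n x \<partial>zs n)\<bar> \<le> \<epsilon> + M * (\<integral>x. r x \<partial>zs n)"
        using elim by (intro int_approx) auto
      have 2: "\<bar>(\<integral>x. h n x \<partial>z) - (\<integral>x. s n x \<partial>z)\<bar> \<le> \<epsilon> + M * (\<integral>x. r x \<partial>z)"
        using elim zP by (intro int_approx) auto
      have "\<bar>(\<integral>x. s n x \<partial>zs n) - (\<integral>x. s n x \<partial>z)\<bar>
          = \<bar>\<Sum>i<k. h n (l i) * ((\<integral>x. p i x \<partial>zs n) - (\<integral>x. p i x \<partial>z))\<bar>"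
        using elim zP by (simp add: s_int(2) sum_subtractf algebra_simps)
      also have "\<dots> \<le> (\<Sum>i<k. M * \<bar>(\<integral>x. p i x \<partial>zs n) - (\<integral>x. p i x \<partial>z)\<bar>)"
        using bound(2)[OF lN(1)]
        by (intro order_trans[OF sum_abs] sum_mono) (auto simp: abs_mult intro!: mult_right_mono)
      also have "\<dots> \<le> \<epsilon>"
        using elim by (simp add: sum_distrib_left)
      finally have 3: "\<bar>(\<integral>x. s n x \<partial>zs n) - (\<integral>x. s n x \<partial>z)\<bar> \<le> \<epsilon>" .
      have 4: "M * (\<integral>x. r x \<partial>zs n) \<le> M * \<epsilon>" "M * (\<integral>x. r x \<partial>z) \<le> M * \<epsilon>"
        using elim p(6) M by (auto intro!: mult_left_mono simp: r_def)
      have "0 \<le> M * \<epsilon>"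
        using M \<epsilon> by simp
      then show ?case
        using 1 2 3 4 by (simp add: abs_le_iff)
    qed
  qed
  show ?thesis
  proof (rule tendstoI)
    fix e :: real assume e: "0 < e"
    (* Chosen so that the bound of the previous step equals e / 2. *)
    define \<epsilon> where "\<epsilon> = e / (2 * (3 + 3 * M))"
    have D: "0 < 3 + 3 * M"
      using M by simp
    have "3 * \<epsilon> + 3 * M * \<epsilon> = (3 + 3 * M) * \<epsilon>"
      by (simp add: algebra_simps)
    also have "\<dots> = e / 2"
    proof -
      have "c * (e / (2 * c)) = e / 2" if "0 < c" for c
        using that by simp
      from this[OF D] show ?thesis
        by (simp only: \<epsilon>_def)
    qed
    finally have \<epsilon>: "0 < \<epsilon>" "3 * \<epsilon> + 3 * M * \<epsilon> = e / 2"
      using e D by (simp_all add: \<epsilon>_def)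
    show "\<forall>\<^sub>F n in sequentially. dist ((\<integral>x. g n x \<partial>zs n) - (\<integral>x. h n x \<partial>z)) 0 < e"
      using key[OF \<epsilon>(1)] by eventually_elim (use e \<epsilon>(2) in \<open>simp add: dist_real_def\<close>)
  qed
qed

section \<open>Semi-uniform Feller kernels\<close>

lemma stochastic_kernelD:
  assumes "stochastic_kernel S1 S2 \<Psi>" "s \<in> topspace S2"
  shows "\<Psi> s \<in> prob_measures S1"
  using measurable_space[OF assms(1)[unfolded stochastic_kernel_def], of s] assms(2)
  by (simp add: prob_measures_def)

lemma prob_measures_prod_topology:
  assumes "second_countable S1" "second_countable S2" "M \<in> prob_measures (prod_topology S1 S2)"
  shows "sets M = sets (borel_of S1 \<Otimes>\<^sub>M borel_of S2)" "space M = topspace S1 \<times> topspace S2"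
    "prob_space M" "fst \<in> M \<rightarrow>\<^sub>M borel_of S1" "snd \<in> M \<rightarrow>\<^sub>M borel_of S2"
proof -
  show s: "sets M = sets (borel_of S1 \<Otimes>\<^sub>M borel_of S2)"
    using prob_measuresD(2)[OF assms(3)] sets_borel_of_prod_topology[OF assms(1,2)] by simp
  show "space M = topspace S1 \<times> topspace S2" "prob_space M"
    using prob_measuresD[OF assms(3)] by simp_all
  show "fst \<in> M \<rightarrow>\<^sub>M borel_of S1" "snd \<in> M \<rightarrow>\<^sub>M borel_of S2"
    using measurable_cong_sets[OF s refl] by (auto intro: measurable_fst measurable_snd)
qed

text \<open>
  \<open>\<integral>f dM(\<cdot>, B)\<close> as an integral over the product, to which mixtures and image measures apply directly.
\<close>

definition cross_integral :: "('s \<Rightarrow> real) \<Rightarrow> 't set \<Rightarrow> ('s \<times> 't) measure \<Rightarrow> real" where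
  "cross_integral f B M = (\<integral>p. f (fst p) * indicator B (snd p) \<partial>M)"

lemma cross_integrand_measurable:
  assumes "B \<in> sets (borel_of S2)" "f \<in> borel_measurable (borel_of S1)"
  shows "(\<lambda>p. f (fst p) * indicator B (snd p) :: real) \<in> borel_measurable (borel_of (prod_topology S1 S2))"
  by (intro borel_measurable_times measurable_compose[OF continuous_map_measurable[OF continuous_map_fst] assms(2)]
      measurable_compose[OF continuous_map_measurable[OF continuous_map_snd] borel_measurable_indicator[OF assms(1)]])

lemma section_measure_integral:
  assumes "second_countable S1" "second_countable S2" "M \<in> prob_measures (prod_topology S1 S2)"
    and B: "B \<in> sets (borel_of S2)" and f: "f \<in> borel_measurable (borel_of S1)"
  shows "(\<integral>x. f x \<partial>section_measure S1 M B) = cross_integral f B M"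
proof -
  note M = prob_measures_prod_topology[OF assms(1-3)]
  note [measurable] = M(4,5) B f
  define N where "N = distr (density M (\<lambda>p. ennreal (indicator B (snd p)))) (borel_of S1) fst"
  have "emeasure M (A \<times> B) = emeasure N A" if A[measurable]: "A \<in> sets (borel_of S1)" for A
  proof -
    have "emeasure N A = (\<integral>\<^sup>+p. ennreal (indicator B (snd p)) * indicator (fst -` A \<inter> space M) p \<partial>M)"
      unfolding N_def by (subst emeasure_distr) (auto simp: emeasure_density measurable_sets[OF M(4)])
    also have "\<dots> = (\<integral>\<^sup>+p. indicator (A \<times> B) p \<partial>M)"
      by (intro nn_integral_cong) (auto split: split_indicator)
    also have "\<dots> = emeasure M (A \<times> B)"
      using A B by (intro nn_integral_indicator) (simp add: M(1))
    finally show ?thesis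
      by simp
  qed
  then have "section_measure S1 M B = measure_of (topspace S1) (sets (borel_of S1)) (emeasure N)"
    unfolding section_measure_def
    using sets.space_closed[of "borel_of S1"] sets.sigma_sets_eq[of "borel_of S1"]
    by (intro measure_of_eq) auto
  also have "\<dots> = N"
    using measure_of_of_measure[of N] by (simp add: N_def)
  finally have "(\<integral>x. f x \<partial>section_measure S1 M B) = (\<integral>x. f x \<partial>N)"
    by simp
  also have "\<dots> = (\<integral>p. f (fst p) \<partial>density M (\<lambda>p. ennreal (indicator B (snd p))))"
    unfolding N_def by (rule integral_distr) (simp_all add: M(4) f)
  also have "\<dots> = (\<integral>p. indicator B (snd p) *\<^sub>R f (fst p) \<partial>M)"
    using measurable_compose[OF M(4) f] measurable_compose[OF M(5) borel_measurable_indicator[OF B]]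
    by (intro integral_density) auto
  also have "\<dots> = cross_integral f B M"
    unfolding cross_integral_def by (simp add: mult.commute)
  finally show ?thesis .
qed

lemma cross_integral_bound:
  assumes "second_countable S1" "second_countable S2" "M \<in> prob_measures (prod_topology S1 S2)"
    and B: "B \<in> sets (borel_of S2)" and f: "f \<in> borel_measurable (borel_of S1)"
    and b: "\<And>x. x \<in> topspace S1 \<Longrightarrow> \<bar>f x\<bar> \<le> b" "0 \<le> b"
  shows "\<bar>cross_integral f B M\<bar> \<le> b" "integrable M (\<lambda>p. f (fst p) * indicator B (snd p))"
proof -
  note M = prob_measures_prod_topology[OF assms(1-3)]
  have "(\<lambda>p. f (fst p) * indicator B (snd p)) \<in> borel_measurable M"
    by (rule measurable_prob_measures[OF assms(3) cross_integrand_measurable[OF B f]])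
  then show "\<bar>cross_integral f B M\<bar> \<le> b" "integrable M (\<lambda>p. f (fst p) * indicator B (snd p))"
    unfolding cross_integral_def using b M(2)
    by (intro prob_space_bounded_integral[OF M(3), of _ b]; auto split: split_indicator)+
qed

text \<open>
  A supremum over sets tends to zero if and only if the differences do so along every
  sequence of sets. The sequential form passes through mixtures and disintegrations by limit
  theorems for integrals.
\<close>

definition feller_along_sets ::
    "'s1 topology \<Rightarrow> 's2 topology \<Rightarrow> 's3 topology \<Rightarrow> ('s3 \<Rightarrow> ('s1 \<times> 's2) measure) \<Rightarrow> bool" where
  "feller_along_sets S1 S2 S3 \<Psi> \<longleftrightarrow>
     (\<forall>s l f B. limitin S3 s l sequentially \<longrightarrow> range s \<subseteq> topspace S3 \<longrightarrow> bounded_continuous S1 f \<longrightarrow>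
        range B \<subseteq> sets (borel_of S2) \<longrightarrow>
        (\<lambda>n. cross_integral f (B n) (\<Psi> (s n)) - cross_integral f (B n) (\<Psi> l)) \<longlonglongrightarrow> 0)"

lemma tendsto_along_sets:
  fixes d :: "nat \<Rightarrow> 'a set \<Rightarrow> real"
  assumes "(\<lambda>n. SUP B\<in>\<B>. \<bar>d n B\<bar>) \<longlonglongrightarrow> 0" "\<And>n B. B \<in> \<B> \<Longrightarrow> \<bar>d n B\<bar> \<le> K" "range C \<subseteq> \<B>"
  shows "(\<lambda>n. d n (C n)) \<longlonglongrightarrow> 0"
proof (rule Lim_null_comparison[OF always_eventually assms(1)], rule allI)
  fix n
  have "bdd_above ((\<lambda>B. \<bar>d n B\<bar>) ` \<B>)"
    using assms(2) by (intro bdd_aboveI[of _ K]) auto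
  then show "norm (d n (C n)) \<le> (SUP B\<in>\<B>. \<bar>d n B\<bar>)"
    unfolding real_norm_def using assms(3) by (intro cSUP_upper) auto
qed

lemma semi_uniform_feller_along_sets:
  assumes S: "separable_metrizable S1" "separable_metrizable S2"
    and \<Psi>: "stochastic_kernel (prod_topology S1 S2) S3 \<Psi>"
    and suf: "semi_uniform_feller S1 S2 S3 \<Psi>"
  shows "feller_along_sets S1 S2 S3 \<Psi>"
  unfolding feller_along_sets_def
proof (intro allI impI)
  fix s l f and B :: "nat \<Rightarrow> 'b set"
  assume s: "limitin S3 s l sequentially" "range s \<subseteq> topspace S3"
    and f: "bounded_continuous S1 f" and B: "range B \<subseteq> sets (borel_of S2)"
  have sc: "second_countable S1" "second_countable S2"
    using S by (auto simp: separable_metrizable_def)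
  obtain b where b: "0 \<le> b" "\<forall>x\<in>topspace S1. \<bar>f x\<bar> \<le> b"
    by (rule bounded_continuousE[OF f])
  have \<Psi>s: "\<Psi> (s n) \<in> prob_measures (prod_topology S1 S2)" "\<Psi> l \<in> prob_measures (prod_topology S1 S2)" for n :: nat
    using stochastic_kernelD[OF \<Psi>] s(2) limitin_topspace[OF s(1)] by auto
  let ?I = "\<lambda>C M. \<integral>x. f x \<partial>section_measure S1 M C"
  have eq: "?I C M = cross_integral f C M"
    if "C \<in> sets (borel_of S2)" "M \<in> prob_measures (prod_topology S1 S2)" for C M
    using that sc f by (intro section_measure_integral bounded_continuous_measurable)
  have "(\<lambda>n. ?I (B n) (\<Psi> (s n)) - ?I (B n) (\<Psi> l)) \<longlonglongrightarrow> 0"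
  proof (rule tendsto_along_sets[where K="b + b"])
    show "(\<lambda>n. SUP C\<in>sets (borel_of S2). \<bar>?I C (\<Psi> (s n)) - ?I C (\<Psi> l)\<bar>) \<longlonglongrightarrow> 0"
      using suf s f by (simp add: semi_uniform_feller_def)
    show "\<bar>?I C (\<Psi> (s n)) - ?I C (\<Psi> l)\<bar> \<le> b + b" if "C \<in> sets (borel_of S2)" for n :: nat and C
      unfolding eq[OF that \<Psi>s(1)] eq[OF that \<Psi>s(2)]
      using that \<Psi>s b sc
      by (intro order_trans[OF abs_triangle_ineq4 add_mono]
          cross_integral_bound(1)[OF sc] bounded_continuous_measurable[OF f]) auto
  qed (use B in auto)
  moreover have "?I (B n) (\<Psi> (s n)) - ?I (B n) (\<Psi> l)
      = cross_integral f (B n) (\<Psi> (s n)) - cross_integral f (B n) (\<Psi> l)" for n :: nat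
    using eq \<Psi>s B by (simp add: image_subset_iff)
  ultimately show "(\<lambda>n. cross_integral f (B n) (\<Psi> (s n)) - cross_integral f (B n) (\<Psi> l)) \<longlonglongrightarrow> 0"
    by simp
qed

lemma tv_continuous_along_sets:
  assumes \<Psi>: "stochastic_kernel S1 S2 \<Psi>" and tv: "tv_continuous S1 S2 \<Psi>"
    and s: "limitin S2 s l sequentially" "range s \<subseteq> topspace S2" and B: "range B \<subseteq> sets (borel_of S1)"
  shows "(\<lambda>n. measure (\<Psi> (s n)) (B n) - measure (\<Psi> l) (B n)) \<longlonglongrightarrow> 0"
proof (rule tendsto_along_sets[where K=1, OF _ _ B])
  show "(\<lambda>n. SUP B\<in>sets (borel_of S1). \<bar>measure (\<Psi> (s n)) B - measure (\<Psi> l) B\<bar>) \<longlonglongrightarrow> 0"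
    using tv s by (simp add: tv_continuous_def)
  have le1: "measure (\<Psi> x) C \<le> 1" if "x \<in> topspace S2" for x C
    by (rule prob_space.prob_le_1[OF prob_measuresD(1)[OF stochastic_kernelD[OF \<Psi> that]]])
  fix n C
  have "s n \<in> topspace S2"
    using s(2) by auto
  then show "\<bar>measure (\<Psi> (s n)) C - measure (\<Psi> l) C\<bar> \<le> 1"
    using le1[of "s n" C] le1[OF limitin_topspace[OF s(1)], of C]
      measure_nonneg[of "\<Psi> (s n)" C] measure_nonneg[of "\<Psi> l" C] by linarith
qed

text \<open>
  Convergence in the parameter space forces the terms of a sequence into it only eventually;
  the others are replaced by the limit.
\<close>

lemma weakly_continuousI:
  assumes "\<And>s l. limitin S2 s l sequentially \<Longrightarrow> range s \<subseteq> topspace S2 \<Longrightarrow>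
    limitin (weak_topology S1) (\<lambda>n. \<Psi> (s n)) (\<Psi> l) sequentially"
  shows "weakly_continuous S1 S2 \<Psi>"
  unfolding weakly_continuous_def
proof (intro allI impI)
  fix s l assume s: "limitin S2 s l sequentially"
  define s' where "s' n = (if s n \<in> topspace S2 then s n else l)" for n
  have ev: "\<forall>\<^sub>F n in sequentially. s n = s' n"
    using limitinD[OF s openin_topspace limitin_topspace[OF s]] by eventually_elim (simp add: s'_def)
  have "limitin S2 s' l sequentially"
    by (rule limitin_transform_eventually[OF ev s])
  then have "limitin (weak_topology S1) (\<lambda>n. \<Psi> (s' n)) (\<Psi> l) sequentially"
    by (rule assms) (use limitin_topspace[OF s] in \<open>auto simp: s'_def\<close>)
  then show "limitin (weak_topology S1) (\<lambda>n. \<Psi> (s n)) (\<Psi> l) sequentially"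
    by (rule limitin_transform_eventually[rotated]) (use ev in \<open>eventually_elim, simp\<close>)
qed

lemma integral_bind_bounded:
  fixes f :: "'b \<Rightarrow> real"
  assumes \<mu>: "\<mu> \<in> space (prob_algebra M)" and K: "K \<in> M \<rightarrow>\<^sub>M prob_algebra N"
    and f: "f \<in> borel_measurable N" and b: "\<And>x. x \<in> space N \<Longrightarrow> \<bar>f x\<bar> \<le> b"
  shows "(\<integral>x. f x \<partial>(\<mu> \<bind> K)) = (\<integral>x. (\<integral>y. f y \<partial>K x) \<partial>\<mu>)"
    "(\<lambda>x. \<integral>y. f y \<partial>K x) \<in> borel_measurable M"
    "x \<in> space M \<Longrightarrow> \<bar>\<integral>y. f y \<partial>K x\<bar> \<le> b"
proof -
  have s\<mu>: "sets \<mu> = sets M" "prob_space \<mu>"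
    using \<mu> by (auto simp: space_prob_algebra)
  have K': "K \<in> M \<rightarrow>\<^sub>M subprob_algebra N" "K \<in> \<mu> \<rightarrow>\<^sub>M subprob_algebra N"
    using measurable_prob_algebraD[OF K] measurable_cong_sets[OF s\<mu>(1) refl] by auto
  have Kx: "prob_space (K x)" "sets (K x) = sets N" "space (K x) = space N" if "x \<in> space M" for x
    using measurable_space[OF K that] by (auto simp: space_prob_algebra dest: sets_eq_imp_space_eq)
  have "AE x in \<mu>. emeasure (K x) (space (K x)) \<le> ennreal 1"
    using Kx(1)[THEN prob_space.emeasure_space_1] sets_eq_imp_space_eq[OF s\<mu>(1)] by (intro AE_I2) simp
  then show "(\<integral>x. f x \<partial>(\<mu> \<bind> K)) = (\<integral>x. (\<integral>y. f y \<partial>K x) \<partial>\<mu>)"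
    using s\<mu>(2) by (intro integral_bind[OF f b K'(2), where B' = 1]) (auto simp: prob_space_def)
  show "(\<lambda>x. \<integral>y. f y \<partial>K x) \<in> borel_measurable M"
    by (rule measurable_compose[OF K'(1) integral_measurable_subprob_algebra[OF f]])
  assume x: "x \<in> space M"
  have "f \<in> borel_measurable (K x)"
    using measurable_cong_sets[OF Kx(2)[OF x] refl, of borel] f by blast
  then show "\<bar>\<integral>y. f y \<partial>K x\<bar> \<le> b"
    using b Kx(3)[OF x] by (intro prob_space_bounded_integral(2)[OF Kx(1)[OF x]]) auto
qed

text \<open>
  Rounding the functions down to multiples of \<open>1/k\<close> leaves finitely many values, independent of
  \<open>n\<close>, on level sets that depend on \<open>n\<close>. This is why convergence is assumed along sequences of sets.
\<close>

lemma tv_convergence_bounded_functions: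
  fixes \<phi> :: "nat \<Rightarrow> 'a \<Rightarrow> real"
  assumes \<mu>: "\<And>n. prob_space (\<mu> n)" "\<And>n. sets (\<mu> n) = sets N" "prob_space \<mu>'" "sets \<mu>' = sets N"
    and conv: "\<And>B. range B \<subseteq> sets N \<Longrightarrow> (\<lambda>n. measure (\<mu> n) (B n) - measure \<mu>' (B n)) \<longlonglongrightarrow> 0"
    and \<phi>[measurable]: "\<And>n. \<phi> n \<in> borel_measurable N" and b: "\<And>n x. x \<in> space N \<Longrightarrow> \<bar>\<phi> n x\<bar> \<le> b"
  shows "(\<lambda>n. (\<integral>x. \<phi> n x \<partial>\<mu> n) - (\<integral>x. \<phi> n x \<partial>\<mu>')) \<longlonglongrightarrow> 0"
proof (rule tendstoI)
  fix e :: real assume e: "0 < e"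
  obtain k :: nat where k: "0 < k" "2 / real k < e / 2"
  proof -
    obtain k :: nat where "4 / e < real k"
      using reals_Archimedean2 by blast
    moreover from this have "0 < real k"
      using e by (smt (verit) divide_pos_pos)
    ultimately show ?thesis
      using e by (intro that[of k]) (auto simp: field_simps)
  qed
  (* The values of s n lie in {j / k | j \<in> J} for all n at once. *)
  define s where "s n x = of_int \<lfloor>real k * \<phi> n x\<rfloor> / real k" for n x
  obtain m :: nat where m: "real k * \<bar>b\<bar> + 1 \<le> real m"
    using real_arch_simple by blast
  define J where "J = {- int m .. int m}"
  define B where "B j n = {x \<in> space N. \<lfloor>real k * \<phi> n x\<rfloor> = j}" for j n
  have B[measurable]: "B j n \<in> sets N" for j n
    unfolding B_def by measurable
  have s_close: "\<bar>\<phi> n x - s n x\<bar> \<le> 1 / real k" for n x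
  proof -
    have "\<bar>real k * \<phi> n x - of_int \<lfloor>real k * \<phi> n x\<rfloor>\<bar> \<le> 1"
      by linarith
    then have "\<bar>(real k * \<phi> n x - of_int \<lfloor>real k * \<phi> n x\<rfloor>) / real k\<bar> \<le> 1 / real k"
      using k(1) by (simp add: abs_divide divide_right_mono)
    moreover have "(real k * \<phi> n x - of_int \<lfloor>real k * \<phi> n x\<rfloor>) / real k = \<phi> n x - s n x"
      using k(1) by (simp add: s_def diff_divide_distrib)
    ultimately show ?thesis
      by simp
  qed
  have inJ: "\<lfloor>real k * \<phi> n x\<rfloor> \<in> J" if "x \<in> space N" for n x
  proof -
    have "\<bar>real k * \<phi> n x\<bar> \<le> real k * \<bar>b\<bar>"
      using b[OF that, of n] by (auto simp: abs_mult intro!: mult_left_mono)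
    then have "- real m \<le> real k * \<phi> n x - 1" "real k * \<phi> n x \<le> real m"
      using m by linarith+
    then show ?thesis
      unfolding J_def by (simp add: le_floor_iff floor_le_iff)
  qed
  have s_sum: "s n x = (\<Sum>j\<in>J. of_int j / real k * indicator (B j n) x)" if "x \<in> space N" for n x
  proof -
    have "(\<Sum>j\<in>J. of_int j / real k * indicator (B j n) x)
        = (\<Sum>j\<in>J. if j = \<lfloor>real k * \<phi> n x\<rfloor> then of_int j / real k else 0)"
      using that by (intro sum.cong) (auto simp: B_def)
    also have "\<dots> = s n x"
      using inJ[OF that] by (simp add: s_def J_def)
    finally show ?thesis
      by simp
  qed
  have main: "integrable \<nu> (\<phi> n)" "\<bar>(\<integral>x. \<phi> n x \<partial>\<nu>) - (\<Sum>j\<in>J. of_int j / real k * measure \<nu> (B j n))\<bar> \<le> 1 / real k"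
    if \<nu>: "prob_space \<nu>" "sets \<nu> = sets N" for \<nu> n
  proof -
    interpret prob_space \<nu> by fact
    have sp: "space \<nu> = space N"
      using \<nu>(2) by (rule sets_eq_imp_space_eq)
    note [measurable_cong] = \<nu>(2)
    show i: "integrable \<nu> (\<phi> n)"
      using b sp by (intro integrable_const_bound[of _ b]) auto
    have "(\<integral>x. s n x \<partial>\<nu>) = (\<integral>x. (\<Sum>j\<in>J. of_int j / real k * indicator (B j n) x) \<partial>\<nu>)"
      using s_sum sp by (intro Bochner_Integration.integral_cong) auto
    also have "\<dots> = (\<Sum>j\<in>J. of_int j / real k * measure \<nu> (B j n))"
      by (subst Bochner_Integration.integral_sum) (auto simp: \<nu>(2) emeasure_eq_measure)
    finally have e: "(\<integral>x. s n x \<partial>\<nu>) = (\<Sum>j\<in>J. of_int j / real k * measure \<nu> (B j n))" .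
    have si: "integrable \<nu> (s n)"
    proof (rule integrable_const_bound[of _ "b + 1 / real k"])
      have "\<bar>s n x\<bar> \<le> b + 1 / real k" if "x \<in> space N" for x
        using s_close[of n x] b[OF that, of n] by linarith
      then show "AE x in \<nu>. norm (s n x) \<le> b + 1 / real k"
        using sp by (intro AE_I2) simp
      show "s n \<in> borel_measurable \<nu>"
        unfolding s_def by measurable
    qed
    have "(\<integral>x. \<phi> n x \<partial>\<nu>) - (\<integral>x. s n x \<partial>\<nu>) = (\<integral>x. \<phi> n x - s n x \<partial>\<nu>)"
      using i si by simp
    also have "\<bar>\<dots>\<bar> \<le> (\<integral>x. \<bar>\<phi> n x - s n x\<bar> \<partial>\<nu>)"
      by (rule integral_abs_bound)
    also have "\<dots> \<le> (\<integral>x. 1 / real k \<partial>\<nu>)"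
      using i si s_close by (intro integral_mono) auto
    finally show "\<bar>(\<integral>x. \<phi> n x \<partial>\<nu>) - (\<Sum>j\<in>J. of_int j / real k * measure \<nu> (B j n))\<bar> \<le> 1 / real k"
      by (simp add: e prob_space)
  qed
  have "(\<lambda>n. \<Sum>j\<in>J. of_int j / real k * (measure (\<mu> n) (B j n) - measure \<mu>' (B j n))) \<longlonglongrightarrow> (\<Sum>j\<in>J. of_int j / real k * 0)"
    using B by (intro tendsto_sum tendsto_mult_left conv) auto
  then have "\<forall>\<^sub>F n in sequentially.
      \<bar>\<Sum>j\<in>J. of_int j / real k * (measure (\<mu> n) (B j n) - measure \<mu>' (B j n))\<bar> < e / 2"
    using e by (auto dest!: tendstoD[where e="e / 2"] simp: dist_real_def)
  then show "\<forall>\<^sub>F n in sequentially. dist ((\<integral>x. \<phi> n x \<partial>\<mu> n) - (\<integral>x. \<phi> n x \<partial>\<mu>')) 0 < e"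
  proof eventually_elim
    case (elim n)
    have "(\<Sum>j\<in>J. of_int j / real k * (measure (\<mu> n) (B j n) - measure \<mu>' (B j n)))
       = (\<Sum>j\<in>J. of_int j / real k * measure (\<mu> n) (B j n)) - (\<Sum>j\<in>J. of_int j / real k * measure \<mu>' (B j n))"
      by (simp add: sum_subtractf algebra_simps)
    moreover have "2 / real k = 1 / real k + 1 / real k"
      by simp
    ultimately show ?case
      using elim main(2)[OF \<mu>(1,2)[of n], of n] main(2)[OF \<mu>(3,4), of n] k(2)
      unfolding dist_real_def by linarith
  qed
qed

lemma belief_joint_prob_measures:
  assumes "stochastic_kernel S (prod_topology S1 A) P" "second_countable S1" "second_countable A"
    and z: "z \<in> prob_measures S1" and a: "a \<in> topspace A"
  shows "(\<lambda>w. P (w, a)) \<in> borel_of S1 \<rightarrow>\<^sub>M prob_algebra (borel_of S)"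
    "belief_joint P z a \<in> prob_measures S"
proof -
  have "(\<lambda>w. (w, a)) \<in> borel_of S1 \<rightarrow>\<^sub>M borel_of (prod_topology S1 A)"
    using a by (intro continuous_map_measurable) (simp add: continuous_map_pairedI)
  then show m: "(\<lambda>w. P (w, a)) \<in> borel_of S1 \<rightarrow>\<^sub>M prob_algebra (borel_of S)"
    using assms(1) unfolding stochastic_kernel_def by (rule measurable_compose)
  have "(\<lambda>_::unit. z \<bind> (\<lambda>w. P (w, a))) \<in> count_space UNIV \<rightarrow>\<^sub>M prob_algebra (borel_of S)"
    using z by (intro measurable_bind_prob_space[OF measurable_const m]) (simp add: prob_measures_def)
  from measurable_space[OF this, of "()"] show "belief_joint P z a \<in> prob_measures S"
    by (simp add: belief_joint_def prob_measures_def)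
qed

lemma cross_integral_belief_joint:
  assumes P: "stochastic_kernel (prod_topology S1 S2) (prod_topology S1 A) P"
    and sc: "second_countable S1" "second_countable S2" "second_countable A"
    and z: "z \<in> prob_measures S1" and a: "a \<in> topspace A"
    and B: "B \<in> sets (borel_of S2)" and f: "f \<in> borel_measurable (borel_of S1)"
    and b: "\<forall>x\<in>topspace S1. \<bar>f x\<bar> \<le> b" "0 \<le> b"
  shows "cross_integral f B (belief_joint P z a) = (\<integral>w. cross_integral f B (P (w, a)) \<partial>z)"
    "(\<lambda>w. cross_integral f B (P (w, a))) \<in> borel_measurable (borel_of S1)"
    "w \<in> topspace S1 \<Longrightarrow> \<bar>cross_integral f B (P (w, a))\<bar> \<le> b"
proof -
  note m = belief_joint_prob_measures(1)[OF P sc(1,3) z a]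
  have meas: "(\<lambda>p. f (fst p) * indicator B (snd p)) \<in> borel_measurable (borel_of (prod_topology S1 S2))"
    by (rule cross_integrand_measurable[OF B f])
  have bd: "\<bar>f (fst p) * indicator B (snd p)\<bar> \<le> b" if "p \<in> space (borel_of (prod_topology S1 S2))" for p
    using that b by (auto split: split_indicator)
  note * = integral_bind_bounded[OF _ m meas bd, of z]
  show "cross_integral f B (belief_joint P z a) = (\<integral>w. cross_integral f B (P (w, a)) \<partial>z)"
    "(\<lambda>w. cross_integral f B (P (w, a))) \<in> borel_measurable (borel_of S1)"
    "w \<in> topspace S1 \<Longrightarrow> \<bar>cross_integral f B (P (w, a))\<bar> \<le> b"
    using *(1,2) *(3)[of w] z unfolding cross_integral_def belief_joint_def by (auto simp: prob_measures_def)
qed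

lemma limitin_prod_topology_Pair:
  "limitin S1 x l F \<Longrightarrow> limitin S2 y m F \<Longrightarrow> limitin (prod_topology S1 S2) (\<lambda>n. (x n, y n)) (l, m) F"
  by (simp add: limitin_pairwise comp_def)

lemma feller_along_setsD:
  assumes "feller_along_sets S1 S2 S3 \<Psi>" "limitin S3 s l sequentially" "range s \<subseteq> topspace S3"
    "bounded_continuous S1 f" "\<And>n. B n \<in> sets (borel_of S2)"
  shows "(\<lambda>n. cross_integral f (B n) (\<Psi> (s n)) - cross_integral f (B n) (\<Psi> l)) \<longlonglongrightarrow> 0"
  using assms unfolding feller_along_sets_def by (simp add: image_subset_iff)

text \<open>
  Along convergent actions, the functions \<open>w \<mapsto> \<integral>f dP(\<cdot>, B n | w, a n)\<close> approach the corresponding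
  functions for the limiting action in the sense of continuous convergence, and can be integrated
  against weakly convergent beliefs.
\<close>

lemma belief_joint_feller_along_sets:
  assumes S: "separable_metrizable S1" "separable_metrizable S2" "separable_metrizable A"
    and P: "stochastic_kernel (prod_topology S1 S2) (prod_topology S1 A) P"
    and F: "feller_along_sets S1 S2 (prod_topology S1 A) P"
  shows "feller_along_sets S1 S2 (prod_topology (weak_topology S1) A) (\<lambda>(z, a). belief_joint P z a)"
  unfolding feller_along_sets_def
proof (intro allI impI)
  fix s l f and B :: "nat \<Rightarrow> 'b set"
  assume s: "limitin (prod_topology (weak_topology S1) A) s l sequentially"
      "range s \<subseteq> topspace (prod_topology (weak_topology S1) A)"
    and f: "bounded_continuous S1 f" and B: "range B \<subseteq> sets (borel_of S2)"
  have sc: "second_countable S1" "second_countable S2" "second_countable A"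
    using S by (auto simp: separable_metrizable_def)
  obtain b where b: "0 \<le> b" "\<forall>x\<in>topspace S1. \<bar>f x\<bar> \<le> b"
    by (rule bounded_continuousE[OF f])
  define z where "z = (\<lambda>n. fst (s n))"
  define a where "a = (\<lambda>n. snd (s n))"
  have lims: "limitin (weak_topology S1) z (fst l) sequentially" "limitin A a (snd l) sequentially"
    using s(1) by (auto simp: limitin_pairwise comp_def z_def a_def)
  have "s n \<in> prob_measures S1 \<times> topspace A" for n
    using s(2) by (auto simp: topspace_weak_topology image_subset_iff)
  then have top: "z n \<in> prob_measures S1" "a n \<in> topspace A" for n
    by (auto simp: z_def a_def mem_Times_iff)
  have ltop: "fst l \<in> prob_measures S1" "snd l \<in> topspace A"
    using lims[THEN limitin_topspace] by (auto simp: topspace_weak_topology)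
  have Bn: "B n \<in> sets (borel_of S2)" for n
    using B by auto
  note fm = bounded_continuous_measurable[OF f]
  note R = cross_integral_belief_joint[OF P sc _ _ Bn fm b(2,1)]
  have "(\<lambda>n. (\<integral>w. cross_integral f (B n) (P (w, a n)) \<partial>z n) - (\<integral>w. cross_integral f (B n) (P (w, snd l)) \<partial>fst l)) \<longlonglongrightarrow> 0"
  proof (rule uniform_weak_convergence[OF S(1) lims(1), where M=b])
    show "(\<lambda>w. cross_integral f (B n) (P (w, a n))) \<in> borel_measurable (borel_of S1)"
      "(\<lambda>w. cross_integral f (B n) (P (w, snd l))) \<in> borel_measurable (borel_of S1)" for n
      using R(2)[OF top(1) top(2)] R(2)[OF ltop] by auto
    show "\<bar>cross_integral f (B n) (P (w, a n))\<bar> \<le> b" "\<bar>cross_integral f (B n) (P (w, snd l))\<bar> \<le> b"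
      if "w \<in> topspace S1" for n w
      using R(3)[OF top(1) top(2) that] R(3)[OF ltop that] by auto
    fix \<sigma> w assume \<sigma>: "limitin S1 \<sigma> w sequentially" "\<And>n. \<sigma> n \<in> topspace S1"
    show "(\<lambda>n. cross_integral f (B n) (P (\<sigma> n, a n)) - cross_integral f (B n) (P (w, snd l))) \<longlonglongrightarrow> 0"
      using \<sigma> lims(2) top f Bn by (intro feller_along_setsD[OF F] limitin_prod_topology_Pair) auto
    show "(\<lambda>n. cross_integral f (B n) (P (\<sigma> n, snd l)) - cross_integral f (B n) (P (w, snd l))) \<longlonglongrightarrow> 0"
      using \<sigma> ltop f Bn by (intro feller_along_setsD[OF F] limitin_prod_topology_Pair) auto
  qed
  then show "(\<lambda>n. cross_integral f (B n) (case s n of (z, a) \<Rightarrow> belief_joint P z a)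
      - cross_integral f (B n) (case l of (z, a) \<Rightarrow> belief_joint P z a)) \<longlonglongrightarrow> 0"
    using R(1)[OF top(1) top(2)] R(1)[OF ltop] by (simp add: z_def a_def split_beta)
qed

section \<open>Continuity of the joint kernel in partially observable models\<close>

lemma stochastic_kernel_pair:
  assumes "second_countable S1" "second_countable S2"
    "stochastic_kernel S1 S3 P" "stochastic_kernel S2 S3 Q"
  shows "stochastic_kernel (prod_topology S1 S2) S3 (\<lambda>s. P s \<Otimes>\<^sub>M Q s)"
proof -
  have "prob_algebra (borel_of S1 \<Otimes>\<^sub>M borel_of S2) = prob_algebra (borel_of (prod_topology S1 S2))"
    unfolding prob_algebra_def
    by (simp add: subprob_algebra_cong[OF sets_borel_of_prod_topology[OF assms(1,2)]])
  then show ?thesis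
    using measurable_pair_prob[OF assms(3,4)[unfolded stochastic_kernel_def]]
    by (simp add: stochastic_kernel_def)
qed

lemma cross_integral_pair_measure:
  assumes \<mu>: "\<mu> \<in> prob_measures S1" "\<nu> \<in> prob_measures S2" and B: "B \<in> sets (borel_of S2)"
    and f: "bounded_continuous S1 f"
  shows "cross_integral f B (\<mu> \<Otimes>\<^sub>M \<nu>) = (\<integral>x. f x \<partial>\<mu>) * measure \<nu> B"
proof -
  interpret \<mu>: prob_space \<mu>
    using prob_measuresD[OF \<mu>(1)] by simp
  interpret \<nu>: prob_space \<nu>
    using prob_measuresD[OF \<mu>(2)] by simp
  interpret pair_prob_space \<mu> \<nu> ..
  obtain b where b: "0 \<le> b" "\<forall>x\<in>topspace S1. \<bar>f x\<bar> \<le> b"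
    by (rule bounded_continuousE[OF f])
  have [measurable]: "f \<in> borel_measurable \<mu>"
    by (rule measurable_prob_measures[OF \<mu>(1) bounded_continuous_measurable[OF f]])
  have [measurable]: "B \<in> sets \<nu>"
    using B prob_measuresD(2)[OF \<mu>(2)] by simp
  have "integrable (\<mu> \<Otimes>\<^sub>M \<nu>) (\<lambda>p. f (fst p) * indicator B (snd p))"
    using b prob_measuresD(3)[OF \<mu>(1)]
    by (intro P.integrable_const_bound[of _ b])
      (auto simp: space_pair_measure intro!: AE_I2 split: split_indicator)
  from integral_fst'[OF this] show ?thesis
    by (simp add: cross_integral_def)
qed

text \<open>
  The difference splits into a difference of integrals of \<open>f\<close> times a probability, and a fixed
  integral times a difference of probabilities.
\<close>

lemma pomdp1_feller_along_sets:
  assumes P: "stochastic_kernel S1 S3 P" and Q: "stochastic_kernel S2 S3 Q"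
    and wc: "weakly_continuous S1 S3 P" and tv: "tv_continuous S2 S3 Q"
  shows "feller_along_sets S1 S2 S3 (\<lambda>s. P s \<Otimes>\<^sub>M Q s)"
  unfolding feller_along_sets_def
proof (intro allI impI)
  fix s l f and B :: "nat \<Rightarrow> 'c set"
  assume s: "limitin S3 s l sequentially" "range s \<subseteq> topspace S3"
    and f: "bounded_continuous S1 f" and B: "range B \<subseteq> sets (borel_of S2)"
  have top: "s n \<in> topspace S3" "l \<in> topspace S3" for n :: nat
    using s(2) limitin_topspace[OF s(1)] by auto
  have "(\<lambda>n. \<integral>x. f x \<partial>P (s n)) \<longlonglongrightarrow> (\<integral>x. f x \<partial>P l)"
    using wc s(1) f by (auto simp: weakly_continuous_def limitin_weak_topology)
  then have 1: "(\<lambda>n. (\<integral>x. f x \<partial>P (s n)) - (\<integral>x. f x \<partial>P l)) \<longlonglongrightarrow> 0"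
    by (rule LIM_zero)
  have 2: "(\<lambda>n. measure (Q (s n)) (B n) - measure (Q l) (B n)) \<longlonglongrightarrow> 0"
    by (rule tv_continuous_along_sets[OF Q tv s B])
  have le: "measure (Q (s n)) C \<le> 1" for n C
    by (rule prob_space.prob_le_1[OF prob_measuresD(1)[OF stochastic_kernelD[OF Q top(1)]]])
  have 3: "(\<lambda>n. ((\<integral>x. f x \<partial>P (s n)) - (\<integral>x. f x \<partial>P l)) * measure (Q (s n)) (B n)) \<longlonglongrightarrow> 0"
  proof (rule Lim_null_comparison[OF always_eventually tendsto_rabs_zero[OF 1]], rule allI)
    show "norm (((\<integral>x. f x \<partial>P (s n)) - (\<integral>x. f x \<partial>P l)) * measure (Q (s n)) (B n))
        \<le> \<bar>(\<integral>x. f x \<partial>P (s n)) - (\<integral>x. f x \<partial>P l)\<bar>" for n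
      using le[of n "B n"] by (simp add: abs_mult mult_left_le)
  qed
  have 4: "(\<lambda>n. (\<integral>x. f x \<partial>P l) * (measure (Q (s n)) (B n) - measure (Q l) (B n))) \<longlonglongrightarrow> 0"
    using tendsto_mult_left[OF 2, of "\<integral>x. f x \<partial>P l"] by simp
  have "cross_integral f (B n) (P (s n) \<Otimes>\<^sub>M Q (s n)) - cross_integral f (B n) (P l \<Otimes>\<^sub>M Q l)
    = ((\<integral>x. f x \<partial>P (s n)) - (\<integral>x. f x \<partial>P l)) * measure (Q (s n)) (B n)
      + (\<integral>x. f x \<partial>P l) * (measure (Q (s n)) (B n) - measure (Q l) (B n))" for n
  proof -
    have Bn: "B n \<in> sets (borel_of S2)"
      using B by auto
    show ?thesis
      unfolding cross_integral_pair_measure[OF stochastic_kernelD[OF P top(1)] stochastic_kernelD[OF Q top(1)] Bn f]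
        cross_integral_pair_measure[OF stochastic_kernelD[OF P top(2)] stochastic_kernelD[OF Q top(2)] Bn f]
      by (simp add: algebra_simps)
  qed
  then show "(\<lambda>n. cross_integral f (B n) (P (s n) \<Otimes>\<^sub>M Q (s n))
      - cross_integral f (B n) (P l \<Otimes>\<^sub>M Q l)) \<longlonglongrightarrow> 0"
    using tendsto_add[OF 3 4] by simp
qed

lemma pomdp2_kernel_measurable:
  assumes sc: "second_countable S1" "second_countable S2" "second_countable A"
    and P: "stochastic_kernel S1 (prod_topology S1 A) P" and Q: "stochastic_kernel S2 (prod_topology A S1) Q"
  shows "stochastic_kernel (prod_topology S1 S2) (prod_topology S1 A)
      (\<lambda>(w, a). P (w, a) \<bind> (\<lambda>w'. distr (Q (a, w')) (borel_of (prod_topology S1 S2)) (Pair w')))"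
    "a \<in> topspace A \<Longrightarrow> (\<lambda>w'. distr (Q (a, w')) (borel_of (prod_topology S1 S2)) (Pair w'))
        \<in> borel_of S1 \<rightarrow>\<^sub>M prob_algebra (borel_of (prod_topology S1 S2))"
proof -
  let ?P = "borel_of (prod_topology S1 S2)" and ?D = "borel_of (prod_topology S1 A)"
  note [measurable_cong] = sets_borel_of_prod_topology[OF sc(1,2)] sets_borel_of_prod_topology[OF sc(1,3)]
    sets_borel_of_prod_topology[OF sc(3,1)]
  have P[measurable]: "P \<in> ?D \<rightarrow>\<^sub>M prob_algebra (borel_of S1)"
    using P by (simp add: stochastic_kernel_def)
  have Q[measurable]: "Q \<in> borel_of (prod_topology A S1) \<rightarrow>\<^sub>M prob_algebra (borel_of S2)"
    using Q by (simp add: stochastic_kernel_def)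
  have Q'[measurable]: "(\<lambda>p. Q (snd (fst p), snd p)) \<in> ?D \<Otimes>\<^sub>M borel_of S1 \<rightarrow>\<^sub>M prob_algebra (borel_of S2)"
    by (rule measurable_compose[OF _ Q]) measurable
  have D: "(\<lambda>p. distr (Q (snd (fst p), snd p)) ?P (Pair (snd p))) \<in> ?D \<Otimes>\<^sub>M borel_of S1 \<rightarrow>\<^sub>M prob_algebra ?P"
    by (rule measurable_distr_prob_space2[OF Q']) measurable
  have "(\<lambda>s. P s \<bind> (\<lambda>w'. distr (Q (snd s, w')) ?P (Pair w'))) \<in> ?D \<rightarrow>\<^sub>M prob_algebra ?P"
    by (rule measurable_bind_prob_space2[OF P]) (use D in \<open>simp add: split_beta\<close>)
  then show "stochastic_kernel (prod_topology S1 S2) (prod_topology S1 A)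
      (\<lambda>(w, a). P (w, a) \<bind> (\<lambda>w'. distr (Q (a, w')) ?P (Pair w')))"
    by (simp add: stochastic_kernel_def split_beta)
  assume a: "a \<in> topspace A"
  have "(\<lambda>w'. (a, w')) \<in> borel_of S1 \<rightarrow>\<^sub>M borel_of (prod_topology A S1)"
    using a by (intro continuous_map_measurable) (simp add: continuous_map_pairedI)
  from measurable_compose[OF this Q] show "(\<lambda>w'. distr (Q (a, w')) ?P (Pair w')) \<in> borel_of S1 \<rightarrow>\<^sub>M prob_algebra ?P"
    by (rule measurable_distr_prob_space2) measurable
qed

lemma pomdp2_cross_integral:
  assumes sc: "second_countable S1" "second_countable S2" "second_countable A"
    and P: "stochastic_kernel S1 (prod_topology S1 A) P" and Q: "stochastic_kernel S2 (prod_topology A S1) Q"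
    and w: "w \<in> topspace S1" "a \<in> topspace A"
    and f: "bounded_continuous S1 f" and b: "\<forall>x\<in>topspace S1. \<bar>f x\<bar> \<le> b" "0 \<le> b"
    and B: "B \<in> sets (borel_of S2)"
  shows "cross_integral f B (P (w, a) \<bind> (\<lambda>w'. distr (Q (a, w')) (borel_of (prod_topology S1 S2)) (Pair w')))
     = (\<integral>w'. f w' * measure (Q (a, w')) B \<partial>P (w, a))"
    "(\<lambda>w'. f w' * measure (Q (a, w')) B) \<in> borel_measurable (borel_of S1)"
    "w' \<in> topspace S1 \<Longrightarrow> \<bar>f w' * measure (Q (a, w')) B\<bar> \<le> b"
proof -
  let ?P = "borel_of (prod_topology S1 S2)"
  have meas: "(\<lambda>p. f (fst p) * indicator B (snd p)) \<in> borel_measurable ?P"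
    by (rule cross_integrand_measurable[OF B bounded_continuous_measurable[OF f]])
  have bd: "\<bar>f (fst p) * indicator B (snd p)\<bar> \<le> b" if "p \<in> space ?P" for p
    using that b by (auto split: split_indicator)
  have Pwa: "P (w, a) \<in> prob_measures S1"
    using stochastic_kernelD[OF P] w by simp
  have inner: "(\<integral>p. f (fst p) * indicator B (snd p) \<partial>distr (Q (a, w')) ?P (Pair w')) = f w' * measure (Q (a, w')) B"
    if w': "w' \<in> topspace S1" for w'
  proof -
    have Qw: "Q (a, w') \<in> prob_measures S2"
      using stochastic_kernelD[OF Q] w w' by simp
    have "Pair w' \<in> borel_of S2 \<rightarrow>\<^sub>M ?P"
      using w' by (intro continuous_map_measurable) (simp add: continuous_map_pairedI)
    then have "Pair w' \<in> Q (a, w') \<rightarrow>\<^sub>M ?P"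
      by (rule measurable_prob_measures[OF Qw])
    then have "(\<integral>p. f (fst p) * indicator B (snd p) \<partial>distr (Q (a, w')) ?P (Pair w'))
        = (\<integral>y. f w' * indicator B y \<partial>Q (a, w'))"
      using meas by (simp add: integral_distr)
    then show ?thesis
      using B prob_measuresD(2)[OF Qw] by simp
  qed
  note * = integral_bind_bounded[OF Pwa[unfolded prob_measures_def] pomdp2_kernel_measurable(2)[OF sc P Q w(2)] meas bd]
  have "cross_integral f B (P (w, a) \<bind> (\<lambda>w'. distr (Q (a, w')) ?P (Pair w')))
     = (\<integral>w'. (\<integral>p. f (fst p) * indicator B (snd p) \<partial>distr (Q (a, w')) ?P (Pair w')) \<partial>P (w, a))"
    unfolding cross_integral_def by (rule *(1))
  also have "\<dots> = (\<integral>w'. f w' * measure (Q (a, w')) B \<partial>P (w, a))"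
    using inner prob_measuresD(3)[OF Pwa] by (intro Bochner_Integration.integral_cong) auto
  finally show "cross_integral f B (P (w, a) \<bind> (\<lambda>w'. distr (Q (a, w')) ?P (Pair w')))
     = (\<integral>w'. f w' * measure (Q (a, w')) B \<partial>P (w, a))" .
  have "(\<lambda>w'. \<integral>p. f (fst p) * indicator B (snd p) \<partial>distr (Q (a, w')) ?P (Pair w')) \<in> borel_measurable (borel_of S1) \<longleftrightarrow>
    (\<lambda>w'. f w' * measure (Q (a, w')) B) \<in> borel_measurable (borel_of S1)"
    by (rule measurable_cong) (simp add: inner)
  with *(2) show "(\<lambda>w'. f w' * measure (Q (a, w')) B) \<in> borel_measurable (borel_of S1)"
    by blast
  show "w' \<in> topspace S1 \<Longrightarrow> \<bar>f w' * measure (Q (a, w')) B\<bar> \<le> b"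
    using *(3)[of w'] inner[of w'] by simp
qed

text \<open>
  The joint kernel integrates \<open>w' \<mapsto> f w' * Q (a, w') B\<close> against \<open>P (w, a)\<close>. Under the first
  condition the integrands converge continuously and the measures weakly. Under the second the
  measures converge in total variation, while the integrands converge boundedly at each point.
\<close>

lemma pomdp2_feller_along_sets:
  assumes S: "separable_metrizable S1" "separable_metrizable S2" "separable_metrizable A"
    and P: "stochastic_kernel S1 (prod_topology S1 A) P" and Q: "stochastic_kernel S2 (prod_topology A S1) Q"
    and cont: "weakly_continuous S1 (prod_topology S1 A) P \<and> tv_continuous S2 (prod_topology A S1) Q \<or>
      tv_continuous S1 (prod_topology S1 A) P \<and> (\<forall>w\<in>topspace S1. tv_continuous S2 A (\<lambda>a. Q (a, w)))"
  shows "feller_along_sets S1 S2 (prod_topology S1 A)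
      (\<lambda>(w, a). P (w, a) \<bind> (\<lambda>w'. distr (Q (a, w')) (borel_of (prod_topology S1 S2)) (Pair w')))"
  unfolding feller_along_sets_def
proof (intro allI impI)
  fix s l f and B :: "nat \<Rightarrow> 'b set"
  assume s: "limitin (prod_topology S1 A) s l sequentially" "range s \<subseteq> topspace (prod_topology S1 A)"
    and f: "bounded_continuous S1 f" and B: "range B \<subseteq> sets (borel_of S2)"
  have sc: "second_countable S1" "second_countable S2" "second_countable A"
    using S by (auto simp: separable_metrizable_def)
  obtain b where b: "0 \<le> b" "\<forall>x\<in>topspace S1. \<bar>f x\<bar> \<le> b"
    by (rule bounded_continuousE[OF f])
  have Bn: "B n \<in> sets (borel_of S2)" for n
    using B by auto
  define w where "w = (\<lambda>n. fst (s n))"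
  define a where "a = (\<lambda>n. snd (s n))"
  define w0 where "w0 = fst l"
  define a0 where "a0 = snd l"
  have sn: "s n = (w n, a n)" "l = (w0, a0)" for n
    by (auto simp: w_def a_def w0_def a0_def)
  have lims: "limitin S1 w w0 sequentially" "limitin A a a0 sequentially"
    using s(1) by (auto simp: limitin_pairwise comp_def w_def a_def w0_def a0_def)
  have "s n \<in> topspace S1 \<times> topspace A" for n
    using s(2) by (auto simp: image_subset_iff)
  then have top: "w n \<in> topspace S1" "a n \<in> topspace A" for n
    by (auto simp: w_def a_def mem_Times_iff)
  have ltop: "w0 \<in> topspace S1" "a0 \<in> topspace A"
    using lims[THEN limitin_topspace] by auto
  have Pw: "P (w n, a n) \<in> prob_measures S1" "P (w0, a0) \<in> prob_measures S1" for n
    using stochastic_kernelD[OF P] top ltop by auto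
  have Q01: "0 \<le> measure (Q (a', w')) C" "measure (Q (a', w')) C \<le> 1"
    if "a' \<in> topspace A" "w' \<in> topspace S1" for a' w' C
    using prob_space.prob_le_1[OF prob_measuresD(1)[OF stochastic_kernelD[OF Q, of "(a', w')"]]] that by auto
  note c = pomdp2_cross_integral[OF sc P Q _ _ f b(2,1) Bn]
  let ?g = "\<lambda>n w'. f w' * measure (Q (a n, w')) (B n)" and ?h = "\<lambda>n w'. f w' * measure (Q (a0, w')) (B n)"
  have meas: "?g n \<in> borel_measurable (borel_of S1)" "?h n \<in> borel_measurable (borel_of S1)" for n
    using c(2)[OF top(1,2)] c(2)[OF ltop] by auto
  have bd: "\<bar>?g n x\<bar> \<le> b" "\<bar>?h n x\<bar> \<le> b" if "x \<in> topspace S1" for n x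
    using c(3)[OF top(1,2) that] c(3)[OF ltop that] by auto
  have "(\<lambda>n. (\<integral>x. ?g n x \<partial>P (w n, a n)) - (\<integral>x. ?h n x \<partial>P (w0, a0))) \<longlonglongrightarrow> 0"
    using cont
  proof (elim disjE conjE)
    assume wc: "weakly_continuous S1 (prod_topology S1 A) P" and tv: "tv_continuous S2 (prod_topology A S1) Q"
    have "limitin (weak_topology S1) (\<lambda>n. P (w n, a n)) (P (w0, a0)) sequentially"
      using wc[unfolded weakly_continuous_def, rule_format, OF s(1)] unfolding sn .
    have conv: "(\<lambda>n. f (\<sigma> n) * measure (Q (a' n, \<sigma> n)) (B n) - f x * measure (Q (a0, x)) (B n)) \<longlonglongrightarrow> 0"
      if \<sigma>: "limitin S1 \<sigma> x sequentially" "\<And>n. \<sigma> n \<in> topspace S1"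
        and a': "limitin A a' a0 sequentially" "\<And>n. a' n \<in> topspace A" for \<sigma> x a'
    proof -
      have x: "x \<in> topspace S1"
        using limitin_topspace[OF \<sigma>(1)] .
      have "(\<lambda>n. f (\<sigma> n)) \<longlonglongrightarrow> f x"
        using continuous_map_limit[OF _ \<sigma>(1), of euclideanreal f] f by (simp add: bounded_continuous_def comp_def)
      then have 1: "(\<lambda>n. f (\<sigma> n) - f x) \<longlonglongrightarrow> 0"
        by (rule LIM_zero)
      have 2: "(\<lambda>n. measure (Q (a' n, \<sigma> n)) (B n) - measure (Q (a0, x)) (B n)) \<longlonglongrightarrow> 0"
        using \<sigma> a' by (intro tv_continuous_along_sets[OF Q tv _ _ B] limitin_prod_topology_Pair) auto
      have 3: "(\<lambda>n. (f (\<sigma> n) - f x) * measure (Q (a' n, \<sigma> n)) (B n)) \<longlonglongrightarrow> 0"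
      proof (rule Lim_null_comparison[OF always_eventually tendsto_rabs_zero[OF 1]], rule allI)
        show "norm ((f (\<sigma> n) - f x) * measure (Q (a' n, \<sigma> n)) (B n)) \<le> \<bar>f (\<sigma> n) - f x\<bar>" for n
          using Q01[OF a'(2) \<sigma>(2), of n n "B n"] by (simp add: abs_mult mult_left_le)
      qed
      have 4: "(\<lambda>n. f x * (measure (Q (a' n, \<sigma> n)) (B n) - measure (Q (a0, x)) (B n))) \<longlonglongrightarrow> 0"
        using tendsto_mult_left[OF 2, of "f x"] by simp
      show ?thesis
        using tendsto_add[OF 3 4] by (simp add: algebra_simps)
    qed
    show ?thesis
    proof (rule uniform_weak_convergence[OF S(1) \<open>limitin (weak_topology S1) (\<lambda>n. P (w n, a n)) (P (w0, a0)) sequentially\<close> meas bd])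
      show "(\<lambda>n. ?g n (\<sigma> n) - ?h n x) \<longlonglongrightarrow> 0" "(\<lambda>n. ?h n (\<sigma> n) - ?h n x) \<longlonglongrightarrow> 0"
        if "limitin S1 \<sigma> x sequentially" "\<And>n. \<sigma> n \<in> topspace S1" for \<sigma> x
        using that lims(2) top(2) ltop(2) by (intro conv; auto)+
    qed
  next
    assume tvP: "tv_continuous S1 (prod_topology S1 A) P"
      and tvQ: "\<forall>w\<in>topspace S1. tv_continuous S2 A (\<lambda>a. Q (a, w))"
    have 1: "(\<lambda>n. (\<integral>x. ?g n x \<partial>P (w n, a n)) - (\<integral>x. ?g n x \<partial>P (w0, a0))) \<longlonglongrightarrow> 0"
    proof (rule tv_convergence_bounded_functions[where N="borel_of S1" and b=b])
      show "(\<lambda>n. measure (P (w n, a n)) (C n) - measure (P (w0, a0)) (C n)) \<longlonglongrightarrow> 0"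
        if "range C \<subseteq> sets (borel_of S1)" for C
        using tv_continuous_along_sets[OF P tvP s that] by (simp add: sn)
    qed (use prob_measuresD[OF Pw(1)] prob_measuresD[OF Pw(2)] meas bd in auto)
    interpret prob_space "P (w0, a0)"
      using prob_measuresD[OF Pw(2)] by simp
    have [simp]: "integrable (P (w0, a0)) (?g n)" "integrable (P (w0, a0)) (?h n)" for n
      using meas bd by (auto intro!: bounded_measurable_integrable[OF Pw(2)])
    have "(\<lambda>n. \<integral>x. ?g n x - ?h n x \<partial>P (w0, a0)) \<longlonglongrightarrow> (\<integral>x. 0 \<partial>P (w0, a0))"
    proof (rule integral_dominated_convergence[where w="\<lambda>_. b + b"])
      show "AE x in P (w0, a0). (\<lambda>n. ?g n x - ?h n x) \<longlonglongrightarrow> 0"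
      proof (rule AE_I2)
        fix x assume "x \<in> space (P (w0, a0))"
        then have x: "x \<in> topspace S1"
          using prob_measuresD(3)[OF Pw(2)] by simp
        have "stochastic_kernel S2 A (\<lambda>a. Q (a, x))"
          unfolding stochastic_kernel_def
          using x by (intro measurable_compose[OF continuous_map_measurable Q[unfolded stochastic_kernel_def]])
            (simp add: continuous_map_pairedI)
        then have "(\<lambda>n. measure (Q (a n, x)) (B n) - measure (Q (a0, x)) (B n)) \<longlonglongrightarrow> 0"
          using tv_continuous_along_sets[of S2 A "\<lambda>a. Q (a, x)" a a0 B] tvQ x lims(2) top(2) B by auto
        from tendsto_mult_left[OF this, of "f x"] show "(\<lambda>n. ?g n x - ?h n x) \<longlonglongrightarrow> 0"
          by (simp add: algebra_simps)
      qed
      have "\<bar>?g n x - ?h n x\<bar> \<le> b + b" if "x \<in> topspace S1" for n x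
        by (rule order_trans[OF abs_triangle_ineq4 add_mono[OF bd(1)[OF that] bd(2)[OF that]]])
      then show "AE x in P (w0, a0). norm (?g n x - ?h n x) \<le> b + b" for n
        using prob_measuresD(3)[OF Pw(2)] by (intro AE_I2) simp
      show "(\<lambda>x. ?g n x - ?h n x) \<in> borel_measurable (P (w0, a0))" for n
        using meas by (intro borel_measurable_diff measurable_prob_measures[OF Pw(2)])
    qed auto
    then have 2: "(\<lambda>n. (\<integral>x. ?g n x \<partial>P (w0, a0)) - (\<integral>x. ?h n x \<partial>P (w0, a0))) \<longlonglongrightarrow> 0"
      by simp
    show ?thesis
      using tendsto_add[OF 1 2] by simp
  qed
  then show "(\<lambda>n. cross_integral f (B n) (case s n of (w, a) \<Rightarrow> P (w, a) \<bind> (\<lambda>w'. distr (Q (a, w')) (borel_of (prod_topology S1 S2)) (Pair w')))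
     - cross_integral f (B n) (case l of (w, a) \<Rightarrow> P (w, a) \<bind> (\<lambda>w'. distr (Q (a, w')) (borel_of (prod_topology S1 S2)) (Pair w')))) \<longlonglongrightarrow> 0"
    using c(1)[OF top(1,2)] c(1)[OF ltop] by (simp add: sn)
qed

section \<open>Jointly measurable densities\<close>

text \<open>
  The absolute difference is integrated over the two sets on which the difference has a constant
  sign; weak information on integrals over sets thereby controls an \<open>L\<^sup>1\<close> distance.
\<close>

lemma integral_abs_diff:
  fixes r r' :: "'a \<Rightarrow> real"
  assumes r: "integrable M r" "integrable M r'"
  defines "C \<equiv> {x \<in> space M. r' x \<le> r x}" and "D \<equiv> {x \<in> space M. \<not> r' x \<le> r x}"
  shows "C \<in> sets M" "D \<in> sets M"
    "(\<integral>x. \<bar>r x - r' x\<bar> \<partial>M) = ((\<integral>x. r x * indicator C x \<partial>M) - (\<integral>x. r' x * indicator C x \<partial>M))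
      - ((\<integral>x. r x * indicator D x \<partial>M) - (\<integral>x. r' x * indicator D x \<partial>M))"
proof -
  note [measurable] = borel_measurable_integrable[OF r(1)] borel_measurable_integrable[OF r(2)]
  show C: "C \<in> sets M" "D \<in> sets M"
    unfolding C_def D_def by measurable
  have [simp]: "integrable M (\<lambda>x. f x * indicator E x)" if "integrable M f" "E \<in> sets M" for f :: "'a \<Rightarrow> real" and E
    using integrable_mult_indicator[OF that(2,1)] by (simp add: mult.commute)
  have "(\<integral>x. \<bar>r x - r' x\<bar> \<partial>M)
      = (\<integral>x. (r x * indicator C x - r' x * indicator C x) - (r x * indicator D x - r' x * indicator D x) \<partial>M)"
    by (intro Bochner_Integration.integral_cong) (auto simp: C_def D_def split: split_indicator)
  then show "(\<integral>x. \<bar>r x - r' x\<bar> \<partial>M) = ((\<integral>x. r x * indicator C x \<partial>M) - (\<integral>x. r' x * indicator C x \<partial>M))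
      - ((\<integral>x. r x * indicator D x \<partial>M) - (\<integral>x. r' x * indicator D x \<partial>M))"
    using r C by simp
qed

lemma L1_le_of_set_integrals:
  fixes r r' :: "'a \<Rightarrow> real"
  assumes r: "integrable M r" "integrable M r'"
    and le: "\<And>C. C \<in> sets M \<Longrightarrow> \<bar>(\<integral>x. r x * indicator C x \<partial>M) - (\<integral>x. r' x * indicator C x \<partial>M)\<bar> \<le> \<epsilon>"
  shows "(\<integral>x. \<bar>r x - r' x\<bar> \<partial>M) \<le> 2 * \<epsilon>"
  using integral_abs_diff(3)[OF r] le[OF integral_abs_diff(1)[OF r]] le[OF integral_abs_diff(2)[OF r]] by linarith

lemma separable_dense_sequence:
  assumes "separable_metrizable S" "topspace S \<noteq> {}"
  obtains d :: "nat \<Rightarrow> 'a" where "range d \<subseteq> topspace S"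
    "\<forall>s\<in>topspace S. \<exists>\<sigma>. limitin S (\<lambda>n. d (\<sigma> n)) s sequentially"
proof -
  obtain M e where Me: "Metric_space M e" "S = Metric_space.mtopology M e"
    using assms by (auto simp: separable_metrizable_def metrizable_space_def)
  interpret Metric_space M e by fact
  obtain C where C: "countable C" "C \<subseteq> topspace S" "S closure_of C = topspace S"
    using second_countable_imp_separable_space[of S] assms(1)
    unfolding separable_metrizable_def separable_space_def by blast
  have "C \<noteq> {}"
    using C(3) assms(2) by (metis closure_of_empty)
  then have rng: "range (from_nat_into C) = C"
    using C(1) by (rule range_from_nat_into)
  show ?thesis
  proof (rule that[of "from_nat_into C"])
    show "\<forall>s\<in>topspace S. \<exists>\<sigma>. limitin S (\<lambda>n. from_nat_into C (\<sigma> n)) s sequentially"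
    proof
      fix s assume "s \<in> topspace S"
      then have "s \<in> S closure_of C"
        by (simp add: C(3))
      then obtain \<tau> where \<tau>: "range \<tau> \<subseteq> C" "limitin S \<tau> s sequentially"
        unfolding Me(2) closure_of_sequentially by auto
      then have "\<forall>n. \<exists>i. \<tau> n = from_nat_into C i"
        using rng by (metis image_iff image_subset_iff rangeI)
      then obtain \<sigma> where \<sigma>: "\<And>n. \<tau> n = from_nat_into C (\<sigma> n)"
        by metis
      then show "\<exists>\<sigma>. limitin S (\<lambda>n. from_nat_into C (\<sigma> n)) s sequentially"
        using \<tau>(2) by (intro exI[of _ \<sigma>]) (simp flip: \<sigma>)
    qed
  qed (use rng C(2) in simp)
qed

text \<open>
  The series of the functions has a finite integral, so it converges almost everywhere.
\<close>

lemma AE_tendsto_zero_of_geometric_L1: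
  fixes f :: "nat \<Rightarrow> 'a \<Rightarrow> real"
  assumes int: "\<And>k. integrable M (f k)" and nonneg: "\<And>k x. 0 \<le> f k x"
    and le: "\<And>k. (\<integral>x. f k x \<partial>M) \<le> K * (1/2) ^ k"
  shows "AE x in M. (\<lambda>k. f k x) \<longlonglongrightarrow> 0"
proof -
  have "0 \<le> (\<integral>x. f 0 x \<partial>M)"
    using nonneg by (intro integral_nonneg_AE) auto
  then have K: "0 \<le> K"
    using le[of 0] by simp
  have [measurable]: "f k \<in> borel_measurable M" for k
    using int by auto
  have "(\<integral>\<^sup>+x. (\<Sum>k. ennreal (f k x)) \<partial>M) = (\<Sum>k. \<integral>\<^sup>+x. ennreal (f k x) \<partial>M)"
    by (rule nn_integral_suminf) simp
  also have "\<dots> = (\<Sum>k. ennreal (\<integral>x. f k x \<partial>M))"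
    using int nonneg by (intro suminf_cong nn_integral_eq_integral) auto
  also have "\<dots> \<le> (\<Sum>k. ennreal (K * (1/2) ^ k))"
    using le by (intro suminf_le summableI ennreal_leI)
  also have "\<dots> = ennreal (\<Sum>k. K * (1/2) ^ k)"
    using K by (intro suminf_ennreal2 summable_mult summable_geometric) auto
  finally have "AE x in M. (\<Sum>k. ennreal (f k x)) \<noteq> \<infinity>"
    by (intro nn_integral_PInf_AE) (auto simp: top_unique)
  then show ?thesis
  proof eventually_elim
    case (elim x)
    then have "summable (\<lambda>k. f k x)"
      using nonneg by (intro summable_suminf_not_top) auto
    then show ?case
      by (rule summable_LIMSEQ_zero)
  qed
qed

text \<open>
  Each \<open>\<kappa> s\<close> has a Radon-Nikodym derivative \<open>r s\<close>, but there is no joint measurability in these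
  choices. Continuity in total variation makes the family separable in \<open>L\<^sup>1\<close>: for a dense sequence
  \<open>d\<close>, the derivative \<open>r s\<close> is within \<open>2 * (1/2) ^ k\<close> of \<open>r (d j)\<close> for the first suitable index \<open>j\<close>, and this index is
  a measurable function of \<open>s\<close>. The geometric rate gives convergence almost everywhere, for every \<open>s\<close>.
\<close>

lemma joint_density_of_tv_continuous_family:
  fixes S :: "'s topology" and \<nu> :: "'b measure"
  assumes S: "separable_metrizable S" and \<nu>: "prob_space \<nu>"
    and \<kappa>: "\<forall>s\<in>topspace S. finite_measure (\<kappa> s) \<and> sets (\<kappa> s) = sets \<nu> \<and> absolutely_continuous \<nu> (\<kappa> s)"
    and cont: "\<And>s l C. limitin S s l sequentially \<Longrightarrow> range s \<subseteq> topspace S \<Longrightarrow> range C \<subseteq> sets \<nu> \<Longrightarrow>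
      (\<lambda>n. measure (\<kappa> (s n)) (C n) - measure (\<kappa> l) (C n)) \<longlonglongrightarrow> 0"
  shows "\<exists>g. g \<in> borel_measurable (borel_of S \<Otimes>\<^sub>M \<nu>) \<and>
    (\<forall>s\<in>topspace S. \<kappa> s = density \<nu> (\<lambda>y. g (s, y)))"
proof (cases "topspace S = {}")
  case True
  then have "space (borel_of S \<Otimes>\<^sub>M \<nu>) = {}"
    by (simp add: space_pair_measure)
  then have "(\<lambda>_. 0 :: ennreal) \<in> borel_measurable (borel_of S \<Otimes>\<^sub>M \<nu>)"
    by simp
  then show ?thesis
    using True by blast
next
  case False
  interpret prob_space \<nu> by fact
  have met: "metrizable_space S"
    using S by (simp add: separable_metrizable_def)
  have "\<exists>r. r \<in> borel_measurable \<nu> \<and> (\<forall>x. 0 \<le> r x) \<and> \<kappa> s = density \<nu> (\<lambda>x. ennreal (r x))"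
    if s: "s \<in> topspace S" for s
  proof -
    have k: "finite_measure (\<kappa> s)" "absolutely_continuous \<nu> (\<kappa> s)" "sets (\<kappa> s) = sets \<nu>"
      using \<kappa> s by auto
    obtain D where D: "D \<in> borel_measurable \<nu>" "AE x in \<nu>. RN_deriv \<nu> (\<kappa> s) x = ennreal (D x)" "\<And>x. 0 \<le> D x"
      using real_RN_deriv[OF k] by metis
    have "density \<nu> (\<lambda>x. ennreal (D x)) = density \<nu> (RN_deriv \<nu> (\<kappa> s))"
      using D by (intro density_cong) auto
    then show ?thesis
      using D density_RN_deriv[OF k(2,3)] by auto
  qed
  then obtain r :: "'s \<Rightarrow> 'b \<Rightarrow> real" where r: "\<And>s. s \<in> topspace S \<Longrightarrow> r s \<in> borel_measurable \<nu>"
    "\<And>s x. s \<in> topspace S \<Longrightarrow> 0 \<le> r s x" "\<And>s. s \<in> topspace S \<Longrightarrow> \<kappa> s = density \<nu> (\<lambda>x. ennreal (r s x))"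
    by metis
  have r_int: "integrable \<nu> (r s)" "C \<in> sets \<nu> \<Longrightarrow> (\<integral>x. r s x * indicator C x \<partial>\<nu>) = measure (\<kappa> s) C"
    if s: "s \<in> topspace S" for s C
  proof -
    interpret k: finite_measure "\<kappa> s"
      using \<kappa> s by auto
    note [measurable] = r(1)[OF s]
    have e: "emeasure (\<kappa> s) C = (\<integral>\<^sup>+x. ennreal (r s x * indicator C x) \<partial>\<nu>)" if "C \<in> sets \<nu>" for C
      unfolding r(3)[OF s] using that
      by (subst emeasure_density) (auto intro!: nn_integral_cong split: split_indicator)
    have "(\<integral>\<^sup>+x. ennreal (r s x) \<partial>\<nu>) = (\<integral>\<^sup>+x. ennreal (r s x * indicator (space \<nu>) x) \<partial>\<nu>)"
      by (intro nn_integral_cong) simp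
    also have "\<dots> < \<infinity>"
      using e[OF sets.top] k.emeasure_finite[of "space \<nu>"] by (simp add: less_top)
    finally show "integrable \<nu> (r s)"
      using r(2)[OF s] by (intro integrableI_nonneg) auto
    assume C: "C \<in> sets \<nu>"
    have "(\<integral>x. r s x * indicator C x \<partial>\<nu>) = enn2real (\<integral>\<^sup>+x. ennreal (r s x * indicator C x) \<partial>\<nu>)"
      using r(2)[OF s] C by (intro integral_eq_nn_integral) auto
    then show "(\<integral>x. r s x * indicator C x \<partial>\<nu>) = measure (\<kappa> s) C"
      using e[OF C] by (simp add: measure_def)
  qed
  obtain d :: "nat \<Rightarrow> 's" where d: "range d \<subseteq> topspace S"
    "\<forall>s\<in>topspace S. \<exists>\<sigma>. limitin S (\<lambda>n. d (\<sigma> n)) s sequentially"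
    using separable_dense_sequence[OF S False] by metis
  have dS: "d j \<in> topspace S" for j
    using d(1) by auto
  define \<epsilon> where "\<epsilon> k = (1/2::real) ^ k" for k :: nat
  define E where "E k j s \<longleftrightarrow> (\<forall>C\<in>sets \<nu>. \<bar>measure (\<kappa> s) C - measure (\<kappa> (d j)) C\<bar> \<le> \<epsilon> k)" for k j s
  have E_ex: "\<exists>j. E k j s" if s: "s \<in> topspace S" for k s
  proof (rule ccontr)
    assume no: "\<not> ?thesis"
    obtain \<sigma> where \<sigma>: "limitin S (\<lambda>n. d (\<sigma> n)) s sequentially"
      using d(2) s by blast
    have "\<forall>n. \<exists>C\<in>sets \<nu>. \<not> \<bar>measure (\<kappa> s) C - measure (\<kappa> (d (\<sigma> n))) C\<bar> \<le> \<epsilon> k"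
      using no unfolding E_def by blast
    then obtain C where C: "\<And>n. C n \<in> sets \<nu>"
        "\<And>n. \<not> \<bar>measure (\<kappa> s) (C n) - measure (\<kappa> (d (\<sigma> n))) (C n)\<bar> \<le> \<epsilon> k"
      by metis
    have "(\<lambda>n. measure (\<kappa> (d (\<sigma> n))) (C n) - measure (\<kappa> s) (C n)) \<longlonglongrightarrow> 0"
      using \<sigma> dS C(1) by (intro cont) auto
    then have "\<forall>\<^sub>F n in sequentially. \<bar>measure (\<kappa> (d (\<sigma> n))) (C n) - measure (\<kappa> s) (C n)\<bar> < \<epsilon> k"
      by (auto dest!: tendstoD[where e="\<epsilon> k"] simp: \<epsilon>_def dist_real_def)
    then obtain n where "\<bar>measure (\<kappa> (d (\<sigma> n))) (C n) - measure (\<kappa> s) (C n)\<bar> < \<epsilon> k"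
      by (auto simp: eventually_sequentially)
    then show False
      using C(2)[of n] by linarith
  qed
  have E_meas: "Measurable.pred (borel_of S) (E k j)" for k j
  proof -
    have "closedin S {s \<in> topspace S. E k j s}"
      unfolding metrizable_closedin_sequentially[OF met]
    proof (intro conjI allI impI)
      fix \<sigma> l assume *: "range \<sigma> \<subseteq> {s \<in> topspace S. E k j s} \<and> limitin S \<sigma> l sequentially"
      have "\<bar>measure (\<kappa> l) C - measure (\<kappa> (d j)) C\<bar> \<le> \<epsilon> k" if C: "C \<in> sets \<nu>" for C
      proof -
        have "(\<lambda>n. measure (\<kappa> (\<sigma> n)) C - measure (\<kappa> l) C) \<longlonglongrightarrow> 0"
          using cont[of \<sigma> l "\<lambda>_. C"] * C by auto
        then have "(\<lambda>n. measure (\<kappa> (\<sigma> n)) C) \<longlonglongrightarrow> measure (\<kappa> l) C"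
          by (simp add: LIM_zero_iff)
        then have "(\<lambda>n. \<bar>measure (\<kappa> (\<sigma> n)) C - measure (\<kappa> (d j)) C\<bar>) \<longlonglongrightarrow> \<bar>measure (\<kappa> l) C - measure (\<kappa> (d j)) C\<bar>"
          by (intro tendsto_intros)
        moreover have "\<bar>measure (\<kappa> (\<sigma> n)) C - measure (\<kappa> (d j)) C\<bar> \<le> \<epsilon> k" for n
          using * C unfolding E_def by auto
        ultimately show ?thesis
          by (intro LIMSEQ_le_const2) auto
      qed
      then show "l \<in> {s \<in> topspace S. E k j s}"
        using * limitin_topspace by (auto simp: E_def)
    qed auto
    then show ?thesis
      using closedin_borel_of by (auto simp: pred_def)
  qed
  define J where "J k s = (LEAST j. E k j s)" for k s
  have J: "E k (J k s) s" if "s \<in> topspace S" for k s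
    unfolding J_def by (rule LeastI_ex[OF E_ex[OF that]])
  have J_meas: "J k \<in> borel_of S \<rightarrow>\<^sub>M count_space UNIV" for k
    unfolding J_def by (intro measurable_Least E_meas)
  define g where "g p = limsup (\<lambda>k. ennreal (r (d (J k (fst p))) (snd p)))" for p
  have "(\<lambda>p. ennreal (r (d (J k (fst p))) (snd p))) \<in> borel_measurable (borel_of S \<Otimes>\<^sub>M \<nu>)" for k
  proof (rule measurable_compose_countable[where f="\<lambda>j p. ennreal (r (d j) (snd p))"])
    show "(\<lambda>p. ennreal (r (d j) (snd p))) \<in> borel_measurable (borel_of S \<Otimes>\<^sub>M \<nu>)" for j
      by (rule measurable_compose[OF measurable_compose[OF measurable_snd r(1)[OF dS]] measurable_ennreal])
    show "(\<lambda>p. J k (fst p)) \<in> borel_of S \<Otimes>\<^sub>M \<nu> \<rightarrow>\<^sub>M count_space UNIV"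
      by (rule measurable_compose[OF measurable_fst J_meas])
  qed
  then have g_meas: "g \<in> borel_measurable (borel_of S \<Otimes>\<^sub>M \<nu>)"
    unfolding g_def by measurable
  have "\<kappa> s = density \<nu> (\<lambda>y. g (s, y))" if s: "s \<in> topspace S" for s
  proof -
    note [measurable] = r(1)[OF s] r(1)[OF dS]
    define \<rho> where "\<rho> k = (\<lambda>y. \<bar>r (d (J k s)) y - r s y\<bar>)" for k
    have "AE y in \<nu>. (\<lambda>k. \<rho> k y) \<longlonglongrightarrow> 0"
    proof (rule AE_tendsto_zero_of_geometric_L1)
      show "integrable \<nu> (\<rho> k)" "0 \<le> \<rho> k x" for k x
        unfolding \<rho>_def using r_int(1)[OF dS] r_int(1)[OF s] by simp_all
      show "(\<integral>y. \<rho> k y \<partial>\<nu>) \<le> 2 * (1/2) ^ k" for k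
        unfolding \<rho>_def
      proof (rule L1_le_of_set_integrals[OF r_int(1)[OF dS] r_int(1)[OF s]])
        fix C assume C: "C \<in> sets \<nu>"
        show "\<bar>(\<integral>x. r (d (J k s)) x * indicator C x \<partial>\<nu>) - (\<integral>x. r s x * indicator C x \<partial>\<nu>)\<bar> \<le> (1/2) ^ k"
          using J[OF s, of k] C unfolding E_def r_int(2)[OF dS C] r_int(2)[OF s C]
          by (simp add: abs_minus_commute \<epsilon>_def)
      qed
    qed
    then have "AE y in \<nu>. ennreal (r s y) = g (s, y)"
    proof eventually_elim
      case (elim y)
      then have "(\<lambda>k. r (d (J k s)) y - r s y) \<longlonglongrightarrow> 0"
        unfolding \<rho>_def by (rule tendsto_rabs_zero_cancel)
      then have "(\<lambda>k. r (d (J k s)) y) \<longlonglongrightarrow> r s y"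
        by (simp add: LIM_zero_iff)
      then have "(\<lambda>k. ennreal (r (d (J k s)) y)) \<longlonglongrightarrow> ennreal (r s y)"
        by (rule tendsto_ennrealI)
      then show ?case
        unfolding g_def by (simp add: lim_imp_Limsup)
    qed
    moreover have "(\<lambda>y. g (s, y)) \<in> borel_measurable \<nu>"
      using measurable_compose[OF measurable_Pair1' g_meas] s by simp
    ultimately show ?thesis
      unfolding r(3)[OF s] by (intro density_cong) auto
  qed
  then show ?thesis
    using g_meas by blast
qed

text \<open>
  A mixture with positive weights over a dense sequence of parameters: its null sets are null for
  each member of the sequence, and then, by continuity, for all parameters.
\<close>

lemma dominating_measure:
  fixes S :: "'s topology"
  assumes S: "separable_metrizable S" "topspace S \<noteq> {}"
    and \<mu>: "\<forall>s\<in>topspace S. prob_space (\<mu> s) \<and> sets (\<mu> s) = sets N"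
    and cont: "\<And>s l C. limitin S s l sequentially \<Longrightarrow> range s \<subseteq> topspace S \<Longrightarrow> range C \<subseteq> sets N \<Longrightarrow>
      (\<lambda>n. measure (\<mu> (s n)) (C n) - measure (\<mu> l) (C n)) \<longlonglongrightarrow> 0"
  shows "\<exists>\<nu>. prob_space \<nu> \<and> sets \<nu> = sets N \<and> (\<forall>s\<in>topspace S. absolutely_continuous \<nu> (\<mu> s))"
proof -
  obtain d :: "nat \<Rightarrow> 's" where d: "range d \<subseteq> topspace S"
    "\<forall>s\<in>topspace S. \<exists>\<sigma>. limitin S (\<lambda>n. d (\<sigma> n)) s sequentially"
    using separable_dense_sequence[OF S] by metis
  have dS: "d j \<in> topspace S" for j
    using d(1) by auto
  (* Any distribution with full support on the natural numbers would do. *)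
  define p where "p = measure_pmf (geometric_pmf (1/2))"
  have p: "p \<in> space (prob_algebra (count_space UNIV))"
    unfolding p_def by (simp add: space_prob_algebra measure_pmf.prob_space_axioms)
  define \<nu> where "\<nu> = p \<bind> (\<lambda>j. \<mu> (d j))"
  have K: "(\<lambda>j. \<mu> (d j)) \<in> count_space UNIV \<rightarrow>\<^sub>M prob_algebra N"
    using \<mu> dS by (auto simp: measurable_count_space_eq1 space_prob_algebra)
  have "(\<lambda>_::unit. p \<bind> (\<lambda>j. \<mu> (d j))) \<in> count_space UNIV \<rightarrow>\<^sub>M prob_algebra N"
    using p by (intro measurable_bind_prob_space[OF measurable_const K])
  from measurable_space[OF this, of "()"] have \<nu>: "prob_space \<nu>" "sets \<nu> = sets N"
    by (auto simp: \<nu>_def space_prob_algebra)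
  have "absolutely_continuous \<nu> (\<mu> s)" if s: "s \<in> topspace S" for s
    unfolding absolutely_continuous_def
  proof
    fix C assume C: "C \<in> null_sets \<nu>"
    then have CN: "C \<in> sets N"
      using \<nu>(2) by auto
    have "0 = (\<integral>\<^sup>+j. emeasure (\<mu> (d j)) C \<partial>p)"
      using C emeasure_bind_prob_algebra[OF p K CN] by (simp add: \<nu>_def null_setsD1)
    then have "AE j in p. emeasure (\<mu> (d j)) C = 0"
      unfolding p_def by (subst (asm) eq_commute) (simp add: nn_integral_0_iff_AE)
    then have z: "emeasure (\<mu> (d j)) C = 0" for j
      unfolding p_def AE_measure_pmf_iff by (simp add: set_pmf_geometric)
    obtain \<sigma> where \<sigma>: "limitin S (\<lambda>n. d (\<sigma> n)) s sequentially"
      using d(2) s by blast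
    have "(\<lambda>n. measure (\<mu> (d (\<sigma> n))) C - measure (\<mu> s) C) \<longlonglongrightarrow> 0"
      using cont[OF \<sigma>, of "\<lambda>_. C"] dS CN by auto
    then have "measure (\<mu> s) C = 0"
      using z by (simp add: measure_def LIMSEQ_const_iff)
    then have "emeasure (\<mu> s) C = 0"
      using \<mu> s by (metis finite_measure.emeasure_eq_measure ennreal_0 prob_space_def)
    then show "C \<in> null_sets (\<mu> s)"
      using CN \<mu> s by (auto simp: null_sets_def)
  qed
  then show ?thesis
    using \<nu> by blast
qed

lemma AE_le_of_set_integrals:
  fixes g h :: "'a \<Rightarrow> ennreal"
  assumes [measurable]: "g \<in> borel_measurable M" "h \<in> borel_measurable M" and fin: "(\<integral>\<^sup>+x. h x \<partial>M) < \<infinity>"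
    and le: "\<And>C. C \<in> sets M \<Longrightarrow> (\<integral>\<^sup>+x. g x * indicator C x \<partial>M) \<le> (\<integral>\<^sup>+x. h x * indicator C x \<partial>M)"
  shows "AE x in M. g x \<le> h x"
proof -
  define C where "C = {x \<in> space M. h x < g x}"
  have C[measurable]: "C \<in> sets M"
    unfolding C_def by measurable
  have hC: "(\<integral>\<^sup>+x. h x * indicator C x \<partial>M) \<noteq> \<infinity>"
  proof -
    have "(\<integral>\<^sup>+x. h x * indicator C x \<partial>M) \<le> (\<integral>\<^sup>+x. h x \<partial>M)"
      by (intro nn_integral_mono) (auto split: split_indicator)
    then show ?thesis
      using fin by auto
  qed
  have "(\<integral>\<^sup>+x. g x * indicator C x - h x * indicator C x \<partial>M)
      = (\<integral>\<^sup>+x. g x * indicator C x \<partial>M) - (\<integral>\<^sup>+x. h x * indicator C x \<partial>M)"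
    using hC by (intro nn_integral_diff) (auto simp: C_def split: split_indicator)
  also have "\<dots> = 0"
    using le[OF C] hC by (intro diff_eq_0_ennreal) (auto simp: less_top[symmetric] top_unique)
  finally have "AE x in M. g x * indicator C x - h x * indicator C x = 0"
    by (subst (asm) nn_integral_0_iff_AE) auto
  moreover have "AE x in M. h x * indicator C x \<noteq> \<infinity>"
    using hC by (intro nn_integral_PInf_AE) auto
  ultimately show ?thesis
    using AE_space
  proof eventually_elim
    case (elim x)
    show ?case
    proof (cases "x \<in> C")
      case True
      then have "g x - h x = 0" "h x \<noteq> \<infinity>"
        using elim by auto
      then show ?thesis
        by (auto simp: diff_eq_0_iff_ennreal)
    qed (use elim(3) in \<open>auto simp: C_def not_less\<close>)
  qed
qed

section \<open>Disintegration of a Feller family\<close>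

text \<open>
  \<open>R s\<close> stands for the joint law of the next state and the next observation, and the parameter \<open>s\<close>
  for a pair of a belief and an action.
\<close>

locale feller_family =
  fixes S :: "'s topology" and S1 :: "'x topology" and S2 :: "'y topology"
    and R :: "'s \<Rightarrow> ('x \<times> 'y) measure"
  assumes sep: "separable_metrizable S" "separable_metrizable S1" "separable_metrizable S2"
    and nonempty: "topspace S \<noteq> {}"
    and R_prob: "\<And>s. s \<in> topspace S \<Longrightarrow> R s \<in> prob_measures (prod_topology S1 S2)"
    and feller: "feller_along_sets S1 S2 S R"
begin

abbreviation "BS \<equiv> borel_of S"
abbreviation "B1 \<equiv> borel_of S1"
abbreviation "B2 \<equiv> borel_of S2"

definition \<mu> :: "'s \<Rightarrow> 'y measure" where
  "\<mu> s = distr (R s) B2 snd"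

text \<open>
  The measure \<open>C \<mapsto> \<integral>u(x) 1\<^sub>C(y) R(dx dy | s)\<close> on observations.
\<close>

definition slice :: "('x \<Rightarrow> ennreal) \<Rightarrow> 's \<Rightarrow> 'y measure" where
  "slice u s = distr (density (R s) (\<lambda>p. u (fst p))) B2 snd"

lemma sc: "second_countable S" "second_countable S1" "second_countable S2"
  using sep by (auto simp: separable_metrizable_def)

lemma R_space:
  assumes "s \<in> topspace S"
  shows "sets (R s) = sets (B1 \<Otimes>\<^sub>M B2)" "space (R s) = topspace S1 \<times> topspace S2" "prob_space (R s)"
    "fst \<in> R s \<rightarrow>\<^sub>M B1" "snd \<in> R s \<rightarrow>\<^sub>M B2"
  using prob_measures_prod_topology[OF sc(2,3) R_prob[OF assms]] .

lemma \<mu>_prob: "s \<in> topspace S \<Longrightarrow> prob_space (\<mu> s)" "sets (\<mu> s) = sets B2" "space (\<mu> s) = topspace S2"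
  unfolding \<mu>_def using R_space by (auto intro!: prob_space.prob_space_distr)

lemma emeasure_slice:
  assumes s: "s \<in> topspace S" and u: "u \<in> borel_measurable B1" and C: "C \<in> sets B2"
  shows "emeasure (slice u s) C = (\<integral>\<^sup>+p. u (fst p) * indicator C (snd p) \<partial>R s)"
proof -
  note R = R_space[OF s]
  have m: "(\<lambda>p. u (fst p)) \<in> borel_measurable (R s)"
    by (rule measurable_compose[OF R(4) u])
  have pre: "snd -` C \<inter> space (R s) \<in> sets (R s)"
    by (rule measurable_sets[OF R(5) C])
  have "emeasure (slice u s) C = (\<integral>\<^sup>+p. u (fst p) * indicator (snd -` C \<inter> space (R s)) p \<partial>R s)"
    unfolding slice_def using R(5) C by (subst emeasure_distr) (auto simp: emeasure_density[OF m pre])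
  also have "\<dots> = (\<integral>\<^sup>+p. u (fst p) * indicator C (snd p) \<partial>R s)"
    by (intro nn_integral_cong) (auto split: split_indicator)
  finally show ?thesis .
qed

lemma emeasure_slice_indicator:
  assumes s: "s \<in> topspace S" and B: "B \<in> sets B1" and C: "C \<in> sets B2"
  shows "emeasure (slice (indicator B) s) C = emeasure (R s) (B \<times> C)"
proof -
  have "emeasure (slice (indicator B) s) C = (\<integral>\<^sup>+p. indicator (B \<times> C) p \<partial>R s)"
    using B C by (subst emeasure_slice[OF s]) (auto intro!: nn_integral_cong split: split_indicator)
  then show ?thesis
    using B C R_space(1)[OF s] by simp
qed

lemma emeasure_\<mu>:
  assumes s: "s \<in> topspace S" and C: "C \<in> sets B2"
  shows "emeasure (\<mu> s) C = emeasure (R s) (topspace S1 \<times> C)"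
proof -
  have "snd -` C \<inter> space (R s) = topspace S1 \<times> C"
    using sets.sets_into_space[OF C] R_space(2)[OF s] by auto
  then show ?thesis
    unfolding \<mu>_def using R_space(5)[OF s] C by (simp add: emeasure_distr)
qed

lemma cross_integral_slice:
  assumes s: "s \<in> topspace S" and f: "bounded_continuous S1 f" "\<And>x. x \<in> topspace S1 \<Longrightarrow> 0 \<le> f x"
    and C: "C \<in> sets B2"
  shows "cross_integral f C (R s) = measure (slice (\<lambda>x. ennreal (f x)) s) C"
    "emeasure (slice (\<lambda>x. ennreal (f x)) s) C \<noteq> \<infinity>"
proof -
  note R = R_space[OF s]
  have fm: "f \<in> borel_measurable B1"
    using f(1) by (rule bounded_continuous_measurable)
  obtain b where b: "0 \<le> b" "\<forall>x\<in>topspace S1. \<bar>f x\<bar> \<le> b"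
    by (rule bounded_continuousE[OF f(1)])
  have m: "integrable (R s) (\<lambda>p. f (fst p) * indicator C (snd p))"
    using b by (intro cross_integral_bound(2)[OF sc(2,3) R_prob[OF s] C fm, of b]) auto
  have "(\<integral>\<^sup>+p. ennreal (f (fst p) * indicator C (snd p)) \<partial>R s) = ennreal (cross_integral f C (R s))"
    unfolding cross_integral_def using f(2) R(2)
    by (intro nn_integral_eq_integral m AE_I2) auto
  moreover have "0 \<le> cross_integral f C (R s)"
    unfolding cross_integral_def using f(2) R(2) by (intro integral_nonneg_AE AE_I2) auto
  moreover have "emeasure (slice (\<lambda>x. ennreal (f x)) s) C = (\<integral>\<^sup>+p. ennreal (f (fst p) * indicator C (snd p)) \<partial>R s)"
    using fm by (subst emeasure_slice[OF s _ C]) (auto intro!: nn_integral_cong split: split_indicator)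
  ultimately show "cross_integral f C (R s) = measure (slice (\<lambda>x. ennreal (f x)) s) C"
    "emeasure (slice (\<lambda>x. ennreal (f x)) s) C \<noteq> \<infinity>"
    by (auto simp: measure_def)
qed

lemma slice_tv_continuous:
  assumes f: "bounded_continuous S1 f" "\<And>x. x \<in> topspace S1 \<Longrightarrow> 0 \<le> f x"
    and s: "limitin S s l sequentially" "range s \<subseteq> topspace S" and C: "range C \<subseteq> sets B2"
  shows "(\<lambda>n. measure (slice (\<lambda>x. ennreal (f x)) (s n)) (C n) - measure (slice (\<lambda>x. ennreal (f x)) l) (C n)) \<longlonglongrightarrow> 0"
proof -
  have 1: "C n \<in> sets B2" "s n \<in> topspace S" for n
    using C s(2) by auto
  have "(\<lambda>n. cross_integral f (C n) (R (s n)) - cross_integral f (C n) (R l)) \<longlonglongrightarrow> 0"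
    by (rule feller_along_setsD[OF feller s f(1) 1(1)])
  then show ?thesis
    using cross_integral_slice(1)[OF 1(2) f 1(1)] cross_integral_slice(1)[OF limitin_topspace[OF s(1)] f 1(1)]
    by simp
qed

lemma slice_one:
  assumes s: "s \<in> topspace S" and C: "C \<in> sets B2"
  shows "measure (slice (\<lambda>x. ennreal 1) s) C = measure (\<mu> s) C"
proof -
  have "emeasure (slice (\<lambda>x. ennreal 1) s) C = (\<integral>\<^sup>+p. ennreal 1 * indicator C (snd p) \<partial>R s)"
    by (rule emeasure_slice[OF s _ C]) simp
  also have "\<dots> = (\<integral>\<^sup>+p. indicator (topspace S1 \<times> C) p \<partial>R s)"
    using R_space(2)[OF s] by (intro nn_integral_cong) (auto split: split_indicator)
  also have "\<dots> = emeasure (\<mu> s) C"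
    unfolding emeasure_\<mu>[OF s C] using C openin_borel_of[OF openin_topspace, of S1]
    by (intro nn_integral_indicator) (auto simp: R_space(1)[OF s])
  finally show ?thesis
    by (simp add: measure_def)
qed

lemma \<mu>_tv_continuous:
  assumes s: "limitin S s l sequentially" "range s \<subseteq> topspace S" and C: "range C \<subseteq> sets B2"
  shows "(\<lambda>n. measure (\<mu> (s n)) (C n) - measure (\<mu> l) (C n)) \<longlonglongrightarrow> 0"
proof -
  have "bounded_continuous S1 (\<lambda>_. 1)"
    by (intro bounded_continuousI[of _ _ 1]) auto
  from slice_tv_continuous[OF this _ s C] show ?thesis
    using s C slice_one limitin_topspace[OF s(1)] by (simp add: image_subset_iff del: ennreal_1)
qed

definition \<nu> :: "'y measure" where
  "\<nu> = (SOME \<nu>. prob_space \<nu> \<and> sets \<nu> = sets B2 \<and> (\<forall>s\<in>topspace S. absolutely_continuous \<nu> (\<mu> s)))"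

lemma \<nu>: "prob_space \<nu>" "sets \<nu> = sets B2" "\<And>s. s \<in> topspace S \<Longrightarrow> absolutely_continuous \<nu> (\<mu> s)"
proof -
  have "\<exists>\<nu>. prob_space \<nu> \<and> sets \<nu> = sets B2 \<and> (\<forall>s\<in>topspace S. absolutely_continuous \<nu> (\<mu> s))"
    using \<mu>_prob \<mu>_tv_continuous by (intro dominating_measure[OF sep(1) nonempty]) auto
  from someI_ex[OF this] show "prob_space \<nu>" "sets \<nu> = sets B2"
      "\<And>s. s \<in> topspace S \<Longrightarrow> absolutely_continuous \<nu> (\<mu> s)"
    by (simp_all add: \<nu>_def[symmetric])
qed

text \<open>
  The equation is demanded for every \<open>s\<close>, not for almost every one; a density of this kind is
  unique only up to null sets that depend on \<open>s\<close>.
\<close>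

definition joint_density :: "('x \<Rightarrow> ennreal) \<Rightarrow> ('s \<times> 'y \<Rightarrow> ennreal) \<Rightarrow> bool" where
  "joint_density u g \<longleftrightarrow> g \<in> borel_measurable (BS \<Otimes>\<^sub>M B2) \<and>
     (\<forall>s\<in>topspace S. \<forall>C\<in>sets B2. emeasure (slice u s) C = (\<integral>\<^sup>+y. g (s, y) * indicator C y \<partial>\<nu>))"

lemma section_measurable:
  assumes "g \<in> BS \<Otimes>\<^sub>M B2 \<rightarrow>\<^sub>M N" "s \<in> topspace S" "sets M = sets B2"
  shows "(\<lambda>y. g (s, y)) \<in> M \<rightarrow>\<^sub>M N"
proof -
  have "s \<in> space BS"
    using assms(2) by simp
  then have "(\<lambda>y. g (s, y)) \<in> B2 \<rightarrow>\<^sub>M N"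
    by (rule measurable_compose[OF measurable_Pair1' assms(1)])
  then show ?thesis
    using measurable_cong_sets[OF assms(3) refl] by blast
qed

text \<open>
  The slices of a bounded continuous function are dominated by the observation law and, by the
  Feller property, continuous in total variation.
\<close>

lemma joint_density_continuous:
  assumes f: "bounded_continuous S1 f" "\<And>x. x \<in> topspace S1 \<Longrightarrow> 0 \<le> f x"
  shows "\<exists>g. joint_density (\<lambda>x. ennreal (f x)) g"
proof -
  let ?u = "\<lambda>x. ennreal (f x)"
  have u: "?u \<in> borel_measurable B1"
    using bounded_continuous_measurable[OF f(1)] by simp
  obtain b where b: "0 \<le> b" "\<forall>x\<in>topspace S1. \<bar>f x\<bar> \<le> b"
    by (rule bounded_continuousE[OF f(1)])
  have "absolutely_continuous \<nu> (slice ?u s)" if s: "s \<in> topspace S" for s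
    unfolding absolutely_continuous_def
  proof
    fix C assume "C \<in> null_sets \<nu>"
    then have C: "C \<in> null_sets (\<mu> s)"
      using \<nu>(3)[OF s] by (auto simp: absolutely_continuous_def)
    then have CB: "C \<in> sets B2"
      using \<mu>_prob(2) by auto
    have "emeasure (slice ?u s) C = (\<integral>\<^sup>+p. ?u (fst p) * indicator C (snd p) \<partial>R s)"
      by (rule emeasure_slice[OF s u CB])
    also have "\<dots> \<le> (\<integral>\<^sup>+p. ennreal b * indicator (topspace S1 \<times> C) p \<partial>R s)"
      using b R_space(2)[OF s] f(2)
      by (intro nn_integral_mono) (auto simp: abs_le_iff intro!: ennreal_leI split: split_indicator)
    also have "\<dots> = ennreal b * emeasure (\<mu> s) C"
      using CB emeasure_\<mu>[OF s CB] R_space(1)[OF s] openin_borel_of[OF openin_topspace, of S1]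
      by (subst nn_integral_cmult_indicator) auto
    finally show "C \<in> null_sets (slice ?u s)"
      using C CB by (auto simp: null_sets_def slice_def)
  qed
  moreover have "finite_measure (slice ?u s)" if s: "s \<in> topspace S" for s
    using cross_integral_slice(2)[OF s f, of "space (slice ?u s)"]
    by (intro finite_measureI) (auto simp: slice_def openin_borel_of)
  moreover have "sets (slice ?u s) = sets \<nu>" for s
    by (simp add: slice_def \<nu>)
  ultimately have "\<exists>g. g \<in> borel_measurable (BS \<Otimes>\<^sub>M \<nu>) \<and> (\<forall>s\<in>topspace S. slice ?u s = density \<nu> (\<lambda>y. g (s, y)))"
    using slice_tv_continuous[OF f] \<nu>
    by (intro joint_density_of_tv_continuous_family[OF sep(1) \<nu>(1)]) auto
  then obtain g where g: "g \<in> borel_measurable (BS \<Otimes>\<^sub>M \<nu>)"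
      "\<forall>s\<in>topspace S. slice ?u s = density \<nu> (\<lambda>y. g (s, y))"
    by blast
  have gB: "g \<in> borel_measurable (BS \<Otimes>\<^sub>M B2)"
    using g(1) measurable_cong_sets[OF sets_pair_measure_cong[OF refl \<nu>(2)] refl] by blast
  have "joint_density ?u g"
    unfolding joint_density_def
    using gB g(2) section_measurable[OF gB _ \<nu>(2)] \<nu>(2) by (auto simp: emeasure_density)
  then show ?thesis
    by blast
qed

lemma joint_density_suminf:
  assumes u: "\<And>k::nat. u k \<in> borel_measurable B1" and g: "\<And>k. joint_density (u k) (g k)"
  shows "joint_density (\<lambda>x. \<Sum>k. u k x) (\<lambda>p. \<Sum>k. g k p)"
proof -
  have gB: "g k \<in> borel_measurable (BS \<Otimes>\<^sub>M B2)" for k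
    using g by (simp add: joint_density_def)
  have "emeasure (slice (\<lambda>x. \<Sum>k. u k x) s) C = (\<integral>\<^sup>+y. (\<Sum>k. g k (s, y)) * indicator C y \<partial>\<nu>)"
    if s: "s \<in> topspace S" and C: "C \<in> sets B2" for s C
  proof -
    have m: "(\<lambda>p. u k (fst p) * indicator C (snd p)) \<in> borel_measurable (R s)" for k
      by (intro borel_measurable_times_ennreal measurable_compose[OF R_space(4)[OF s] u]
          measurable_compose[OF R_space(5)[OF s] borel_measurable_indicator[OF C]])
    have m': "(\<lambda>y. g k (s, y) * indicator C y) \<in> borel_measurable \<nu>" for k
      by (intro borel_measurable_times_ennreal section_measurable[OF gB s \<nu>(2)] borel_measurable_indicator)
        (simp add: \<nu>(2) C)
    have "emeasure (slice (\<lambda>x. \<Sum>k. u k x) s) C = (\<integral>\<^sup>+p. (\<Sum>k. u k (fst p)) * indicator C (snd p) \<partial>R s)"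
      by (rule emeasure_slice[OF s _ C]) (use u in measurable)
    also have "\<dots> = (\<integral>\<^sup>+p. (\<Sum>k. u k (fst p) * indicator C (snd p)) \<partial>R s)"
      by (simp only: ennreal_suminf_multc)
    also have "\<dots> = (\<Sum>k. \<integral>\<^sup>+p. u k (fst p) * indicator C (snd p) \<partial>R s)"
      by (rule nn_integral_suminf[OF m])
    also have "\<dots> = (\<Sum>k. \<integral>\<^sup>+y. g k (s, y) * indicator C y \<partial>\<nu>)"
      using g s C by (simp add: emeasure_slice[OF s u C, symmetric] joint_density_def)
    also have "\<dots> = (\<integral>\<^sup>+y. (\<Sum>k. g k (s, y) * indicator C y) \<partial>\<nu>)"
      by (rule nn_integral_suminf[symmetric, OF m'])
    finally show ?thesis
      by (simp only: ennreal_suminf_multc)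
  qed
  then show ?thesis
    unfolding joint_density_def using gB by simp
qed

lemma joint_density_cong:
  assumes "joint_density u g" "u \<in> borel_measurable B1" "\<And>x. x \<in> topspace S1 \<Longrightarrow> u x = v x"
  shows "joint_density v g"
proof -
  have v: "v \<in> borel_measurable B1"
    using assms(2,3) measurable_cong[of B1 u v] by simp
  have "emeasure (slice v s) C = emeasure (slice u s) C" if "s \<in> topspace S" "C \<in> sets B2" for s C
    using that assms R_space(2)[of s] v by (auto simp: emeasure_slice intro!: nn_integral_cong)
  then show ?thesis
    using assms(1) by (simp add: joint_density_def)
qed

text \<open>
  The indicator of an open set is a countable sum of nonnegative bounded continuous functions, the
  increments of an increasing approximation, and densities of summands add up.
\<close>

lemma joint_density_open:
  assumes U: "openin S1 U"
  shows "\<exists>g. joint_density (indicator U) g"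
proof -
  obtain h :: "nat \<Rightarrow> 'x \<Rightarrow> real" where h: "\<And>k. bounded_continuous S1 (h k)"
    "\<And>k x. x \<in> topspace S1 \<Longrightarrow> 0 \<le> h k x"
    "\<And>x. x \<in> topspace S1 \<Longrightarrow> incseq (\<lambda>k. h k x) \<and> (SUP k. ennreal (h k x)) = indicator U x"
    using lower_semicontinuous_incseq_approximation[OF sep(2) lower_semicontinuous_indicator[OF U]] by blast
  define u where "u k = (if k = 0 then h 0 else (\<lambda>x. h k x - h (k - 1) x))" for k
  have u_cont: "bounded_continuous S1 (u k)" for k
  proof (cases "k = 0")
    case False
    obtain b where b: "0 \<le> b" "\<forall>x\<in>topspace S1. \<bar>h k x\<bar> \<le> b"
      by (rule bounded_continuousE[OF h(1)])
    obtain b' where b': "0 \<le> b'" "\<forall>x\<in>topspace S1. \<bar>h (k - 1) x\<bar> \<le> b'"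
      by (rule bounded_continuousE[OF h(1)])
    have "bounded_continuous S1 (\<lambda>x. h k x - h (k - 1) x)"
      using b b' h(1) by (intro bounded_continuousI[of _ _ "b + b'"] continuous_map_diff)
        (auto simp: bounded_continuous_def intro!: order_trans[OF abs_triangle_ineq4 add_mono])
    then show ?thesis
      using False by (simp add: u_def)
  qed (simp add: u_def h(1))
  have u_nonneg: "0 \<le> u k x" if x: "x \<in> topspace S1" for k x
  proof (cases k)
    case 0
    then show ?thesis
      using h(2)[OF x] by (simp add: u_def)
  next
    case (Suc j)
    then show ?thesis
      using h(3)[OF x] by (auto simp: u_def incseq_Suc_iff)
  qed
  have sum_u: "(\<Sum>i<Suc k. u i x) = h k x" for k x
    by (induction k) (auto simp: u_def)
  obtain g where g: "\<And>k. joint_density (\<lambda>x. ennreal (u k x)) (g k)"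
    using joint_density_continuous[OF u_cont u_nonneg] by metis
  have um: "(\<lambda>x. ennreal (u k x)) \<in> borel_measurable B1" for k
    using bounded_continuous_measurable[OF u_cont] by simp
  have "joint_density (indicator U) (\<lambda>p. \<Sum>k. g k p)"
  proof (rule joint_density_cong[OF joint_density_suminf[OF um g]])
    show "(\<lambda>x. \<Sum>k. ennreal (u k x)) \<in> borel_measurable B1"
      using um by measurable
    fix x assume x: "x \<in> topspace S1"
    have "(\<lambda>k. \<Sum>i<Suc k. ennreal (u i x)) \<longlonglongrightarrow> (\<Sum>k. ennreal (u k x))"
      using summable_LIMSEQ[of "\<lambda>k. ennreal (u k x)"] by (intro LIMSEQ_Suc) auto
    moreover have "(\<Sum>i<Suc k. ennreal (u i x)) = ennreal (h k x)" for k
      using u_nonneg[OF x] sum_u[where k=k and x=x] by (subst sum_ennreal) (auto simp del: sum.lessThan_Suc)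
    ultimately have "(\<lambda>k. ennreal (h k x)) \<longlonglongrightarrow> (\<Sum>k. ennreal (u k x))"
      by simp
    moreover have "(\<lambda>k. ennreal (h k x)) \<longlonglongrightarrow> (SUP k. ennreal (h k x))"
      using h(3)[OF x] by (intro LIMSEQ_SUP) (auto simp: incseq_def intro!: ennreal_leI)
    ultimately show "(\<Sum>k. ennreal (u k x)) = indicator U x"
      using h(3)[OF x] LIMSEQ_unique by fastforce
  qed
  then show ?thesis
    by blast
qed

lemma joint_density_finite:
  assumes "joint_density (indicator B) g" "B \<in> sets B1" "s \<in> topspace S"
  shows "(\<integral>\<^sup>+y. g (s, y) \<partial>\<nu>) \<le> 1"
proof -
  interpret prob_space "R s"
    using R_space(3)[OF assms(3)] .
  have "(\<integral>\<^sup>+y. g (s, y) \<partial>\<nu>) = (\<integral>\<^sup>+y. g (s, y) * indicator (topspace S2) y \<partial>\<nu>)"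
    using sets_eq_imp_space_eq[OF \<nu>(2)] by (intro nn_integral_cong) simp
  also have "\<dots> = emeasure (R s) (B \<times> topspace S2)"
    using assms emeasure_slice_indicator[OF assms(3,2), of "topspace S2"] openin_borel_of[OF openin_topspace, of S2]
    by (simp add: joint_density_def)
  also have "\<dots> \<le> 1"
    by (rule emeasure_le_1)
  finally show ?thesis .
qed

lemma joint_density_mono:
  assumes "joint_density (indicator A) g" "joint_density (indicator B) h" "A \<in> sets B1" "B \<in> sets B1"
    "A \<subseteq> B" and s: "s \<in> topspace S"
  shows "AE y in \<nu>. g (s, y) \<le> h (s, y)"
proof (rule AE_le_of_set_integrals)
  show "(\<lambda>y. g (s, y)) \<in> borel_measurable \<nu>" "(\<lambda>y. h (s, y)) \<in> borel_measurable \<nu>"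
    using assms by (auto intro!: section_measurable \<nu>(2) simp: joint_density_def)
  show "(\<integral>\<^sup>+y. h (s, y) \<partial>\<nu>) < \<infinity>"
    by (rule le_less_trans[OF joint_density_finite[OF assms(2,4) s]]) simp
  fix C assume "C \<in> sets \<nu>"
  then have C: "C \<in> sets B2"
    by (simp add: \<nu>)
  have "emeasure (R s) (A \<times> C) \<le> emeasure (R s) (B \<times> C)"
    using assms C R_space(1)[OF s] by (intro emeasure_mono) auto
  then show "(\<integral>\<^sup>+y. g (s, y) * indicator C y \<partial>\<nu>) \<le> (\<integral>\<^sup>+y. h (s, y) * indicator C y \<partial>\<nu>)"
    using assms(1,2) s C emeasure_slice_indicator[OF s assms(3) C] emeasure_slice_indicator[OF s assms(4) C]
    by (simp add: joint_density_def)
qed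

text \<open>
  Borel sets arise from open sets by complements and disjoint unions; densities can be subtracted
  because those of the smaller set are almost everywhere smaller and have a finite integral.
\<close>

lemma joint_density_Borel:
  assumes B: "B \<in> sets B1"
  shows "\<exists>g. joint_density (indicator B) g"
proof -
  have "Int_stable {U. openin S1 U}" "{U. openin S1 U} \<subseteq> Pow (topspace S1)"
    by (auto simp: Int_stable_def dest: openin_subset)
  then show ?thesis
    using B[unfolded sets_borel_of]
proof (induction B rule: sigma_sets_induct_disjoint)
  case (basic A)
  then show ?case
    by (intro joint_density_open) simp
next
  case empty
  show ?case
    by (rule joint_density_open) simp
next
  case (union A)
  then have A: "A i \<in> sets B1" for i
    by (auto simp: sets_borel_of)
  obtain g where g: "\<And>i. joint_density (indicator (A i)) (g i)"
    using union(3) by metis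
  have "joint_density (indicator (\<Union>i. A i)) (\<lambda>p. \<Sum>i. g i p)"
  proof (rule joint_density_cong[OF joint_density_suminf[OF _ g]])
    show "indicator (A k) \<in> borel_measurable B1" for k
      using A by simp
    show "(\<lambda>x. \<Sum>k. indicator (A k) x :: ennreal) \<in> borel_measurable B1"
      using A by simp
  qed (use suminf_indicator[OF union(1)] in simp)
  then show ?case
    by blast
next
  case (compl A)
  then obtain g where g: "joint_density (indicator A) g"
    by auto
  obtain h where h: "joint_density (indicator (topspace S1)) h"
    using joint_density_open[OF openin_topspace] by auto
  have A: "A \<in> sets B1" and top: "topspace S1 \<in> sets B1"
    using compl(1) by (auto simp: sets_borel_of[symmetric] openin_borel_of)
  have "joint_density (indicator (topspace S1 - A)) (\<lambda>p. h p - g p)"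
    unfolding joint_density_def
  proof (intro conjI ballI)
    have [measurable]: "g \<in> borel_measurable (BS \<Otimes>\<^sub>M B2)" "h \<in> borel_measurable (BS \<Otimes>\<^sub>M B2)"
      using g h by (auto simp: joint_density_def)
    show "(\<lambda>p. h p - g p) \<in> borel_measurable (BS \<Otimes>\<^sub>M B2)"
      by measurable
    fix s C assume s: "s \<in> topspace S" and C: "C \<in> sets B2"
    have gm: "(\<lambda>y. g (s, y)) \<in> borel_measurable \<nu>" and hm: "(\<lambda>y. h (s, y)) \<in> borel_measurable \<nu>"
      using g h s by (auto intro!: section_measurable \<nu>(2) simp: joint_density_def)
    have C': "C \<in> sets \<nu>"
      using C \<nu>(2) by simp
    interpret Rs: prob_space "R s"
      using R_space(3)[OF s] .
    have gi: "(\<integral>\<^sup>+y. g (s, y) * indicator C y \<partial>\<nu>) = emeasure (R s) (A \<times> C)"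
      using g s C emeasure_slice_indicator[OF s A C] by (simp add: joint_density_def)
    have hi: "(\<integral>\<^sup>+y. h (s, y) * indicator C y \<partial>\<nu>) = emeasure (R s) (topspace S1 \<times> C)"
      using h s C emeasure_slice_indicator[OF s top C] by (simp add: joint_density_def)
    have "(\<integral>\<^sup>+y. (h (s, y) - g (s, y)) * indicator C y \<partial>\<nu>)
      = (\<integral>\<^sup>+y. h (s, y) * indicator C y - g (s, y) * indicator C y \<partial>\<nu>)"
      by (intro nn_integral_cong) (auto split: split_indicator)
    also have "\<dots> = emeasure (R s) (topspace S1 \<times> C) - emeasure (R s) (A \<times> C)"
      unfolding gi[symmetric] hi[symmetric]
    proof (rule nn_integral_diff)
      show "AE y in \<nu>. g (s, y) * indicator C y \<le> h (s, y) * indicator C y"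
        using joint_density_mono[OF g h A top _ s] sets.sets_into_space[OF A]
        by (auto elim!: eventually_mono split: split_indicator)
      show "(\<integral>\<^sup>+y. g (s, y) * indicator C y \<partial>\<nu>) \<noteq> \<infinity>"
        unfolding gi using Rs.emeasure_finite by simp
    qed (use gm hm C' in auto)
    also have "\<dots> = emeasure (R s) (topspace S1 \<times> C - A \<times> C)"
      using A top C R_space(1)[OF s] sets.sets_into_space[OF A]
      by (intro emeasure_Diff[symmetric]) (auto simp: Rs.emeasure_eq_measure)
    also have "topspace S1 \<times> C - A \<times> C = (topspace S1 - A) \<times> C"
      by auto
    finally show "emeasure (slice (indicator (topspace S1 - A)) s) C
        = (\<integral>\<^sup>+y. (h (s, y) - g (s, y)) * indicator C y \<partial>\<nu>)"
      using emeasure_slice_indicator[OF s _ C] A top by (simp add: sets.Diff)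
  qed
  then show ?case
    by blast
qed
qed

text \<open>
  The quotient of the densities for \<open>B\<close> and for the whole space, truncated at \<open>1\<close> so that the
  bounds hold everywhere and not only almost everywhere.
\<close>

lemma conditional_probability:
  assumes B: "B \<in> sets B1"
  shows "\<exists>h :: 's \<times> 'y \<Rightarrow> real. h \<in> borel_measurable (BS \<Otimes>\<^sub>M B2) \<and> (\<forall>p. 0 \<le> h p \<and> h p \<le> 1) \<and>
    (\<forall>s\<in>topspace S. \<forall>C\<in>sets B2.
       emeasure (R s) (B \<times> C) = (\<integral>\<^sup>+y. ennreal (h (s, y)) * indicator C y \<partial>\<mu> s))"
proof -
  obtain g where g: "joint_density (indicator B) g"
    using joint_density_Borel[OF B] by auto
  obtain k where k: "joint_density (indicator (topspace S1)) k"
    using joint_density_open[OF openin_topspace] by auto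
  have top: "topspace S1 \<in> sets B1"
    by (simp add: openin_borel_of)
  define h where "h p = min 1 (enn2real (g p / k p))" for p
  have gm[measurable]: "g \<in> borel_measurable (BS \<Otimes>\<^sub>M B2)" and km[measurable]: "k \<in> borel_measurable (BS \<Otimes>\<^sub>M B2)"
    using g k by (auto simp: joint_density_def)
  have hm[measurable]: "h \<in> borel_measurable (BS \<Otimes>\<^sub>M B2)"
    unfolding h_def by measurable
  have "emeasure (R s) (B \<times> C) = (\<integral>\<^sup>+y. ennreal (h (s, y)) * indicator C y \<partial>\<mu> s)"
    if s: "s \<in> topspace S" and C: "C \<in> sets B2" for s C
  proof -
    have m: "(\<lambda>y. g (s, y)) \<in> borel_measurable \<nu>" "(\<lambda>y. k (s, y)) \<in> borel_measurable \<nu>"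
        "(\<lambda>y. h (s, y)) \<in> borel_measurable \<nu>"
      by (rule section_measurable[OF gm s \<nu>(2)] section_measurable[OF km s \<nu>(2)]
          section_measurable[OF hm s \<nu>(2)])+
    have C': "C \<in> sets \<nu>"
      using C \<nu>(2) by simp
    have \<mu>d: "\<mu> s = density \<nu> (\<lambda>y. k (s, y))"
    proof (rule measure_eqI)
      fix E assume "E \<in> sets (\<mu> s)"
      then have E: "E \<in> sets B2"
        by (simp add: \<mu>_prob)
      then have "emeasure (\<mu> s) E = (\<integral>\<^sup>+y. k (s, y) * indicator E y \<partial>\<nu>)"
        using k s emeasure_\<mu>[OF s E] emeasure_slice_indicator[OF s top E] by (simp add: joint_density_def)
      then show "emeasure (\<mu> s) E = emeasure (density \<nu> (\<lambda>y. k (s, y))) E"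
        using E m \<nu>(2) by (simp add: emeasure_density)
    qed (simp add: \<mu>_prob \<nu>)
    have "AE y in \<nu>. k (s, y) \<noteq> \<infinity>"
      using joint_density_finite[OF k top s] m(2) by (intro nn_integral_PInf_AE) (auto simp: top_unique)
    moreover have "AE y in \<nu>. g (s, y) \<le> k (s, y)"
      using joint_density_mono[OF g k B top _ s] sets.sets_into_space[OF B] by simp
    ultimately have ae: "AE y in \<nu>. g (s, y) * indicator C y = k (s, y) * (ennreal (h (s, y)) * indicator C y)"
    proof eventually_elim
      case (elim y)
      have "g (s, y) = k (s, y) * ennreal (h (s, y))"
      proof (cases "k (s, y) = 0")
        case True
        then show ?thesis
          using elim by simp
      next
        case False
        have fin: "k (s, y) < top" "g (s, y) < top"
          using elim by (auto simp: less_top[symmetric] top_unique)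
        have le1: "g (s, y) / k (s, y) \<le> 1"
          using elim(2) False fin by (metis divide_right_mono_ennreal ennreal_divide_self)
        then have ne: "g (s, y) / k (s, y) < top"
          by (rule le_less_trans) simp
        have "enn2real (g (s, y) / k (s, y)) \<le> 1"
          using le1 enn2real_leI[of 1] by simp
        then have "ennreal (h (s, y)) = g (s, y) / k (s, y)"
          using ne by (simp add: h_def min_absorb2)
        then show ?thesis
          using False fin by (simp add: ennreal_times_divide mult.commute ennreal_mult_divide_eq mult_divide_eq_ennreal)
      qed
      then show ?case
        by (simp add: mult.assoc)
    qed
    have "emeasure (R s) (B \<times> C) = (\<integral>\<^sup>+y. g (s, y) * indicator C y \<partial>\<nu>)"
      using g s C emeasure_slice_indicator[OF s B C] by (simp add: joint_density_def)
    also have "\<dots> = (\<integral>\<^sup>+y. k (s, y) * (ennreal (h (s, y)) * indicator C y) \<partial>\<nu>)"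
      by (rule nn_integral_cong_AE[OF ae])
    also have "\<dots> = (\<integral>\<^sup>+y. ennreal (h (s, y)) * indicator C y \<partial>\<mu> s)"
      unfolding \<mu>d using m C' by (subst nn_integral_density) auto
    finally show ?thesis .
  qed
  moreover have "0 \<le> h p \<and> h p \<le> 1" for p
    by (simp add: h_def)
  ultimately show ?thesis
    using hm by blast
qed

end

context feller_family
begin

text \<open>
  The conditional probabilities of \<open>{T \<le> q}\<close> for rational \<open>q\<close> are monotone in \<open>q\<close> outside a null
  set. Where they are, their right limits along rationals form a distribution function; elsewhere
  the distribution function of the unit mass at \<open>0\<close> is substituted. Since \<open>T\<close> takes values in the
  unit interval, the values for \<open>q < 0\<close> and \<open>q \<ge> 1\<close> can be prescribed, and the limits at infinity are
  automatic.
\<close>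

lemma conditional_distribution_function:
  fixes T :: "'x \<Rightarrow> real"
  assumes T[measurable]: "T \<in> borel_measurable B1" and T01: "\<forall>x\<in>topspace S1. 0 \<le> T x \<and> T x \<le> 1"
  shows "\<exists>F :: 's \<times> 'y \<Rightarrow> real \<Rightarrow> real.
    (\<forall>x. (\<lambda>p. F p x) \<in> borel_measurable (BS \<Otimes>\<^sub>M B2)) \<and>
    (\<forall>p. mono (F p) \<and> (\<forall>x. continuous (at_right x) (F p)) \<and> (F p \<longlongrightarrow> 0) at_bot \<and> (F p \<longlongrightarrow> 1) at_top) \<and>
    (\<forall>s\<in>topspace S. \<forall>C\<in>sets B2. \<forall>x.
       emeasure (R s) ({w \<in> topspace S1. T w \<le> x} \<times> C) = (\<integral>\<^sup>+y. ennreal (F (s, y) x) * indicator C y \<partial>\<mu> s))"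
proof -
  define B where "B x = {w \<in> topspace S1. T w \<le> x}" for x
  have B: "B x \<in> sets B1" for x
  proof -
    have "{w \<in> space B1. T w \<le> x} \<in> sets B1"
      by measurable
    then show ?thesis
      by (simp add: B_def)
  qed
  have B_triv: "B x = {}" if "x < 0" for x
    using T01 that by (force simp: B_def)
  have B_top: "B x = topspace S1" if "1 \<le> x" for x
    using T01 that by (force simp: B_def)
  have "\<forall>q::rat. \<exists>h :: 's \<times> 'y \<Rightarrow> real. h \<in> borel_measurable (BS \<Otimes>\<^sub>M B2) \<and>
    (\<forall>p. 0 \<le> h p \<and> h p \<le> 1 \<and> (q < 0 \<longrightarrow> h p = 0) \<and> (1 \<le> q \<longrightarrow> h p = 1)) \<and>
    (\<forall>s\<in>topspace S. \<forall>C\<in>sets B2.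
       emeasure (R s) (B (of_rat q) \<times> C) = (\<integral>\<^sup>+y. ennreal (h (s, y)) * indicator C y \<partial>\<mu> s))"
    (is "\<forall>q. \<exists>h. ?H q h")
  proof
    fix q :: rat
    consider "q < 0" | "1 \<le> q" | "0 \<le> q" "q < 1"
      by linarith
    then show "\<exists>h. ?H q h"
    proof cases
      case 1
      then show ?thesis
        by (intro exI[of _ "\<lambda>_. 0"]) (simp add: B_triv)
    next
      case 2
      then show ?thesis
        by (intro exI[of _ "\<lambda>_. 1"]) (simp add: B_top emeasure_\<mu>[symmetric] \<mu>_prob)
    next
      case 3
      then show ?thesis
        using conditional_probability[OF B, of "of_rat q"] by auto
    qed
  qed
  from choice[OF this] obtain h :: "rat \<Rightarrow> 's \<times> 'y \<Rightarrow> real" where hh: "\<forall>q. ?H q (h q)"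
    by (elim exE) (rule that)
  then have
    h_meas[measurable]: "\<And>q. h q \<in> borel_measurable (BS \<Otimes>\<^sub>M B2)" and
    h01: "\<And>q p. 0 \<le> h q p \<and> h q p \<le> 1" and
    h0: "\<And>q p. q < 0 \<Longrightarrow> h q p = 0" and h1: "\<And>q p. 1 \<le> q \<Longrightarrow> h q p = 1" and
    h: "\<And>q s C. s \<in> topspace S \<Longrightarrow> C \<in> sets B2 \<Longrightarrow>
       emeasure (R s) (B (of_rat q) \<times> C) = (\<integral>\<^sup>+y. ennreal (h q (s, y)) * indicator C y \<partial>\<mu> s)"
    by blast+
  have h_sec: "(\<lambda>y. h q (s, y)) \<in> borel_measurable (\<mu> s)" if "s \<in> topspace S" for q s
    by (rule section_measurable[OF h_meas that \<mu>_prob(2)])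
  have h_le: "AE y in \<mu> s. ennreal (h q (s, y)) \<le> ennreal (h q' (s, y))"
    if s: "s \<in> topspace S" and "q \<le> q'" for s q q'
  proof (rule AE_le_of_set_integrals)
    interpret m: prob_space "\<mu> s"
      using \<mu>_prob(1)[OF s] .
    show "(\<lambda>y. ennreal (h q (s, y))) \<in> borel_measurable (\<mu> s)" "(\<lambda>y. ennreal (h q' (s, y))) \<in> borel_measurable (\<mu> s)"
      using h_sec[OF s] by auto
    have "(\<integral>\<^sup>+y. ennreal (h q' (s, y)) \<partial>\<mu> s) \<le> (\<integral>\<^sup>+y. 1 \<partial>\<mu> s)"
      using h01 by (intro nn_integral_mono) (simp add: ennreal_le_1)
    then show "(\<integral>\<^sup>+y. ennreal (h q' (s, y)) \<partial>\<mu> s) < \<infinity>"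
      using m.emeasure_space_1 by (simp add: le_less_trans)
    fix C assume "C \<in> sets (\<mu> s)"
    then have C: "C \<in> sets B2"
      by (simp add: \<mu>_prob)
    have "(of_rat q :: real) \<le> of_rat q'"
      using \<open>q \<le> q'\<close> by (simp add: of_rat_less_eq)
    then have "B (of_rat q) \<subseteq> B (of_rat q')"
      by (auto simp: B_def)
    then have "emeasure (R s) (B (of_rat q) \<times> C) \<le> emeasure (R s) (B (of_rat q') \<times> C)"
      using B C R_space(1)[OF s] by (intro emeasure_mono) auto
    then show "(\<integral>\<^sup>+y. ennreal (h q (s, y)) * indicator C y \<partial>\<mu> s) \<le> (\<integral>\<^sup>+y. ennreal (h q' (s, y)) * indicator C y \<partial>\<mu> s)"
      using h[OF s C] by simp
  qed
  (* The set on which the rational conditional probabilities form a monotone function. *)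
  define good where "good p \<longleftrightarrow> (\<forall>q q'. q \<le> q' \<longrightarrow> h q p \<le> h q' p)" for p
  have good_meas[measurable]: "Measurable.pred (BS \<Otimes>\<^sub>M B2) good"
    unfolding good_def by measurable
  have AE_good: "AE y in \<mu> s. good (s, y)" if s: "s \<in> topspace S" for s
    unfolding good_def AE_all_countable
  proof (intro allI)
    fix q q'
    show "AE y in \<mu> s. q \<le> q' \<longrightarrow> h q (s, y) \<le> h q' (s, y)"
    proof (cases "q \<le> q'")
      case True
      from h_le[OF s this] show ?thesis
        by (rule eventually_mono) (use h01 in \<open>simp add: ennreal_le_iff\<close>)
    qed simp
  qed
  define F where "F p x = (if good p then (INF q\<in>{q. x < of_rat q}. h q p) else if 0 \<le> x then 1 else 0)" for p and x :: real
  have Q_ne: "{q. x < of_rat q} \<noteq> {}" for x :: real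
    using of_rat_dense[of x "x + 1"] by auto
  have bdd: "bdd_below ((\<lambda>q. h q p) ` A)" for p A
    by (rule bdd_belowI2[of _ 0]) (simp add: h01)
  have F_le: "F p x \<le> h q p" if "good p" "x < of_rat q" for p x q
    using that by (auto simp: F_def intro!: cINF_lower bdd)
  have F_ge: "c \<le> F p x" if "good p" "\<And>q. x < of_rat q \<Longrightarrow> c \<le> h q p" for p x c
  proof -
    have "c \<le> (INF q\<in>{q. x < of_rat q}. h q p)"
      by (rule cINF_greatest[OF Q_ne]) (use that(2) in simp)
    then show ?thesis
      using that(1) by (simp add: F_def)
  qed
  have F_less: "\<exists>q. x < of_rat q \<and> h q p < c" if "good p" "F p x < c" for p x c
  proof (rule ccontr)
    assume no: "\<not> ?thesis"
    have "c \<le> h q p" if "x < of_rat q" for q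
      using no that not_less by blast
    then have "c \<le> F p x"
      by (rule F_ge[OF \<open>good p\<close>])
    then show False
      using that(2) by simp
  qed
  have F_meas: "(\<lambda>p. F p x) \<in> borel_measurable (BS \<Otimes>\<^sub>M B2)" for x
    unfolding F_def
    by (intro measurable_If borel_measurable_cINF_real h_meas good_meas[unfolded pred_def]) (auto intro: countableI_type)
  have F_mono: "mono (F p)" for p
  proof (rule monoI)
    fix x x' :: real assume "x \<le> x'"
    show "F p x \<le> F p x'"
    proof (cases "good p")
      case True
      then show ?thesis
        using \<open>x \<le> x'\<close> by (intro F_ge[OF True] F_le[OF True]) simp
    qed (use \<open>x \<le> x'\<close> in \<open>auto simp: F_def\<close>)
  qed
  have F_cont: "continuous (at_right x) (F p)" for p x
    unfolding continuous_within
  proof (rule order_tendstoI)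
    fix c assume "c < F p x"
    then have "\<forall>\<^sub>F x' in at_right x. c < F p x"
      by simp
    moreover have "\<forall>\<^sub>F x' in at_right x. x < x'"
      by (simp add: eventually_at_filter)
    ultimately show "\<forall>\<^sub>F x' in at_right x. c < F p x'"
    proof eventually_elim
      case (elim x')
      then show ?case
        using monoD[OF F_mono, of x x' p] by simp
    qed
  next
    fix c assume c: "F p x < c"
    have "\<exists>b>x. F p b < c"
    proof (cases "good p")
      case True
      then obtain q where q: "x < of_rat q" "h q p < c"
        using F_less[OF True c] by blast
      define b where "b = (x + of_rat q) / 2"
      have "x < b" "b < of_rat q"
        using q(1) by (auto simp: b_def)
      then show ?thesis
        using q(2) F_le[OF True, of b q] by (intro exI[of _ b]) auto
    next
      case False
      define b where "b = (if 0 \<le> x then x + 1 else x / 2)"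
      have "x < b" "F p b = F p x"
        using False by (auto simp: F_def b_def)
      then show ?thesis
        using c by auto
    qed
    then obtain b where b: "x < b" "F p b < c"
      by blast
    have "\<forall>\<^sub>F x' in at_right x. x' < b"
      using b(1) by (auto simp: eventually_at_right)
    then show "\<forall>\<^sub>F x' in at_right x. F p x' < c"
    proof eventually_elim
      case (elim x')
      then have "F p x' \<le> F p b"
        using monoD[OF F_mono] by simp
      then show ?case
        using b(2) by simp
    qed
  qed
  have F0: "F p x = 0" if "x < 0" for p x
  proof (cases "good p")
    case True
    obtain q where q: "x < of_rat q" "of_rat q < (0::real)"
      using of_rat_dense[OF \<open>x < 0\<close>] by blast
    then have "h q p = 0"
      by (simp add: h0)
    then have "F p x \<le> 0"
      using F_le[OF True q(1)] by simp
    moreover have "0 \<le> F p x"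
      by (rule F_ge[OF True]) (simp add: h01)
    ultimately show ?thesis
      by simp
  qed (use that in \<open>simp add: F_def\<close>)
  have F1: "F p x = 1" if "1 \<le> x" for p x
  proof (cases "good p")
    case True
    have *: "h q p = 1" if "x < of_rat q" for q
    proof -
      have "(1 :: real) \<le> of_rat q"
        using that \<open>1 \<le> x\<close> by linarith
      then show ?thesis
        by (simp add: h1)
    qed
    have "(INF q\<in>{q. x < of_rat q}. h q p) = (INF q\<in>{q. x < of_rat q}. 1)"
      using * by (intro INF_cong) auto
    also have "\<dots> = 1"
      by (rule cINF_const[OF Q_ne])
    finally show ?thesis
      using True by (simp add: F_def)
  qed (use that in \<open>simp add: F_def\<close>)
  have lims: "(F p \<longlongrightarrow> 0) at_bot" "(F p \<longlongrightarrow> 1) at_top" for p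
  proof -
    have "\<forall>\<^sub>F x in at_bot. F p x = 0"
      using F0 by (intro eventually_mono[OF eventually_gt_at_bot[of 0]]) auto
    then show "(F p \<longlongrightarrow> 0) at_bot"
      by (rule tendsto_eventually)
    have "\<forall>\<^sub>F x in at_top. F p x = 1"
      using F1 by (intro eventually_mono[OF eventually_ge_at_top[of 1]]) auto
    then show "(F p \<longlongrightarrow> 1) at_top"
      by (rule tendsto_eventually)
  qed
  have "emeasure (R s) (B x \<times> C) = (\<integral>\<^sup>+y. ennreal (F (s, y) x) * indicator C y \<partial>\<mu> s)"
    if s: "s \<in> topspace S" and C: "C \<in> sets B2" for s C x
  proof -
    interpret Rs: prob_space "R s"
      using R_space(3)[OF s] .
    interpret m: prob_space "\<mu> s"
      using \<mu>_prob(1)[OF s] .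
    (* Rational numbers decreasing to x from above, one in each of consecutive disjoint intervals. *)
    have "\<forall>n. \<exists>q. x + 1 / real (n + 2) < of_rat q \<and> of_rat q < x + 1 / real (n + 1)"
      by (intro allI of_rat_dense add_strict_left_mono divide_strict_left_mono) auto
    from choice[OF this] obtain q
      where "\<forall>n. x + 1 / real (n + 2) < of_rat (q n) \<and> of_rat (q n) < x + 1 / real (n + 1)"
      by (elim exE) (rule that)
    then have q: "\<And>n. x + 1 / real (n + 2) < of_rat (q n)" "\<And>n. of_rat (q n) < x + 1 / real (n + 1)"
      by blast+
    have q_dec: "of_rat (q (Suc n)) \<le> (of_rat (q n) :: real)" for n
      using q(1)[of n] q(2)[of "Suc n"] by (simp add: add.commute)
    then have q_anti: "decseq (\<lambda>n. of_rat (q n) :: real)"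
      by (intro decseq_SucI)
    have qx: "x < of_rat (q n)" for n
    proof -
      have "0 < 1 / real (n + 2)"
        by simp
      then show ?thesis
        using q(1)[of n] by linarith
    qed
    have q_lim: "\<forall>\<^sub>F n in sequentially. of_rat (q n) < c" if "x < c" for c :: real
    proof -
      have "0 < c - x"
        using \<open>x < c\<close> by simp
      then obtain N where N: "1 / real (Suc N) < c - x"
        by (rule nat_approx_posE)
      then have qN: "of_rat (q N) < c"
        using q(2)[of N] by simp
      have "of_rat (q n) < c" if "N \<le> n" for n
        using decseqD[OF q_anti that] qN by simp
      then show ?thesis
        unfolding eventually_sequentially by blast
    qed
    have "(\<Inter>n. B (of_rat (q n)) \<times> C) = B x \<times> C"
    proof (intro equalityI subsetI)
      fix p assume p: "p \<in> (\<Inter>n. B (of_rat (q n)) \<times> C)"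
      then have Tq: "T (fst p) \<le> of_rat (q n)" for n
        by (auto simp: B_def)
      have "T (fst p) \<le> x"
      proof (rule ccontr)
        assume "\<not> T (fst p) \<le> x"
        then have "\<forall>\<^sub>F n in sequentially. of_rat (q n) < T (fst p)"
          by (intro q_lim) simp
        then obtain n where "of_rat (q n) < T (fst p)"
          unfolding eventually_sequentially by blast
        then show False
          using Tq[of n] by simp
      qed
      then show "p \<in> B x \<times> C"
        using p by (auto simp: B_def)
    next
      fix p assume "p \<in> B x \<times> C"
      then show "p \<in> (\<Inter>n. B (of_rat (q n)) \<times> C)"
        using qx[THEN less_imp_le] by (auto simp: B_def intro: order_trans)
    qed
    moreover have "(\<lambda>n. emeasure (R s) (B (of_rat (q n)) \<times> C)) \<longlonglongrightarrow> emeasure (R s) (\<Inter>n. B (of_rat (q n)) \<times> C)"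
    proof (rule Lim_emeasure_decseq)
      show "range (\<lambda>n. B (of_rat (q n)) \<times> C) \<subseteq> sets (R s)"
        using B C R_space(1)[OF s] by auto
      show "decseq (\<lambda>n. B (of_rat (q n)) \<times> C)"
        using q_dec by (intro decseq_SucI) (auto simp: B_def intro: order_trans)
    qed simp
    ultimately have 1: "(\<lambda>n. \<integral>\<^sup>+y. ennreal (h (q n) (s, y)) * indicator C y \<partial>\<mu> s) \<longlonglongrightarrow> emeasure (R s) (B x \<times> C)"
      using h[OF s C] by simp
    have C': "C \<in> sets (\<mu> s)"
      using C by (simp add: \<mu>_prob)
    have 2: "(\<lambda>n. \<integral>\<^sup>+y. ennreal (h (q n) (s, y)) * indicator C y \<partial>\<mu> s)
        \<longlonglongrightarrow> (\<integral>\<^sup>+y. ennreal (F (s, y) x) * indicator C y \<partial>\<mu> s)"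
    proof (rule nn_integral_dominated_convergence[where w="\<lambda>_. 1"])
      show "(\<lambda>y. ennreal (h (q n) (s, y)) * indicator C y) \<in> borel_measurable (\<mu> s)" for n
        using h_sec[OF s, of "q n"] C' by simp
      show "(\<lambda>y. ennreal (F (s, y) x) * indicator C y) \<in> borel_measurable (\<mu> s)"
        using section_measurable[OF F_meas s \<mu>_prob(2)] C' by simp
      show "AE y in \<mu> s. ennreal (h (q n) (s, y)) * indicator C y \<le> 1" for n
        using h01 by (intro AE_I2) (auto simp: ennreal_le_1 split: split_indicator)
      show "(\<integral>\<^sup>+y. 1 \<partial>\<mu> s) < \<infinity>"
        using m.emeasure_space_1 by simp
      show "AE y in \<mu> s. (\<lambda>n. ennreal (h (q n) (s, y)) * indicator C y) \<longlonglongrightarrow> ennreal (F (s, y) x) * indicator C y"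
        using AE_good[OF s]
      proof eventually_elim
        case (elim y)
        have "(\<lambda>n. h (q n) (s, y)) \<longlonglongrightarrow> F (s, y) x"
        proof (rule order_tendstoI)
          fix c assume "c < F (s, y) x"
          then show "\<forall>\<^sub>F n in sequentially. c < h (q n) (s, y)"
            using F_le[OF elim qx] by (intro always_eventually allI) (rule less_le_trans)
        next
          fix c assume "F (s, y) x < c"
          then obtain r where r: "x < of_rat r" "h r (s, y) < c"
            using F_less[OF elim] by blast
          from q_lim[OF r(1)] show "\<forall>\<^sub>F n in sequentially. h (q n) (s, y) < c"
          proof eventually_elim
            fix n assume "of_rat (q n) < (of_rat r :: real)"
            then have "h (q n) (s, y) \<le> h r (s, y)"
              using elim by (simp add: good_def of_rat_less)
            then show "h (q n) (s, y) < c"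
              using r(2) by simp
          qed
        qed
        then have "(\<lambda>n. ennreal (h (q n) (s, y))) \<longlonglongrightarrow> ennreal (F (s, y) x)"
          by (rule tendsto_ennrealI)
        then show ?case
          by (cases "y \<in> C") auto
      qed
    qed simp
    show ?thesis
      by (rule LIMSEQ_unique[OF 1 2])
  qed
  then show ?thesis
    using F_meas F_mono F_cont lims unfolding B_def by (intro exI[of _ F]) auto
qed

text \<open>
  The conditional distribution functions define measures on the real line, and both sides agree on
  the half-lines, which generate the Borel sets.
\<close>

lemma conditional_law_real:
  fixes T :: "'x \<Rightarrow> real"
  assumes T: "T \<in> borel_measurable B1" and T01: "\<forall>x\<in>topspace S1. 0 \<le> T x \<and> T x \<le> 1"
  shows "\<exists>K. K \<in> BS \<Otimes>\<^sub>M B2 \<rightarrow>\<^sub>M prob_algebra (borel :: real measure) \<and>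
    (\<forall>s\<in>topspace S. \<forall>C\<in>sets B2. \<forall>E\<in>sets borel.
       emeasure (R s) ({w \<in> topspace S1. T w \<in> E} \<times> C) = (\<integral>\<^sup>+y. emeasure (K (s, y)) E * indicator C y \<partial>\<mu> s))"
proof -
  obtain F :: "'s \<times> 'y \<Rightarrow> real \<Rightarrow> real" where FF: "(\<forall>x. (\<lambda>p. F p x) \<in> borel_measurable (BS \<Otimes>\<^sub>M B2)) \<and>
    (\<forall>p. mono (F p) \<and> (\<forall>x. continuous (at_right x) (F p)) \<and> (F p \<longlongrightarrow> 0) at_bot \<and> (F p \<longlongrightarrow> 1) at_top) \<and>
    (\<forall>s\<in>topspace S. \<forall>C\<in>sets B2. \<forall>x.
       emeasure (R s) ({w \<in> topspace S1. T w \<le> x} \<times> C) = (\<integral>\<^sup>+y. ennreal (F (s, y) x) * indicator C y \<partial>\<mu> s))"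
    using conditional_distribution_function[OF T T01] by (elim exE) (rule that)
  then have F_meas: "(\<lambda>p. F p x) \<in> borel_measurable (BS \<Otimes>\<^sub>M B2)" for x
    by blast
  have F_mono: "x \<le> x' \<Longrightarrow> F p x \<le> F p x'" and F_cont: "continuous (at_right x) (F p)"
    and F_bot: "(F p \<longlongrightarrow> 0) at_bot" and F_top: "(F p \<longlongrightarrow> 1) at_top" for p x x'
  proof -
    have "mono (F p) \<and> (\<forall>x. continuous (at_right x) (F p)) \<and> (F p \<longlongrightarrow> 0) at_bot \<and> (F p \<longlongrightarrow> 1) at_top"
      using FF by blast
    then show "x \<le> x' \<Longrightarrow> F p x \<le> F p x'" "continuous (at_right x) (F p)"
        "(F p \<longlongrightarrow> 0) at_bot" "(F p \<longlongrightarrow> 1) at_top"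
      by (auto dest: monoD)
  qed
  have F: "emeasure (R s) ({w \<in> topspace S1. T w \<le> x} \<times> C) = (\<integral>\<^sup>+y. ennreal (F (s, y) x) * indicator C y \<partial>\<mu> s)"
    if "s \<in> topspace S" "C \<in> sets B2" for s C x
    using FF that by blast
  define K where "K p = interval_measure (F p)" for p
  have K_prob: "prob_space (K p)" "sets (K p) = sets borel" for p
  proof -
    interpret real_distribution "K p"
      unfolding K_def by (rule real_distribution_interval_measure[OF F_mono F_cont F_bot F_top])
    show "prob_space (K p)" "sets (K p) = sets borel"
      by (simp_all add: prob_space_axioms)
  qed
  have K_Iic: "emeasure (K p) {..x} = ennreal (F p x)" for p x
    unfolding K_def by (rule emeasure_interval_measure_Iic[OF F_mono F_cont F_bot])
  have borel: "sets (borel :: real measure) = sigma_sets UNIV (range (\<lambda>a. {..a}))"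
    by (simp add: borel_eq_atMost)
  have Istable: "Int_stable (range (\<lambda>a::real. {..a}))"
    by (auto simp: Int_stable_def)
  have K_meas: "K \<in> BS \<Otimes>\<^sub>M B2 \<rightarrow>\<^sub>M prob_algebra borel"
  proof (rule measurable_prob_algebra_generated[OF borel Istable])
    show "(\<lambda>p. emeasure (K p) A) \<in> borel_measurable (BS \<Otimes>\<^sub>M B2)" if "A \<in> range (\<lambda>a. {..a})" for A
      using that F_meas by (auto simp: K_Iic)
  qed (use K_prob in auto)
  have "emeasure (R s) ({w \<in> topspace S1. T w \<in> E} \<times> C) = (\<integral>\<^sup>+y. emeasure (K (s, y)) E * indicator C y \<partial>\<mu> s)"
    if s: "s \<in> topspace S" and C: "C \<in> sets B2" and E: "E \<in> sets borel" for s C E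
  proof -
    interpret Rs: prob_space "R s"
      using R_space(3)[OF s] .
    have C': "C \<in> sets (\<mu> s)"
      using C by (simp add: \<mu>_prob)
    have TC: "{w \<in> topspace S1. T w \<in> E} \<times> C \<in> sets (R s)" if "E \<in> sets borel" for E
    proof -
      have "T -` E \<inter> space B1 \<in> sets B1"
        by (rule measurable_sets[OF T that])
      moreover have "T -` E \<inter> space B1 = {w \<in> topspace S1. T w \<in> E}"
        by auto
      ultimately show ?thesis
        using C R_space(1)[OF s] by auto
    qed
    have Ksec: "(\<lambda>y. K (s, y)) \<in> \<mu> s \<rightarrow>\<^sub>M prob_algebra borel"
      by (rule section_measurable[OF K_meas s \<mu>_prob(2)])
    then have Ksub: "(\<lambda>y. K (s, y)) \<in> density (\<mu> s) (indicator C) \<rightarrow>\<^sub>M subprob_algebra borel"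
      using measurable_prob_algebraD by simp
    define M1 where "M1 = density (\<mu> s) (indicator C) \<bind> (\<lambda>y. K (s, y))"
    define M2 where "M2 = distr (density (R s) (\<lambda>p. indicator C (snd p))) borel (\<lambda>p. T (fst p))"
    have ne: "space (density (\<mu> s) (indicator C)) \<noteq> {}"
      using prob_space.not_empty[OF \<mu>_prob(1)[OF s]] by simp
    have M1: "emeasure M1 E = (\<integral>\<^sup>+y. emeasure (K (s, y)) E * indicator C y \<partial>\<mu> s)" if E: "E \<in> sets borel" for E
    proof -
      have m: "(\<lambda>y. emeasure (K (s, y)) E) \<in> borel_measurable (\<mu> s)"
        using measurable_compose[OF measurable_prob_algebraD[OF Ksec] measurable_emeasure_subprob_algebra[OF E]] .
      have "emeasure M1 E = (\<integral>\<^sup>+y. emeasure (K (s, y)) E \<partial>density (\<mu> s) (indicator C))"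
        unfolding M1_def by (rule emeasure_bind[OF ne Ksub E])
      also have "\<dots> = (\<integral>\<^sup>+y. indicator C y * emeasure (K (s, y)) E \<partial>\<mu> s)"
        using m C' by (subst nn_integral_density) auto
      finally show ?thesis
        by (simp add: mult.commute)
    qed
    have M2: "emeasure M2 E = emeasure (R s) ({w \<in> topspace S1. T w \<in> E} \<times> C)" if E: "E \<in> sets borel" for E
    proof -
      have Tm: "(\<lambda>p. T (fst p)) \<in> borel_measurable (R s)"
        by (rule measurable_compose[OF R_space(4)[OF s] T])
      have Cm: "(\<lambda>p. indicator C (snd p) :: ennreal) \<in> borel_measurable (R s)"
        by (rule measurable_compose[OF R_space(5)[OF s] borel_measurable_indicator[OF C]])
      have "emeasure M2 E = (\<integral>\<^sup>+p. indicator C (snd p) * indicator ((\<lambda>p. T (fst p)) -` E \<inter> space (R s)) p \<partial>R s)"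
        unfolding M2_def using E Tm Cm measurable_sets[OF Tm E] by (subst emeasure_distr) (auto simp: emeasure_density)
      also have "\<dots> = (\<integral>\<^sup>+p. indicator ({w \<in> topspace S1. T w \<in> E} \<times> C) p \<partial>R s)"
        using R_space(2)[OF s] by (intro nn_integral_cong) (auto split: split_indicator)
      finally show ?thesis
        using TC[OF E] by simp
    qed
    have "M1 = M2"
    proof (rule measure_eqI_generator_eq[OF Istable, where \<Omega>=UNIV and A="\<lambda>n. {..real n}"])
      have "sets M1 = sets borel"
        unfolding M1_def using sets_bind[OF _ ne, of "\<lambda>y. K (s, y)" borel] K_prob(2) by simp
      then show "sets M1 = sigma_sets UNIV (range (\<lambda>a. {..a}))"
        using borel by simp
      show "sets M2 = sigma_sets UNIV (range (\<lambda>a. {..a}))"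
        unfolding M2_def using borel by simp
      show eq: "emeasure M1 X = emeasure M2 X" if "X \<in> range (\<lambda>a. {..a})" for X
      proof -
        obtain a where X: "X = {..a}"
          by (rule imageE[OF \<open>X \<in> range (\<lambda>a. {..a})\<close>])
        have "X \<in> sets borel"
          by (simp add: X)
        show ?thesis
          unfolding M1[OF \<open>X \<in> sets borel\<close>] M2[OF \<open>X \<in> sets borel\<close>] using F[OF s C, of a] by (simp add: X K_Iic)
      qed
      show "emeasure M1 {..real n} \<noteq> \<infinity>" for n
        using eq[of "{..real n}"] M2[of "{..real n}"] by simp
      show "(\<Union>n. {..real n}) = UNIV"
        using real_arch_simple by auto
    qed auto
    then show ?thesis
      using M1[OF E] M2[OF E] by simp
  qed
  then show ?thesis
    using K_meas by blast
qed

text \<open>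
  With a Borel code \<open>T\<close> of the states by real numbers and a Borel decoding \<open>D\<close>, the conditional
  law of the state is the image under \<open>D\<close> of the conditional law of its code.
\<close>

lemma disintegration:
  fixes T :: "'x \<Rightarrow> real" and D :: "real \<Rightarrow> 'x"
  assumes T: "T \<in> borel_measurable B1" and T01: "\<forall>x\<in>topspace S1. 0 \<le> T x \<and> T x \<le> 1"
    and D: "D \<in> borel \<rightarrow>\<^sub>M B1" and DT: "\<And>x. x \<in> topspace S1 \<Longrightarrow> D (T x) = x"
  shows "\<exists>H. H \<in> BS \<Otimes>\<^sub>M B2 \<rightarrow>\<^sub>M prob_algebra B1 \<and>
    (\<forall>s\<in>topspace S. \<forall>B\<in>sets B1. \<forall>C\<in>sets B2.
       emeasure (R s) (B \<times> C) = (\<integral>\<^sup>+y. emeasure (H (s, y)) B * indicator C y \<partial>\<mu> s))"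
proof -
  obtain K where K: "K \<in> BS \<Otimes>\<^sub>M B2 \<rightarrow>\<^sub>M prob_algebra (borel :: real measure)"
    "\<forall>s\<in>topspace S. \<forall>C\<in>sets B2. \<forall>E\<in>sets borel.
       emeasure (R s) ({w \<in> topspace S1. T w \<in> E} \<times> C) = (\<integral>\<^sup>+y. emeasure (K (s, y)) E * indicator C y \<partial>\<mu> s)"
    using conditional_law_real[OF T T01] by blast
  define H where "H p = distr (K p) B1 D" for p
  have "H \<in> BS \<Otimes>\<^sub>M B2 \<rightarrow>\<^sub>M prob_algebra B1"
    unfolding H_def by (rule measurable_compose[OF K(1) measurable_distr_prob_space[OF D]])
  moreover have "emeasure (R s) (B \<times> C) = (\<integral>\<^sup>+y. emeasure (H (s, y)) B * indicator C y \<partial>\<mu> s)"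
    if s: "s \<in> topspace S" and B: "B \<in> sets B1" and C: "C \<in> sets B2" for s B C
  proof -
    have E: "D -` B \<in> sets borel"
      using measurable_sets[OF D B] by simp
    have pre: "{w \<in> topspace S1. T w \<in> D -` B} = B"
      using DT sets.sets_into_space[OF B] by auto
    have "emeasure (R s) (B \<times> C) = (\<integral>\<^sup>+y. emeasure (K (s, y)) (D -` B) * indicator C y \<partial>\<mu> s)"
      using K(2)[rule_format, OF s C E] unfolding pre .
    also have "\<dots> = (\<integral>\<^sup>+y. emeasure (H (s, y)) B * indicator C y \<partial>\<mu> s)"
    proof (rule nn_integral_cong)
      fix y assume "y \<in> space (\<mu> s)"
      then have "(s, y) \<in> space (BS \<Otimes>\<^sub>M B2)"
        using s by (simp add: space_pair_measure \<mu>_prob)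
      then have k: "sets (K (s, y)) = sets borel"
        using measurable_space[OF K(1)] by (auto simp: space_prob_algebra)
      then have "D \<in> K (s, y) \<rightarrow>\<^sub>M B1" "space (K (s, y)) = UNIV"
        using D measurable_cong_sets[OF k refl] sets_eq_imp_space_eq[OF k] by auto
      then show "emeasure (K (s, y)) (D -` B) * indicator C y = emeasure (H (s, y)) B * indicator C y"
        unfolding H_def using B by (simp add: emeasure_distr)
    qed
    finally show ?thesis .
  qed
  ultimately show ?thesis
    by blast
qed

end

subsection \<open>Coding a Polish space by real numbers\<close>

text \<open>
  Expansions in base four with digits zero and one are unique: the tail after \<open>n + 1\<close> digits is
  less than one unit of the last digit, so a floor recovers the digits.
\<close>

lemma binary_digit_base_four:
  fixes b :: "nat \<Rightarrow> bool"
  defines "t \<equiv> (\<Sum>i. of_bool (b i) / 4 ^ Suc i :: real)"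
  shows "0 \<le> t" "t \<le> 1" "odd \<lfloor>4 ^ Suc n * t\<rfloor> \<longleftrightarrow> b n"
proof -
  have geo: "summable (\<lambda>i. 1 / 4 ^ Suc i :: real)" "(\<Sum>i. 1 / 4 ^ Suc i :: real) = 1 / 3"
  proof -
    have "(\<lambda>i. (1/4) * (1/4) ^ i :: real) sums (1/4 * (1 / (1 - 1/4)))"
      by (intro sums_mult geometric_sums) simp
    then have "(\<lambda>i. 1 / 4 ^ Suc i :: real) sums (1/3)"
      by (simp add: power_divide)
    then show "summable (\<lambda>i. 1 / 4 ^ Suc i :: real)" "(\<Sum>i. 1 / 4 ^ Suc i :: real) = 1 / 3"
      by (auto simp: sums_iff)
  qed
  have bound: "summable (\<lambda>i. of_bool (c i) / 4 ^ Suc i :: real)" "0 \<le> (\<Sum>i. of_bool (c i) / 4 ^ Suc i :: real)"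
    "(\<Sum>i. of_bool (c i) / 4 ^ Suc i :: real) \<le> 1 / 3" for c :: "nat \<Rightarrow> bool"
  proof -
    show s: "summable (\<lambda>i. of_bool (c i) / 4 ^ Suc i :: real)"
      by (rule summable_comparison_test[OF _ geo(1)]) (auto intro!: exI[of _ 0] divide_right_mono)
    show "0 \<le> (\<Sum>i. of_bool (c i) / 4 ^ Suc i :: real)"
      by (rule suminf_nonneg[OF s]) simp
    show "(\<Sum>i. of_bool (c i) / 4 ^ Suc i :: real) \<le> 1 / 3"
      unfolding geo(2)[symmetric] by (intro suminf_le s geo(1) divide_right_mono) auto
  qed
  show "0 \<le> t" "t \<le> 1"
    using bound(2,3)[of b] by (simp_all add: t_def)
  define r where "r = (\<Sum>i. of_bool (b (i + Suc n)) / 4 ^ Suc i :: real)"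
  define N where "N = (\<Sum>i<Suc n. of_bool (b i) * 4 ^ (n - i) :: int)"
  have "t = (\<Sum>i. of_bool (b (i + Suc n)) / 4 ^ Suc (i + Suc n)) + (\<Sum>i<Suc n. of_bool (b i) / 4 ^ Suc i)"
    unfolding t_def by (rule suminf_split_initial_segment[OF bound(1)])
  moreover have "(\<Sum>i. of_bool (b (i + Suc n)) / 4 ^ Suc (i + Suc n) :: real) = (1 / 4 ^ Suc n) * r"
  proof -
    have "(\<Sum>i. of_bool (b (i + Suc n)) / 4 ^ Suc (i + Suc n) :: real)
        = (\<Sum>i. (1 / 4 ^ Suc n) * (of_bool (b (i + Suc n)) / 4 ^ Suc i))"
      by (intro suminf_cong) (simp add: power_add field_simps)
    also have "\<dots> = (1 / 4 ^ Suc n) * r"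
      unfolding r_def by (rule suminf_mult[OF bound(1)])
    finally show ?thesis .
  qed
  ultimately have "4 ^ Suc n * t = r + (\<Sum>i<Suc n. 4 ^ Suc n * (of_bool (b i) / 4 ^ Suc i))"
    by (simp add: ring_distribs sum_distrib_left del: sum.lessThan_Suc power_Suc)
  also have "(\<Sum>i<Suc n. 4 ^ Suc n * (of_bool (b i) / 4 ^ Suc i)) = real_of_int N"
    unfolding N_def of_int_sum
  proof (rule sum.cong[OF refl])
    fix i assume "i \<in> {..<Suc n}"
    then have "(4::real) ^ Suc n = 4 ^ (n - i) * 4 ^ Suc i"
      by (simp add: power_add[symmetric] del: power_Suc)
    then show "4 ^ Suc n * (of_bool (b i) / 4 ^ Suc i) = real_of_int (of_bool (b i) * 4 ^ (n - i))"
      by (simp del: power_Suc)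
  qed
  finally have "\<lfloor>4 ^ Suc n * t\<rfloor> = N"
    using bound(2,3)[of "\<lambda>i. b (i + Suc n)"] unfolding r_def[symmetric] by (intro floor_unique) auto
  moreover have "odd N \<longleftrightarrow> b n"
  proof -
    have "even (\<Sum>i<n. of_bool (b i) * 4 ^ (n - i) :: int)"
      by (intro dvd_sum) auto
    then show ?thesis
      by (simp add: N_def)
  qed
  ultimately show "odd \<lfloor>4 ^ Suc n * t\<rfloor> \<longleftrightarrow> b n"
    by simp
qed

text \<open>
  A point is coded by the answers to all questions whether its distance to \<open>d j\<close> is below
  \<open>(1/2) ^ k\<close>, with \<open>d\<close> a dense sequence. The decoding takes, for each \<open>k\<close>, the first \<open>d j\<close> with a
  positive answer and passes to the limit; it is Borel since convergence of these sequences is a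
  Borel condition.
\<close>

lemma polish_space_real_code:
  obtains T :: "'w::polish_space \<Rightarrow> real" and D :: "real \<Rightarrow> 'w" where
    "T \<in> borel_measurable borel" "\<forall>w. 0 \<le> T w \<and> T w \<le> 1" "D \<in> borel_measurable borel" "\<forall>w. D (T w) = w"
proof -
  obtain X :: "'w set" where X: "countable X" "\<And>U :: 'w set. open U \<Longrightarrow> U \<noteq> {} \<Longrightarrow> \<exists>d\<in>X. d \<in> U"
    by (erule countable_dense_setE)
  have "X \<noteq> {}"
    using X(2)[of UNIV] by auto
  define d where "d = from_nat_into X"
  have d: "\<exists>j. dist w (d j) < (1/2) ^ k" for w k
  proof -
    have "(0::real) < (1/2) ^ k"
      by simp
    then have "w \<in> ball w ((1/2) ^ k)"
      by (simp only: centre_in_ball)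
    then have "\<exists>x\<in>X. x \<in> ball w ((1/2) ^ k)"
      using X(2)[OF open_ball, of w "(1/2) ^ k"] by blast
    then obtain x where x: "x \<in> X" "dist w x < (1/2) ^ k"
      by auto
    then obtain j where "d j = x"
      using from_nat_into_surj[OF X(1)] unfolding d_def by blast
    then show ?thesis
      using x(2) by blast
  qed
  define b where "b n w \<longleftrightarrow> (case prod_decode n of (k, j) \<Rightarrow> dist w (d j) < (1/2) ^ k)" for n and w :: 'w
  define T where "T w = (\<Sum>i. of_bool (b i w) / 4 ^ Suc i :: real)" for w
  define digit where "digit n r \<longleftrightarrow> odd \<lfloor>4 ^ Suc n * r\<rfloor>" for n and r :: real
  define J where "J k r = (LEAST j. digit (prod_encode (k, j)) r)" for k r
  define cau where "cau r \<longleftrightarrow> Cauchy (\<lambda>k. d (J k r))" for r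
  define \<delta> where "\<delta> k r = (if cau r then d (J k r) else d 0)" for k r
  define D where "D r = lim (\<lambda>k. \<delta> k r)" for r
  have b_meas[measurable]: "Measurable.pred borel (b n)" for n
    unfolding b_def by (cases "prod_decode n") simp
  have T_meas: "T \<in> borel_measurable borel"
    unfolding T_def by measurable
  have digit_meas[measurable]: "Measurable.pred borel (digit n)" for n
    unfolding digit_def by measurable
  have J_meas[measurable]: "J k \<in> borel \<rightarrow>\<^sub>M count_space UNIV" for k
    unfolding J_def by measurable
  have dJ[measurable]: "(\<lambda>r. d (J k r)) \<in> borel_measurable borel" for k
    by (rule measurable_compose[OF J_meas]) simp
  have "{r \<in> space borel. Cauchy (\<lambda>k. d (J k r))} \<in> sets borel"
    by (rule sets_Collect_Cauchy[OF dJ])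
  then have [measurable]: "Measurable.pred borel cau"
    by (simp add: cau_def pred_def)
  have D_lim: "(\<lambda>k. \<delta> k r) \<longlonglongrightarrow> D r" for r
  proof -
    have "convergent (\<lambda>k. \<delta> k r)"
      by (cases "cau r") (simp_all add: \<delta>_def cau_def Cauchy_convergent convergent_const)
    then show ?thesis
      by (simp add: D_def convergent_LIMSEQ_iff)
  qed
  have D_meas: "D \<in> borel_measurable borel"
  proof (rule borel_measurable_LIMSEQ_metric[OF _ D_lim])
    show "\<delta> k \<in> borel_measurable borel" for k
      unfolding \<delta>_def by measurable
  qed
  have "D (T w) = w" for w
  proof -
    have dig: "digit n (T w) \<longleftrightarrow> b n w" for n
      unfolding digit_def T_def by (rule binary_digit_base_four(3))
    have "dist w (d (J k (T w))) < (1/2) ^ k" for k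
    proof -
      have "J k (T w) = (LEAST j. dist w (d j) < (1/2) ^ k)"
        unfolding J_def dig b_def by simp
      then show ?thesis
        using LeastI_ex[OF d[of w k]] by simp
    qed
    then have "\<forall>k. norm (dist (d (J k (T w))) w) \<le> (1/2) ^ k"
      by (simp add: dist_commute less_imp_le)
    moreover have "(\<lambda>k. (1/2::real) ^ k) \<longlonglongrightarrow> 0"
      by (intro LIMSEQ_power_zero) simp
    ultimately have "(\<lambda>k. dist (d (J k (T w))) w) \<longlonglongrightarrow> 0"
      by (rule Lim_null_comparison[OF always_eventually])
    then have lim: "(\<lambda>k. d (J k (T w))) \<longlonglongrightarrow> w"
      by (rule tendsto_dist_iff[THEN iffD2])
    then have "cau (T w)"
      by (simp add: cau_def LIMSEQ_imp_Cauchy)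
    then have "(\<lambda>k. \<delta> k (T w)) \<longlonglongrightarrow> w"
      using lim by (simp add: \<delta>_def)
    then show ?thesis
      by (rule LIMSEQ_unique[OF D_lim])
  qed
  moreover have "0 \<le> T w \<and> T w \<le> 1" for w
    unfolding T_def using binary_digit_base_four(1,2)[of "\<lambda>i. b i w"] by simp
  ultimately show ?thesis
    by (intro that[of T D] T_meas D_meas allI)
qed

section \<open>The filter and the weak continuity of the belief transition\<close>

text \<open>
  One subsequence for countably many sequences: its \<open>k\<close>-th index makes the first \<open>k + 1\<close> integrals
  smaller than \<open>(1/2) ^ k\<close>.
\<close>

lemma L1_null_AE_subsequence:
  fixes f :: "nat \<Rightarrow> nat \<Rightarrow> 'a \<Rightarrow> real"
  assumes int: "\<And>i n. integrable M (f i n)" and nonneg: "\<And>i n x. 0 \<le> f i n x"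
    and lim: "\<And>i. (\<lambda>n. \<integral>x. f i n x \<partial>M) \<longlonglongrightarrow> 0"
  shows "\<exists>r. strict_mono r \<and> (AE x in M. \<forall>i. (\<lambda>k. f i (r k) x) \<longlonglongrightarrow> 0)"
proof -
  have ev: "\<forall>\<^sub>F n in sequentially. \<forall>i\<le>k. (\<integral>x. f i n x \<partial>M) < (1/2) ^ k" for k
  proof -
    have "\<forall>\<^sub>F n in sequentially. \<forall>i\<in>{..k}. (\<integral>x. f i n x \<partial>M) < (1/2) ^ k"
      by (intro eventually_ball_finite ballI order_tendstoD(2)[OF lim]) simp_all
    then show ?thesis
      by (rule eventually_mono) auto
  qed
  have "\<exists>n>m. \<forall>i\<le>k. (\<integral>x. f i n x \<partial>M) < (1/2) ^ k" for m k
    using eventually_conj[OF ev[of k] eventually_gt_at_top[of m]] unfolding eventually_sequentially by blast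
  from strict_mono_selection[where P = "\<lambda>k n. \<forall>i\<le>k. (\<integral>x. f i n x \<partial>M) < (1/2) ^ k", OF this]
  obtain r where mono: "strict_mono r" and r: "\<forall>k. \<forall>i\<le>k. (\<integral>x. f i (r k) x \<partial>M) < (1/2) ^ k"
    by blast
  have "AE x in M. (\<lambda>k. f i (r k) x) \<longlonglongrightarrow> 0" for i
  proof -
    have "AE x in M. (\<lambda>k. f i (r (k + i)) x) \<longlonglongrightarrow> 0"
    proof (rule AE_tendsto_zero_of_geometric_L1[where K = "(1/2) ^ i"])
      show "(\<integral>x. f i (r (k + i)) x \<partial>M) \<le> (1/2) ^ i * (1/2) ^ k" for k
        using r[rule_format, of i "k + i"] by (simp add: power_add mult.commute less_imp_le)
    qed (use int nonneg in auto)
    then show ?thesis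
      by (rule eventually_mono) (rule LIMSEQ_offset)
  qed
  then have "AE x in M. \<forall>i. (\<lambda>k. f i (r k) x) \<longlonglongrightarrow> 0"
    by (simp add: AE_all_countable)
  then show ?thesis
    using mono by blast
qed

lemma LIMSEQ_from_subsequences:
  fixes x :: "nat \<Rightarrow> real"
  assumes "\<And>r :: nat \<Rightarrow> nat. strict_mono r \<Longrightarrow> \<exists>r'. strict_mono r' \<and> (\<lambda>k. x (r (r' k))) \<longlonglongrightarrow> l"
  shows "x \<longlonglongrightarrow> l"
proof (rule ccontr)
  assume "\<not> x \<longlonglongrightarrow> l"
  then obtain e where e: "0 < e" "\<exists>\<^sub>F n in sequentially. e \<le> dist (x n) l"
    unfolding tendsto_iff by (auto simp: not_eventually not_less)
  then have "infinite {n. e \<le> dist (x n) l}"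
    by (simp add: frequently_cofinite[symmetric] cofinite_eq_sequentially)
  then obtain r :: "nat \<Rightarrow> nat" where r: "strict_mono r" "\<And>n. r n \<in> {n. e \<le> dist (x n) l}"
    using infinite_enumerate by blast
  obtain r' where "strict_mono r'" "(\<lambda>k. x (r (r' k))) \<longlonglongrightarrow> l"
    using assms[OF r(1)] by blast
  then have "\<forall>\<^sub>F k in sequentially. dist (x (r (r' k))) l < e"
    using e(1) by (intro tendstoD)
  then obtain k where "dist (x (r (r' k))) l < e"
    by (auto simp: eventually_sequentially)
  then show False
    using r(2)[of "r' k"] by simp
qed

locale feller_filter = feller_family +
  fixes H
  assumes H_meas: "H \<in> BS \<Otimes>\<^sub>M B2 \<rightarrow>\<^sub>M prob_algebra B1"
    and H_dis: "\<And>s B C. s \<in> topspace S \<Longrightarrow> B \<in> sets B1 \<Longrightarrow> C \<in> sets B2 \<Longrightarrow>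
       emeasure (R s) (B \<times> C) = (\<integral>\<^sup>+y. emeasure (H (s, y)) B * indicator C y \<partial>\<mu> s)"
begin

lemma H_prob: "s \<in> topspace S \<Longrightarrow> y \<in> topspace S2 \<Longrightarrow> H (s, y) \<in> prob_measures S1"
  using measurable_space[OF H_meas, of "(s, y)"] by (simp add: space_pair_measure prob_measures_def)

lemma H_sec: "s \<in> topspace S \<Longrightarrow> (\<lambda>y. H (s, y)) \<in> B2 \<rightarrow>\<^sub>M prob_algebra B1"
  by (rule section_measurable[OF H_meas]) simp_all

lemma \<mu>_prob_measures: "s \<in> topspace S \<Longrightarrow> \<mu> s \<in> prob_measures S2"
  using \<mu>_prob by (simp add: prob_measures_iff)

text \<open>
  The disintegration determines \<open>R s\<close> on rectangles, which generate the product field.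
\<close>

lemma R_eq_bind:
  assumes s: "s \<in> topspace S"
  shows "R s = \<mu> s \<bind> (\<lambda>y. distr (H (s, y)) (B1 \<Otimes>\<^sub>M B2) (\<lambda>w. (w, y)))"
    "(\<lambda>y. distr (H (s, y)) (B1 \<Otimes>\<^sub>M B2) (\<lambda>w. (w, y))) \<in> B2 \<rightarrow>\<^sub>M prob_algebra (B1 \<Otimes>\<^sub>M B2)"
proof -
  let ?K = "\<lambda>y. distr (H (s, y)) (B1 \<Otimes>\<^sub>M B2) (\<lambda>w. (w, y))"
  show K: "?K \<in> B2 \<rightarrow>\<^sub>M prob_algebra (B1 \<Otimes>\<^sub>M B2)"
    by (rule measurable_distr_prob_space2[OF H_sec[OF s]]) measurable
  interpret Rs: prob_space "R s"
    using R_space(3)[OF s] .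
  have m: "\<mu> s \<in> space (prob_algebra B2)"
    using \<mu>_prob_measures[OF s] by (simp add: prob_measures_def)
  have ne: "space (\<mu> s) \<noteq> {}"
    using prob_space.not_empty[OF \<mu>_prob(1)[OF s]] .
  have Kx: "?K \<in> \<mu> s \<rightarrow>\<^sub>M subprob_algebra (B1 \<Otimes>\<^sub>M B2)"
    using measurable_prob_algebraD[OF K] measurable_cong_sets[OF \<mu>_prob(2) refl] by blast
  have b: "sets (\<mu> s \<bind> ?K) = sets (B1 \<Otimes>\<^sub>M B2)"
    using sets_bind[OF _ ne, of ?K "B1 \<Otimes>\<^sub>M B2"] by simp
  show "R s = \<mu> s \<bind> ?K"
  proof (rule measure_eqI_generator_eq[OF Int_stable_pair_measure_generator,
        where \<Omega>="space B1 \<times> space B2" and A="\<lambda>_. space B1 \<times> space B2"])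
    show "{a \<times> b |a b. a \<in> sets B1 \<and> b \<in> sets B2} \<subseteq> Pow (space B1 \<times> space B2)"
      using sets.sets_into_space[of _ B1] sets.sets_into_space[of _ B2] by blast
    show "sets (R s) = sigma_sets (space B1 \<times> space B2) {a \<times> b |a b. a \<in> sets B1 \<and> b \<in> sets B2}"
      "sets (\<mu> s \<bind> ?K) = sigma_sets (space B1 \<times> space B2) {a \<times> b |a b. a \<in> sets B1 \<and> b \<in> sets B2}"
      using R_space(1)[OF s] b by (simp_all add: sets_pair_measure)
    show "range (\<lambda>_. space B1 \<times> space B2) \<subseteq> {a \<times> b |a b. a \<in> sets B1 \<and> b \<in> sets B2}"
      using sets.top[of B1] sets.top[of B2] by blast
    fix X assume "X \<in> {a \<times> b |a b. a \<in> sets B1 \<and> b \<in> sets B2}"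
    then obtain A C where X: "X = A \<times> C" "A \<in> sets B1" "C \<in> sets B2"
      by blast
    have "emeasure (\<mu> s \<bind> ?K) X = (\<integral>\<^sup>+y. emeasure (?K y) X \<partial>\<mu> s)"
      using X by (intro emeasure_bind[OF ne Kx]) auto
    also have "\<dots> = (\<integral>\<^sup>+y. emeasure (H (s, y)) A * indicator C y \<partial>\<mu> s)"
    proof (rule nn_integral_cong)
      fix y assume "y \<in> space (\<mu> s)"
      then have y: "y \<in> topspace S2"
        by (simp add: \<mu>_prob)
      have "(\<lambda>w. (w, y)) \<in> B1 \<rightarrow>\<^sub>M B1 \<Otimes>\<^sub>M B2"
        using y by simp
      then have "(\<lambda>w. (w, y)) \<in> H (s, y) \<rightarrow>\<^sub>M B1 \<Otimes>\<^sub>M B2"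
        by (rule measurable_prob_measures[OF H_prob[OF s y]])
      then have "emeasure (?K y) X = emeasure (H (s, y)) ((\<lambda>w. (w, y)) -` X \<inter> space (H (s, y)))"
        using X by (simp add: emeasure_distr)
      also have "(\<lambda>w. (w, y)) -` X \<inter> space (H (s, y)) = (if y \<in> C then A else {})"
        using X sets.sets_into_space[OF X(2)] prob_measuresD(3)[OF H_prob[OF s y]] by auto
      finally show "emeasure (?K y) X = emeasure (H (s, y)) A * indicator C y"
        by (auto split: split_indicator)
    qed
    also have "\<dots> = emeasure (R s) X"
      using H_dis[OF s X(2,3)] X(1) by simp
    finally show "emeasure (R s) X = emeasure (\<mu> s \<bind> ?K) X"
      by simp
  qed (use Rs.emeasure_finite in auto)
qed

lemma cross_integral_disintegration:
  assumes s: "s \<in> topspace S" and f: "bounded_continuous S1 f" and C: "C \<in> sets B2"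
  shows "cross_integral f C (R s) = (\<integral>y. (\<integral>w. f w \<partial>H (s, y)) * indicator C y \<partial>\<mu> s)"
proof -
  let ?K = "\<lambda>y. distr (H (s, y)) (B1 \<Otimes>\<^sub>M B2) (\<lambda>w. (w, y))"
  obtain b where b: "0 \<le> b" "\<forall>x\<in>topspace S1. \<bar>f x\<bar> \<le> b"
    by (rule bounded_continuousE[OF f])
  have fm: "f \<in> borel_measurable B1"
    by (rule bounded_continuous_measurable[OF f])
  have meas: "(\<lambda>p. f (fst p) * indicator C (snd p)) \<in> borel_measurable (B1 \<Otimes>\<^sub>M B2)"
    using measurable_compose[OF measurable_fst fm, of B2]
      measurable_compose[OF measurable_snd borel_measurable_indicator[OF C], of B1]
    by (intro borel_measurable_times)
  have bd: "\<bar>f (fst p) * indicator C (snd p)\<bar> \<le> b" if "p \<in> space (B1 \<Otimes>\<^sub>M B2)" for p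
    using that b by (auto simp: space_pair_measure split: split_indicator)
  have m: "\<mu> s \<in> space (prob_algebra B2)"
    using \<mu>_prob_measures[OF s] by (simp add: prob_measures_def)
  have "cross_integral f C (R s) = (\<integral>y. (\<integral>p. f (fst p) * indicator C (snd p) \<partial>?K y) \<partial>\<mu> s)"
    unfolding cross_integral_def by (subst R_eq_bind(1)[OF s]) (rule integral_bind_bounded(1)[OF m R_eq_bind(2)[OF s] meas bd])
  also have "\<dots> = (\<integral>y. (\<integral>w. f w \<partial>H (s, y)) * indicator C y \<partial>\<mu> s)"
  proof (rule Bochner_Integration.integral_cong[OF refl])
    fix y assume "y \<in> space (\<mu> s)"
    then have y: "y \<in> topspace S2"
      by (simp add: \<mu>_prob)
    have "(\<lambda>w. (w, y)) \<in> B1 \<rightarrow>\<^sub>M B1 \<Otimes>\<^sub>M B2"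
      using y by simp
    then have "(\<lambda>w. (w, y)) \<in> H (s, y) \<rightarrow>\<^sub>M B1 \<Otimes>\<^sub>M B2"
      by (rule measurable_prob_measures[OF H_prob[OF s y]])
    then show "(\<integral>p. f (fst p) * indicator C (snd p) \<partial>?K y) = (\<integral>w. f w \<partial>H (s, y)) * indicator C y"
      using meas by (simp add: integral_distr)
  qed
  finally show ?thesis .
qed

lemma conditional_integral_bounded:
  assumes s: "s \<in> topspace S" and f: "bounded_continuous S1 f" and b: "\<forall>x\<in>topspace S1. \<bar>f x\<bar> \<le> b"
  shows "(\<lambda>y. \<integral>w. f w \<partial>H (s, y)) \<in> borel_measurable B2"
    "y \<in> topspace S2 \<Longrightarrow> \<bar>\<integral>w. f w \<partial>H (s, y)\<bar> \<le> b"
proof -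
  show "(\<lambda>y. \<integral>w. f w \<partial>H (s, y)) \<in> borel_measurable B2"
    by (rule measurable_compose[OF measurable_prob_algebraD[OF H_sec[OF s]]
          integral_measurable_subprob_algebra[OF bounded_continuous_measurable[OF f]]])
  assume y: "y \<in> topspace S2"
  note Hp = H_prob[OF s y]
  show "\<bar>\<integral>w. f w \<partial>H (s, y)\<bar> \<le> b"
    using b prob_measuresD[OF Hp]
    by (intro prob_space_bounded_integral(2) measurable_prob_measures[OF Hp] bounded_continuous_measurable[OF f]) auto
qed

text \<open>
  Total variation convergence of the observation laws turns the Feller property into convergence
  of the integrals of \<open>h n - h'\<close> over sets \<open>E n\<close> with respect to the fixed law \<open>\<mu> l\<close>. With \<open>E n\<close> the set on which
  \<open>h n - h'\<close> is nonnegative, and its complement, this is convergence in \<open>L\<^sup>1\<close>.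
\<close>

lemma conditional_integral_L1:
  assumes s: "limitin S s l sequentially" "range s \<subseteq> topspace S" and f: "bounded_continuous S1 f"
  shows "(\<lambda>n. \<integral>y. \<bar>(\<integral>w. f w \<partial>H (s n, y)) - (\<integral>w. f w \<partial>H (l, y))\<bar> \<partial>\<mu> l) \<longlonglongrightarrow> 0"
proof -
  have top: "s n \<in> topspace S" "l \<in> topspace S" for n
    using s(2) limitin_topspace[OF s(1)] by auto
  obtain b where b: "0 \<le> b" "\<forall>x\<in>topspace S1. \<bar>f x\<bar> \<le> b"
    by (rule bounded_continuousE[OF f])
  define h where "h n y = (\<integral>w. f w \<partial>H (s n, y))" for n y
  define h' where "h' y = (\<integral>w. f w \<partial>H (l, y))" for y
  have hm: "(\<lambda>y. h n y) \<in> borel_measurable B2" "(\<lambda>y. h' y) \<in> borel_measurable B2"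
    and hb: "y \<in> topspace S2 \<Longrightarrow> \<bar>h n y\<bar> \<le> b" "y \<in> topspace S2 \<Longrightarrow> \<bar>h' y\<bar> \<le> b" for n y
    unfolding h_def h'_def
    using conditional_integral_bounded[OF top(1) f b(2)] conditional_integral_bounded[OF top(2) f b(2)] by auto
  note [measurable] = hm
  have conv: "(\<lambda>n. (\<integral>y. h n y * indicator (E n) y \<partial>\<mu> l) - (\<integral>y. h' y * indicator (E n) y \<partial>\<mu> l)) \<longlonglongrightarrow> 0"
    if E: "\<And>n. E n \<in> sets B2" for E
  proof -
    have 1: "(\<lambda>n. (\<integral>y. h n y * indicator (E n) y \<partial>\<mu> (s n)) - (\<integral>y. h n y * indicator (E n) y \<partial>\<mu> l)) \<longlonglongrightarrow> 0"
    proof (rule tv_convergence_bounded_functions[where N=B2 and b=b])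
      show "(\<lambda>n. measure (\<mu> (s n)) (B n) - measure (\<mu> l) (B n)) \<longlonglongrightarrow> 0" if "range B \<subseteq> sets B2" for B
        by (rule \<mu>_tv_continuous[OF s that])
      show "(\<lambda>y. h n y * indicator (E n) y) \<in> borel_measurable B2" for n
        using E by (intro borel_measurable_times hm borel_measurable_indicator)
      show "\<bar>h n y * indicator (E n) y\<bar> \<le> b" if "y \<in> space B2" for n y
        using hb(1)[of y n] that b(1) by (auto split: split_indicator)
    qed (use \<mu>_prob top in auto)
    have 2: "(\<lambda>n. (\<integral>y. h n y * indicator (E n) y \<partial>\<mu> (s n)) - (\<integral>y. h' y * indicator (E n) y \<partial>\<mu> l)) \<longlonglongrightarrow> 0"
      using feller_along_setsD[OF feller s f E]
      unfolding cross_integral_disintegration[OF top(1) f E] cross_integral_disintegration[OF top(2) f E]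
        h_def h'_def .
    show ?thesis
      using tendsto_diff[OF 2 1] by simp
  qed
  have int: "integrable (\<mu> l) (h n)" "integrable (\<mu> l) h'" for n
    using bounded_measurable_integrable[OF \<mu>_prob_measures[OF top(2)] hm(1) hb(1)]
      bounded_measurable_integrable[OF \<mu>_prob_measures[OF top(2)] hm(2) hb(2)] by auto
  note d = integral_abs_diff[OF int]
  let ?C = "\<lambda>n. {y \<in> space (\<mu> l). h' y \<le> h n y}" and ?D = "\<lambda>n. {y \<in> space (\<mu> l). \<not> h' y \<le> h n y}"
  have "?C n \<in> sets B2" "?D n \<in> sets B2" for n
    using d(1)[of n] d(2)[of n] \<mu>_prob(2)[of l] by blast+
  then have "(\<lambda>n. \<integral>y. \<bar>h n y - h' y\<bar> \<partial>\<mu> l) \<longlonglongrightarrow> 0"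
    unfolding d(3) using tendsto_diff[OF conv[of ?C] conv[of ?D]] by simp
  then show ?thesis
    unfolding h_def h'_def .
qed

text \<open>
  Along a subsequence the posteriors converge weakly for almost every observation under the
  limiting law, so the integrals of \<open>F\<close> converge under that law, and total variation convergence
  replaces it by the laws of the sequence. A limit that exists along suitable subsequences of all
  subsequences is a limit of the sequence.
\<close>

lemma filter_law_continuous:
  assumes s: "limitin S s l sequentially" "range s \<subseteq> topspace S"
    and F: "bounded_continuous (weak_topology S1) F"
  shows "(\<lambda>n. \<integral>y. F (H (s n, y)) \<partial>\<mu> (s n)) \<longlonglongrightarrow> (\<integral>y. F (H (l, y)) \<partial>\<mu> l)"
proof (rule LIMSEQ_from_subsequences)
  fix r :: "nat \<Rightarrow> nat" assume r: "strict_mono r"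
  have sr: "limitin S (\<lambda>n. s (r n)) l sequentially" "range (\<lambda>n. s (r n)) \<subseteq> topspace S"
    using limitin_subsequence[OF r s(1)] s(2) by (auto simp: comp_def)
  have top: "s n \<in> topspace S" "l \<in> topspace S" for n
    using s(2) limitin_topspace[OF s(1)] by auto
  obtain \<gamma> :: "nat \<Rightarrow> 'b \<Rightarrow> real" where \<gamma>: "\<And>i. bounded_continuous S1 (\<gamma> i)"
    "\<And>\<mu>s \<mu>. \<mu> \<in> prob_measures S1 \<Longrightarrow> (\<And>n. \<mu>s n \<in> prob_measures S1) \<Longrightarrow>
       (\<And>i. (\<lambda>n. \<integral>x. \<gamma> i x \<partial>\<mu>s n) \<longlonglongrightarrow> (\<integral>x. \<gamma> i x \<partial>\<mu>)) \<Longrightarrow>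
       limitin (weak_topology S1) \<mu>s \<mu> sequentially"
    "\<And>\<mu> \<nu>. \<mu> \<in> prob_measures S1 \<Longrightarrow> \<nu> \<in> prob_measures S1 \<Longrightarrow>
       (\<And>i. (\<integral>x. \<gamma> i x \<partial>\<mu>) = (\<integral>x. \<gamma> i x \<partial>\<nu>)) \<Longrightarrow> \<mu> = \<nu>"
    using weak_convergence_determining_sequence[OF sep(2)] by blast
  interpret m: prob_space "\<mu> l"
    using \<mu>_prob(1)[OF top(2)] .
  define f where "f i n = (\<lambda>y. \<bar>(\<integral>w. \<gamma> i w \<partial>H (s (r n), y)) - (\<integral>w. \<gamma> i w \<partial>H (l, y))\<bar>)" for i n
  have "\<exists>r'. strict_mono r' \<and> (AE y in \<mu> l. \<forall>i. (\<lambda>k. f i (r' k) y) \<longlonglongrightarrow> 0)"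
  proof (rule L1_null_AE_subsequence)
    show "integrable (\<mu> l) (f i n)" for i n
    proof -
      obtain b where b: "0 \<le> b" "\<forall>x\<in>topspace S1. \<bar>\<gamma> i x\<bar> \<le> b"
        by (rule bounded_continuousE[OF \<gamma>(1)])
      note c1 = conditional_integral_bounded[OF top(1) \<gamma>(1) b(2)]
      note c2 = conditional_integral_bounded[OF top(2) \<gamma>(1) b(2)]
      have "integrable (\<mu> l) (\<lambda>y. \<integral>w. \<gamma> i w \<partial>H (s (r n), y))" "integrable (\<mu> l) (\<lambda>y. \<integral>w. \<gamma> i w \<partial>H (l, y))"
        by (rule bounded_measurable_integrable[OF \<mu>_prob_measures[OF top(2)] c1(1) c1(2)]
            bounded_measurable_integrable[OF \<mu>_prob_measures[OF top(2)] c2(1) c2(2)], assumption)+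
      then show ?thesis
        unfolding f_def by simp
    qed
    show "(\<lambda>n. \<integral>y. f i n y \<partial>\<mu> l) \<longlonglongrightarrow> 0" for i
      unfolding f_def by (rule conditional_integral_L1[OF sr \<gamma>(1)])
  qed (simp add: f_def)
  then obtain r' where r': "strict_mono r'" "AE y in \<mu> l. \<forall>i. (\<lambda>k. f i (r' k) y) \<longlonglongrightarrow> 0"
    by blast
  define t where "t k = s (r (r' k))" for k
  have tt: "t k \<in> topspace S" for k
    using top by (simp add: t_def)
  obtain b where b: "0 \<le> b" "\<forall>\<mu>\<in>prob_measures S1. \<bar>F \<mu>\<bar> \<le> b"
    using bounded_continuousE[OF F] unfolding topspace_weak_topology by blast
  have Fm: "F \<in> borel_measurable (prob_algebra B1)"
    using bounded_continuous_measurable[OF F] measurable_cong_sets[OF sets_borel_of_weak_topology[OF sep(2)] refl]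
    by blast
  have FH: "(\<lambda>y. F (H (u, y))) \<in> borel_measurable B2" if "u \<in> topspace S" for u
    by (rule measurable_compose[OF H_sec[OF that] Fm])
  have FHb: "\<bar>F (H (u, y))\<bar> \<le> b" if "u \<in> topspace S" "y \<in> topspace S2" for u y
    using b(2) H_prob[OF that] by blast
  have "AE y in \<mu> l. (\<lambda>k. F (H (t k, y))) \<longlonglongrightarrow> F (H (l, y))"
    using r'(2) AE_space
  proof eventually_elim
    case (elim y)
    then have y: "y \<in> topspace S2"
      by (simp add: \<mu>_prob)
    have "limitin (weak_topology S1) (\<lambda>k. H (t k, y)) (H (l, y)) sequentially"
    proof (rule \<gamma>(2))
      show "H (l, y) \<in> prob_measures S1" "H (t k, y) \<in> prob_measures S1" for k
        using H_prob[OF top(2) y] H_prob[OF tt y] by auto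
      fix i
      have "(\<lambda>k. f i (r' k) y) \<longlonglongrightarrow> 0"
        using elim(1) by blast
      then have "(\<lambda>k. (\<integral>w. \<gamma> i w \<partial>H (t k, y)) - (\<integral>w. \<gamma> i w \<partial>H (l, y))) \<longlonglongrightarrow> 0"
        unfolding f_def t_def by (rule tendsto_rabs_zero_cancel)
      then show "(\<lambda>k. \<integral>w. \<gamma> i w \<partial>H (t k, y)) \<longlonglongrightarrow> (\<integral>w. \<gamma> i w \<partial>H (l, y))"
        by (simp add: LIM_zero_iff)
    qed
    then show ?case
      using continuous_map_limit[of "weak_topology S1" euclideanreal F] F
      by (fastforce simp: bounded_continuous_def comp_def)
  qed
  then have 1: "(\<lambda>k. \<integral>y. F (H (t k, y)) \<partial>\<mu> l) \<longlonglongrightarrow> (\<integral>y. F (H (l, y)) \<partial>\<mu> l)"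
  proof (rule integral_dominated_convergence[where w="\<lambda>_. b", rotated 3])
    show "(\<lambda>y. F (H (l, y))) \<in> borel_measurable (\<mu> l)" "(\<lambda>y. F (H (t k, y))) \<in> borel_measurable (\<mu> l)" for k
      by (rule measurable_prob_measures[OF \<mu>_prob_measures[OF top(2)] FH[OF top(2)]]
          measurable_prob_measures[OF \<mu>_prob_measures[OF top(2)] FH[OF tt]])+
    show "AE y in \<mu> l. norm (F (H (t k, y))) \<le> b" for k
      using FHb[OF tt] by (intro AE_I2) (simp add: \<mu>_prob)
  qed simp
  have 2: "(\<lambda>k. (\<integral>y. F (H (t k, y)) \<partial>\<mu> (t k)) - (\<integral>y. F (H (t k, y)) \<partial>\<mu> l)) \<longlonglongrightarrow> 0"
  proof (rule tv_convergence_bounded_functions[where N=B2 and b=b])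
    have "limitin S t l sequentially"
      using limitin_subsequence[OF r'(1) sr(1)] by (simp add: comp_def t_def[abs_def])
    then show "(\<lambda>n. measure (\<mu> (t n)) (B n) - measure (\<mu> l) (B n)) \<longlonglongrightarrow> 0" if "range B \<subseteq> sets B2" for B
      using tt that by (intro \<mu>_tv_continuous) auto
    show "\<bar>F (H (t n, y))\<bar> \<le> b" if "y \<in> space B2" for n y
      using FHb[OF tt] that by simp
  qed (use \<mu>_prob tt top(2) FH[OF tt] in auto)
  have "(\<lambda>k. \<integral>y. F (H (t k, y)) \<partial>\<mu> (t k)) \<longlonglongrightarrow> (\<integral>y. F (H (l, y)) \<partial>\<mu> l)"
    using tendsto_add[OF 2 1] by simp
  then show "\<exists>r'. strict_mono r' \<and> (\<lambda>k. \<integral>y. F (H (s (r (r' k)), y)) \<partial>\<mu> (s (r (r' k)))) \<longlonglongrightarrow> (\<integral>y. F (H (l, y)) \<partial>\<mu> l)"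
    using r'(1) unfolding t_def by blast
qed

end

lemma top_of_set_Times: "top_of_set (A \<times> B) = prod_topology (top_of_set A) (top_of_set B)"
  by simp

lemma belief_feller_family:
  fixes W :: "'w::polish_space set" and Y :: "'y::polish_space set" and A :: "'a::polish_space set"
  assumes P: "stochastic_kernel (top_of_set (W \<times> Y)) (top_of_set (W \<times> A)) P"
    and F: "feller_along_sets (top_of_set W) (top_of_set Y) (top_of_set (W \<times> A)) P"
    and ne: "topspace (prod_topology (beliefs W) (top_of_set A)) \<noteq> {}"
  shows "feller_family (prod_topology (beliefs W) (top_of_set A)) (top_of_set W) (top_of_set Y)
    (\<lambda>(z, a). belief_joint P z a)"
proof
  have sm: "separable_metrizable (top_of_set W)" "separable_metrizable (top_of_set Y)" "separable_metrizable (top_of_set A)"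
    by (rule separable_metrizable_top_of_set)+
  then have sc: "second_countable (top_of_set W)" "second_countable (top_of_set A)"
    by (auto simp: separable_metrizable_def)
  show "separable_metrizable (prod_topology (beliefs W) (top_of_set A))"
    by (intro separable_metrizable_prod_topology separable_metrizable_weak_topology sm)
  show "(case s of (z, a) \<Rightarrow> belief_joint P z a) \<in> prob_measures (prod_topology (top_of_set W) (top_of_set Y))"
    if "s \<in> topspace (prod_topology (beliefs W) (top_of_set A))" for s
    using that belief_joint_prob_measures(2)[OF P[unfolded top_of_set_Times[of W A]] sc]
    by (auto simp: topspace_weak_topology split_beta)
  show "feller_along_sets (top_of_set W) (top_of_set Y) (prod_topology (beliefs W) (top_of_set A))
      (\<lambda>(z, a). belief_joint P z a)"
    by (rule belief_joint_feller_along_sets[OF sm P[unfolded top_of_set_Times] F[unfolded top_of_set_Times]])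
qed (use ne separable_metrizable_top_of_set in auto)

text \<open>
  The decoding function of \<open>polish_space_real_code\<close> may leave \<open>W\<close> on numbers that code no state of
  \<open>W\<close>; there it is redefined to a fixed state \<open>w0\<close>, which is Borel because \<open>W\<close> is.
\<close>

lemma is_filter_kernel_exists:
  fixes W :: "'w::polish_space set" and Y :: "'y::polish_space set" and A :: "'a::polish_space set"
  assumes W: "W \<in> sets borel"
    and P: "stochastic_kernel (top_of_set (W \<times> Y)) (top_of_set (W \<times> A)) P"
    and F: "feller_along_sets (top_of_set W) (top_of_set Y) (top_of_set (W \<times> A)) P"
  shows "\<exists>H. is_filter_kernel W Y A P H"
proof (cases "topspace (prod_topology (beliefs W) (top_of_set A)) = {}")
  case True
  let ?H = "\<lambda>_. undefined :: 'w measure"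
  have "topspace (beliefs W) = {} \<or> A = {}"
    using True by (simp add: topspace_prod_topology del: prod_topology_trivial_iff prod_topology_subtopology_eu)
  moreover from this have "space (borel_of (prod_topology (beliefs W) (top_of_set (A \<times> Y)))) = {}"
    by auto
  then have "?H \<in> borel_of (prod_topology (beliefs W) (top_of_set (A \<times> Y))) \<rightarrow>\<^sub>M prob_algebra (borel_of (top_of_set W))"
    by (auto simp: measurable_def)
  ultimately have "is_filter_kernel W Y A P ?H"
    unfolding is_filter_kernel_def stochastic_kernel_def by blast
  then show ?thesis
    by blast
next
  case False
  let ?S = "prod_topology (beliefs W) (top_of_set A)"
  interpret feller_family ?S "top_of_set W" "top_of_set Y" "\<lambda>(z, a). belief_joint P z a"
    by (rule belief_feller_family[OF P F False])
  obtain s where "s \<in> topspace ?S"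
    using False by blast
  then have "fst s \<in> prob_measures (top_of_set W)"
    by (auto simp: topspace_weak_topology)
  then have "space (fst s) \<noteq> {}" "space (fst s) = W"
    using prob_measuresD[of "fst s" "top_of_set W"] prob_space.not_empty by auto
  then obtain w0 where w0: "w0 \<in> W"
    by auto
  obtain T :: "'w \<Rightarrow> real" and D :: "real \<Rightarrow> 'w" where TD: "T \<in> borel_measurable borel" "\<forall>w. 0 \<le> T w \<and> T w \<le> 1"
      "D \<in> borel_measurable borel" "\<forall>w. D (T w) = w"
    by (rule polish_space_real_code)
  let ?D = "\<lambda>r. if D r \<in> W then D r else w0"
  have T: "T \<in> borel_measurable B1"
  proof -
    have "(\<lambda>w. w) \<in> borel_measurable B1"
      by (rule continuous_map_borel_measurable) (simp add: continuous_map_in_subtopology)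
    from measurable_compose[OF this TD(1)] show ?thesis .
  qed
  have D: "?D \<in> borel \<rightarrow>\<^sub>M B1"
  proof -
    have [measurable]: "D \<in> borel_measurable borel" "W \<in> sets borel"
      by fact+
    have "?D \<in> borel_measurable borel"
      by measurable
    then show ?thesis
      using w0 by (simp add: measurable_borel_of_top_of_set)
  qed
  have T01: "\<forall>x\<in>topspace (top_of_set W). 0 \<le> T x \<and> T x \<le> 1"
    using TD(2) by simp
  have "\<exists>H. H \<in> BS \<Otimes>\<^sub>M B2 \<rightarrow>\<^sub>M prob_algebra B1 \<and>
    (\<forall>s\<in>topspace ?S. \<forall>B\<in>sets B1. \<forall>C\<in>sets B2.
       emeasure (case s of (z, a) \<Rightarrow> belief_joint P z a) (B \<times> C)
         = (\<integral>\<^sup>+y. emeasure (H (s, y)) B * indicator C y \<partial>\<mu> s))"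
    by (rule disintegration[OF T T01 D]) (simp add: TD(4))
  then obtain H where H: "H \<in> BS \<Otimes>\<^sub>M B2 \<rightarrow>\<^sub>M prob_algebra B1"
    "\<forall>s\<in>topspace ?S. \<forall>B\<in>sets B1. \<forall>C\<in>sets B2.
       emeasure (case s of (z, a) \<Rightarrow> belief_joint P z a) (B \<times> C)
         = (\<integral>\<^sup>+y. emeasure (H (s, y)) B * indicator C y \<partial>\<mu> s)"
    by (elim exE conjE) (rule that)
  (* Only the nesting of the argument changes: a filter kernel takes triples (z, a, y). *)
  define H' where "H' p = H ((fst p, fst (snd p)), snd (snd p))" for p
  have sc': "second_countable (beliefs W)" "second_countable (top_of_set A)" "second_countable (top_of_set Y)"
    using separable_metrizable_weak_topology[OF separable_metrizable_top_of_set[of W]]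
      separable_metrizable_top_of_set[of A] separable_metrizable_top_of_set[of Y] by (auto simp: separable_metrizable_def)
  have "stochastic_kernel (top_of_set W) (prod_topology (beliefs W) (top_of_set (A \<times> Y))) H'"
    unfolding stochastic_kernel_def
  proof -
    note [measurable_cong] = sets_borel_of_prod_topology[OF sc'(1,2)]
      sets_borel_of_prod_topology[OF sc'(2,3)]
      sets_borel_of_prod_topology[OF sc'(1) second_countable_prod_topology[OF sc'(2,3)]]
    note [measurable] = H(1)
    show "H' \<in> borel_of (prod_topology (beliefs W) (top_of_set (A \<times> Y))) \<rightarrow>\<^sub>M prob_algebra B1"
      unfolding top_of_set_Times H'_def[abs_def] by measurable
  qed
  moreover have "emeasure (belief_joint P z a) (B \<times> C) = (\<integral>\<^sup>+y\<in>C. emeasure (H' (z, a, y)) B \<partial>belief_obs Y P z a)"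
    if "z \<in> topspace (beliefs W)" "a \<in> A" "B \<in> sets B1" "C \<in> sets B2" for z a B C
    using H(2)[rule_format, of "(z, a)" B C] that by (simp add: H'_def \<mu>_def belief_obs_def)
  ultimately have "is_filter_kernel W Y A P H'"
    unfolding is_filter_kernel_def by blast
  then show ?thesis
    by blast
qed

text \<open>
  Any filter kernel disintegrates the joint law, so the continuity of the law of the posterior
  applies to the one that defines the belief-MDP.
\<close>

lemma belief_kernel_stochastic_and_continuous:
  fixes W :: "'w::polish_space set" and Y :: "'y::polish_space set" and A :: "'a::polish_space set"
  assumes W: "W \<in> sets borel"
    and P: "stochastic_kernel (top_of_set (W \<times> Y)) (top_of_set (W \<times> A)) P"
    and F: "feller_along_sets (top_of_set W) (top_of_set Y) (top_of_set (W \<times> A)) P"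
  shows "stochastic_kernel (beliefs W) (prod_topology (beliefs W) (top_of_set A)) (belief_kernel W Y A P)"
    "weakly_continuous (beliefs W) (prod_topology (beliefs W) (top_of_set A)) (belief_kernel W Y A P)"
proof -
  let ?S = "prod_topology (beliefs W) (top_of_set A)" and ?q = "belief_kernel W Y A P"
  let ?H = "filter_kernel W Y A P"
  have H: "is_filter_kernel W Y A P ?H"
    unfolding filter_kernel_def by (rule someI_ex[OF is_filter_kernel_exists[OF assms]])
  have "stochastic_kernel (beliefs W) ?S ?q \<and> weakly_continuous (beliefs W) ?S ?q"
  proof (cases "topspace ?S = {}")
    case True
    then have "space (borel_of ?S) = {}"
      by simp
    then have "stochastic_kernel (beliefs W) ?S ?q"
      unfolding stochastic_kernel_def by (auto simp: measurable_def)
    moreover have "weakly_continuous (beliefs W) ?S ?q"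
    proof (rule weakly_continuousI)
      fix s l assume "limitin ?S s l sequentially"
      then have "l \<in> topspace ?S"
        by (rule limitin_topspace)
      then show "limitin (weak_topology (beliefs W)) (\<lambda>n. ?q (s n)) (?q l) sequentially"
        unfolding True by simp
    qed
    ultimately show ?thesis ..
  next
    case False
    let ?R = "\<lambda>(z, a). belief_joint P z a"
    have smX: "separable_metrizable (beliefs W)"
      by (intro separable_metrizable_weak_topology separable_metrizable_top_of_set)
    have sc': "second_countable (beliefs W)" "second_countable (top_of_set A)" "second_countable (top_of_set Y)"
        "second_countable (top_of_set W)"
      using smX separable_metrizable_top_of_set[of A] separable_metrizable_top_of_set[of Y]
        separable_metrizable_top_of_set[of W] by (auto simp: separable_metrizable_def)
    note cong = sets_borel_of_prod_topology[OF sc'(1,2)]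
      sets_borel_of_prod_topology[OF sc'(2,3)] sets_borel_of_prod_topology[OF sc'(4,2)]
      sets_borel_of_prod_topology[OF sc'(1) second_countable_prod_topology[OF sc'(2,3)]]
      sets_borel_of_weak_topology[OF separable_metrizable_top_of_set[of W]]
    interpret feller_family ?S "top_of_set W" "top_of_set Y" ?R
      by (rule belief_feller_family[OF P F False])
    let ?H' = "\<lambda>p. ?H (fst (fst p), snd (fst p), snd p)"
    have Hm: "?H \<in> borel_of (prod_topology (beliefs W) (prod_topology (top_of_set A) (top_of_set Y))) \<rightarrow>\<^sub>M prob_algebra B1"
      using H by (simp add: is_filter_kernel_def stochastic_kernel_def)
    have H'm: "?H' \<in> BS \<Otimes>\<^sub>M B2 \<rightarrow>\<^sub>M prob_algebra B1"
    proof -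
      note [measurable_cong] = cong(1,2,4)
      have "(\<lambda>p. (fst (fst p), snd (fst p), snd p)) \<in>
          BS \<Otimes>\<^sub>M B2 \<rightarrow>\<^sub>M borel_of (prod_topology (beliefs W) (prod_topology (top_of_set A) (top_of_set Y)))"
        by measurable
      then show ?thesis
        by (rule measurable_compose[OF _ Hm])
    qed
    interpret feller_filter ?S "top_of_set W" "top_of_set Y" ?R ?H'
    proof
      show "?H' \<in> BS \<Otimes>\<^sub>M B2 \<rightarrow>\<^sub>M prob_algebra B1"
        by (rule H'm)
      fix s B C assume s: "s \<in> topspace ?S" and B: "B \<in> sets B1" and C: "C \<in> sets B2"
      have "emeasure (belief_joint P (fst s) (snd s)) (B \<times> C)
          = (\<integral>\<^sup>+y\<in>C. emeasure (?H (fst s, snd s, y)) B \<partial>belief_obs Y P (fst s) (snd s))"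
        using H s B C unfolding is_filter_kernel_def by auto
      then show "emeasure (?R s) (B \<times> C)
          = (\<integral>\<^sup>+y. emeasure (?H (fst (fst (s, y)), snd (fst (s, y)), snd (s, y))) B * indicator C y \<partial>\<mu> s)"
        by (simp add: \<mu>_def belief_obs_def split_beta)
    qed
    have q: "?q s = distr (\<mu> s) (borel_of (beliefs W)) (\<lambda>y. ?H' (s, y))" for s
      by (simp add: belief_kernel_def \<mu>_def belief_obs_def split_beta)
    have \<mu>m: "\<mu> \<in> BS \<rightarrow>\<^sub>M prob_algebra B2"
    proof -
      have Pm: "P \<in> borel_of (prod_topology (top_of_set W) (top_of_set A)) \<rightarrow>\<^sub>M prob_algebra (borel_of (top_of_set (W \<times> Y)))"
        using P by (simp add: stochastic_kernel_def)
      have "(\<lambda>p. (snd p, snd (fst p))) \<in> BS \<Otimes>\<^sub>M B1 \<rightarrow>\<^sub>M borel_of (prod_topology (top_of_set W) (top_of_set A))"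
      proof -
        note [measurable_cong] = cong(1,3)
        show ?thesis
          by measurable
      qed
      then have K: "(\<lambda>p. P (snd p, snd (fst p))) \<in> BS \<Otimes>\<^sub>M B1 \<rightarrow>\<^sub>M prob_algebra (borel_of (top_of_set (W \<times> Y)))"
        by (rule measurable_compose[OF _ Pm])
      have "fst \<in> BS \<rightarrow>\<^sub>M borel_of (beliefs W)"
        by (rule continuous_map_measurable[OF continuous_map_fst])
      then have "fst \<in> BS \<rightarrow>\<^sub>M prob_algebra B1"
        using measurable_cong_sets[OF refl cong(5)] by blast
      then have "(\<lambda>s. fst s \<bind> (\<lambda>w. P (w, snd s))) \<in> BS \<rightarrow>\<^sub>M prob_algebra (borel_of (top_of_set (W \<times> Y)))"
        by (rule measurable_bind_prob_space2) (use K in \<open>simp add: split_beta\<close>)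
      moreover have "snd \<in> borel_of (top_of_set (W \<times> Y)) \<rightarrow>\<^sub>M B2"
        unfolding top_of_set_Times by (rule continuous_map_measurable[OF continuous_map_snd])
      ultimately have "(\<lambda>s. distr (fst s \<bind> (\<lambda>w. P (w, snd s))) B2 snd) \<in> BS \<rightarrow>\<^sub>M prob_algebra B2"
        by (rule measurable_compose[OF _ measurable_distr_prob_space])
      moreover have "\<mu> = (\<lambda>s. distr (fst s \<bind> (\<lambda>w. P (w, snd s))) B2 snd)"
      proof (rule ext)
        fix s
        show "\<mu> s = distr (fst s \<bind> (\<lambda>w. P (w, snd s))) B2 snd"
          unfolding \<mu>_def by (simp add: belief_joint_def split_beta)
      qed
      ultimately show ?thesis
        by simp
    qed
    have H'X: "?H' \<in> BS \<Otimes>\<^sub>M B2 \<rightarrow>\<^sub>M borel_of (beliefs W)"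
      using H'm measurable_cong_sets[OF refl cong(5)] by blast
    have "stochastic_kernel (beliefs W) ?S ?q"
      unfolding stochastic_kernel_def q[abs_def]
      by (rule measurable_distr_prob_space2[OF \<mu>m]) (use H'X in \<open>simp add: split_beta\<close>)
    moreover have "weakly_continuous (beliefs W) ?S ?q"
    proof (rule weakly_continuousI)
      fix s l assume s: "limitin ?S s l sequentially" "range s \<subseteq> topspace ?S"
      have sn: "s n \<in> topspace ?S" for n
        using s(2) by auto
      have int: "(\<integral>x. G x \<partial>?q u) = (\<integral>y. G (?H' (u, y)) \<partial>\<mu> u)"
        if "u \<in> topspace ?S" and G: "bounded_continuous (beliefs W) G" for u G
        unfolding q
      proof (rule integral_distr)
        show "(\<lambda>y. ?H' (u, y)) \<in> \<mu> u \<rightarrow>\<^sub>M borel_of (beliefs W)"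
          using section_measurable[OF H'X \<open>u \<in> topspace ?S\<close> \<mu>_prob(2)] .
      qed (rule bounded_continuous_measurable[OF G])
      have "(\<lambda>n. \<integral>x. G x \<partial>?q (s n)) \<longlonglongrightarrow> (\<integral>x. G x \<partial>?q l)" if G: "bounded_continuous (beliefs W) G" for G
        using filter_law_continuous[OF s G] unfolding int[OF sn G] int[OF limitin_topspace[OF s(1)] G] .
      then show "limitin (weak_topology (beliefs W)) (\<lambda>n. ?q (s n)) (?q l) sequentially"
        using stochastic_kernelD[OF \<open>stochastic_kernel (beliefs W) ?S ?q\<close>] sn limitin_topspace[OF s(1)]
        by (simp add: limitin_weak_topology)
    qed
    ultimately show ?thesis ..
  qed
  then show "stochastic_kernel (beliefs W) ?S ?q" "weakly_continuous (beliefs W) ?S ?q"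
    by auto
qed

section \<open>Inf-compact costs\<close>

lemma enn2ereal_le_ereal_iff: "0 \<le> r \<Longrightarrow> enn2ereal x \<le> ereal r \<longleftrightarrow> x \<le> ennreal r"
  by (simp add: less_eq_ennreal.rep_eq enn2ereal_ennreal)

lemma metrizable_convergent_sequence_compact:
  assumes "metrizable_space X" "limitin X \<sigma> l sequentially" "range \<sigma> \<subseteq> topspace X"
  shows "compactin X (insert l (range \<sigma>))"
  using assms limitin_topspace[OF assms(2)] metrizable_imp_Hausdorff_space
  by (intro compactin_sequence_with_limit[OF assms(2)]) auto

text \<open>
  The form in which inf-compactness is used: bounded costs along a convergent sequence of states
  leave a convergent subsequence of actions. A convergent sequence together with its limit
  is compact.
\<close>

lemma K_inf_compact_subsequence:
  assumes met: "metrizable_space S1" "metrizable_space S2"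
    and K: "K_inf_compact S1 S2 (\<lambda>s. enn2ereal (c s))"
    and x: "limitin S1 x l sequentially" "\<And>n. x n \<in> topspace S1" and a: "\<And>n. a n \<in> topspace S2"
    and le: "\<And>n. c (x n, a n) \<le> ennreal r" and r: "0 \<le> r"
  obtains \<rho> b where "strict_mono \<rho>" "limitin S2 (\<lambda>k. a (\<rho> k)) b sequentially" "c (l, b) \<le> ennreal r"
proof -
  have metP: "metrizable_space (prod_topology S1 S2)"
    using met by (simp add: metrizable_space_prod_topology)
  define L where "L = {s \<in> insert l (range x) \<times> topspace S2. enn2ereal (c s) \<le> ereal r}"
  have "compactin S1 (insert l (range x))"
    using x by (intro metrizable_convergent_sequence_compact[OF met(1)]) auto
  then have "compactin (prod_topology S1 S2) L"
    unfolding L_def using K by (simp add: K_inf_compact_def)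
  moreover have "range (\<lambda>n. (x n, a n)) \<subseteq> L"
    using a le r by (auto simp: L_def enn2ereal_le_ereal_iff)
  ultimately obtain m \<rho> where m: "m \<in> L" "strict_mono \<rho>"
      "limitin (prod_topology S1 S2) ((\<lambda>n. (x n, a n)) \<circ> \<rho>) m sequentially"
    unfolding metrizable_compactin_sequentially[OF metP] by blast
  then have lim: "limitin S1 (\<lambda>k. x (\<rho> k)) (fst m) sequentially" "limitin S2 (\<lambda>k. a (\<rho> k)) (snd m) sequentially"
    by (auto simp: limitin_pairwise comp_def)
  have "limitin S1 (\<lambda>k. x (\<rho> k)) l sequentially"
    using limitin_subsequence[OF m(2) x(1)] by (simp add: comp_def)
  then have "fst m = l"
    using lim(1) metrizable_imp_Hausdorff_space[OF met(1)] limitin_Hausdorff_unique[of S1 "\<lambda>k. x (\<rho> k)" l sequentially "fst m"]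
    by simp
  then have "c (l, snd m) \<le> ennreal r"
    using m(1) r by (auto simp: L_def enn2ereal_le_ereal_iff)
  then show ?thesis
    using that[OF m(2) lim(2)] by simp
qed

lemma K_inf_compact_lower_semicontinuous:
  assumes met: "metrizable_space S1" "metrizable_space S2"
    and K: "K_inf_compact S1 S2 (\<lambda>s. enn2ereal (c s))"
  shows "lower_semicontinuous (prod_topology S1 S2) c"
proof (rule lower_semicontinuous_sequentially)
  show "metrizable_space (prod_topology S1 S2)"
    using met by (simp add: metrizable_space_prod_topology)
  fix \<sigma> l t assume \<sigma>: "limitin (prod_topology S1 S2) \<sigma> l sequentially"
      "range \<sigma> \<subseteq> topspace (prod_topology S1 S2)" "\<And>n. c (\<sigma> n) \<le> t"
  show "c l \<le> t"
  proof (cases t)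
    case (real r)
    have "\<sigma> n \<in> topspace S1 \<times> topspace S2" for n
      using \<sigma>(2) by (auto simp: image_subset_iff)
    then have top: "fst (\<sigma> n) \<in> topspace S1" "snd (\<sigma> n) \<in> topspace S2" for n
      by (auto simp: mem_Times_iff)
    have lim: "limitin S1 (\<lambda>n. fst (\<sigma> n)) (fst l) sequentially" "limitin S2 (\<lambda>n. snd (\<sigma> n)) (snd l) sequentially"
      using \<sigma>(1) by (auto simp: limitin_pairwise comp_def)
    have le: "c (fst (\<sigma> n), snd (\<sigma> n)) \<le> ennreal r" for n
      using \<sigma>(3)[of n] real by simp
    obtain \<rho> b where \<rho>: "strict_mono \<rho>" "limitin S2 (\<lambda>k. snd (\<sigma> (\<rho> k))) b sequentially" "c (fst l, b) \<le> ennreal r"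
      by (rule K_inf_compact_subsequence[OF met K lim(1) top le]) (use real in auto)
    have "limitin S2 (\<lambda>k. snd (\<sigma> (\<rho> k))) (snd l) sequentially"
      using limitin_subsequence[OF \<rho>(1) lim(2)] by (simp add: comp_def)
    then have "b = snd l"
      using \<rho>(2) metrizable_imp_Hausdorff_space[OF met(2)]
        limitin_Hausdorff_unique[of S2 "\<lambda>k. snd (\<sigma> (\<rho> k))" b sequentially "snd l"] by simp
    then show ?thesis
      using \<rho>(3) real by simp
  qed simp
qed

text \<open>
  Conversely, lower semicontinuity and this subsequence property are sufficient.
\<close>

lemma K_inf_compactI:
  assumes met: "metrizable_space S1" "metrizable_space S2"
    and lsc: "lower_semicontinuous (prod_topology S1 S2) c"
    and sub: "\<And>x l a r. limitin S1 x l sequentially \<Longrightarrow> (\<And>n. x n \<in> topspace S1) \<Longrightarrow> (\<And>n. a n \<in> topspace S2) \<Longrightarrow>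
      (\<And>n. c (x n, a n) \<le> ennreal r) \<Longrightarrow> 0 \<le> r \<Longrightarrow>
      \<exists>(\<rho> :: nat \<Rightarrow> nat) b. strict_mono \<rho> \<and> limitin S2 (\<lambda>k. a (\<rho> k)) b sequentially"
  shows "K_inf_compact S1 S2 (\<lambda>s. enn2ereal (c s))"
  unfolding K_inf_compact_def
proof (intro allI impI)
  fix K and r :: real assume K: "compactin S1 K \<and> K \<noteq> {}"
  have metP: "metrizable_space (prod_topology S1 S2)"
    using met by (simp add: metrizable_space_prod_topology)
  let ?L = "{s \<in> K \<times> topspace S2. enn2ereal (c s) \<le> ereal r}"
  have KS: "K \<subseteq> topspace S1"
    using K compactin_subset_topspace by blast
  show "compactin (prod_topology S1 S2) ?L"
  proof (cases "0 \<le> r")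
    case False
    then have "ereal r < enn2ereal (c s)" for s
      using enn2ereal_nonneg[of "c s"] by (metis ereal_less(2) less_le_trans linorder_not_le zero_ereal_def ereal_less_eq(3))
    then have "?L = {}"
      by (auto simp: not_le[symmetric])
    then show ?thesis
      by (simp only: compactin_empty)
  next
    case True
    show ?thesis
      unfolding metrizable_compactin_sequentially[OF metP]
    proof (intro conjI allI impI)
      show "?L \<subseteq> topspace (prod_topology S1 S2)"
        using KS by auto
      fix \<sigma> :: "nat \<Rightarrow> _" assume \<sigma>: "range \<sigma> \<subseteq> ?L"
      have \<sigma>L: "\<sigma> n \<in> ?L" for n
        using \<sigma> by blast
      have top: "fst (\<sigma> n) \<in> K" "snd (\<sigma> n) \<in> topspace S2" "c (\<sigma> n) \<le> ennreal r" for n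
        using \<sigma>L[of n] True by (auto simp: mem_Times_iff enn2ereal_le_ereal_iff)
      have "range (\<lambda>n. fst (\<sigma> n)) \<subseteq> K"
        using top(1) by auto
      then obtain x \<rho> where x: "x \<in> K" "strict_mono \<rho>" "limitin S1 ((\<lambda>n. fst (\<sigma> n)) \<circ> \<rho>) x sequentially"
        using K unfolding metrizable_compactin_sequentially[OF met(1)] by blast
      have "\<exists>(\<rho>' :: nat \<Rightarrow> nat) b. strict_mono \<rho>' \<and> limitin S2 (\<lambda>k. snd (\<sigma> (\<rho> (\<rho>' k)))) b sequentially"
      proof (rule sub[of "\<lambda>n. fst (\<sigma> (\<rho> n))"])
        show "limitin S1 (\<lambda>n. fst (\<sigma> (\<rho> n))) x sequentially"
          using x(3) by (simp add: comp_def)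
        show "c (fst (\<sigma> (\<rho> n)), snd (\<sigma> (\<rho> n))) \<le> ennreal r" for n
          using top(3) by simp
      qed (use top KS True in auto)
      then obtain \<rho>' b where b: "strict_mono \<rho>'" "limitin S2 (\<lambda>k. snd (\<sigma> (\<rho> (\<rho>' k)))) b sequentially"
        by blast
      have "limitin S1 (\<lambda>k. fst (\<sigma> (\<rho> (\<rho>' k)))) x sequentially"
        using limitin_subsequence[OF b(1) x(3)] by (simp add: comp_def)
      then have lim: "limitin (prod_topology S1 S2) (\<lambda>k. \<sigma> (\<rho> (\<rho>' k))) (x, b) sequentially"
        using b(2) by (simp add: limitin_pairwise comp_def)
      have "c (x, b) \<le> liminf (\<lambda>k. c (\<sigma> (\<rho> (\<rho>' k))))"
        by (rule lower_semicontinuous_le_liminf[OF lsc lim])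
      also have "\<dots> \<le> liminf (\<lambda>k. ennreal r)"
        by (intro Liminf_mono always_eventually) (simp add: top(3))
      finally have "c (x, b) \<le> ennreal r"
        by (simp add: Liminf_const)
      then have "(x, b) \<in> ?L"
        using x(1) limitin_topspace[OF b(2)] True by (simp add: enn2ereal_le_ereal_iff)
      moreover have "strict_mono (\<rho> \<circ> \<rho>')"
        using x(2) b(1) by (rule strict_mono_o)
      ultimately show "\<exists>l r. l \<in> ?L \<and> strict_mono r \<and> limitin (prod_topology S1 S2) (\<sigma> \<circ> r) l sequentially"
        using lim by (intro exI[of _ "(x, b)"] exI[of _ "\<rho> \<circ> \<rho>'"]) (simp add: comp_def)
    qed
  qed
qed

text \<open>
  The cost is an increasing limit of bounded continuous functions of the state and the action, and
  the integrals of these are jointly continuous in the belief and the action.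
\<close>

lemma belief_cost_lower_semicontinuous:
  assumes S: "separable_metrizable S1" "separable_metrizable A"
    and c: "lower_semicontinuous (prod_topology S1 A) c"
  shows "lower_semicontinuous (prod_topology (weak_topology S1) A) (belief_cost c)"
proof (rule lower_semicontinuous_sequentially)
  have met: "metrizable_space (weak_topology S1)" "metrizable_space A"
    using separable_metrizable_weak_topology[OF S(1)] S(2) by (auto simp: separable_metrizable_def)
  then show "metrizable_space (prod_topology (weak_topology S1) A)"
    by (simp add: metrizable_space_prod_topology)
  fix \<sigma> l t assume \<sigma>: "limitin (prod_topology (weak_topology S1) A) \<sigma> l sequentially"
      "range \<sigma> \<subseteq> topspace (prod_topology (weak_topology S1) A)" "\<And>n. belief_cost c (\<sigma> n) \<le> t"
  define z where "z = (\<lambda>n. fst (\<sigma> n))"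
  define a where "a = (\<lambda>n. snd (\<sigma> n))"
  have lims: "limitin (weak_topology S1) z (fst l) sequentially" "limitin A a (snd l) sequentially"
    using \<sigma>(1) by (auto simp: limitin_pairwise comp_def z_def a_def)
  have "\<sigma> n \<in> prob_measures S1 \<times> topspace A" for n
    using \<sigma>(2) by (auto simp: topspace_weak_topology image_subset_iff)
  then have top: "z n \<in> prob_measures S1" "a n \<in> topspace A" for n
    by (auto simp: z_def a_def mem_Times_iff)
  have ltop: "fst l \<in> prob_measures S1" "snd l \<in> topspace A"
    using lims[THEN limitin_topspace] by (auto simp: topspace_weak_topology)
  obtain g :: "nat \<Rightarrow> 'a \<times> 'b \<Rightarrow> real" where g: "\<And>k. bounded_continuous (prod_topology S1 A) (g k)"
    "\<And>k x. x \<in> topspace (prod_topology S1 A) \<Longrightarrow> 0 \<le> g k x"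
    "\<And>x. x \<in> topspace (prod_topology S1 A) \<Longrightarrow> incseq (\<lambda>k. g k x) \<and> (SUP k. ennreal (g k x)) = c x"
    using lower_semicontinuous_incseq_approximation[OF separable_metrizable_prod_topology[OF S] c] by blast
  have sec: "bounded_continuous S1 (\<lambda>w. g k (w, b))" if b: "b \<in> topspace A" for k b
  proof -
    obtain m where m: "0 \<le> m" "\<forall>x\<in>topspace (prod_topology S1 A). \<bar>g k x\<bar> \<le> m"
      by (rule bounded_continuousE[OF g(1)])
    have "continuous_map S1 (prod_topology S1 A) (\<lambda>w. (w, b))"
      using b by (simp add: continuous_map_pairedI)
    from continuous_map_compose[OF this, of euclideanreal "g k"]
    have "continuous_map S1 euclideanreal (\<lambda>w. g k (w, b))"
      using g(1) by (simp add: bounded_continuous_def comp_def)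
    then show ?thesis
      using m b by (intro bounded_continuousI[of _ _ m]) auto
  qed
  have nonneg: "0 \<le> g k (w, b)" if "w \<in> topspace S1" "b \<in> topspace A" for k w b
    using g(2) that by simp
  have g_le: "ennreal (g k (w, b)) \<le> c (w, b)" if "w \<in> topspace S1" "b \<in> topspace A" for k w b
  proof -
    have "(SUP k. ennreal (g k (w, b))) = c (w, b)"
      using g(3) that by simp
    then show ?thesis
      by (metis SUP_upper UNIV_I)
  qed
  have "ennreal (\<integral>w. g k (w, snd l) \<partial>fst l) \<le> t" for k
  proof -
    obtain m where m: "0 \<le> m" "\<forall>x\<in>topspace (prod_topology S1 A). \<bar>g k x\<bar> \<le> m"
      by (rule bounded_continuousE[OF g(1)])
    have gc: "continuous_map (prod_topology S1 A) euclideanreal (g k)"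
      using g(1) by (simp add: bounded_continuous_def)
    have "(\<lambda>n. (\<integral>w. g k (w, a n) \<partial>z n) - (\<integral>w. g k (w, snd l) \<partial>fst l)) \<longlonglongrightarrow> 0"
    proof (rule uniform_weak_convergence[OF S(1) lims(1), where M=m])
      show "(\<lambda>w. g k (w, a n)) \<in> borel_measurable (borel_of S1)" "(\<lambda>w. g k (w, snd l)) \<in> borel_measurable (borel_of S1)" for n
        using bounded_continuous_measurable[OF sec[OF top(2)]] bounded_continuous_measurable[OF sec[OF ltop(2)]] by auto
      show "\<bar>g k (w, a n)\<bar> \<le> m" "\<bar>g k (w, snd l)\<bar> \<le> m" if "w \<in> topspace S1" for n w
        using m(2) top(2) ltop(2) that by auto
      fix s w assume s: "limitin S1 s w sequentially" "\<And>n. s n \<in> topspace S1"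
      have "(\<lambda>n. g k (s n, b n)) \<longlonglongrightarrow> g k (w, snd l)" if "limitin A b (snd l) sequentially" for b
        using continuous_map_limit[OF gc limitin_prod_topology_Pair[OF s(1) that]] by (simp add: comp_def)
      from this[OF lims(2)] this[of "\<lambda>_. snd l"]
      show "(\<lambda>n. g k (s n, a n) - g k (w, snd l)) \<longlonglongrightarrow> 0" "(\<lambda>n. g k (s n, snd l) - g k (w, snd l)) \<longlonglongrightarrow> 0"
        using ltop(2) by (auto intro: LIM_zero)
    qed
    then have "(\<lambda>n. \<integral>w. g k (w, a n) \<partial>z n) \<longlonglongrightarrow> (\<integral>w. g k (w, snd l) \<partial>fst l)"
      by (simp add: LIM_zero_iff)
    then have "(\<lambda>n. ennreal (\<integral>w. g k (w, a n) \<partial>z n)) \<longlonglongrightarrow> ennreal (\<integral>w. g k (w, snd l) \<partial>fst l)"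
      by (rule tendsto_ennrealI)
    moreover have "ennreal (\<integral>w. g k (w, a n) \<partial>z n) \<le> t" for n
    proof -
      have "ennreal (\<integral>w. g k (w, a n) \<partial>z n) = (\<integral>\<^sup>+w. ennreal (g k (w, a n)) \<partial>z n)"
        by (rule nn_integral_bounded_continuous[OF top(1) sec[OF top(2)], symmetric]) (use nonneg top(2) in auto)
      also have "\<dots> \<le> (\<integral>\<^sup>+w. c (w, a n) \<partial>z n)"
        using g_le top(2) prob_measuresD(3)[OF top(1)] by (intro nn_integral_mono) auto
      also have "\<dots> = belief_cost c (\<sigma> n)"
        by (simp add: belief_cost_def z_def a_def split_beta)
      finally show ?thesis
        using \<sigma>(3)[of n] by simp
    qed
    ultimately show ?thesis
      by (intro LIMSEQ_le_const2) auto
  qed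
  moreover have "(\<integral>\<^sup>+w. c (w, snd l) \<partial>fst l) = (SUP k. ennreal (\<integral>w. g k (w, snd l) \<partial>fst l))"
    using g(3) nonneg ltop by (intro nn_integral_SUP_approximation[OF ltop(1)] sec) auto
  ultimately show "belief_cost c l \<le> t"
    by (simp add: belief_cost_def split_beta SUP_le_iff)
qed

text \<open>
  By Markov's inequality the sets \<open>E n\<close> of states with cost at most \<open>2 r + 1\<close> under the action
  \<open>a n\<close> carry at least half of \<open>z n\<close>. If every state had a neighbourhood that eventually misses the \<open>E n\<close>,
  then a partition of unity subordinate to these neighbourhoods would have a sum \<open>\<phi>\<close>
  with \<open>z0\<close>-integral above \<open>1/2\<close> that vanishes on \<open>E n\<close> for large \<open>n\<close>, against weak convergence.
\<close>

lemma belief_cost_K_inf_compact: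
  assumes S: "separable_metrizable S1" "separable_metrizable A"
    and K: "K_inf_compact S1 A (\<lambda>s. enn2ereal (c s))"
  shows "K_inf_compact (weak_topology S1) A (\<lambda>s. enn2ereal (belief_cost c s))"
proof (rule K_inf_compactI)
  have met1: "metrizable_space S1"
    using S(1) by (simp add: separable_metrizable_def)
  show met: "metrizable_space (weak_topology S1)" "metrizable_space A"
    using separable_metrizable_weak_topology[OF S(1)] S(2) by (auto simp: separable_metrizable_def)
  have c: "lower_semicontinuous (prod_topology S1 A) c"
    by (rule K_inf_compact_lower_semicontinuous[OF met1 met(2) K])
  show "lower_semicontinuous (prod_topology (weak_topology S1) A) (belief_cost c)"
    by (rule belief_cost_lower_semicontinuous[OF S c])
  fix z z0 a r assume z: "limitin (weak_topology S1) z z0 sequentially" "\<And>n. z n \<in> topspace (weak_topology S1)"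
    and a: "\<And>n. a n \<in> topspace A" and le: "\<And>n. belief_cost c (z n, a n) \<le> ennreal r" and r: "0 \<le> r"
  have zP: "z n \<in> prob_measures S1" "z0 \<in> prob_measures S1" for n
    using z(2) limitin_topspace[OF z(1)] by (simp_all add: topspace_weak_topology)
  define E where "E n = {w \<in> topspace S1. c (w, a n) \<le> ennreal (2 * r + 1)}" for n
  have cm: "(\<lambda>w. c (w, a n)) \<in> borel_measurable (borel_of S1)" for n
  proof -
    have "(\<lambda>w. (w, a n)) \<in> borel_of S1 \<rightarrow>\<^sub>M borel_of (prod_topology S1 A)"
      using a by (intro continuous_map_measurable) (simp add: continuous_map_pairedI)
    then show ?thesis
      by (rule measurable_compose[OF _ lower_semicontinuous_measurable[OF c]])
  qed
  have C: "topspace S1 - E n = {w \<in> space (borel_of S1). ennreal (2 * r + 1) < c (w, a n)}" for n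
    by (auto simp: E_def not_le)
  have "topspace S1 - E n \<in> sets (borel_of S1)" for n
    unfolding C using cm by measurable
  then have Cs: "topspace S1 - E n \<in> sets (z n)" for n
    by (simp add: prob_measuresD(2)[OF zP(1)])
  have small: "measure (z n) (topspace S1 - E n) < 1/2" for n
  proof -
    interpret prob_space "z n"
      using prob_measuresD[OF zP(1)] by simp
    let ?C = "topspace S1 - E n"
    have "ennreal ((2 * r + 1) * prob ?C) = (\<integral>\<^sup>+w. ennreal (2 * r + 1) * indicator ?C w \<partial>z n)"
      using Cs r by (simp add: nn_integral_cmult_indicator emeasure_eq_measure ennreal_mult)
    also have "\<dots> \<le> (\<integral>\<^sup>+w. c (w, a n) \<partial>z n)"
      using C by (intro nn_integral_mono) (auto split: split_indicator simp: less_imp_le)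
    also have "\<dots> \<le> ennreal r"
      using le[of n] by (simp add: belief_cost_def)
    finally have "(2 * r + 1) * prob ?C \<le> r"
      using r by (simp add: ennreal_le_iff)
    moreover have "2 * r + 1 > 0"
      using r by simp
    ultimately have "prob ?C \<le> r / (2 * r + 1)"
      by (simp add: pos_le_divide_eq mult.commute)
    also have "\<dots> < 1 / 2"
      using r by (simp add: divide_simps)
    finally show ?thesis .
  qed
  have "\<exists>w\<in>topspace S1. \<forall>U N. openin S1 U \<and> w \<in> U \<longrightarrow> (\<exists>n\<ge>N. U \<inter> E n \<noteq> {})"
  proof (rule ccontr)
    assume no: "\<not> ?thesis"
    define \<U> where "\<U> = {U. openin S1 U \<and> (\<exists>N. \<forall>n\<ge>N. U \<inter> E n = {})}"
    have "topspace S1 \<subseteq> \<Union>\<U>"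
      using no by (fastforce simp: \<U>_def)
    moreover have "\<forall>U\<in>\<U>. openin S1 U"
      by (simp add: \<U>_def)
    ultimately obtain k :: nat and V :: "nat \<Rightarrow> 'a set" and p :: "nat \<Rightarrow> 'a \<Rightarrow> real" where
      P: "(\<forall>i. V i \<in> \<U>) \<and> (\<forall>i. bounded_continuous S1 (p i)) \<and>
        (\<forall>i. \<forall>x\<in>topspace S1. 0 \<le> p i x \<and> (x \<notin> V i \<longrightarrow> p i x = 0)) \<and>
        (\<forall>x\<in>topspace S1. (\<Sum>i<k. p i x) \<le> 1) \<and> (\<integral>x. 1 - (\<Sum>i<k. p i x) \<partial>z0) < 1/2"
      using partition_of_unity_integral[OF S(1) zP(2), of "1/2" \<U>] by (auto intro: that)
    define \<phi> where "\<phi> x = (\<Sum>i<k. p i x)" for x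
    have \<phi>01: "0 \<le> \<phi> x" "\<phi> x \<le> 1" if "x \<in> topspace S1" for x
      using P that by (auto simp: \<phi>_def intro!: sum_nonneg)
    have \<phi>_bc: "bounded_continuous S1 \<phi>"
    proof (rule bounded_continuousI[of _ _ 1])
      show "continuous_map S1 euclideanreal \<phi>"
        unfolding \<phi>_def using P by (auto intro!: continuous_map_sum simp: bounded_continuous_def)
    qed (use \<phi>01 in auto)
    interpret z0: prob_space z0
      using prob_measuresD[OF zP(2)] by simp
    have "1/2 < (\<integral>x. \<phi> x \<partial>z0)"
      using P bounded_continuous_integrable[OF zP(2) \<phi>_bc] by (simp add: \<phi>_def[symmetric] z0.prob_space)
    moreover have "(\<lambda>n. \<integral>x. \<phi> x \<partial>z n) \<longlonglongrightarrow> (\<integral>x. \<phi> x \<partial>z0)"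
      using z(1) \<phi>_bc by (simp add: limitin_weak_topology)
    ultimately have 1: "\<forall>\<^sub>F n in sequentially. 1/2 < (\<integral>x. \<phi> x \<partial>z n)"
      by (rule order_tendstoD(1)[rotated])
    have "\<forall>i. \<exists>N. \<forall>n\<ge>N. V i \<inter> E n = {}"
      using P by (auto simp: \<U>_def)
    then obtain N where N: "\<And>i n. N i \<le> n \<Longrightarrow> V i \<inter> E n = {}"
      by metis
    have 2: "\<forall>\<^sub>F n in sequentially. \<forall>i<k. N i \<le> n"
      by (intro eventually_sequentiallyI[of "Max (insert 0 (N ` {..<k}))"]) auto
    from eventually_conj[OF 1 2] obtain n where n: "1/2 < (\<integral>x. \<phi> x \<partial>z n)" "\<forall>i<k. N i \<le> n"
      by (auto simp: eventually_sequentially)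
    interpret prob_space "z n"
      using prob_measuresD[OF zP(1)] by simp
    have "(\<integral>x. \<phi> x \<partial>z n) \<le> (\<integral>x. indicator (topspace S1 - E n) x \<partial>z n)"
    proof (rule integral_mono)
      show "integrable (z n) \<phi>"
        by (rule bounded_continuous_integrable[OF zP(1) \<phi>_bc])
      show "integrable (z n) (indicator (topspace S1 - E n) :: 'a \<Rightarrow> real)"
        using Cs by (simp add: emeasure_eq_measure)
      fix x assume "x \<in> space (z n)"
      then have x: "x \<in> topspace S1"
        using prob_measuresD(3)[OF zP(1)] by simp
      show "\<phi> x \<le> indicator (topspace S1 - E n) x"
      proof (cases "x \<in> E n")
        case True
        then have "p i x = 0" if "i < k" for i
        proof -
          have "x \<notin> V i"
            using N[of i n] n(2) that True by blast
          then show ?thesis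
            using P x by blast
        qed
        then show ?thesis
          using True by (simp add: \<phi>_def)
      qed (use x \<phi>01 in auto)
    qed
    also have "\<dots> = prob (topspace S1 - E n)"
      using Cs by simp
    finally show False
      using small[of n] n(1) by simp
  qed
  then obtain w where w: "w \<in> topspace S1" "\<forall>U N. openin S1 U \<and> w \<in> U \<longrightarrow> (\<exists>n\<ge>N. U \<inter> E n \<noteq> {})"
    by (elim bexE) (rule that)
  obtain U :: "nat \<Rightarrow> 'a set" where U: "\<And>k. openin S1 (U k)" "\<And>k. w \<in> U k" "decseq U"
    "\<And>V. openin S1 V \<Longrightarrow> w \<in> V \<Longrightarrow> \<exists>k. U k \<subseteq> V"
    using metrizable_decreasing_base[OF met1 w(1)] by metis
  have "\<exists>n>m. \<exists>x. x \<in> U k \<and> x \<in> E n" for m k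
  proof -
    obtain n where "Suc m \<le> n" "U k \<inter> E n \<noteq> {}"
      using w(2) U(1,2) by meson
    then show ?thesis
      by (intro exI[of _ n]) auto
  qed
  from strict_mono_selection[where P = "\<lambda>k n. \<exists>x. x \<in> U k \<and> x \<in> E n", OF this]
  obtain \<rho> where mono: "strict_mono \<rho>" and "\<forall>k. \<exists>x. x \<in> U k \<and> x \<in> E (\<rho> k)"
    by blast
  then obtain x where x: "\<And>k. x k \<in> U k" "\<And>k. x k \<in> E (\<rho> k)"
    by metis
  have xw: "limitin S1 x w sequentially"
    unfolding limitin_sequentially
  proof (intro conjI w(1) allI impI)
    fix V assume "openin S1 V \<and> w \<in> V"
    then obtain k where k: "U k \<subseteq> V"
      using U(4) by blast
    have "x n \<in> V" if "n \<ge> k" for n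
      using x(1)[of n] k U(3) that unfolding decseq_def by blast
    then show "\<exists>N. \<forall>n\<ge>N. x n \<in> V"
      by blast
  qed
  have xt: "x k \<in> topspace S1" "c (x k, a (\<rho> k)) \<le> ennreal (2 * r + 1)" for k
    using x(2)[of k] by (auto simp: E_def)
  have at: "a (\<rho> k) \<in> topspace A" for k
    using a .
  obtain \<rho>' b where "strict_mono \<rho>'" "limitin A (\<lambda>k. a (\<rho> (\<rho>' k))) b sequentially"
    by (rule K_inf_compact_subsequence[OF met1 met(2) K xw xt(1) at xt(2)]) (use r in auto)
  then show "\<exists>(\<rho> :: nat \<Rightarrow> nat) b. strict_mono \<rho> \<and> limitin A (\<lambda>k. a (\<rho> k)) b sequentially"
    using strict_mono_o[OF mono] by (intro exI[of _ "\<rho> \<circ> \<rho>'"] exI[of _ b]) (simp add: comp_def)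
qed

section \<open>Minima over actions\<close>

lemma ennreal_INF_approximating_sequence:
  fixes f :: "'b \<Rightarrow> ennreal"
  assumes "B \<noteq> {}"
  obtains b :: "nat \<Rightarrow> 'b" where "range b \<subseteq> B" "\<And>n. f (b n) \<le> (INF x\<in>B. f x) + ennreal (1 / Suc n)"
proof -
  have "\<exists>b. b \<in> B \<and> f b \<le> (INF x\<in>B. f x) + ennreal (1 / Suc n)" for n :: nat
  proof (cases "(INF x\<in>B. f x) = \<infinity>")
    case False
    moreover have "m < m + ennreal (1 / Suc n)" if "m \<noteq> \<infinity>" for m :: ennreal
      using that by (cases m) (auto simp: ennreal_plus[symmetric] ennreal_less_iff simp del: ennreal_plus)
    ultimately have "(INF x\<in>B. f x) < (INF x\<in>B. f x) + ennreal (1 / Suc n)"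
      by blast
    then show ?thesis
      unfolding INF_less_iff by (auto intro: less_imp_le)
  qed (use assms in auto)
  then obtain b where "\<And>n. b n \<in> B \<and> f (b n) \<le> (INF x\<in>B. f x) + ennreal (1 / Suc n)"
    by metis
  then show ?thesis
    by (intro that[of b]) auto
qed

text \<open>
  Actions that approach the infimum have a convergent subsequence, and lower semicontinuity
  makes its limit a minimizer. When all values are infinite every action is one.
\<close>

lemma K_inf_compact_minimum_attained:
  assumes met: "metrizable_space X" "metrizable_space A"
    and K: "K_inf_compact X A (\<lambda>s. enn2ereal (u s))"
    and x: "x \<in> topspace X" and F: "closedin A F" "F \<noteq> {}"
  obtains a where "a \<in> F" "u (x, a) = (INF b\<in>F. u (x, b))"
proof (cases "(INF b\<in>F. u (x, b)) = \<infinity>")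
  case True
  obtain a where a: "a \<in> F"
    using F(2) by blast
  then have "(INF b\<in>F. u (x, b)) \<le> u (x, a)"
    by (rule INF_lower)
  then show ?thesis
    using that[OF a] True by (simp add: top_unique)
next
  case False
  define m where "m = (INF b\<in>F. u (x, b))"
  obtain r where r: "0 \<le> r" "m = ennreal r"
    using False unfolding m_def[symmetric] by (cases m) auto
  obtain b :: "nat \<Rightarrow> 'b" where b: "range b \<subseteq> F" "\<And>n. u (x, b n) \<le> m + ennreal (1 / Suc n)"
    using ennreal_INF_approximating_sequence[OF F(2), of "\<lambda>b. u (x, b)"] unfolding m_def by blast
  have bt: "b n \<in> topspace A" for n
    using b(1) closedin_subset[OF F(1)] by auto
  have le: "u (x, b n) \<le> ennreal (r + 1)" for n
  proof -
    have "ennreal (1 / Suc n) \<le> 1"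
      by (simp add: ennreal_le_1)
    then have "m + ennreal (1 / Suc n) \<le> m + 1"
      by (rule add_left_mono)
    then show ?thesis
      using order_trans[OF b(2)[of n]] r by (simp add: ennreal_plus)
  qed
  obtain \<rho> a where a: "strict_mono \<rho>" "limitin A (\<lambda>k. b (\<rho> k)) a sequentially"
    by (rule K_inf_compact_subsequence[OF met K _ _ bt le, where l = x]) (use x r in auto)
  have aF: "a \<in> F"
    by (rule limitin_closedin[OF a(2) F(1)]) (use b(1) in \<open>auto intro!: always_eventually\<close>)
  have "(\<lambda>n. ennreal (1 / Suc n)) \<longlonglongrightarrow> ennreal 0"
    by (rule tendsto_ennrealI) (rule LIMSEQ_Suc[OF lim_1_over_n])
  from tendsto_add[OF tendsto_const[of m] this]
  have "(\<lambda>n. m + ennreal (1 / Suc n)) \<longlonglongrightarrow> m"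
    by simp
  then have lim: "(\<lambda>k. m + ennreal (1 / Suc (\<rho> k))) \<longlonglongrightarrow> m"
    using LIMSEQ_subseq_LIMSEQ[OF _ a(1)] by (auto simp: comp_def)
  have "u (x, a) \<le> liminf (\<lambda>k. u (x, b (\<rho> k)))"
    by (rule lower_semicontinuous_le_liminf[OF K_inf_compact_lower_semicontinuous[OF met K]
          limitin_prod_topology_Pair[OF _ a(2)]]) (use x in simp)
  also have "\<dots> \<le> liminf (\<lambda>k. m + ennreal (1 / Suc (\<rho> k)))"
    by (intro Liminf_mono always_eventually allI b(2))
  also have "\<dots> = m"
    using lim by (rule lim_imp_Liminf[OF sequentially_bot])
  finally have "u (x, a) \<le> m" .
  moreover have "m \<le> u (x, a)"
    unfolding m_def using aF by (rule INF_lower)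
  ultimately show ?thesis
    using that[OF aF] by (simp add: m_def)
qed

lemma lower_semicontinuous_minimum:
  assumes met: "metrizable_space X" "metrizable_space A"
    and K: "K_inf_compact X A (\<lambda>s. enn2ereal (u s))" and F: "closedin A F"
  shows "lower_semicontinuous X (\<lambda>x. INF b\<in>F. u (x, b))"
proof (rule lower_semicontinuous_sequentially[OF met(1)])
  fix x l t assume x: "limitin X x l sequentially" "range x \<subseteq> topspace X" "\<And>n. (INF b\<in>F. u (x n, b)) \<le> t"
  show "(INF b\<in>F. u (l, b)) \<le> t"
  proof (cases "t = \<infinity> \<or> F = {}")
    case True
    then show ?thesis
      using x(3) by auto
  next
    case False
    then obtain r where r: "0 \<le> r" "t = ennreal r"
      by (cases t) auto
    have xt: "x n \<in> topspace X" for n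
      using x(2) by auto
    have "\<exists>b. b \<in> F \<and> u (x n, b) \<le> ennreal r" for n
    proof -
      obtain b where "b \<in> F" "u (x n, b) = (INF b\<in>F. u (x n, b))"
        by (rule K_inf_compact_minimum_attained[OF met K xt F]) (use False in auto)
      then show ?thesis
        using x(3)[of n] r by (intro exI[of _ b]) simp
    qed
    then obtain b where b: "\<And>n. b n \<in> F" "\<And>n. u (x n, b n) \<le> ennreal r"
      by metis
    have bt: "b n \<in> topspace A" for n
      using b(1) closedin_subset[OF F] by auto
    obtain \<rho> a where a: "strict_mono \<rho>" "limitin A (\<lambda>k. b (\<rho> k)) a sequentially" "u (l, a) \<le> ennreal r"
      by (rule K_inf_compact_subsequence[OF met K x(1) xt bt b(2) r(1)])
    have "a \<in> F"
      by (rule limitin_closedin[OF a(2) F]) (use b(1) in auto)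
    then show ?thesis
      using a(3) r by (intro INF_lower2[of a]) auto
  qed
qed

lemma compactin_nested_closed:
  fixes C :: "nat \<Rightarrow> 'a set"
  assumes "compactin A K" "\<And>n. closedin A (C n)" "\<And>n. C n \<subseteq> K" "\<And>n. C n \<noteq> {}" "decseq C"
  shows "(\<Inter>n. C n) \<noteq> {}"
proof -
  have "closedin (subtopology A K) (C n)" for n
    using assms(2,3) by (auto simp: closedin_subtopology)
  then show ?thesis
    using assms(1,4,5) by (intro compact_space_imp_nest[of "subtopology A K"]) (auto simp: compactin_subspace)
qed

text \<open>
  Where the minimum is finite the set of minimizers is compact. It is cut down successively by the
  complements \<open>F i\<close> of the sets of a countable base, whenever the intersection is nonempty. In the
  limit one point is left, since the \<open>F i\<close> separate points. Whether the \<open>i\<close>-th set of remaining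
  minimizers meets a closed set is a Borel condition on the state, because minima over closed
  sets of actions are lower semicontinuous; so the selected point depends measurably on
  the state. Where the minimum is infinite a fixed action is chosen.
\<close>

lemma measurable_minimum_selector:
  assumes X: "metrizable_space X" and A: "separable_metrizable A" "topspace A \<noteq> {}"
    and K: "K_inf_compact X A (\<lambda>s. enn2ereal (u s))"
  obtains \<phi> where "\<phi> \<in> borel_of X \<rightarrow>\<^sub>M borel_of A"
    "\<forall>x\<in>topspace X. u (x, \<phi> x) = (INF a\<in>topspace A. u (x, a))"
proof -
  have metA: "metrizable_space A"
    using A(1) by (simp add: separable_metrizable_def)
  have lsc: "lower_semicontinuous (prod_topology X A) u"
    by (rule K_inf_compact_lower_semicontinuous[OF X metA K])
  obtain \<B> where \<B>: "countable \<B>" "\<forall>V\<in>\<B>. openin A V"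
      "\<forall>U x. openin A U \<and> x \<in> U \<longrightarrow> (\<exists>V\<in>\<B>. x \<in> V \<and> V \<subseteq> U)"
    using A(1) unfolding separable_metrizable_def second_countable_def by blast
  have \<B>_ne: "\<B> \<noteq> {}"
    using \<B>(3) A(2) openin_topspace by blast
  define F where "F i = topspace A - from_nat_into \<B> i" for i
  have F_closed: "closedin A (F i)" for i
    using \<B>(2) from_nat_into[OF \<B>_ne] by (auto simp: F_def)
  have F_sep: "\<exists>i. a \<notin> F i \<and> b \<in> F i" if ab: "a \<in> topspace A" "b \<in> topspace A" "a \<noteq> b" for a b
  proof -
    obtain U where "openin A U" "a \<in> U" "b \<notin> U"
      using metrizable_imp_t1_space[OF metA] ab unfolding t1_space_def by blast
    then obtain V where "V \<in> \<B>" "a \<in> V" "V \<subseteq> U"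
      using \<B>(3) by blast
    moreover then obtain i where "from_nat_into \<B> i = V"
      using from_nat_into_surj[OF \<B>(1)] by blast
    ultimately show ?thesis
      using \<open>b \<notin> U\<close> ab by (intro exI[of _ i]) (auto simp: F_def)
  qed
  define m where "m x = (INF a\<in>topspace A. u (x, a))" for x
  have m_le: "m x \<le> u (x, a)" if "a \<in> topspace A" for x a
    unfolding m_def using that by (rule INF_lower)
  define D where "D = {x \<in> topspace X. m x \<noteq> \<infinity>}"
  have m_meas: "m \<in> borel_measurable (borel_of X)"
    unfolding m_def by (intro lower_semicontinuous_measurable lower_semicontinuous_minimum[OF X metA K]) simp
  have Ds: "D \<in> sets (borel_of X)"
  proof -
    have "D = {x \<in> space (borel_of X). m x \<noteq> \<infinity>}"
      by (simp add: D_def)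
    also have "\<dots> \<in> sets (borel_of X)"
      using m_meas by measurable
    finally show ?thesis .
  qed
  define \<Phi> where "\<Phi> = rec_nat (\<lambda>x. {a \<in> topspace A. u (x, a) \<le> m x})
    (\<lambda>i P x. if P x \<inter> F i \<noteq> {} then P x \<inter> F i else P x)"
  have \<Phi>_0: "\<Phi> 0 x = {a \<in> topspace A. u (x, a) \<le> m x}" for x
    by (simp add: \<Phi>_def)
  have \<Phi>_Suc: "\<Phi> (Suc i) x = (if \<Phi> i x \<inter> F i \<noteq> {} then \<Phi> i x \<inter> F i else \<Phi> i x)" for i x
    by (simp add: \<Phi>_def)
  have \<Phi>0_compact: "compactin A (\<Phi> 0 x)" if "x \<in> D" for x
  proof -
    from that obtain r where r: "0 \<le> r" "m x = ennreal r" and x: "x \<in> topspace X"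
      by (cases "m x") (auto simp: D_def)
    have "compactin (prod_topology X A) {s \<in> {x} \<times> topspace A. enn2ereal (u s) \<le> ereal r}"
      using K x by (simp add: K_inf_compact_def)
    then have "compactin A (snd ` {s \<in> {x} \<times> topspace A. enn2ereal (u s) \<le> ereal r})"
      by (rule image_compactin) (rule continuous_map_snd)
    moreover have "snd ` {s \<in> {x} \<times> topspace A. enn2ereal (u s) \<le> ereal r} = \<Phi> 0 x"
      using r by (force simp: \<Phi>_0 enn2ereal_le_ereal_iff)
    ultimately show ?thesis
      by simp
  qed
  have \<Phi>_closed: "closedin A (\<Phi> i x)" if "x \<in> D" for i x
  proof (induction i)
    case 0
    show ?case
      using \<Phi>0_compact[OF that] metrizable_imp_Hausdorff_space[OF metA] by (rule compactin_imp_closedin[rotated])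
  qed (auto simp: \<Phi>_Suc intro: closedin_Int F_closed)
  have \<Phi>_ne: "\<Phi> i x \<noteq> {}" if "x \<in> D" for i x
  proof (induction i)
    case 0
    have "x \<in> topspace X"
      using that by (simp add: D_def)
    then obtain a where "a \<in> topspace A" "u (x, a) = (INF b\<in>topspace A. u (x, b))"
      by (rule K_inf_compact_minimum_attained[OF X metA K _ closedin_topspace A(2)])
    then show ?case
      by (auto simp: \<Phi>_0 m_def)
  qed (simp add: \<Phi>_Suc)
  have \<Phi>_dec: "decseq (\<lambda>i. \<Phi> i x)" for x
    by (intro decseq_SucI) (auto simp: \<Phi>_Suc)
  have \<Phi>_sub0: "\<Phi> i x \<subseteq> \<Phi> 0 x" for i x
    using \<Phi>_dec[of x] by (auto simp: decseq_def)
  have unique: "a = b" if x: "x \<in> D" and a: "\<forall>i. a \<in> \<Phi> i x" and b: "\<forall>i. b \<in> \<Phi> i x" for a b x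
  proof (rule ccontr)
    assume "a \<noteq> b"
    moreover have "a \<in> topspace A" "b \<in> topspace A"
      using a[rule_format, of 0] b[rule_format, of 0] by (auto simp: \<Phi>_0)
    ultimately obtain i where i: "a \<notin> F i" "b \<in> F i"
      using F_sep by blast
    have "\<Phi> (Suc i) x = \<Phi> i x \<inter> F i"
      using b i(2) by (auto simp: \<Phi>_Suc)
    then show False
      using a i(1) by blast
  qed
  obtain a0 where a0: "a0 \<in> topspace A"
    using A(2) by blast
  define \<phi> where "\<phi> x = (if x \<in> D then SOME a. \<forall>i. a \<in> \<Phi> i x else a0)" for x
  have \<phi>_mem: "\<forall>i. \<phi> x \<in> \<Phi> i x" if x: "x \<in> D" for x
  proof -
    have "(\<Inter>i. \<Phi> i x) \<noteq> {}"
      by (rule compactin_nested_closed[OF \<Phi>0_compact[OF x] \<Phi>_closed[OF x] \<Phi>_sub0 \<Phi>_ne[OF x] \<Phi>_dec])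
    then have "\<exists>a. \<forall>i. a \<in> \<Phi> i x"
      by auto
    then show ?thesis
      using x unfolding \<phi>_def by (simp add: someI_ex[of "\<lambda>a. \<forall>i. a \<in> \<Phi> i x"])
  qed
  have hit: "\<forall>C. closedin A C \<longrightarrow> {x \<in> D. \<Phi> i x \<inter> C \<noteq> {}} \<in> sets (borel_of X)" for i
  proof (induction i)
    case 0
    show ?case
    proof (intro allI impI)
      fix C assume C: "closedin A C"
      have "{x \<in> D. \<Phi> 0 x \<inter> C \<noteq> {}} = {x \<in> space (borel_of X). (INF b\<in>C. u (x, b)) \<le> m x} \<inter> D \<inter> {x. C \<noteq> {}}" (is "?L = ?R")
      proof (intro equalityI subsetI)
        fix x assume "x \<in> ?L"
        then obtain a where "x \<in> D" "a \<in> C" "u (x, a) \<le> m x"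
          by (auto simp: \<Phi>_0)
        then show "x \<in> ?R"
          by (auto simp: D_def intro: INF_lower2)
      next
        fix x assume x: "x \<in> ?R"
        then have "x \<in> topspace X" "C \<noteq> {}"
          by auto
        then obtain a where "a \<in> C" "u (x, a) = (INF b\<in>C. u (x, b))"
          by (rule K_inf_compact_minimum_attained[OF X metA K _ C])
        then show "x \<in> ?L"
          using x closedin_subset[OF C] by (auto simp: \<Phi>_0)
      qed
      moreover have "(\<lambda>x. INF b\<in>C. u (x, b)) \<in> borel_measurable (borel_of X)"
        by (intro lower_semicontinuous_measurable lower_semicontinuous_minimum[OF X metA K] C)
      then have "{x \<in> space (borel_of X). (INF b\<in>C. u (x, b)) \<le> m x} \<in> sets (borel_of X)"
        using m_meas by measurable
      ultimately show "{x \<in> D. \<Phi> 0 x \<inter> C \<noteq> {}} \<in> sets (borel_of X)"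
        using Ds by (cases "C = {}") auto
    qed
  next
    case (Suc i)
    show ?case
    proof (intro allI impI)
      fix C assume C: "closedin A C"
      have "{x \<in> D. \<Phi> (Suc i) x \<inter> C \<noteq> {}} =
          ({x \<in> D. \<Phi> i x \<inter> (F i \<inter> C) \<noteq> {}} \<inter> {x \<in> D. \<Phi> i x \<inter> F i \<noteq> {}})
          \<union> ({x \<in> D. \<Phi> i x \<inter> C \<noteq> {}} - {x \<in> D. \<Phi> i x \<inter> F i \<noteq> {}})"
        unfolding \<Phi>_Suc by (auto split: if_splits)
      also have "\<dots> \<in> sets (borel_of X)"
        using Suc.IH[rule_format, OF closedin_Int[OF F_closed[of i] C]] Suc.IH[rule_format, OF F_closed[of i]]
          Suc.IH[rule_format, OF C]
        by (intro sets.Un sets.Int sets.Diff)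
      finally show "{x \<in> D. \<Phi> (Suc i) x \<inter> C \<noteq> {}} \<in> sets (borel_of X)" .
    qed
  qed
  have \<phi>_iff: "\<phi> x \<in> C \<longleftrightarrow> (\<forall>i. \<Phi> i x \<inter> C \<noteq> {})" if C: "closedin A C" and x: "x \<in> D" for C x
  proof
    assume "\<phi> x \<in> C"
    then show "\<forall>i. \<Phi> i x \<inter> C \<noteq> {}"
      using \<phi>_mem[OF x] by blast
  next
    assume ne: "\<forall>i. \<Phi> i x \<inter> C \<noteq> {}"
    have "(\<Inter>i. \<Phi> i x \<inter> C) \<noteq> {}"
    proof (rule compactin_nested_closed[OF \<Phi>0_compact[OF x]])
      show "decseq (\<lambda>i. \<Phi> i x \<inter> C)"
        using \<Phi>_dec[of x] by (fastforce simp: decseq_def)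
    qed (use \<Phi>_closed[OF x] C \<Phi>_sub0 ne in \<open>auto intro: closedin_Int\<close>)
    then obtain a where "a \<in> C" "\<forall>i. a \<in> \<Phi> i x"
      by auto
    then show "\<phi> x \<in> C"
      using unique[OF x _ \<phi>_mem[OF x]] by blast
  qed
  have \<phi>_top: "\<phi> x \<in> topspace A" for x
    using \<phi>_mem[of x] a0 by (cases "x \<in> D") (auto simp: \<Phi>_0 \<phi>_def dest: spec[of _ 0])
  have "\<phi> \<in> borel_of X \<rightarrow>\<^sub>M borel_of A"
  proof (rule measurable_borel_ofI)
    fix U assume U: "openin A U"
    define C where "C = topspace A - U"
    have C: "closedin A C"
      using U by (auto simp: C_def)
    have Dt: "D \<subseteq> topspace X"
      by (auto simp: D_def)
    have "{x \<in> D. \<phi> x \<in> C} = (\<Inter>i. {x \<in> D. \<Phi> i x \<inter> C \<noteq> {}})"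
      using \<phi>_iff[OF C] by auto
    also have "\<dots> \<in> sets (borel_of X)"
      using hit C by (intro sets.countable_INT) auto
    finally have 1: "{x \<in> D. \<phi> x \<in> C} \<in> sets (borel_of X)" .
    have "\<phi> -` U \<inter> space (borel_of X) = (D - {x \<in> D. \<phi> x \<in> C}) \<union> ((topspace X - D) \<inter> {x. a0 \<in> U})"
      using Dt \<phi>_top by (auto simp: C_def) (auto simp: \<phi>_def split: if_splits)
    moreover have "(topspace X - D) \<inter> {x. a0 \<in> U} \<in> sets (borel_of X)"
      using Ds sets.compl_sets[OF Ds] by (cases "a0 \<in> U") auto
    ultimately show "\<phi> -` U \<inter> space (borel_of X) \<in> sets (borel_of X)"
      using 1 Ds by auto
  qed (rule \<phi>_top)
  moreover have "u (x, \<phi> x) = m x" if x: "x \<in> topspace X" for x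
  proof (cases "x \<in> D")
    case True
    then have "u (x, \<phi> x) \<le> m x"
      using \<phi>_mem[OF True, rule_format, of 0] by (simp add: \<Phi>_0)
    then show ?thesis
      using m_le[OF \<phi>_top] by (simp add: antisym)
  next
    case False
    then show ?thesis
      using x m_le[OF \<phi>_top[of x], of x] by (simp add: D_def top_unique)
  qed
  ultimately show ?thesis
    by (intro that[of \<phi>]) (auto simp: m_def)
qed

section \<open>Dynamic programming\<close>

locale inf_compact_mdp =
  fixes X :: "'x topology" and A :: "'a topology" and q :: "'x \<times> 'a \<Rightarrow> 'x measure"
    and c :: "'x \<times> 'a \<Rightarrow> ennreal" and \<alpha> :: real
  assumes X: "separable_metrizable X" and A: "separable_metrizable A" and A_nonempty: "topspace A \<noteq> {}"
    and c_inf_compact: "K_inf_compact X A (\<lambda>s. enn2ereal (c s))"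
    and q: "stochastic_kernel X (prod_topology X A) q" "weakly_continuous X (prod_topology X A) q"
    and \<alpha>_nonneg: "0 \<le> \<alpha>"
begin

lemma metrizable: "metrizable_space X" "metrizable_space A" "metrizable_space (prod_topology X A)"
  using X A separable_metrizable_prod_topology[OF X A] by (auto simp: separable_metrizable_def)

lemma q_prob: "x \<in> topspace X \<Longrightarrow> a \<in> topspace A \<Longrightarrow> q (x, a) \<in> prob_measures X"
  by (rule stochastic_kernelD[OF q(1)]) simp

lemma lower_semicontinuous_expectation:
  assumes "lower_semicontinuous X v"
  shows "lower_semicontinuous (prod_topology X A) (\<lambda>s. \<integral>\<^sup>+x'. v x' \<partial>q s)"
proof (rule lower_semicontinuous_sequentially_liminf[OF metrizable(3)])
  fix \<sigma> l assume "limitin (prod_topology X A) \<sigma> l sequentially"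
  then have "limitin (weak_topology X) (\<lambda>n. q (\<sigma> n)) (q l) sequentially"
    using q(2) unfolding weakly_continuous_def by blast
  from lower_semicontinuous_le_liminf[OF lower_semicontinuous_nn_integral[OF X assms] this]
  show "(\<integral>\<^sup>+x'. v x' \<partial>q l) \<le> liminf (\<lambda>n. \<integral>\<^sup>+x'. v x' \<partial>q (\<sigma> n))" .
qed

lemma bellman_mono:
  assumes "x \<in> topspace X" "a \<in> topspace A" "\<And>y. y \<in> topspace X \<Longrightarrow> v y \<le> w y"
  shows "bellman q c \<alpha> v x a \<le> bellman q c \<alpha> w x a"
  unfolding bellman_def using assms(3) prob_measuresD(3)[OF q_prob[OF assms(1,2)]]
  by (intro add_left_mono mult_left_mono nn_integral_mono) auto

lemma bellman_cong:
  assumes "x \<in> topspace X" "a \<in> topspace A" "\<And>y. y \<in> topspace X \<Longrightarrow> v y = w y"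
  shows "bellman q c \<alpha> v x a = bellman q c \<alpha> w x a"
  using bellman_mono[OF assms(1,2), of v w] bellman_mono[OF assms(1,2), of w v] assms(3) by (simp add: antisym)

text \<open>
  The one-step cost bounds the Bellman function from below, so bounded values of the latter
  already leave a convergent subsequence of actions.
\<close>

lemma bellman_K_inf_compact:
  assumes "lower_semicontinuous X v"
  shows "K_inf_compact X A (\<lambda>s. enn2ereal (bellman q c \<alpha> v (fst s) (snd s)))"
proof (rule K_inf_compactI[OF metrizable(1,2)])
  show "lower_semicontinuous (prod_topology X A) (\<lambda>s. bellman q c \<alpha> v (fst s) (snd s))"
    using lower_semicontinuous_add_cmult[OF metrizable(3) K_inf_compact_lower_semicontinuous[OF metrizable(1,2) c_inf_compact]
        lower_semicontinuous_expectation[OF assms], of \<alpha>]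
    by (simp add: bellman_def)
  fix x l a and r :: real
  assume x: "limitin X x l sequentially" "\<And>n. x n \<in> topspace X" and a: "\<And>n. a n \<in> topspace A"
    and le: "\<And>n. bellman q c \<alpha> v (fst (x n, a n)) (snd (x n, a n)) \<le> ennreal r" and r: "0 \<le> r"
  have c: "c (x n, a n) \<le> ennreal r" for n
    using le[of n] by (auto simp: bellman_def intro: order_trans[rotated])
  show "\<exists>(\<rho> :: nat \<Rightarrow> nat) b. strict_mono \<rho> \<and> limitin A (\<lambda>k. a (\<rho> k)) b sequentially"
    by (rule K_inf_compact_subsequence[OF metrizable(1,2) c_inf_compact x a c r]) blast
qed

definition bellman_min :: "('x \<Rightarrow> ennreal) \<Rightarrow> 'x \<Rightarrow> ennreal" where
  "bellman_min v x = (INF a\<in>topspace A. bellman q c \<alpha> v x a)"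

lemma bellman_min_le: "a \<in> topspace A \<Longrightarrow> bellman_min v x \<le> bellman q c \<alpha> v x a"
  unfolding bellman_min_def by (rule INF_lower)

lemma lower_semicontinuous_bellman_min:
  "lower_semicontinuous X v \<Longrightarrow> lower_semicontinuous X (bellman_min v)"
  using lower_semicontinuous_minimum[OF metrizable(1,2) bellman_K_inf_compact closedin_topspace, of v]
  by (simp add: bellman_min_def[abs_def])

lemma attains_min_iff:
  "attains_min A (bellman q c \<alpha> v x) a \<longleftrightarrow> a \<in> topspace A \<and> bellman q c \<alpha> v x a = bellman_min v x"
proof
  assume "attains_min A (bellman q c \<alpha> v x) a"
  then have a: "a \<in> topspace A" "\<forall>b\<in>topspace A. bellman q c \<alpha> v x a \<le> bellman q c \<alpha> v x b"
    by (auto simp: attains_min_def is_arg_min_def not_less)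
  then have "bellman q c \<alpha> v x a \<le> bellman_min v x"
    unfolding bellman_min_def by (intro INF_greatest) auto
  then show "a \<in> topspace A \<and> bellman q c \<alpha> v x a = bellman_min v x"
    using a(1) bellman_min_le[OF a(1), of v x] by simp
next
  assume "a \<in> topspace A \<and> bellman q c \<alpha> v x a = bellman_min v x"
  then show "attains_min A (bellman q c \<alpha> v x) a"
    by (auto simp: attains_min_def is_arg_min_def not_less intro: bellman_min_le)
qed

lemma bellman_min_attained:
  assumes "lower_semicontinuous X v" "x \<in> topspace X"
  obtains a where "a \<in> topspace A" "bellman q c \<alpha> v x a = bellman_min v x"
  by (rule K_inf_compact_minimum_attained[OF metrizable(1,2) bellman_K_inf_compact[OF assms(1)] assms(2)
        closedin_topspace A_nonempty]) (simp add: bellman_min_def that)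

lemma bellman_min_selector:
  assumes "lower_semicontinuous X v"
  obtains \<phi> where "\<phi> \<in> borel_selectors X A" "\<forall>x\<in>topspace X. bellman q c \<alpha> v x (\<phi> x) = bellman_min v x"
proof -
  obtain \<phi> where \<phi>: "\<phi> \<in> borel_of X \<rightarrow>\<^sub>M borel_of A" "\<forall>x\<in>topspace X. bellman q c \<alpha> v (fst (x, \<phi> x)) (snd (x, \<phi> x)) =
      (INF a\<in>topspace A. bellman q c \<alpha> v (fst (x, a)) (snd (x, a)))"
    by (rule measurable_minimum_selector[OF metrizable(1) A A_nonempty bellman_K_inf_compact[OF assms]])
  show ?thesis
    by (rule that[of \<phi>]) (use \<phi> in \<open>simp_all add: borel_selectors_def bellman_min_def\<close>)
qed

primrec value_iterate :: "nat \<Rightarrow> 'x \<Rightarrow> ennreal" where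
  "value_iterate 0 = (\<lambda>_. 0)"
| "value_iterate (Suc t) = bellman_min (value_iterate t)"

lemma lower_semicontinuous_value_iterate: "lower_semicontinuous X (value_iterate t)"
proof (induction t)
  case 0
  show ?case
    by (simp add: lower_semicontinuous_def)
qed (simp add: lower_semicontinuous_bellman_min)

lemma bellman_min_mono:
  assumes "x \<in> topspace X" "\<And>y. y \<in> topspace X \<Longrightarrow> v y \<le> w y"
  shows "bellman_min v x \<le> bellman_min w x"
  unfolding bellman_min_def by (intro INF_mono) (use assms bellman_mono in blast)

lemma value_iterate_le_Suc: "x \<in> topspace X \<Longrightarrow> value_iterate t x \<le> value_iterate (Suc t) x"
proof (induction t arbitrary: x)
  case (Suc t)
  then show ?case
    using bellman_min_mono[of x "value_iterate t" "value_iterate (Suc t)"] by simp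
qed simp

lemma value_iterate_incseq: "x \<in> topspace X \<Longrightarrow> incseq (\<lambda>t. value_iterate t x)"
  by (intro incseq_SucI value_iterate_le_Suc)

definition limit_value :: "'x \<Rightarrow> ennreal" where
  "limit_value x = (SUP t. value_iterate t x)"

lemma value_iterate_le_limit: "value_iterate t x \<le> limit_value x"
  unfolding limit_value_def by (rule SUP_upper) simp

lemma lower_semicontinuous_limit_value: "lower_semicontinuous X limit_value"
  by (rule lower_semicontinuous_SUP[OF lower_semicontinuous_value_iterate]) (rule limit_value_def)

lemma bellman_limit_value:
  assumes x: "x \<in> topspace X" and a: "a \<in> topspace A"
  shows "bellman q c \<alpha> limit_value x a = (SUP t. bellman q c \<alpha> (value_iterate t) x a)"
proof -
  have sp: "space (q (x, a)) = topspace X"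
    using prob_measuresD(3)[OF q_prob[OF x a]] .
  have "(\<integral>\<^sup>+y. limit_value y \<partial>q (x, a)) = (SUP t. \<integral>\<^sup>+y. value_iterate t y \<partial>q (x, a))"
    unfolding limit_value_def
  proof (rule nn_integral_monotone_convergence_SUP_AE)
    show "AE y in q (x, a). value_iterate i y \<le> value_iterate (Suc i) y" for i
      by (rule AE_I2) (simp only: sp value_iterate_le_Suc)
    show "value_iterate i \<in> borel_measurable (q (x, a))" for i
      by (rule measurable_prob_measures[OF q_prob[OF x a] lower_semicontinuous_measurable[OF lower_semicontinuous_value_iterate]])
  qed
  moreover have "c (x, a) + (SUP t. ennreal \<alpha> * (\<integral>\<^sup>+y. value_iterate t y \<partial>q (x, a))) =
      (SUP t. c (x, a) + ennreal \<alpha> * (\<integral>\<^sup>+y. value_iterate t y \<partial>q (x, a)))"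
    by (rule ennreal_SUP_add_right) simp
  ultimately show ?thesis
    unfolding bellman_def by (simp add: SUP_mult_left_ennreal)
qed

text \<open>
  That the limit does not exceed its Bellman image is monotonicity. Conversely, if the limit is
  the finite number \<open>r\<close>, then minimizers \<open>a t\<close> of the \<open>t\<close>-th equation have a limit point \<open>b\<close>. For
  each \<open>t\<close> the value of the \<open>t\<close>-th Bellman function at \<open>b\<close> is at most \<open>r\<close>, because these functions increase with
  \<open>t\<close> and are lower semicontinuous, and monotone convergence gives the same bound in the limit.
\<close>

lemma limit_value_optimality:
  assumes x: "x \<in> topspace X"
  shows "limit_value x = bellman_min limit_value x"
proof (rule antisym)
  have "value_iterate t x \<le> bellman_min limit_value x" for t
  proof (cases t)
    case (Suc s)
    then show ?thesis
      using bellman_min_mono[OF x, of "value_iterate s" limit_value] value_iterate_le_limit by simp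
  qed simp
  then show "limit_value x \<le> bellman_min limit_value x"
    unfolding limit_value_def[of x] by (intro SUP_least)
  show "bellman_min limit_value x \<le> limit_value x"
  proof (cases "limit_value x")
    case (real r)
    have "\<exists>a. a \<in> topspace A \<and> bellman q c \<alpha> (value_iterate t) x a \<le> ennreal r" for t
    proof -
      obtain a where "a \<in> topspace A" "bellman q c \<alpha> (value_iterate t) x a = bellman_min (value_iterate t) x"
        by (rule bellman_min_attained[OF lower_semicontinuous_value_iterate x])
      then show ?thesis
        using value_iterate_le_limit[of "Suc t" x] real by (intro exI[of _ a]) simp
    qed
    then obtain a where a: "\<And>t. a t \<in> topspace A" "\<And>t. bellman q c \<alpha> (value_iterate t) x (a t) \<le> ennreal r"
      by metis
    have c: "c (x, a t) \<le> ennreal r" for t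
      using a(2)[of t] by (auto simp: bellman_def intro: order_trans[rotated])
    obtain \<rho> b where b: "strict_mono \<rho>" "limitin A (\<lambda>k. a (\<rho> k)) b sequentially"
      by (rule K_inf_compact_subsequence[OF metrizable(1,2) c_inf_compact _ _ a(1) c, where l = x]) (use x real in auto)
    have bt: "b \<in> topspace A"
      using limitin_topspace[OF b(2)] .
    have "bellman q c \<alpha> (value_iterate t) x b \<le> ennreal r" for t
    proof -
      have "(\<lambda>s. bellman q c \<alpha> (value_iterate t) (fst s) (snd s)) (x, b) \<le>
          liminf (\<lambda>k. (\<lambda>s. bellman q c \<alpha> (value_iterate t) (fst s) (snd s)) (x, a (\<rho> k)))"
        by (rule lower_semicontinuous_le_liminf[OF K_inf_compact_lower_semicontinuous[OF metrizable(1,2)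
                bellman_K_inf_compact[OF lower_semicontinuous_value_iterate]] limitin_prod_topology_Pair[OF _ b(2)]])
          (use x in simp)
      also have "\<dots> \<le> liminf (\<lambda>k. ennreal r)"
      proof (rule Liminf_mono, rule eventually_sequentiallyI[of t])
        fix k assume "t \<le> k"
        then have "t \<le> \<rho> k"
          using seq_suble[OF b(1), of k] by simp
        then have "bellman q c \<alpha> (value_iterate t) x (a (\<rho> k)) \<le> bellman q c \<alpha> (value_iterate (\<rho> k)) x (a (\<rho> k))"
          by (intro bellman_mono x a(1)) (use value_iterate_incseq in \<open>auto simp: incseq_def\<close>)
        then show "(\<lambda>s. bellman q c \<alpha> (value_iterate t) (fst s) (snd s)) (x, a (\<rho> k)) \<le> ennreal r"
          using a(2)[of "\<rho> k"] by simp
      qed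
      finally show ?thesis
        by (simp add: Liminf_const)
    qed
    then have "bellman q c \<alpha> limit_value x b \<le> ennreal r"
      unfolding bellman_limit_value[OF x bt] by (rule SUP_least)
    then show ?thesis
      using bellman_min_le[OF bt, of limit_value x] real by simp
  qed simp
qed

end

section \<open>The measure of a policy\<close>

lemma nn_integral_distr_borel:
  assumes "T \<in> M \<rightarrow>\<^sub>M N" "f \<in> borel_measurable N"
  shows "(\<integral>\<^sup>+x. f x \<partial>distr M N T) = (\<integral>\<^sup>+x. f (T x) \<partial>M)"
  by (rule nn_integral_distr) (use assms in simp_all)

lemma markov_policy_in_policies:
  assumes "\<forall>t. \<phi> t \<in> borel_selectors X A"
  shows "markov_policy A \<phi> \<in> policies X A"
  unfolding policies_def mem_Collect_eq
proof
  fix t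
  let ?x = "\<lambda>h :: 'a \<times> (nat \<Rightarrow> 'b \<times> 'a). if t = 0 then fst h else snd (snd h (t - 1))"
  have "continuous_map (history_space X A t) X ?x"
  proof (cases "t = 0")
    case True
    then show ?thesis
      by (simp add: history_space_def continuous_map_fst)
  next
    case False
    then have "continuous_map (product_topology (\<lambda>_. prod_topology A X) {..<t}) (prod_topology A X) (\<lambda>h. h (t - 1))"
      by (intro continuous_map_product_projection) auto
    from continuous_map_compose[OF continuous_map_compose[OF continuous_map_snd this] continuous_map_snd]
    show ?thesis
      using False by (simp add: history_space_def comp_def)
  qed
  then have "?x \<in> borel_of (history_space X A t) \<rightarrow>\<^sub>M borel_of X"
    by (rule continuous_map_measurable)
  then have "(\<lambda>h. return (borel_of A) (\<phi> t (?x h))) \<in> borel_of (history_space X A t) \<rightarrow>\<^sub>M prob_algebra (borel_of A)"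
    using assms by (intro measurable_compose[OF _ measurable_return_prob_space] measurable_compose[of ?x _ "borel_of X" "\<phi> t"])
      (auto simp: borel_selectors_def)
  then show "stochastic_kernel A (history_space X A t) (markov_policy A \<phi> t)"
    by (simp add: stochastic_kernel_def markov_policy_def split_beta)
qed

text \<open>
  The setting in which the measure of a policy from one initial state is analysed; the next
  state and the choice of an action are the two factors of the law of each step.
\<close>

locale controlled_process =
  fixes X :: "'x topology" and A :: "'a topology" and q :: "'x \<times> 'a \<Rightarrow> 'x measure"
    and \<pi> :: "('x, 'a) policy" and x :: 'x
  assumes X: "separable_metrizable X" and A: "separable_metrizable A"
    and q: "stochastic_kernel X (prod_topology X A) q"
    and \<pi>: "\<pi> \<in> policies X A" and x: "x \<in> topspace X"
begin

abbreviation "BXA \<equiv> borel_of (prod_topology X A)"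
abbreviation "L \<equiv> strategic_measure X A q \<pi> x"
abbreviation "steps \<equiv> step_kernel X A q \<pi> x"

lemma sets_BXA: "sets BXA = sets (borel_of X \<Otimes>\<^sub>M borel_of A)"
  using X A by (intro sets_borel_of_prod_topology) (auto simp: separable_metrizable_def)

lemma measurable_Pair_BXA:
  "f \<in> M \<rightarrow>\<^sub>M borel_of X \<Longrightarrow> g \<in> M \<rightarrow>\<^sub>M borel_of A \<Longrightarrow> (\<lambda>y. (f y, g y)) \<in> M \<rightarrow>\<^sub>M BXA"
  using measurable_Pair[of f M "borel_of X" g "borel_of A"] measurable_cong_sets[OF refl sets_BXA, of M] by blast

lemma fst_BXA: "fst \<in> BXA \<rightarrow>\<^sub>M borel_of X" and snd_BXA: "snd \<in> BXA \<rightarrow>\<^sub>M borel_of A"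
  by (rule continuous_map_measurable[OF continuous_map_fst], rule continuous_map_measurable[OF continuous_map_snd])

lemma history_measurable:
  "(\<lambda>(\<omega>, y). history n \<omega> y) \<in> (\<Pi>\<^sub>M i\<in>{0..<n}. BXA) \<Otimes>\<^sub>M borel_of X \<rightarrow>\<^sub>M borel_of (history_space X A n)"
proof -
  let ?M = "(\<Pi>\<^sub>M i\<in>{0..<n}. BXA) \<Otimes>\<^sub>M borel_of X"
  have sc: "second_countable X" "second_countable A" "second_countable (prod_topology A X)"
    using X A separable_metrizable_prod_topology[OF A X] by (auto simp: separable_metrizable_def)
  have comp: "(\<lambda>p. fst p i) \<in> ?M \<rightarrow>\<^sub>M BXA" if "i < n" for i
    using that by (intro measurable_compose[OF measurable_fst measurable_component_singleton]) auto
  have 1: "(\<lambda>p. if n = 0 then snd p else fst (fst p 0)) \<in> ?M \<rightarrow>\<^sub>M borel_of X"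
    using measurable_compose[OF comp[of 0] fst_BXA] by (cases "n = 0") auto
  have 2: "(\<lambda>p. \<lambda>i\<in>{..<n}. (snd (fst p i), if Suc i = n then snd p else fst (fst p (Suc i)))) \<in>
      ?M \<rightarrow>\<^sub>M borel_of (product_topology (\<lambda>_. prod_topology A X) {..<n})"
  proof (rule measurable_borel_of_finite_product)
    fix i assume i: "i \<in> {..<n}"
    have "(\<lambda>p. if Suc i = n then snd p else fst (fst p (Suc i))) \<in> ?M \<rightarrow>\<^sub>M borel_of X"
    proof (cases "Suc i = n")
      case False
      then have "Suc i < n"
        using i by simp
      then show ?thesis
        using False measurable_compose[OF comp fst_BXA] by simp
    qed simp
    from measurable_Pair[OF measurable_compose[OF comp snd_BXA] this]
    have "(\<lambda>p. (snd (fst p i), if Suc i = n then snd p else fst (fst p (Suc i)))) \<in> ?M \<rightarrow>\<^sub>M borel_of A \<Otimes>\<^sub>M borel_of X"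
      using i by simp
    then show "(\<lambda>p. (\<lambda>i\<in>{..<n}. (snd (fst p i), if Suc i = n then snd p else fst (fst p (Suc i)))) i) \<in> ?M \<rightarrow>\<^sub>M borel_of (prod_topology A X)"
      using i measurable_cong_sets[OF refl sets_borel_of_prod_topology[OF sc(2,1)], of ?M] by simp
  qed (use sc in auto)
  have "(\<lambda>p. (if n = 0 then snd p else fst (fst p 0),
      \<lambda>i\<in>{..<n}. (snd (fst p i), if Suc i = n then snd p else fst (fst p (Suc i))))) \<in> ?M \<rightarrow>\<^sub>M
      borel_of X \<Otimes>\<^sub>M borel_of (product_topology (\<lambda>_. prod_topology A X) {..<n})"
    by (rule measurable_Pair[OF 1 2])
  then show ?thesis
    using measurable_cong_sets[OF refl sets_borel_of_prod_topology[OF sc(1) second_countable_finite_product[OF _ sc(3)], of "{..<n}"], of ?M]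
    by (simp add: history_def split_beta' history_space_def)
qed

definition next_state :: "nat \<Rightarrow> (nat \<Rightarrow> 'x \<times> 'a) \<Rightarrow> 'x measure" where
  "next_state n \<omega> = (if n = 0 then return (borel_of X) x else q (\<omega> (n - 1)))"

lemma next_state_measurable: "next_state n \<in> (\<Pi>\<^sub>M i\<in>{0..<n}. BXA) \<rightarrow>\<^sub>M prob_algebra (borel_of X)"
proof (cases "n = 0")
  case True
  have "return (borel_of X) x \<in> space (prob_algebra (borel_of X))"
    using x by (simp add: space_prob_algebra prob_space_return)
  then show ?thesis
    using True by (simp add: next_state_def[abs_def])
next
  case False
  then have "(\<lambda>\<omega>. \<omega> (n - 1)) \<in> (\<Pi>\<^sub>M i\<in>{0..<n}. BXA) \<rightarrow>\<^sub>M BXA"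
    by (intro measurable_component_singleton) auto
  from measurable_compose[OF this q[unfolded stochastic_kernel_def]]
  show ?thesis
    using False by (simp add: next_state_def[abs_def])
qed

definition choose_action :: "nat \<Rightarrow> (nat \<Rightarrow> 'x \<times> 'a) \<Rightarrow> 'x \<Rightarrow> ('x \<times> 'a) measure" where
  "choose_action n \<omega> y = distr (\<pi> n (history n \<omega> y)) BXA (Pair y)"

lemma choose_measurable: "(\<lambda>(\<omega>, y). choose_action n \<omega> y) \<in> (\<Pi>\<^sub>M i\<in>{0..<n}. BXA) \<Otimes>\<^sub>M borel_of X \<rightarrow>\<^sub>M prob_algebra BXA"
proof -
  let ?M = "(\<Pi>\<^sub>M i\<in>{0..<n}. BXA) \<Otimes>\<^sub>M borel_of X"
  have "\<pi> n \<in> borel_of (history_space X A n) \<rightarrow>\<^sub>M prob_algebra (borel_of A)"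
    using \<pi> by (simp add: policies_def stochastic_kernel_def)
  from measurable_compose[OF history_measurable this]
  have 1: "(\<lambda>p. \<pi> n (history n (fst p) (snd p))) \<in> ?M \<rightarrow>\<^sub>M prob_algebra (borel_of A)"
    by (simp add: split_beta')
  have "(\<lambda>p. (snd (fst p), snd p)) \<in> ?M \<Otimes>\<^sub>M borel_of A \<rightarrow>\<^sub>M BXA"
    by (rule measurable_Pair_BXA) measurable
  then have "(\<lambda>(p, a). (snd p, a)) \<in> ?M \<Otimes>\<^sub>M borel_of A \<rightarrow>\<^sub>M BXA"
    by (simp add: split_beta')
  from measurable_distr_prob_space2[OF 1 this]
  show ?thesis
    by (simp add: choose_action_def split_beta')
qed

lemma steps_eq: "steps n \<omega> = next_state n \<omega> \<bind> choose_action n \<omega>"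
  by (simp add: step_kernel_def next_state_def choose_action_def[abs_def])

lemma steps_measurable: "steps n \<in> (\<Pi>\<^sub>M i\<in>{0..<n}. BXA) \<rightarrow>\<^sub>M prob_algebra BXA"
  unfolding steps_eq[abs_def] by (rule measurable_bind_prob_space2[OF next_state_measurable choose_measurable])

lemma Ionescu_Tulcea_steps: "Ionescu_Tulcea steps (\<lambda>_. BXA)"
  unfolding Ionescu_Tulcea_def
  using measurable_prob_algebraD[OF steps_measurable] measurable_space[OF steps_measurable]
  by (simp add: space_prob_algebra)

sublocale IT: Ionescu_Tulcea steps "\<lambda>_. BXA"
  by (rule Ionescu_Tulcea_steps)

lemma strategic_measure_eq: "L = IT.PF.lim"
  by (simp add: strategic_measure_def)

lemma sets_strategic_measure: "sets L = sets (\<Pi>\<^sub>M i\<in>UNIV. BXA)"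
  unfolding strategic_measure_eq by simp

lemma coordinate_measurable: "(\<lambda>\<omega>. \<omega> n) \<in> L \<rightarrow>\<^sub>M BXA"
  using measurable_component_singleton[of n UNIV "\<lambda>_. BXA"] measurable_cong_sets[OF sets_strategic_measure refl] by blast

lemma coordinate_space:
  assumes "\<omega> \<in> space L"
  shows "fst (\<omega> n) \<in> topspace X" "snd (\<omega> n) \<in> topspace A"
  using measurable_space[OF coordinate_measurable assms, of n] by (auto simp: mem_Times_iff)

lemma restrict_measurable: "(\<lambda>\<omega>. restrict \<omega> {0..<n}) \<in> L \<rightarrow>\<^sub>M (\<Pi>\<^sub>M i\<in>{0..<n}. BXA)"
  by (intro measurable_restrict coordinate_measurable)

lemma law_restrict: "distr L (\<Pi>\<^sub>M i\<in>{0..<n}. BXA) (\<lambda>\<omega>. restrict \<omega> {0..<n}) = IT.C 0 n (\<lambda>_. undefined)"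
proof -
  have "IT.up_to {0..<n} = n"
    unfolding IT.up_to_def
  proof (rule Least_equality)
    show "n \<le> m" if "\<forall>i\<ge>m. i \<notin> {0..<n}" for m
      using that[rule_format, of m] by simp
  qed auto
  then have "IT.CI {0..<n} = IT.C 0 n (\<lambda>_. undefined)"
    using IT.distr_C[of n n "\<lambda>_. undefined" 0] unfolding IT.CI_def
    by (simp add: space_PiM PiE_iff extensional_def)
  then show ?thesis
    unfolding strategic_measure_eq by (subst IT.distr_lim) auto
qed

text \<open>
  The law of the first \<open>n + 1\<close> coordinates is obtained from that of the first \<open>n\<close> by one step
  kernel.
\<close>

lemma nn_integral_step:
  assumes f: "f \<in> borel_measurable (\<Pi>\<^sub>M i\<in>{0..<Suc n}. BXA)"
  shows "(\<integral>\<^sup>+\<omega>. f (restrict \<omega> {0..<Suc n}) \<partial>L) =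
    (\<integral>\<^sup>+\<omega>. (\<integral>\<^sup>+s. f ((restrict \<omega> {0..<n})(n := s)) \<partial>steps n (restrict \<omega> {0..<n})) \<partial>L)"
proof -
  let ?u = "\<lambda>_ :: nat. undefined :: 'x \<times> 'a"
  have u: "?u \<in> space (\<Pi>\<^sub>M i\<in>{0..<0}. BXA)"
    by (simp add: space_PiM PiE_iff extensional_def)
  have eP: "IT.eP n \<in> IT.C 0 n ?u \<rightarrow>\<^sub>M subprob_algebra (\<Pi>\<^sub>M i\<in>{0..<Suc n}. BXA)"
    unfolding measurable_cong_sets[OF IT.sets_C[OF u, of n] refl] using IT.measurable_eP[of n] by (simp only: add_0)
  have int: "(\<lambda>\<omega>. \<integral>\<^sup>+y. f y \<partial>IT.eP n \<omega>) \<in> borel_measurable (\<Pi>\<^sub>M i\<in>{0..<n}. BXA)"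
    by (rule measurable_compose[OF IT.measurable_eP nn_integral_measurable_subprob_algebra[OF f]])
  have "(\<integral>\<^sup>+\<omega>. f (restrict \<omega> {0..<Suc n}) \<partial>L) = (\<integral>\<^sup>+\<omega>. f \<omega> \<partial>IT.C 0 (Suc n) ?u)"
    unfolding law_restrict[symmetric] by (rule nn_integral_distr_borel[OF restrict_measurable f, symmetric])
  also have "\<dots> = (\<integral>\<^sup>+\<omega>. (\<integral>\<^sup>+y. f y \<partial>IT.eP n \<omega>) \<partial>IT.C 0 n ?u)"
    using nn_integral_bind[OF f eP] by simp
  also have "\<dots> = (\<integral>\<^sup>+\<omega>. (\<integral>\<^sup>+y. f y \<partial>IT.eP n (restrict \<omega> {0..<n})) \<partial>L)"
    unfolding law_restrict[symmetric] by (rule nn_integral_distr_borel[OF restrict_measurable int])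
  also have "\<dots> = (\<integral>\<^sup>+\<omega>. (\<integral>\<^sup>+s. f ((restrict \<omega> {0..<n})(n := s)) \<partial>steps n (restrict \<omega> {0..<n})) \<partial>L)"
    by (intro nn_integral_cong IT.nn_integral_eP f measurable_space[OF restrict_measurable])
  finally show ?thesis .
qed

lemma next_state_prob: "\<omega> \<in> space L \<Longrightarrow> next_state n (restrict \<omega> {0..<n}) \<in> prob_measures X"
  using measurable_space[OF next_state_measurable measurable_space[OF restrict_measurable]] by (simp add: prob_measures_def)

lemma history_policy_prob:
  assumes "\<omega> \<in> space L" "y \<in> topspace X"
  shows "\<pi> n (history n (restrict \<omega> {0..<n}) y) \<in> prob_measures A"
proof -
  have "history n (restrict \<omega> {0..<n}) y \<in> space (borel_of (history_space X A n))"
    using measurable_space[OF history_measurable, of "(restrict \<omega> {0..<n}, y)" n] assms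
      measurable_space[OF restrict_measurable assms(1)] by (simp add: space_pair_measure)
  then show ?thesis
    using \<pi> by (intro stochastic_kernelD[of A "history_space X A n"]) (auto simp: policies_def)
qed

lemma nn_integral_coordinate:
  assumes f: "f \<in> borel_measurable BXA"
  shows "(\<integral>\<^sup>+\<omega>. f (\<omega> n) \<partial>L) = (\<integral>\<^sup>+\<omega>. (\<integral>\<^sup>+y. (\<integral>\<^sup>+a. f (y, a) \<partial>\<pi> n (history n (restrict \<omega> {0..<n}) y))
    \<partial>next_state n (restrict \<omega> {0..<n})) \<partial>L)"
proof -
  have "(\<lambda>\<omega>. f (\<omega> n)) \<in> borel_measurable (\<Pi>\<^sub>M i\<in>{0..<Suc n}. BXA)"
    by (rule measurable_compose[where f = "\<lambda>\<omega>. \<omega> n", OF measurable_component_singleton f]) simp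
  from nn_integral_step[OF this]
  have "(\<integral>\<^sup>+\<omega>. f (\<omega> n) \<partial>L) = (\<integral>\<^sup>+\<omega>. (\<integral>\<^sup>+s. f s \<partial>steps n (restrict \<omega> {0..<n})) \<partial>L)"
    by simp
  also have "\<dots> = (\<integral>\<^sup>+\<omega>. (\<integral>\<^sup>+y. (\<integral>\<^sup>+a. f (y, a) \<partial>\<pi> n (history n (restrict \<omega> {0..<n}) y))
    \<partial>next_state n (restrict \<omega> {0..<n})) \<partial>L)"
  proof (rule nn_integral_cong)
    fix \<omega> assume \<omega>: "\<omega> \<in> space L"
    then have r: "restrict \<omega> {0..<n} \<in> space (\<Pi>\<^sub>M i\<in>{0..<n}. BXA)" (is "?r \<in> _")
      by (rule measurable_space[OF restrict_measurable])
    note N = next_state_prob[OF \<omega>, of n]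
    have cm: "choose_action n ?r \<in> borel_of X \<rightarrow>\<^sub>M prob_algebra BXA"
      using measurable_Pair2[OF choose_measurable r] by simp
    have "(\<integral>\<^sup>+s. f s \<partial>steps n ?r) = (\<integral>\<^sup>+y. (\<integral>\<^sup>+s. f s \<partial>choose_action n ?r y) \<partial>next_state n ?r)"
      unfolding steps_eq
      by (rule nn_integral_bind[OF f measurable_prob_measures[OF N measurable_prob_algebraD[OF cm]]])
    also have "\<dots> = (\<integral>\<^sup>+y. (\<integral>\<^sup>+a. f (y, a) \<partial>\<pi> n (history n ?r y)) \<partial>next_state n ?r)"
    proof (rule nn_integral_cong)
      fix y assume "y \<in> space (next_state n ?r)"
      then have y: "y \<in> topspace X"
        using prob_measuresD(3)[OF N] by simp
      note P = history_policy_prob[OF \<omega> y, of n]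
      have Py: "Pair y \<in> borel_of A \<rightarrow>\<^sub>M BXA"
        by (rule measurable_Pair_BXA) (use y in auto)
      show "(\<integral>\<^sup>+s. f s \<partial>choose_action n ?r y) = (\<integral>\<^sup>+a. f (y, a) \<partial>\<pi> n (history n ?r y))"
        unfolding choose_action_def by (rule nn_integral_distr_borel[OF measurable_prob_measures[OF P Py] f])
    qed
    finally show "(\<integral>\<^sup>+s. f s \<partial>steps n ?r) = (\<integral>\<^sup>+y. (\<integral>\<^sup>+a. f (y, a) \<partial>\<pi> n (history n ?r y)) \<partial>next_state n ?r)" .
  qed
  finally show ?thesis .
qed

lemma nn_integral_state:
  assumes g: "g \<in> borel_measurable (borel_of X)"
  shows "(\<integral>\<^sup>+\<omega>. g (fst (\<omega> n)) \<partial>L) = (\<integral>\<^sup>+\<omega>. (\<integral>\<^sup>+y. g y \<partial>next_state n (restrict \<omega> {0..<n})) \<partial>L)"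
proof -
  have "(\<lambda>s. g (fst s)) \<in> borel_measurable BXA"
    by (rule measurable_compose[OF fst_BXA g])
  from nn_integral_coordinate[OF this, of n]
  have "(\<integral>\<^sup>+\<omega>. g (fst (\<omega> n)) \<partial>L) = (\<integral>\<^sup>+\<omega>. (\<integral>\<^sup>+y. (\<integral>\<^sup>+a. g y \<partial>\<pi> n (history n (restrict \<omega> {0..<n}) y))
    \<partial>next_state n (restrict \<omega> {0..<n})) \<partial>L)"
    by simp
  also have "\<dots> = (\<integral>\<^sup>+\<omega>. (\<integral>\<^sup>+y. g y \<partial>next_state n (restrict \<omega> {0..<n})) \<partial>L)"
  proof (intro nn_integral_cong)
    fix \<omega> y assume \<omega>: "\<omega> \<in> space L" and y: "y \<in> space (next_state n (restrict \<omega> {0..<n}))"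
    have "y \<in> topspace X"
      using y prob_measuresD(3)[OF next_state_prob[OF \<omega>]] by simp
    from prob_measuresD(1)[OF history_policy_prob[OF \<omega> this]]
    show "(\<integral>\<^sup>+a. g y \<partial>\<pi> n (history n (restrict \<omega> {0..<n}) y)) = g y"
      by (simp add: prob_space.emeasure_space_1)
  qed
  finally show ?thesis .
qed

lemma prob_space_strategic_measure: "prob_space L"
proof (rule prob_space_distrD[OF restrict_measurable[of 0]])
  show "prob_space (distr L (\<Pi>\<^sub>M i\<in>{0..<0}. BXA) (\<lambda>\<omega>. restrict \<omega> {0..<0}))"
    unfolding law_restrict by (rule IT.prob_space_C) (simp add: space_PiM PiE_iff extensional_def)
qed

lemma nn_integral_initial_state:
  assumes g: "g \<in> borel_measurable (borel_of X)"
  shows "(\<integral>\<^sup>+\<omega>. g (fst (\<omega> 0)) \<partial>L) = g x"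
  using nn_integral_state[OF g, of 0] x prob_space.emeasure_space_1[OF prob_space_strategic_measure]
  by (simp add: next_state_def nn_integral_return[OF _ g])

lemma nn_integral_next_state:
  assumes g: "g \<in> borel_measurable (borel_of X)"
  shows "(\<integral>\<^sup>+\<omega>. g (fst (\<omega> (Suc n))) \<partial>L) = (\<integral>\<^sup>+\<omega>. (\<integral>\<^sup>+y. g y \<partial>q (\<omega> n)) \<partial>L)"
  using nn_integral_state[OF g, of "Suc n"] by (simp add: next_state_def)

end

text \<open>
  A Markov policy puts its action on the graph of \<open>\<phi> n\<close>.
\<close>

lemma nn_integral_markov_action:
  assumes "controlled_process X A q (markov_policy A \<phi>) x" and \<phi>: "\<forall>t. \<phi> t \<in> borel_selectors X A"
    and f: "f \<in> borel_measurable (borel_of (prod_topology X A))"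
  shows "(\<integral>\<^sup>+\<omega>. f (\<omega> n) \<partial>strategic_measure X A q (markov_policy A \<phi>) x) =
    (\<integral>\<^sup>+\<omega>. f (fst (\<omega> n), \<phi> n (fst (\<omega> n))) \<partial>strategic_measure X A q (markov_policy A \<phi>) x)"
proof -
  interpret controlled_process X A q "markov_policy A \<phi>" x
    by fact
  have \<phi>n: "\<phi> n \<in> borel_of X \<rightarrow>\<^sub>M borel_of A"
    using \<phi> by (simp add: borel_selectors_def)
  have "(\<lambda>y. (y, \<phi> n y)) \<in> borel_of X \<rightarrow>\<^sub>M BXA"
    by (rule measurable_Pair_BXA) (use \<phi>n in auto)
  from measurable_compose[OF this f]
  have g: "(\<lambda>y. f (y, \<phi> n y)) \<in> borel_measurable (borel_of X)" .
  have "(\<integral>\<^sup>+\<omega>. f (\<omega> n) \<partial>L) = (\<integral>\<^sup>+\<omega>. (\<integral>\<^sup>+y. f (y, \<phi> n y) \<partial>next_state n (restrict \<omega> {0..<n})) \<partial>L)"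
    unfolding nn_integral_coordinate[OF f]
  proof (intro nn_integral_cong)
    fix \<omega> y assume \<omega>: "\<omega> \<in> space L" and y: "y \<in> space (next_state n (restrict \<omega> {0..<n}))"
    have yt: "y \<in> topspace X"
      using y prob_measuresD(3)[OF next_state_prob[OF \<omega>]] by simp
    have "Pair y \<in> borel_of A \<rightarrow>\<^sub>M BXA"
      by (rule measurable_Pair_BXA) (use yt in auto)
    from measurable_compose[OF this f]
    have fy: "(\<lambda>a. f (y, a)) \<in> borel_measurable (borel_of A)" .
    have "markov_policy A \<phi> n (history n (restrict \<omega> {0..<n}) y) = return (borel_of A) (\<phi> n y)"
      by (cases n) (auto simp: markov_policy_def history_def)
    then show "(\<integral>\<^sup>+a. f (y, a) \<partial>markov_policy A \<phi> n (history n (restrict \<omega> {0..<n}) y)) = f (y, \<phi> n y)"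
      using nn_integral_return[OF _ fy, of "\<phi> n y"] measurable_space[OF \<phi>n, of y] yt by simp
  qed
  also have "\<dots> = (\<integral>\<^sup>+\<omega>. f (fst (\<omega> n), \<phi> n (fst (\<omega> n))) \<partial>L)"
    by (rule nn_integral_state[OF g, symmetric])
  finally show ?thesis .
qed

section \<open>Optimality\<close>

lemma attains_min_cong:
  "(\<And>a. a \<in> topspace A \<Longrightarrow> f a = g a) \<Longrightarrow> attains_min A f a \<longleftrightarrow> attains_min A g a"
  by (auto simp: attains_min_def is_arg_min_def)

context inf_compact_mdp
begin

lemma controlled_processI: "\<pi> \<in> policies X A \<Longrightarrow> x \<in> topspace X \<Longrightarrow> controlled_process X A q \<pi> x"
  by (rule controlled_process.intro) (use X A q in auto)

text \<open>
  Costs of policies depend on the measure of the policy only through these expectations.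
\<close>

definition stage_cost :: "('x, 'a) policy \<Rightarrow> 'x \<Rightarrow> nat \<Rightarrow> ennreal" where
  "stage_cost \<pi> x t = (\<integral>\<^sup>+\<omega>. c (\<omega> t) \<partial>strategic_measure X A q \<pi> x)"

lemma c_measurable: "c \<in> borel_measurable (borel_of (prod_topology X A))"
  by (rule lower_semicontinuous_measurable[OF K_inf_compact_lower_semicontinuous[OF metrizable(1,2) c_inf_compact]])

lemma policy_cost_fin_eq:
  assumes "\<pi> \<in> policies X A" "x \<in> topspace X"
  shows "policy_cost_fin X A q c \<alpha> T \<pi> x = (\<Sum>t<T. ennreal (\<alpha> ^ t) * stage_cost \<pi> x t)"
proof -
  interpret controlled_process X A q \<pi> x
    by (rule controlled_processI[OF assms])
  have c: "(\<lambda>\<omega>. c (\<omega> t)) \<in> borel_measurable L" for t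
    by (rule measurable_compose[OF coordinate_measurable c_measurable])
  show ?thesis
    unfolding policy_cost_fin_def stage_cost_def using c by (simp add: nn_integral_sum nn_integral_cmult)
qed

lemma policy_cost_inf_eq:
  assumes "\<pi> \<in> policies X A" "x \<in> topspace X"
  shows "policy_cost_inf X A q c \<alpha> \<pi> x = (\<Sum>t. ennreal (\<alpha> ^ t) * stage_cost \<pi> x t)"
proof -
  interpret controlled_process X A q \<pi> x
    by (rule controlled_processI[OF assms])
  have c: "(\<lambda>\<omega>. c (\<omega> t)) \<in> borel_measurable L" for t
    by (rule measurable_compose[OF coordinate_measurable c_measurable])
  show ?thesis
    unfolding policy_cost_inf_def stage_cost_def using c by (simp add: nn_integral_suminf nn_integral_cmult)
qed

lemma policy_cost_inf_SUP:
  assumes "\<pi> \<in> policies X A" "x \<in> topspace X"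
  shows "policy_cost_inf X A q c \<alpha> \<pi> x = (SUP T. policy_cost_fin X A q c \<alpha> T \<pi> x)"
  unfolding policy_cost_inf_eq[OF assms] policy_cost_fin_eq[OF assms] by (rule suminf_eq_SUP)

definition expected_value :: "('x, 'a) policy \<Rightarrow> 'x \<Rightarrow> nat \<Rightarrow> ('x \<Rightarrow> ennreal) \<Rightarrow> ennreal" where
  "expected_value \<pi> x t v = (\<integral>\<^sup>+\<omega>. v (fst (\<omega> t)) \<partial>strategic_measure X A q \<pi> x)"

lemma expected_value_0:
  assumes "\<pi> \<in> policies X A" "x \<in> topspace X" "lower_semicontinuous X v"
  shows "expected_value \<pi> x 0 v = v x"
  unfolding expected_value_def
  by (rule controlled_process.nn_integral_initial_state[OF controlled_processI[OF assms(1,2)]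
        lower_semicontinuous_measurable[OF assms(3)]])

lemma bellman_measurable:
  assumes "lower_semicontinuous X v"
  shows "(\<lambda>s. bellman q c \<alpha> v (fst s) (snd s)) \<in> borel_measurable (borel_of (prod_topology X A))"
  by (rule lower_semicontinuous_measurable[OF K_inf_compact_lower_semicontinuous[OF metrizable(1,2)
        bellman_K_inf_compact[OF assms]]])

lemma expected_bellman:
  assumes "\<pi> \<in> policies X A" "x \<in> topspace X" and v: "lower_semicontinuous X v"
  shows "(\<integral>\<^sup>+\<omega>. bellman q c \<alpha> v (fst (\<omega> t)) (snd (\<omega> t)) \<partial>strategic_measure X A q \<pi> x) =
    stage_cost \<pi> x t + ennreal \<alpha> * expected_value \<pi> x (Suc t) v"
proof -
  interpret controlled_process X A q \<pi> x
    by (rule controlled_processI[OF assms(1,2)])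
  have c: "(\<lambda>\<omega>. c (\<omega> t)) \<in> borel_measurable L"
    by (rule measurable_compose[OF coordinate_measurable c_measurable])
  have i: "(\<lambda>\<omega>. \<integral>\<^sup>+y. v y \<partial>q (\<omega> t)) \<in> borel_measurable L"
    by (rule measurable_compose[OF coordinate_measurable lower_semicontinuous_measurable[OF lower_semicontinuous_expectation[OF v]]])
  show ?thesis
    using c i nn_integral_next_state[OF lower_semicontinuous_measurable[OF v]]
    by (simp add: bellman_def stage_cost_def expected_value_def nn_integral_add nn_integral_cmult)
qed

lemma expected_value_le:
  assumes \<pi>: "\<pi> \<in> policies X A" "x \<in> topspace X" and v: "lower_semicontinuous X v"
  shows "expected_value \<pi> x t (bellman_min v) \<le> stage_cost \<pi> x t + ennreal \<alpha> * expected_value \<pi> x (Suc t) v"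
proof -
  interpret controlled_process X A q \<pi> x
    by (rule controlled_processI[OF assms(1,2)])
  show ?thesis
    unfolding expected_bellman[OF assms, symmetric] expected_value_def[of _ _ _ "bellman_min v"]
    by (intro nn_integral_mono bellman_min_le coordinate_space(2))
qed

lemma expected_value_eq:
  assumes \<phi>: "\<forall>t. \<phi> t \<in> borel_selectors X A" and x: "x \<in> topspace X" and v: "lower_semicontinuous X v"
    and min: "\<forall>y\<in>topspace X. bellman q c \<alpha> v y (\<phi> t y) = bellman_min v y"
  shows "expected_value (markov_policy A \<phi>) x t (bellman_min v) =
    stage_cost (markov_policy A \<phi>) x t + ennreal \<alpha> * expected_value (markov_policy A \<phi>) x (Suc t) v"
proof -
  note \<pi> = markov_policy_in_policies[OF \<phi>]
  interpret controlled_process X A q "markov_policy A \<phi>" x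
    by (rule controlled_processI[OF \<pi> x])
  have "(\<integral>\<^sup>+\<omega>. bellman q c \<alpha> v (fst (\<omega> t)) (snd (\<omega> t)) \<partial>L) =
      (\<integral>\<^sup>+\<omega>. bellman q c \<alpha> v (fst (\<omega> t)) (\<phi> t (fst (\<omega> t))) \<partial>L)"
    using nn_integral_markov_action[OF controlled_processI[OF \<pi> x] \<phi> bellman_measurable[OF v]] by simp
  also have "\<dots> = expected_value (markov_policy A \<phi>) x t (bellman_min v)"
    unfolding expected_value_def by (intro nn_integral_cong) (simp add: min coordinate_space(1))
  finally show ?thesis
    by (simp add: expected_bellman[OF \<pi> x v])
qed

lemma discounted_step: "ennreal (\<alpha> ^ n) * (a + ennreal \<alpha> * b) = ennreal (\<alpha> ^ n) * a + ennreal (\<alpha> ^ Suc n) * b"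
proof -
  have "ennreal (\<alpha> ^ Suc n) = ennreal (\<alpha> ^ n) * ennreal \<alpha>"
    using \<alpha>_nonneg by (simp add: ennreal_mult[symmetric] mult.commute)
  then show ?thesis
    by (simp only: distrib_left mult.assoc)
qed

text \<open>
  The expected cost of the first \<open>n\<close> steps plus the discounted expectation of the value iterate for
  the remaining horizon does not decrease with \<open>n\<close>, since at each step the Bellman minimum is at most the
  value of the action that is taken.
\<close>

lemma value_iterate_le_cost:
  assumes \<pi>: "\<pi> \<in> policies X A" "x \<in> topspace X"
  shows "value_iterate T x \<le> policy_cost_fin X A q c \<alpha> T \<pi> x"
proof -
  have "n \<le> T \<Longrightarrow> value_iterate T x \<le> (\<Sum>t<n. ennreal (\<alpha> ^ t) * stage_cost \<pi> x t) +
      ennreal (\<alpha> ^ n) * expected_value \<pi> x n (value_iterate (T - n))" for n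
  proof (induction n)
    case 0
    show ?case
      using expected_value_0[OF \<pi> lower_semicontinuous_value_iterate] by simp
  next
    case (Suc n)
    have "T - n = Suc (T - Suc n)"
      using Suc.prems by simp
    then have "value_iterate (T - n) = bellman_min (value_iterate (T - Suc n))"
      by simp
    then have "ennreal (\<alpha> ^ n) * expected_value \<pi> x n (value_iterate (T - n)) \<le>
        ennreal (\<alpha> ^ n) * stage_cost \<pi> x n + ennreal (\<alpha> ^ Suc n) * expected_value \<pi> x (Suc n) (value_iterate (T - Suc n))"
      unfolding discounted_step[symmetric]
      using expected_value_le[OF \<pi> lower_semicontinuous_value_iterate] by (intro mult_left_mono) auto
    then have "(\<Sum>t<n. ennreal (\<alpha> ^ t) * stage_cost \<pi> x t) + ennreal (\<alpha> ^ n) * expected_value \<pi> x n (value_iterate (T - n))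
        \<le> (\<Sum>t<Suc n. ennreal (\<alpha> ^ t) * stage_cost \<pi> x t) + ennreal (\<alpha> ^ Suc n) * expected_value \<pi> x (Suc n) (value_iterate (T - Suc n))"
      by (simp add: add.assoc add_left_mono)
    then show ?case
      using Suc.IH Suc.prems by (simp add: order_trans)
  qed
  from this[of T] show ?thesis
    by (simp add: policy_cost_fin_eq[OF \<pi>] expected_value_def)
qed

text \<open>
  The same interpolation is constant when each action attains its minimum. At time \<open>n\<close> there are
  \<open>T - n\<close> steps left, which explains the reversed index of the selectors.
\<close>

lemma value_iterate_eq_cost:
  assumes \<phi>: "\<forall>t. \<phi> t \<in> borel_selectors X A" and x: "x \<in> topspace X"
    and min: "\<forall>y\<in>topspace X. \<forall>t<T. bellman q c \<alpha> (value_iterate t) y (\<phi> (T - 1 - t) y) = value_iterate (Suc t) y"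
  shows "policy_cost_fin X A q c \<alpha> T (markov_policy A \<phi>) x = value_iterate T x"
proof -
  let ?\<pi> = "markov_policy A \<phi>"
  note \<pi> = markov_policy_in_policies[OF \<phi>]
  have "n \<le> T \<Longrightarrow> value_iterate T x = (\<Sum>t<n. ennreal (\<alpha> ^ t) * stage_cost ?\<pi> x t) +
      ennreal (\<alpha> ^ n) * expected_value ?\<pi> x n (value_iterate (T - n))" for n
  proof (induction n)
    case 0
    show ?case
      using expected_value_0[OF \<pi> x lower_semicontinuous_value_iterate] by simp
  next
    case (Suc n)
    have T: "T - n = Suc (T - Suc n)" "T - 1 - (T - Suc n) = n" "T - Suc n < T"
      using Suc.prems by auto
    have "\<forall>y\<in>topspace X. bellman q c \<alpha> (value_iterate (T - Suc n)) y (\<phi> n y) = bellman_min (value_iterate (T - Suc n)) y"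
    proof
      fix y assume "y \<in> topspace X"
      then show "bellman q c \<alpha> (value_iterate (T - Suc n)) y (\<phi> n y) = bellman_min (value_iterate (T - Suc n)) y"
        using min[rule_format, of y "T - Suc n"] T(2,3) by simp
    qed
    note step = expected_value_eq[where t = n, OF \<phi> x lower_semicontinuous_value_iterate this]
    have "ennreal (\<alpha> ^ n) * expected_value ?\<pi> x n (value_iterate (T - n)) =
        ennreal (\<alpha> ^ n) * stage_cost ?\<pi> x n + ennreal (\<alpha> ^ Suc n) * expected_value ?\<pi> x (Suc n) (value_iterate (T - Suc n))"
      unfolding T(1) value_iterate.simps step by (rule discounted_step)
    then show ?case
      using Suc.IH Suc.prems by (simp add: add.assoc)
  qed
  from this[of T] show ?thesis
    by (simp add: policy_cost_fin_eq[OF \<pi> x] expected_value_def)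
qed

lemma value_iterate_selectors:
  obtains \<psi> where "\<forall>t. \<psi> t \<in> borel_selectors X A"
    "\<forall>t. \<forall>y\<in>topspace X. bellman q c \<alpha> (value_iterate t) y (\<psi> t y) = value_iterate (Suc t) y"
proof -
  have "\<exists>\<psi>. \<psi> \<in> borel_selectors X A \<and> (\<forall>y\<in>topspace X. bellman q c \<alpha> (value_iterate t) y (\<psi> y) = value_iterate (Suc t) y)" for t
    unfolding value_iterate.simps by (rule bellman_min_selector[OF lower_semicontinuous_value_iterate]) blast
  then obtain \<psi> where "\<forall>t. \<psi> t \<in> borel_selectors X A \<and> (\<forall>y\<in>topspace X. bellman q c \<alpha> (value_iterate t) y (\<psi> t y) = value_iterate (Suc t) y)"
    by (elim choice[OF allI, THEN exE]) (rule that)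
  then show ?thesis
    by (intro that[of \<psi>]) auto
qed

lemma value_iterate_policy:
  obtains \<phi> where "\<forall>t. \<phi> t \<in> borel_selectors X A"
    "\<forall>x\<in>topspace X. policy_cost_fin X A q c \<alpha> T (markov_policy A \<phi>) x = value_iterate T x"
proof -
  obtain \<psi> where \<psi>: "\<forall>t. \<psi> t \<in> borel_selectors X A"
    "\<forall>t. \<forall>y\<in>topspace X. bellman q c \<alpha> (value_iterate t) y (\<psi> t y) = value_iterate (Suc t) y"
    by (rule value_iterate_selectors)
  define \<phi> where "\<phi> t = \<psi> (T - 1 - t)" for t
  have "\<forall>y\<in>topspace X. \<forall>t<T. bellman q c \<alpha> (value_iterate t) y (\<phi> (T - 1 - t) y) = value_iterate (Suc t) y"
  proof (intro ballI allI impI)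
    fix y t assume "y \<in> topspace X" "t < T"
    then show "bellman q c \<alpha> (value_iterate t) y (\<phi> (T - 1 - t) y) = value_iterate (Suc t) y"
      using \<psi>(2)[rule_format, of y t] by (simp add: \<phi>_def)
  qed
  moreover have "\<forall>t. \<phi> t \<in> borel_selectors X A"
    using \<psi>(1) by (simp add: \<phi>_def)
  ultimately show ?thesis
    by (intro that[of \<phi>] ballI value_iterate_eq_cost) auto
qed

lemma value_fin_eq:
  assumes x: "x \<in> topspace X"
  shows "value_fin X A q c \<alpha> T x = value_iterate T x"
proof (rule antisym)
  obtain \<phi> where \<phi>: "\<forall>t. \<phi> t \<in> borel_selectors X A"
    "\<forall>x\<in>topspace X. policy_cost_fin X A q c \<alpha> T (markov_policy A \<phi>) x = value_iterate T x"
    by (rule value_iterate_policy)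
  show "value_fin X A q c \<alpha> T x \<le> value_iterate T x"
    unfolding value_fin_def using \<phi>(2) x by (intro INF_lower2[OF markov_policy_in_policies[OF \<phi>(1)]]) simp
  show "value_iterate T x \<le> value_fin X A q c \<alpha> T x"
    unfolding value_fin_def by (intro INF_greatest value_iterate_le_cost x)
qed

lemma stationary_policy_in_policies: "\<phi> \<in> borel_selectors X A \<Longrightarrow> stationary_policy A \<phi> \<in> policies X A"
  unfolding stationary_policy_def by (rule markov_policy_in_policies) simp

lemma limit_value_le_cost:
  assumes \<pi>: "\<pi> \<in> policies X A" "x \<in> topspace X"
  shows "limit_value x \<le> policy_cost_inf X A q c \<alpha> \<pi> x"
  unfolding limit_value_def policy_cost_inf_SUP[OF \<pi>]
  by (intro SUP_mono) (use value_iterate_le_cost[OF \<pi>] in blast)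

text \<open>
  The interpolation with the continuation value \<open>limit_value\<close> is constant, so the cost of every finite horizon
  is at most \<open>limit_value x\<close>.
\<close>

lemma stationary_cost_eq_limit_value:
  assumes \<phi>: "\<phi> \<in> borel_selectors X A" and x: "x \<in> topspace X"
    and min: "\<forall>y\<in>topspace X. bellman q c \<alpha> limit_value y (\<phi> y) = bellman_min limit_value y"
  shows "policy_cost_inf X A q c \<alpha> (stationary_policy A \<phi>) x = limit_value x"
proof (rule antisym)
  let ?\<pi> = "markov_policy A (\<lambda>_. \<phi>)"
  have \<pi>: "?\<pi> \<in> policies X A"
    using \<phi> by (intro markov_policy_in_policies) simp
  have step: "expected_value ?\<pi> x n (bellman_min limit_value) =
      stage_cost ?\<pi> x n + ennreal \<alpha> * expected_value ?\<pi> x (Suc n) limit_value" for n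
    by (rule expected_value_eq[OF _ x lower_semicontinuous_limit_value]) (use min \<phi> in auto)
  have cong: "expected_value ?\<pi> x n (bellman_min limit_value) = expected_value ?\<pi> x n limit_value" for n
    unfolding expected_value_def using controlled_process.coordinate_space(1)[OF controlled_processI[OF \<pi> x]]
    by (intro nn_integral_cong) (simp add: limit_value_optimality[symmetric])
  have "limit_value x = (\<Sum>t<n. ennreal (\<alpha> ^ t) * stage_cost ?\<pi> x t) + ennreal (\<alpha> ^ n) * expected_value ?\<pi> x n limit_value" for n
  proof (induction n)
    case 0
    show ?case
      using expected_value_0[OF \<pi> x lower_semicontinuous_limit_value] by simp
  next
    case (Suc n)
    have "ennreal (\<alpha> ^ n) * expected_value ?\<pi> x n limit_value =
        ennreal (\<alpha> ^ n) * stage_cost ?\<pi> x n + ennreal (\<alpha> ^ Suc n) * expected_value ?\<pi> x (Suc n) limit_value"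
      unfolding cong[symmetric, of n] step by (rule discounted_step)
    then show ?case
      using Suc.IH by (simp add: add.assoc)
  qed
  then have "policy_cost_fin X A q c \<alpha> T ?\<pi> x \<le> limit_value x" for T
    unfolding policy_cost_fin_eq[OF \<pi> x] by (metis le_iff_add)
  then show "policy_cost_inf X A q c \<alpha> (stationary_policy A \<phi>) x \<le> limit_value x"
    unfolding stationary_policy_def policy_cost_inf_SUP[OF \<pi> x] by (rule SUP_least)
  show "limit_value x \<le> policy_cost_inf X A q c \<alpha> (stationary_policy A \<phi>) x"
    by (rule limit_value_le_cost[OF stationary_policy_in_policies[OF \<phi>] x])
qed

lemma value_inf_eq:
  assumes x: "x \<in> topspace X"
  shows "value_inf X A q c \<alpha> x = limit_value x"
proof (rule antisym)
  obtain \<phi> where \<phi>: "\<phi> \<in> borel_selectors X A" "\<forall>x\<in>topspace X. bellman q c \<alpha> limit_value x (\<phi> x) = bellman_min limit_value x"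
    by (rule bellman_min_selector[OF lower_semicontinuous_limit_value])
  show "value_inf X A q c \<alpha> x \<le> limit_value x"
    unfolding value_inf_def using stationary_cost_eq_limit_value[OF \<phi>(1) x \<phi>(2)]
    by (intro INF_lower2[OF stationary_policy_in_policies[OF \<phi>(1)]]) simp
  show "limit_value x \<le> value_inf X A q c \<alpha> x"
    unfolding value_inf_def by (intro INF_greatest limit_value_le_cost x)
qed

text \<open>
  Under a stationary policy the expectations are iterates of the one-step operator \<open>T\<close>; this
  relates the costs from different initial states without a Markov property of the whole measure.
\<close>

lemma stationary_stage_cost:
  assumes \<phi>: "\<phi> \<in> borel_selectors X A"
  defines "T \<equiv> \<lambda>g y. \<integral>\<^sup>+z. g z \<partial>q (y, \<phi> y)"
  shows "g \<in> borel_measurable (borel_of X) \<Longrightarrow> x \<in> topspace X \<Longrightarrow>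
    expected_value (stationary_policy A \<phi>) x t g = (T ^^ t) g x"
    and "g \<in> borel_measurable (borel_of X) \<Longrightarrow> (T ^^ t) g \<in> borel_measurable (borel_of X)"
    and "x \<in> topspace X \<Longrightarrow> stage_cost (stationary_policy A \<phi>) x t = (T ^^ t) (\<lambda>y. c (y, \<phi> y)) x"
    and "(\<lambda>y. c (y, \<phi> y)) \<in> borel_measurable (borel_of X)"
proof -
  note \<pi> = stationary_policy_in_policies[OF \<phi>]
  have sc: "second_countable X" "second_countable A"
    using X A by (auto simp: separable_metrizable_def)
  have graph: "(\<lambda>y. (y, \<phi> y)) \<in> borel_of X \<rightarrow>\<^sub>M borel_of (prod_topology X A)"
    using measurable_Pair[OF measurable_ident_sets[OF refl] \<phi>[unfolded borel_selectors_def]]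
      measurable_cong_sets[OF refl sets_borel_of_prod_topology[OF sc], of "borel_of X"] by simp
  show c\<phi>: "(\<lambda>y. c (y, \<phi> y)) \<in> borel_measurable (borel_of X)"
    by (rule measurable_compose[OF graph c_measurable])
  have T: "T g \<in> borel_measurable (borel_of X)" if g: "g \<in> borel_measurable (borel_of X)" for g
    unfolding T_def
    by (rule measurable_compose[OF measurable_compose[OF graph measurable_prob_algebraD[OF q(1)[unfolded stochastic_kernel_def]]]
          nn_integral_measurable_subprob_algebra[OF g]])
  have Tn: "(T ^^ t) g \<in> borel_measurable (borel_of X)" if "g \<in> borel_measurable (borel_of X)" for t g
    by (induction t) (use that T in auto)
  then show "g \<in> borel_measurable (borel_of X) \<Longrightarrow> (T ^^ t) g \<in> borel_measurable (borel_of X)" .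
  have E: "expected_value (stationary_policy A \<phi>) x t g = (T ^^ t) g x"
    if g: "g \<in> borel_measurable (borel_of X)" and x: "x \<in> topspace X" for g x t
    using g
  proof (induction t arbitrary: g)
    case 0
    show ?case
      using controlled_process.nn_integral_initial_state[OF controlled_processI[OF \<pi> x] 0] by (simp add: expected_value_def)
  next
    case (Suc t)
    have f: "(\<lambda>s. \<integral>\<^sup>+y. g y \<partial>q s) \<in> borel_measurable (borel_of (prod_topology X A))"
      by (rule measurable_compose[OF measurable_prob_algebraD[OF q(1)[unfolded stochastic_kernel_def]]
          nn_integral_measurable_subprob_algebra[OF Suc.prems]])
    have "expected_value (stationary_policy A \<phi>) x (Suc t) g = expected_value (stationary_policy A \<phi>) x t (T g)"
      unfolding expected_value_def T_def
        controlled_process.nn_integral_next_state[OF controlled_processI[OF \<pi> x] Suc.prems]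
      using nn_integral_markov_action[OF controlled_processI[OF \<pi>[unfolded stationary_policy_def] x] _ f, of t] \<phi>
      by (simp add: stationary_policy_def)
    also have "\<dots> = (T ^^ Suc t) g x"
      using Suc.IH[OF T[OF Suc.prems]] by (simp add: funpow_swap1)
    finally show ?case .
  qed
  then show "g \<in> borel_measurable (borel_of X) \<Longrightarrow> x \<in> topspace X \<Longrightarrow>
    expected_value (stationary_policy A \<phi>) x t g = (T ^^ t) g x" .
  assume x: "x \<in> topspace X"
  have "stage_cost (stationary_policy A \<phi>) x t = expected_value (stationary_policy A \<phi>) x t (\<lambda>y. c (y, \<phi> y))"
    unfolding stage_cost_def expected_value_def
    using nn_integral_markov_action[OF controlled_processI[OF \<pi>[unfolded stationary_policy_def] x] _ c_measurable, of t] \<phi>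
    by (simp add: stationary_policy_def)
  then show "stage_cost (stationary_policy A \<phi>) x t = (T ^^ t) (\<lambda>y. c (y, \<phi> y)) x"
    by (simp add: E[OF c\<phi> x])
qed

text \<open>
  The series over the iterates of \<open>T\<close> is shifted by one term.
\<close>

lemma stationary_cost_recursion:
  assumes \<phi>: "\<phi> \<in> borel_selectors X A" and x: "x \<in> topspace X"
  defines "w \<equiv> policy_cost_inf X A q c \<alpha> (stationary_policy A \<phi>)"
  shows "w x = bellman q c \<alpha> w x (\<phi> x)"
proof -
  define T where "T = (\<lambda>(g :: 'x \<Rightarrow> ennreal) y. \<integral>\<^sup>+z. g z \<partial>q (y, \<phi> y))"
  define g where "g = (\<lambda>y. c (y, \<phi> y))"
  note facts = stationary_stage_cost[OF \<phi>, folded T_def g_def]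
  have \<phi>x: "\<phi> x \<in> topspace A"
    using measurable_space[OF \<phi>[unfolded borel_selectors_def]] x by simp
  note Q = q_prob[OF x \<phi>x]
  have w: "w y = (\<Sum>t. ennreal (\<alpha> ^ t) * (T ^^ t) g y)" if "y \<in> topspace X" for y
    unfolding w_def policy_cost_inf_eq[OF stationary_policy_in_policies[OF \<phi>] that] using facts(3)[OF that] by simp
  have m: "(T ^^ t) g \<in> borel_measurable (q (x, \<phi> x))" for t
    by (rule measurable_prob_measures[OF Q facts(2)[OF facts(4)]])
  have "(\<integral>\<^sup>+y. w y \<partial>q (x, \<phi> x)) = (\<integral>\<^sup>+y. (\<Sum>t. ennreal (\<alpha> ^ t) * (T ^^ t) g y) \<partial>q (x, \<phi> x))"
    by (intro nn_integral_cong) (simp add: w prob_measuresD(3)[OF Q])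
  also have "\<dots> = (\<Sum>t. ennreal (\<alpha> ^ t) * (\<integral>\<^sup>+y. (T ^^ t) g y \<partial>q (x, \<phi> x)))"
    using m by (simp add: nn_integral_suminf nn_integral_cmult)
  also have "\<dots> = (\<Sum>t. ennreal (\<alpha> ^ t) * (T ^^ Suc t) g x)"
    by (simp add: T_def)
  finally have int: "(\<integral>\<^sup>+y. w y \<partial>q (x, \<phi> x)) = (\<Sum>t. ennreal (\<alpha> ^ t) * (T ^^ Suc t) g x)" .
  have "ennreal \<alpha> * (ennreal (\<alpha> ^ t) * z) = ennreal (\<alpha> ^ Suc t) * z" for t z
    using \<alpha>_nonneg by (simp add: ennreal_mult mult.assoc)
  then have "ennreal \<alpha> * (\<integral>\<^sup>+y. w y \<partial>q (x, \<phi> x)) = (\<Sum>t. ennreal (\<alpha> ^ Suc t) * (T ^^ Suc t) g x)"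
    unfolding int ennreal_suminf_cmult[symmetric] by simp
  then have "bellman q c \<alpha> w x (\<phi> x) = (\<Sum>t. ennreal (\<alpha> ^ Suc t) * (T ^^ Suc t) g x) + ennreal (\<alpha> ^ 0) * (T ^^ 0) g x"
    by (simp add: bellman_def g_def add.commute)
  also have "\<dots> = w x"
    unfolding w[OF x] using suminf_offset[of "\<lambda>t. ennreal (\<alpha> ^ t) * (T ^^ t) g x" 1] by (simp add: add.commute)
  finally show ?thesis ..
qed

lemma attains_min_value_fin:
  "x \<in> topspace X \<Longrightarrow> attains_min A (bellman q c \<alpha> (value_fin X A q c \<alpha> t) x) a \<longleftrightarrow>
    a \<in> topspace A \<and> bellman q c \<alpha> (value_iterate t) x a = value_iterate (Suc t) x"
  using attains_min_cong[of A "bellman q c \<alpha> (value_fin X A q c \<alpha> t) x" "bellman q c \<alpha> (value_iterate t) x" a]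
    bellman_cong[of x _ "value_fin X A q c \<alpha> t" "value_iterate t"]
  by (simp add: attains_min_iff value_fin_eq)

lemma attains_min_value_inf:
  "x \<in> topspace X \<Longrightarrow> attains_min A (bellman q c \<alpha> (value_inf X A q c \<alpha>) x) a \<longleftrightarrow>
    a \<in> topspace A \<and> bellman q c \<alpha> limit_value x a = limit_value x"
  using attains_min_cong[of A "bellman q c \<alpha> (value_inf X A q c \<alpha>) x" "bellman q c \<alpha> limit_value x" a]
    bellman_cong[of x _ "value_inf X A q c \<alpha>" limit_value]
  by (simp add: attains_min_iff value_inf_eq limit_value_optimality[symmetric])

text \<open>
  If the policy is optimal then its cost is the value function, and the recursion for its cost says
  that its actions attain the minima.
\<close>

lemma discount_optimal_iff:
  assumes \<phi>: "\<phi> \<in> borel_selectors X A"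
  shows "discount_optimal X A q c \<alpha> (stationary_policy A \<phi>) \<longleftrightarrow>
    (\<forall>x\<in>topspace X. bellman q c \<alpha> limit_value x (\<phi> x) = limit_value x)"
proof
  let ?w = "policy_cost_inf X A q c \<alpha> (stationary_policy A \<phi>)"
  assume "discount_optimal X A q c \<alpha> (stationary_policy A \<phi>)"
  then have w: "?w x = limit_value x" if "x \<in> topspace X" for x
    using that by (simp add: discount_optimal_def value_inf_eq)
  show "\<forall>x\<in>topspace X. bellman q c \<alpha> limit_value x (\<phi> x) = limit_value x"
  proof
    fix x assume x: "x \<in> topspace X"
    then have "\<phi> x \<in> topspace A"
      using measurable_space[OF \<phi>[unfolded borel_selectors_def]] by simp
    then have "bellman q c \<alpha> limit_value x (\<phi> x) = bellman q c \<alpha> ?w x (\<phi> x)"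
      by (intro bellman_cong x) (simp_all add: w)
    then show "bellman q c \<alpha> limit_value x (\<phi> x) = limit_value x"
      using stationary_cost_recursion[OF \<phi> x] w[OF x] by simp
  qed
next
  assume "\<forall>x\<in>topspace X. bellman q c \<alpha> limit_value x (\<phi> x) = limit_value x"
  then have "\<forall>x\<in>topspace X. bellman q c \<alpha> limit_value x (\<phi> x) = bellman_min limit_value x"
    using limit_value_optimality by auto
  then show "discount_optimal X A q c \<alpha> (stationary_policy A \<phi>)"
    using stationary_cost_eq_limit_value[OF \<phi>] by (auto simp: discount_optimal_def value_inf_eq)
qed

theorem optimality_equations: "optimality_equations_define_optimal_policies X A q c \<alpha>"
  unfolding optimality_equations_define_optimal_policies_def
proof (intro conjI ballI allI impI)
  show "value_fin X A q c \<alpha> 0 x = 0" if "x \<in> topspace X" for x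
    using value_fin_eq[OF that, of 0] by simp
  show "is_minimum A (bellman q c \<alpha> (value_fin X A q c \<alpha> t) x) (value_fin X A q c \<alpha> (Suc t) x)"
    if x: "x \<in> topspace X" for x t
  proof -
    obtain a where "a \<in> topspace A" "bellman q c \<alpha> (value_iterate t) x a = bellman_min (value_iterate t) x"
      by (rule bellman_min_attained[OF lower_semicontinuous_value_iterate x])
    then have a: "a \<in> topspace A" "bellman q c \<alpha> (value_iterate t) x a = value_iterate (Suc t) x"
      by simp_all
    then have "bellman q c \<alpha> (value_fin X A q c \<alpha> t) x a = value_iterate (Suc t) x"
      using bellman_cong[OF x a(1), of "value_fin X A q c \<alpha> t" "value_iterate t"] by (simp add: value_fin_eq)
    then show ?thesis
      using a x unfolding is_minimum_def attains_min_value_fin[OF x] value_fin_eq[OF x] by blast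
  qed
  show "is_minimum A (bellman q c \<alpha> (value_inf X A q c \<alpha>) x) (value_inf X A q c \<alpha> x)"
    if x: "x \<in> topspace X" for x
  proof -
    obtain a where "a \<in> topspace A" "bellman q c \<alpha> limit_value x a = bellman_min limit_value x"
      by (rule bellman_min_attained[OF lower_semicontinuous_limit_value x])
    then have a: "a \<in> topspace A" "bellman q c \<alpha> limit_value x a = limit_value x"
      using limit_value_optimality[OF x] by simp_all
    then have "bellman q c \<alpha> (value_inf X A q c \<alpha>) x a = limit_value x"
      using bellman_cong[OF x a(1), of "value_inf X A q c \<alpha>" limit_value] by (simp add: value_inf_eq)
    then show ?thesis
      using a x unfolding is_minimum_def attains_min_value_inf[OF x] value_inf_eq[OF x] by blast
  qed
  show "horizon_optimal X A q c \<alpha> T (markov_policy A \<phi>)"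
    if "1 \<le> T" "\<forall>t. \<phi> t \<in> borel_selectors X A"
      "\<forall>x\<in>topspace X. \<forall>t<T. attains_min A (bellman q c \<alpha> (value_fin X A q c \<alpha> t) x) (\<phi> (T - 1 - t) x)" for T \<phi>
    unfolding horizon_optimal_def
  proof
    fix x assume x: "x \<in> topspace X"
    have "policy_cost_fin X A q c \<alpha> T (markov_policy A \<phi>) x = value_iterate T x"
      by (rule value_iterate_eq_cost[OF that(2) x]) (use that(3) attains_min_value_fin in blast)
    then show "policy_cost_fin X A q c \<alpha> T (markov_policy A \<phi>) x = value_fin X A q c \<alpha> T x"
      by (simp add: value_fin_eq[OF x])
  qed
  show "discount_optimal X A q c \<alpha> (stationary_policy A \<phi>) \<longleftrightarrow>
    (\<forall>x\<in>topspace X. attains_min A (bellman q c \<alpha> (value_inf X A q c \<alpha>) x) (\<phi> x))"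
    if \<phi>: "\<phi> \<in> borel_selectors X A" for \<phi>
    unfolding discount_optimal_iff[OF \<phi>] using attains_min_value_inf
      measurable_space[OF \<phi>[unfolded borel_selectors_def]] by auto
qed

theorem value_iteration: "value_iteration_converges X A q c \<alpha>"
  unfolding value_iteration_converges_def
proof
  fix x assume x: "x \<in> topspace X"
  show "(\<lambda>t. value_fin X A q c \<alpha> t x) \<longlonglongrightarrow> value_inf X A q c \<alpha> x"
    unfolding value_fin_eq[OF x] value_inf_eq[OF x] limit_value_def
    by (rule LIMSEQ_SUP[OF value_iterate_incseq[OF x]])
qed

theorem markov_optimal: "markov_optimal_policies_exist X A q c \<alpha>"
  unfolding markov_optimal_policies_exist_def horizon_optimal_def
proof (intro allI impI)
  fix T :: nat
  obtain \<phi> where "\<forall>t. \<phi> t \<in> borel_selectors X A"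
    "\<forall>x\<in>topspace X. policy_cost_fin X A q c \<alpha> T (markov_policy A \<phi>) x = value_iterate T x"
    by (rule value_iterate_policy)
  then show "\<exists>\<phi>. (\<forall>t. \<phi> t \<in> borel_selectors X A) \<and>
      (\<forall>x\<in>topspace X. policy_cost_fin X A q c \<alpha> T (markov_policy A \<phi>) x = value_fin X A q c \<alpha> T x)"
    by (intro exI[of _ \<phi>]) (simp add: value_fin_eq)
qed

theorem stationary_optimal: "stationary_optimal_policies_exist X A q c \<alpha>"
proof -
  obtain \<phi> where \<phi>: "\<phi> \<in> borel_selectors X A" "\<forall>x\<in>topspace X. bellman q c \<alpha> limit_value x (\<phi> x) = bellman_min limit_value x"
    by (rule bellman_min_selector[OF lower_semicontinuous_limit_value])
  then have "discount_optimal X A q c \<alpha> (stationary_policy A \<phi>)"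
    by (simp add: discount_optimal_iff limit_value_optimality)
  then show ?thesis
    using \<phi>(1) by (auto simp: stationary_optimal_policies_exist_def)
qed

end

section \<open>The belief-MDP\<close>

text \<open>
  The common core of all three models: they differ only in how the joint kernel acquires
  its continuity along sequences of sets.
\<close>

lemma belief_mdp_conclusions_along_sets:
  fixes W :: "'w::polish_space set" and Y :: "'y::polish_space set" and A :: "'a::polish_space set"
  assumes spaces: "model_spaces W Y A"
    and P: "stochastic_kernel (top_of_set (W \<times> Y)) (top_of_set (W \<times> A)) P"
    and F: "feller_along_sets (top_of_set W) (top_of_set Y) (top_of_set (W \<times> A)) P"
    and c: "K_inf_compact (top_of_set W) (top_of_set A) (\<lambda>s. enn2ereal (c s))"
  shows "belief_mdp_conclusions W Y A P c"
proof -
  have W: "W \<in> sets borel" and A: "A \<noteq> {}"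
    using spaces by (auto simp: model_spaces_def)
  note q = belief_kernel_stochastic_and_continuous[OF W P F]
  note c' = belief_cost_K_inf_compact[OF separable_metrizable_top_of_set separable_metrizable_top_of_set c]
  have mdp: "inf_compact_mdp (beliefs W) (top_of_set A) (belief_kernel W Y A P) (belief_cost c) \<alpha>" if "0 \<le> \<alpha>" for \<alpha>
  proof
    show "separable_metrizable (beliefs W)"
      by (rule separable_metrizable_weak_topology[OF separable_metrizable_top_of_set])
    show "topspace (top_of_set A) \<noteq> {}"
      using A by simp
  qed (use q c' that separable_metrizable_top_of_set in auto)
  show ?thesis
    unfolding belief_mdp_conclusions_def Let_def
    by (intro conjI allI impI q c' inf_compact_mdp.optimality_equations[OF mdp] inf_compact_mdp.value_iteration[OF mdp]
        inf_compact_mdp.markov_optimal[OF mdp] inf_compact_mdp.stationary_optimal[OF mdp])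
qed

theorem corollary6p12:
  fixes W :: "'w::polish_space set" and Y :: "'y::polish_space set" and A :: "'a::polish_space set"
    and c :: "'w \<times> 'a \<Rightarrow> ennreal"
  assumes c_inf_compact: "K_inf_compact (top_of_set W) (top_of_set A) (\<lambda>s. enn2ereal (c s))"
  shows "(\<forall>P. platzman_model W Y A P c \<and>
              semi_uniform_feller (top_of_set W) (top_of_set Y) (top_of_set (W \<times> A)) P
            \<longrightarrow> belief_mdp_conclusions W Y A P c)
       \<and> (\<forall>P1 Q1. pomdp1 W Y A P1 Q1 c \<and>
              weakly_continuous (top_of_set W) (top_of_set (W \<times> A)) P1 \<and>
              tv_continuous (top_of_set Y) (top_of_set (W \<times> A)) Q1
            \<longrightarrow> belief_mdp_conclusions W Y A (pomdp1_kernel P1 Q1) c)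
       \<and> (\<forall>P2 Q2. pomdp2 W Y A P2 Q2 c \<and>
              ((weakly_continuous (top_of_set W) (top_of_set (W \<times> A)) P2 \<and>
                tv_continuous (top_of_set Y) (top_of_set (A \<times> W)) Q2) \<or>
               (tv_continuous (top_of_set W) (top_of_set (W \<times> A)) P2 \<and>
                (\<forall>w\<in>W. tv_continuous (top_of_set Y) (top_of_set A) (\<lambda>a. Q2 (a, w)))))
            \<longrightarrow> belief_mdp_conclusions W Y A (pomdp2_kernel W Y P2 Q2) c)"
proof (intro conjI allI impI; elim conjE)
  have S: "separable_metrizable (top_of_set W)" "separable_metrizable (top_of_set Y)" "separable_metrizable (top_of_set A)"
    by (rule separable_metrizable_top_of_set)+
  then have sc: "second_countable (top_of_set W)" "second_countable (top_of_set Y)" "second_countable (top_of_set A)"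
    by (auto simp: separable_metrizable_def)
  show "belief_mdp_conclusions W Y A P c"
    if model: "platzman_model W Y A P c"
      and suf: "semi_uniform_feller (top_of_set W) (top_of_set Y) (top_of_set (W \<times> A)) P" for P
  proof -
    have P: "stochastic_kernel (top_of_set (W \<times> Y)) (top_of_set (W \<times> A)) P"
      using model by (simp add: platzman_model_def)
    have "feller_along_sets (top_of_set W) (top_of_set Y) (top_of_set (W \<times> A)) P"
      by (rule semi_uniform_feller_along_sets[OF S(1,2) P[unfolded top_of_set_Times[of W Y]] suf])
    then show ?thesis
      using model by (intro belief_mdp_conclusions_along_sets P c_inf_compact) (auto simp: platzman_model_def)
  qed
  show "belief_mdp_conclusions W Y A (pomdp1_kernel P1 Q1) c"
    if model: "pomdp1 W Y A P1 Q1 c"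
      and cont: "weakly_continuous (top_of_set W) (top_of_set (W \<times> A)) P1"
        "tv_continuous (top_of_set Y) (top_of_set (W \<times> A)) Q1" for P1 Q1
  proof -
    have K: "stochastic_kernel (top_of_set W) (top_of_set (W \<times> A)) P1"
        "stochastic_kernel (top_of_set Y) (top_of_set (W \<times> A)) Q1"
      using model by (auto simp: pomdp1_def)
    have "stochastic_kernel (top_of_set (W \<times> Y)) (top_of_set (W \<times> A)) (pomdp1_kernel P1 Q1)"
      unfolding pomdp1_kernel_def top_of_set_Times[of W Y] by (rule stochastic_kernel_pair[OF sc(1,2) K])
    moreover have "feller_along_sets (top_of_set W) (top_of_set Y) (top_of_set (W \<times> A)) (pomdp1_kernel P1 Q1)"
      unfolding pomdp1_kernel_def by (rule pomdp1_feller_along_sets[OF K cont])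
    ultimately show ?thesis
      using model by (intro belief_mdp_conclusions_along_sets c_inf_compact) (auto simp: pomdp1_def)
  qed
  show "belief_mdp_conclusions W Y A (pomdp2_kernel W Y P2 Q2) c"
    if model: "pomdp2 W Y A P2 Q2 c"
      and cont: "(weakly_continuous (top_of_set W) (top_of_set (W \<times> A)) P2 \<and>
                tv_continuous (top_of_set Y) (top_of_set (A \<times> W)) Q2) \<or>
               (tv_continuous (top_of_set W) (top_of_set (W \<times> A)) P2 \<and>
                (\<forall>w\<in>W. tv_continuous (top_of_set Y) (top_of_set A) (\<lambda>a. Q2 (a, w))))" for P2 Q2
  proof -
    have K: "stochastic_kernel (top_of_set W) (prod_topology (top_of_set W) (top_of_set A)) P2"
        "stochastic_kernel (top_of_set Y) (prod_topology (top_of_set A) (top_of_set W)) Q2"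
      using model by (auto simp: pomdp2_def)
    have "stochastic_kernel (top_of_set (W \<times> Y)) (top_of_set (W \<times> A)) (pomdp2_kernel W Y P2 Q2)"
      unfolding pomdp2_kernel_def top_of_set_Times by (rule pomdp2_kernel_measurable(1)[OF sc K])
    moreover have "feller_along_sets (top_of_set W) (top_of_set Y) (top_of_set (W \<times> A)) (pomdp2_kernel W Y P2 Q2)"
      unfolding pomdp2_kernel_def top_of_set_Times
      by (rule pomdp2_feller_along_sets[OF S K]) (use cont in simp)
    ultimately show ?thesis
      using model by (intro belief_mdp_conclusions_along_sets c_inf_compact) (auto simp: pomdp2_def)
  qed
qed

end
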